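(* Let $\Omega\subset\mathbb{R}^3$ be a bounded domain of class $C^{3,1}$, $T>0$, $Q=\Omega\times(0,T)$. Let $\{d_\delta\}_{\delta\in(0,1)}$ be a family of functions bounded in $L^\infty(0,T;H^1(\Omega;\mathbb{R}^3))$ such that $$\sup_{\delta\in(0,1)}\big\|\,|d_\delta|\,\nabla d_\delta\big\|_{L^\infty(0,T;L^2(\Omega))}<\infty$$ and such that $\{d_\delta\}$ is relatively compact in $L^2(0,T;L^2(\Omega;\mathbb{R}^3))$. Then there exist a sequence $\delta_n\to0$, a limit $d$ of $d_{\delta_n}$ in $L^2(0,T;L^2(\Omega;\mathbb{R}^3))$, and a generalized gradient Young measure $(\nu^o,m_t,\nu^\infty)$ such that for all $f\in\mathcal{R}$ $$\int_Qf(y,d_{\delta_n}(y),\nabla d_{\delta_n}(y))\,dy\longrightarrow\int_0^T\langle\langle f,\nu_t\rangle\rangle\,dt\qquad(n\to\infty).$$ Additionally, $\nu^o$ is a classical gradient Young measure in the sense that $\int_{\mathbb{R}^{3\times3}}S\,\nu^o_y(dS)=\nabla d(y)$ for a.e. $y\in Q$.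
   Context: $B_3$, $B_{3\times3}$ denote the open unit balls of $\mathbb{R}^3$ and $\mathbb{R}^{3\times3}$, $S^8$ the unit sphere of $\mathbb{R}^{3\times3}$ (Frobenius norm). For $f\in C(\overline Q\times\mathbb{R}^3\times\mathbb{R}^{3\times3})$ define on $\overline Q\times B_3\times B_{3\times3}$ $$\tilde f(y,\tilde h,\tilde S)=f\Big(y,\tfrac{\tilde h}{\sqrt{1-|\tilde h|^2}},\tfrac{\tilde S}{\sqrt{1-|\tilde S|^2}}\Big)(1-|\tilde h|^2)(1-|\tilde S|^2).$$ $\mathcal{R}$ is the set of those $f$ for which $\tilde f$ extends continuously to $\overline Q\times\overline{B_3}\times\overline{B_{3\times3}}$; the extension is again denoted $\tilde f$. A generalized gradient Young measure on $\overline\Omega\times[0,T]$ with values in $\mathbb{R}^3\times\mathbb{R}^{3\times3}$ is a triple $(\nu^o_y,m_t,\nu^\infty_y)$ consisting of a (weakly measurable) family $\nu^o_y\in\mathcal{P}(\mathbb{R}^{3\times3})$ of probability measures for a.e. $y\in Q$ (oscillation measure), positive Radon measures $m_t\in\mathcal{M}^+(\overline\Omega)$ for a.e. $t\in(0,T)$ (concentration measure), and a family of probability measures $\nu^\infty_{(x,t)}\in\mathcal{P}(\overline{B_3}\times S^8)$ for $m_t$-a.e. $x\in\overline\Omega$ and a.e. $t$ (concentration angle measure). The pairing is, for $f\in\mathcal{R}$, $$\langle\langle f,\nu_t\rangle\rangle=\int_\Omega\int_{\mathbb{R}^{3\times3}}f((x,t),d(x,t),S)\,\nu^o_{(x,t)}(dS)\,dx+\int_{\overline\Omega}\int_{\overline{B_3}\times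 S^8}\tilde f((x,t),\tilde h,\tilde S)\,\nu^\infty_{(x,t)}(d\tilde h,d\tilde S)\,m_t(dx).$$ *)

theory Defs
  imports "HOL-Probability.Probability"
begin

type_synonym point = "(real ^ 3) \<times> real"

definition cylinder :: "(real ^ 3) set \<Rightarrow> real \<Rightarrow> point set" where
  "cylinder \<Omega> T = \<Omega> \<times> {0<..<T}"

definition slice :: "(point \<Rightarrow> 'b) \<Rightarrow> real \<Rightarrow> real ^ 3 \<Rightarrow> 'b" where
  "slice u t = (\<lambda>x. u (x, t))"

primrec Ck_fun :: "nat \<Rightarrow> ('a::euclidean_space \<Rightarrow> real) \<Rightarrow> bool" where
  "Ck_fun 0 f \<longleftrightarrow> continuous_on UNIV f"
| "Ck_fun (Suc k) f \<longleftrightarrow> (\<forall>x. f differentiable (at x)) \<and>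
     (\<forall>b\<in>Basis. Ck_fun k (\<lambda>x. frechet_derivative f (at x) b))"

primrec Ck1_fun :: "nat \<Rightarrow> ('a::euclidean_space \<Rightarrow> real) \<Rightarrow> bool" where
  "Ck1_fun 0 f \<longleftrightarrow> (\<exists>L. L-lipschitz_on UNIV f)"
| "Ck1_fun (Suc k) f \<longleftrightarrow> (\<forall>x. f differentiable (at x)) \<and>
     (\<forall>b\<in>Basis. Ck1_fun k (\<lambda>x. frechet_derivative f (at x) b))"

text \<open>Near each boundary point, after an orthogonal change of coordinates, the domain is the
  region above the graph of a function of class \<open>C\<close> to the \<open>k,1\<close>.  It is no restriction that
  the graph function is defined on the whole plane, since only its values near the boundary point
  matter.\<close>

definition bounded_Ck1_domain :: "nat \<Rightarrow> (real ^ 3) set \<Rightarrow> bool" where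
  "bounded_Ck1_domain k \<Omega> \<longleftrightarrow>
     open \<Omega> \<and> connected \<Omega> \<and> \<Omega> \<noteq> {} \<and> bounded \<Omega> \<and>
     (\<forall>p\<in>frontier \<Omega>. \<exists>r>0. \<exists>(R :: real ^ 3 \<Rightarrow> real ^ 3) (\<gamma> :: real ^ 2 \<Rightarrow> real).
        orthogonal_transformation R \<and> Ck1_fun k \<gamma> \<and>
        \<Omega> \<inter> ball p r = {x \<in> ball p r. \<gamma> (vector [R x $ 1, R x $ 2]) < R x $ 3})"

text \<open>Elements of the function spaces below are functions, not classes modulo equality almost
  everywhere; the norms are therefore seminorms.\<close>

definition L2 :: "'a measure \<Rightarrow> ('a \<Rightarrow> 'b::euclidean_space) set" where
  "L2 M = {u \<in> borel_measurable M. integrable M (\<lambda>x. (norm (u x))\<^sup>2)}"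

definition L2_norm :: "'a measure \<Rightarrow> ('a \<Rightarrow> 'b::euclidean_space) \<Rightarrow> real" where
  "L2_norm M u = sqrt (\<integral>x. (norm (u x))\<^sup>2 \<partial>M)"

definition test_functions :: "(real ^ 3) set \<Rightarrow> (real ^ 3 \<Rightarrow> real) set" where
  "test_functions \<Omega> = {\<phi>. (\<forall>k. Ck_fun k \<phi>) \<and>
     compact (closure {x. \<phi> x \<noteq> 0}) \<and> closure {x. \<phi> x \<noteq> 0} \<subseteq> \<Omega>}"

definition locally_integrable :: "(real ^ 3) set \<Rightarrow> (real ^ 3 \<Rightarrow> 'b::euclidean_space) \<Rightarrow> bool" where
  "locally_integrable \<Omega> u \<longleftrightarrow> u \<in> borel_measurable (lebesgue_on \<Omega>) \<and>
     (\<forall>K. compact K \<and> K \<subseteq> \<Omega> \<longrightarrow> integrable (lebesgue_on K) u)"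

text \<open>Convention: the entry in row \<open>i\<close>, column \<open>j\<close> of the gradient is the \<open>j\<close>-th partial
  derivative of the \<open>i\<close>-th component.\<close>

definition weak_gradient ::
    "(real ^ 3) set \<Rightarrow> (real ^ 3 \<Rightarrow> real ^ 3) \<Rightarrow> (real ^ 3 \<Rightarrow> real ^ 3 ^ 3) \<Rightarrow> bool" where
  "weak_gradient \<Omega> u G \<longleftrightarrow> locally_integrable \<Omega> u \<and> locally_integrable \<Omega> G \<and>
     (\<forall>\<phi>\<in>test_functions \<Omega>. \<forall>i j.
        (\<integral>x. u x $ i * frechet_derivative \<phi> (at x) (axis j 1) \<partial>lebesgue_on \<Omega>) =
        - (\<integral>x. G x $ i $ j * \<phi> x \<partial>lebesgue_on \<Omega>))"

definition H1 :: "(real ^ 3) set \<Rightarrow> (real ^ 3 \<Rightarrow> real ^ 3) set" where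
  "H1 \<Omega> = {u \<in> L2 (lebesgue_on \<Omega>). \<exists>G\<in>L2 (lebesgue_on \<Omega>). weak_gradient \<Omega> u G}"

definition H1_norm :: "(real ^ 3) set \<Rightarrow> (real ^ 3 \<Rightarrow> real ^ 3) \<Rightarrow> real" where
  "H1_norm \<Omega> u = sqrt ((L2_norm (lebesgue_on \<Omega>) u)\<^sup>2 +
     (L2_norm (lebesgue_on \<Omega>) (SOME G. G \<in> L2 (lebesgue_on \<Omega>) \<and> weak_gradient \<Omega> u G))\<^sup>2)"

text \<open>Strong measurability of a map from \<open>(0,T)\<close> to a space \<open>V\<close> of functions with (semi)norm \<open>N\<close>:
  it is almost everywhere a limit, in the norm of \<open>V\<close>, of \<open>V\<close>-valued simple functions.\<close>

definition strongly_measurable ::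
    "real \<Rightarrow> (real ^ 3 \<Rightarrow> 'b::euclidean_space) set \<Rightarrow> ((real ^ 3 \<Rightarrow> 'b) \<Rightarrow> real) \<Rightarrow>
     (real \<Rightarrow> real ^ 3 \<Rightarrow> 'b) \<Rightarrow> bool" where
  "strongly_measurable T V N v \<longleftrightarrow>
     (AE t in lebesgue_on {0<..<T}. v t \<in> V) \<and>
     (\<exists>s :: nat \<Rightarrow> real \<Rightarrow> real ^ 3 \<Rightarrow> 'b.
        (\<forall>n. simple_function (lebesgue_on {0<..<T}) (s n) \<and> s n ` {0<..<T} \<subseteq> V) \<and>
        (AE t in lebesgue_on {0<..<T}. (\<lambda>n. N (\<lambda>x. v t x - s n t x)) \<longlonglongrightarrow> 0))"

text \<open>The elements of the Bochner spaces are represented by jointly measurable functions on the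
  space-time cylinder.\<close>

definition bochner_measurable ::
    "(real ^ 3) set \<Rightarrow> real \<Rightarrow> (real ^ 3 \<Rightarrow> 'b::euclidean_space) set \<Rightarrow>
     ((real ^ 3 \<Rightarrow> 'b) \<Rightarrow> real) \<Rightarrow> (point \<Rightarrow> 'b) set" where
  "bochner_measurable \<Omega> T V N = {u \<in> borel_measurable (lebesgue_on (cylinder \<Omega> T)).
     strongly_measurable T V N (slice u)}"

definition bochner_Linf_norm ::
    "real \<Rightarrow> ((real ^ 3 \<Rightarrow> 'b::euclidean_space) \<Rightarrow> real) \<Rightarrow> (point \<Rightarrow> 'b) \<Rightarrow> ennreal" where
  "bochner_Linf_norm T N u =
     Inf {C. AE t in lebesgue_on {0<..<T}. ennreal (N (slice u t)) \<le> C}"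

definition bochner_Linf ::
    "(real ^ 3) set \<Rightarrow> real \<Rightarrow> (real ^ 3 \<Rightarrow> 'b::euclidean_space) set \<Rightarrow>
     ((real ^ 3 \<Rightarrow> 'b) \<Rightarrow> real) \<Rightarrow> (point \<Rightarrow> 'b) set" where
  "bochner_Linf \<Omega> T V N = {u \<in> bochner_measurable \<Omega> T V N. bochner_Linf_norm T N u < \<infinity>}"

definition bochner_L2 ::
    "(real ^ 3) set \<Rightarrow> real \<Rightarrow> (real ^ 3 \<Rightarrow> 'b::euclidean_space) set \<Rightarrow>
     ((real ^ 3 \<Rightarrow> 'b) \<Rightarrow> real) \<Rightarrow> (point \<Rightarrow> 'b) set" where
  "bochner_L2 \<Omega> T V N = {u \<in> bochner_measurable \<Omega> T V N.
     integrable (lebesgue_on {0<..<T}) (\<lambda>t. (N (slice u t))\<^sup>2)}"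

definition bochner_L2_norm ::
    "real \<Rightarrow> ((real ^ 3 \<Rightarrow> 'b::euclidean_space) \<Rightarrow> real) \<Rightarrow> (point \<Rightarrow> 'b) \<Rightarrow> real" where
  "bochner_L2_norm T N u = sqrt (\<integral>t. (N (slice u t))\<^sup>2 \<partial>lebesgue_on {0<..<T})"

abbreviation LinfH1 :: "(real ^ 3) set \<Rightarrow> real \<Rightarrow> (point \<Rightarrow> real ^ 3) set" where
  "LinfH1 \<Omega> T \<equiv> bochner_Linf \<Omega> T (H1 \<Omega>) (H1_norm \<Omega>)"

abbreviation LinfH1_norm :: "(real ^ 3) set \<Rightarrow> real \<Rightarrow> (point \<Rightarrow> real ^ 3) \<Rightarrow> ennreal" where
  "LinfH1_norm \<Omega> T \<equiv> bochner_Linf_norm T (H1_norm \<Omega>)"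

abbreviation LinfL2 :: "(real ^ 3) set \<Rightarrow> real \<Rightarrow> (point \<Rightarrow> 'b::euclidean_space) set" where
  "LinfL2 \<Omega> T \<equiv> bochner_Linf \<Omega> T (L2 (lebesgue_on \<Omega>)) (L2_norm (lebesgue_on \<Omega>))"

abbreviation LinfL2_norm ::
    "(real ^ 3) set \<Rightarrow> real \<Rightarrow> (point \<Rightarrow> 'b::euclidean_space) \<Rightarrow> ennreal" where
  "LinfL2_norm \<Omega> T \<equiv> bochner_Linf_norm T (L2_norm (lebesgue_on \<Omega>))"

abbreviation L2L2 :: "(real ^ 3) set \<Rightarrow> real \<Rightarrow> (point \<Rightarrow> 'b::euclidean_space) set" where
  "L2L2 \<Omega> T \<equiv> bochner_L2 \<Omega> T (L2 (lebesgue_on \<Omega>)) (L2_norm (lebesgue_on \<Omega>))"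

abbreviation L2L2_norm ::
    "(real ^ 3) set \<Rightarrow> real \<Rightarrow> (point \<Rightarrow> 'b::euclidean_space) \<Rightarrow> real" where
  "L2L2_norm \<Omega> T \<equiv> bochner_L2_norm T (L2_norm (lebesgue_on \<Omega>))"

definition spatial_gradient ::
    "(real ^ 3) set \<Rightarrow> real \<Rightarrow> (point \<Rightarrow> real ^ 3) \<Rightarrow> (point \<Rightarrow> real ^ 3 ^ 3) \<Rightarrow> bool" where
  "spatial_gradient \<Omega> T u G \<longleftrightarrow> G \<in> borel_measurable (lebesgue_on (cylinder \<Omega> T)) \<and>
     (AE t in lebesgue_on {0<..<T}. weak_gradient \<Omega> (slice u t) (slice G t))"

text \<open>The topology of a (semi)norm \<open>N\<close> on a set \<open>V\<close> of functions.  Identifying functions at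
  distance zero does not affect whether a set has compact closure.\<close>

definition seminorm_topology ::
    "('a \<Rightarrow> 'b::real_normed_vector) set \<Rightarrow> (('a \<Rightarrow> 'b) \<Rightarrow> real) \<Rightarrow> ('a \<Rightarrow> 'b) topology" where
  "seminorm_topology V N = topology (\<lambda>U. U \<subseteq> V \<and>
     (\<forall>u\<in>U. \<exists>e>0. \<forall>v\<in>V. N (\<lambda>x. v x - u x) < e \<longrightarrow> v \<in> U))"

lemma openin_seminorm_topology:
  "openin (seminorm_topology V N) U \<longleftrightarrow>
     U \<subseteq> V \<and> (\<forall>u\<in>U. \<exists>e>0. \<forall>v\<in>V. N (\<lambda>x. v x - u x) < e \<longrightarrow> v \<in> U)"
proof -
  let ?P = "\<lambda>U. U \<subseteq> V \<and> (\<forall>u\<in>U. \<exists>e>0. \<forall>v\<in>V. N (\<lambda>x. v x - u x) < e \<longrightarrow> v \<in> U)"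
  have "istopology ?P"
    unfolding istopology_def
  proof (intro conjI allI impI)
    fix A B assume A: "?P A" and B: "?P B"
    show "A \<inter> B \<subseteq> V" using A by blast
    show "\<forall>u\<in>A \<inter> B. \<exists>e>0. \<forall>v\<in>V. N (\<lambda>x. v x - u x) < e \<longrightarrow> v \<in> A \<inter> B"
    proof
      fix u assume u: "u \<in> A \<inter> B"
      obtain a where a: "a > 0" "\<forall>v\<in>V. N (\<lambda>x. v x - u x) < a \<longrightarrow> v \<in> A" using A u by blast
      obtain b where b: "b > 0" "\<forall>v\<in>V. N (\<lambda>x. v x - u x) < b \<longrightarrow> v \<in> B" using B u by blast
      show "\<exists>e>0. \<forall>v\<in>V. N (\<lambda>x. v x - u x) < e \<longrightarrow> v \<in> A \<inter> B"
        using a b by (intro exI[of _ "min a b"]) auto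
    qed
  next
    fix \<K> assume K: "\<forall>U\<in>\<K>. ?P U"
    show "\<Union>\<K> \<subseteq> V" using K by blast
    show "\<forall>u\<in>\<Union>\<K>. \<exists>e>0. \<forall>v\<in>V. N (\<lambda>x. v x - u x) < e \<longrightarrow> v \<in> \<Union>\<K>"
      using K by (meson UnionE UnionI)
  qed
  then show ?thesis
    by (simp add: seminorm_topology_def topology_inverse')
qed

definition relatively_compact_in :: "'a topology \<Rightarrow> 'a set \<Rightarrow> bool" where
  "relatively_compact_in X S \<longleftrightarrow> S \<subseteq> topspace X \<and> compactin X (X closure_of S)"

type_synonym integrand = "point \<times> (real ^ 3) \<times> (real ^ 3 ^ 3) \<Rightarrow> real"

text \<open>The norm of the type \<open>real ^ 3 ^ 3\<close> is the Frobenius norm.\<close>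

definition tilde :: "integrand \<Rightarrow> integrand" where
  "tilde f = (\<lambda>(y, h, S).
     f (y, h /\<^sub>R sqrt (1 - (norm h)\<^sup>2), S /\<^sub>R sqrt (1 - (norm S)\<^sup>2)) *
     (1 - (norm h)\<^sup>2) * (1 - (norm S)\<^sup>2))"

definition tilde_extension :: "(real ^ 3) set \<Rightarrow> real \<Rightarrow> integrand \<Rightarrow> integrand \<Rightarrow> bool" where
  "tilde_extension \<Omega> T f g \<longleftrightarrow>
     continuous_on (closure (cylinder \<Omega> T) \<times> cball 0 1 \<times> cball 0 1) g \<and>
     (\<forall>z\<in>closure (cylinder \<Omega> T) \<times> ball 0 1 \<times> ball 0 1. g z = tilde f z)"

definition integrands :: "(real ^ 3) set \<Rightarrow> real \<Rightarrow> integrand set" where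
  "integrands \<Omega> T = {f. continuous_on (closure (cylinder \<Omega> T) \<times> UNIV \<times> UNIV) f \<and>
     (\<exists>g. tilde_extension \<Omega> T f g)}"

text \<open>By density, the extension is unique on the product of the closed sets.\<close>

definition tilde_ext :: "(real ^ 3) set \<Rightarrow> real \<Rightarrow> integrand \<Rightarrow> integrand" where
  "tilde_ext \<Omega> T f = (SOME g. tilde_extension \<Omega> T f g)"

text \<open>On the compact metrizable space \<open>closure \<Omega>\<close> the positive Radon measures are the finite Borel
  measures.  Weak measurability of the oscillation measures is tested against the continuous
  functions vanishing at infinity.\<close>

definition generalized_young_measure ::
    "(real ^ 3) set \<Rightarrow> real \<Rightarrow> (point \<Rightarrow> (real ^ 3 ^ 3) measure) \<Rightarrow> (real \<Rightarrow> (real ^ 3) measure) \<Rightarrow>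
     (point \<Rightarrow> ((real ^ 3) \<times> (real ^ 3 ^ 3)) measure) \<Rightarrow> bool" where
  "generalized_young_measure \<Omega> T \<nu>o m \<nu>i \<longleftrightarrow>
     (AE y in lebesgue_on (cylinder \<Omega> T). sets (\<nu>o y) = sets borel \<and> prob_space (\<nu>o y)) \<and>
     (\<forall>\<phi> :: real ^ 3 ^ 3 \<Rightarrow> real. continuous_on UNIV \<phi> \<and> (\<phi> \<longlongrightarrow> 0) at_infinity \<longrightarrow>
        (\<lambda>y. \<integral>S. \<phi> S \<partial>\<nu>o y) \<in> borel_measurable (lebesgue_on (cylinder \<Omega> T))) \<and>
     (AE t in lebesgue_on {0<..<T}.
        sets (m t) = sets (restrict_space borel (closure \<Omega>)) \<and> finite_measure (m t) \<and>
        (AE x in m t. sets (\<nu>i (x, t)) = sets (restrict_space borel (cball 0 1 \<times> sphere 0 1)) \<and>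
           prob_space (\<nu>i (x, t))))"

definition pairing ::
    "(real ^ 3) set \<Rightarrow> real \<Rightarrow> (point \<Rightarrow> real ^ 3) \<Rightarrow> (point \<Rightarrow> (real ^ 3 ^ 3) measure) \<Rightarrow>
     (real \<Rightarrow> (real ^ 3) measure) \<Rightarrow> (point \<Rightarrow> ((real ^ 3) \<times> (real ^ 3 ^ 3)) measure) \<Rightarrow>
     integrand \<Rightarrow> real \<Rightarrow> real" where
  "pairing \<Omega> T d \<nu>o m \<nu>i f t =
     (\<integral>x. (\<integral>S. f ((x, t), d (x, t), S) \<partial>\<nu>o (x, t)) \<partial>lebesgue_on \<Omega>) +
     (\<integral>x. (\<integral>(h, S). tilde_ext \<Omega> T f ((x, t), h, S) \<partial>\<nu>i (x, t)) \<partial>m t)"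

text \<open>All integrals occurring in the time integral of the pairing exist.  This has to be asserted
  separately, because the integral of a non-integrable function is zero by convention; it subsumes
  the measurability of the concentration measures and of the concentration angle measures.\<close>

definition pairing_integrable ::
    "(real ^ 3) set \<Rightarrow> real \<Rightarrow> (point \<Rightarrow> real ^ 3) \<Rightarrow> (point \<Rightarrow> (real ^ 3 ^ 3) measure) \<Rightarrow>
     (real \<Rightarrow> (real ^ 3) measure) \<Rightarrow> (point \<Rightarrow> ((real ^ 3) \<times> (real ^ 3 ^ 3)) measure) \<Rightarrow>
     integrand \<Rightarrow> bool" where
  "pairing_integrable \<Omega> T d \<nu>o m \<nu>i f \<longleftrightarrow>
     (AE t in lebesgue_on {0<..<T}.
        (AE x in lebesgue_on \<Omega>. integrable (\<nu>o (x, t)) (\<lambda>S. f ((x, t), d (x, t), S))) \<and>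
        integrable (lebesgue_on \<Omega>) (\<lambda>x. \<integral>S. f ((x, t), d (x, t), S) \<partial>\<nu>o (x, t)) \<and>
        (AE x in m t. integrable (\<nu>i (x, t)) (\<lambda>(h, S). tilde_ext \<Omega> T f ((x, t), h, S))) \<and>
        integrable (m t) (\<lambda>x. \<integral>(h, S). tilde_ext \<Omega> T f ((x, t), h, S) \<partial>\<nu>i (x, t))) \<and>
     integrable (lebesgue_on {0<..<T}) (pairing \<Omega> T d \<nu>o m \<nu>i f)"

end

theory Submission
  imports Defs
begin

text \<open>
  The hypotheses say that \<open>(1 + |d|\<^sup>2)(1 + |\<nabla>d|\<^sup>2)\<close> has integrals over \<open>\<Omega>\<close> that are bounded uniformly in time and in the
  parameter (\<open>energy_bounds\<close>). The admissible integrands are exactly those which, divided by this weight and written in the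
  coordinates \<open>h / sqrt (1 + |h|\<^sup>2)\<close> of the unit balls, extend continuously to the compact set
  \<open>closure Q \<times> cball 0 1 \<times> cball 0 1\<close> (\<open>tilde_extension_into_ball\<close>). So consider the images of the weighted Lebesgue measure on
  \<open>Q\<close> under the map to position, state and gradient in ball coordinates. They form a bounded sequence of measures on a compact set and
  have a weakly convergent subsequence with a limit \<open>\<mu>\<close> (\<open>weighted_laws_subsequence\<close>), and the limit of the integrals of \<open>f\<close> is the
  integral of the extension of \<open>f\<close> with respect to \<open>\<mu>\<close>. What remains is to write \<open>\<mu>\<close> in the form required by the pairing.

  Where the ball coordinate of the gradient has norm less than 1, the strong convergence of the states fixes the state: this part of
  \<open>\<mu>\<close> lives over the graph of the limit (\<open>AE_graph\<close>). Taking the weight off again leaves a measure with Lebesgue measure as its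
  marginal in space-time, and its disintegration is the oscillation measure (\<open>oscillation_measure\<close>). The part of \<open>\<mu>\<close> over the unit
  sphere of gradients is the concentration. The energy bound is uniform in time, so the law of the time under the concentration is at most a
  constant times Lebesgue measure (\<open>time_law_le\<close>), and disintegrating twice gives \<open>m t\<close> and the angle measures
  (\<open>concentration_measure\<close>).

  Functions that are linear in the state and the gradient grow more slowly than the weight and do not see the concentration
  (\<open>linear_limit\<close>). Integration by parts therefore passes to the limit, and the barycenter of the oscillation measure is the weak gradient
  of the limit (\<open>limit_weak_gradient\<close>).

  Two tools carry the measure theory: weak sequential compactness of measures on compact sets and disintegration over an arbitrary base.
  Both are reduced to distribution functions on the real line by coding a compact set as a subset of the Cantor set
  (\<open>compact_real_parametrization\<close>).
\<close>

section \<open>Coding compact sets by real numbers\<close>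

text \<open>The digits are only \<open>0\<close> and \<open>1\<close>, in every base. In base 2 the sums fill
  an interval; in base 3 they form a Cantor set.\<close>

definition digit_sum :: "real \<Rightarrow> (nat \<Rightarrow> bool) \<Rightarrow> real" where
  "digit_sum b c = (\<Sum>k. of_bool (c k) / b ^ k)"

lemma summable_digits:
  assumes "b > 1"
  shows "summable (\<lambda>k. of_bool (c k) / b ^ k :: real)"
proof (rule summable_comparison_test)
  show "summable (\<lambda>k. (1 / b) ^ k)"
    using assms by (intro summable_geometric) auto
  show "\<exists>N. \<forall>n\<ge>N. norm (of_bool (c n) / b ^ n) \<le> (1 / b) ^ n"
    using assms by (auto simp: field_simps intro!: exI[of _ 0])
qed

lemma digit_sum_bounds:
  assumes "b > 1"
  shows "0 \<le> digit_sum b c" and "digit_sum b c \<le> b / (b - 1)"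
proof -
  show "0 \<le> digit_sum b c"
    unfolding digit_sum_def using assms by (intro suminf_nonneg summable_digits) auto
  have "digit_sum b c \<le> (\<Sum>k. (1 / b) ^ k)"
    unfolding digit_sum_def
    using assms by (intro suminf_le summable_digits summable_geometric) (auto simp: field_simps)
  also have "\<dots> = b / (b - 1)"
    using assms by (subst suminf_geometric) (auto simp: field_simps)
  finally show "digit_sum b c \<le> b / (b - 1)" .
qed

lemma digit_sum_rec:
  assumes "b > 1"
  shows "digit_sum b c = of_bool (c 0) + digit_sum b (\<lambda>k. c (Suc k)) / b"
proof -
  have "(\<Sum>k. of_bool (c (Suc k)) / b ^ Suc k) = (\<Sum>k. of_bool (c (Suc k)) / b ^ k / b)"
    by (simp add: field_simps)
  also have "\<dots> = digit_sum b (\<lambda>k. c (Suc k)) / b"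
    unfolding digit_sum_def using summable_digits[OF assms, of "\<lambda>k. c (Suc k)"]
    by (rule suminf_divide)
  finally show ?thesis
    using suminf_split_head[OF summable_digits[OF assms, of c]]
    by (simp add: digit_sum_def)
qed

text \<open>Two sums whose first digits differ are at least \<open>1 - 1/2\<close> apart, because the digits
  behind the first contribute at most \<open>(3/2)/3 = 1/2\<close>. In base 2 this gap closes,
  which is why base 3 is used for the coding.\<close>

lemma inj_digit_sum_3: "inj (digit_sum 3)"
proof (rule injI)
  have first: "c 0 = c' 0 \<and> digit_sum 3 (\<lambda>k. c (Suc k)) = digit_sum 3 (\<lambda>k. c' (Suc k))"
    if "digit_sum 3 c = digit_sum 3 c'" for c c'
    using that digit_sum_rec[of 3 c] digit_sum_rec[of 3 c']
      digit_sum_bounds[of 3 "\<lambda>k. c (Suc k)"] digit_sum_bounds[of 3 "\<lambda>k. c' (Suc k)"]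
    by (cases "c 0"; cases "c' 0") auto
  fix c c' assume "digit_sum 3 c = digit_sum 3 c'"
  then have "c n = c' n" for n
    using first by (induction n arbitrary: c c') (blast, metis)
  then show "c = c'" by auto
qed

lemma continuous_on_digit_sum:
  assumes "b > 1"
  shows "continuous_on UNIV (digit_sum b)"
proof -
  have "uniform_limit UNIV (\<lambda>n c. \<Sum>k<n. of_bool (c k) / b ^ k) (digit_sum b) sequentially"
    unfolding digit_sum_def
  proof (rule Weierstrass_m_test)
    show "summable (\<lambda>k. (1 / b) ^ k)"
      using assms by (intro summable_geometric) auto
  qed (use assms in \<open>auto simp: field_simps\<close>)
  moreover have "continuous_on UNIV (\<lambda>c::nat \<Rightarrow> bool. of_bool (c k) :: real)" for k
    by (rule continuous_on_compose2[of UNIV of_bool]) 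
       (auto intro!: continuous_on_product_coordinates)
  ultimately show ?thesis
    by (intro uniform_limit_theorem[OF _ \<open>uniform_limit _ _ _ _\<close>] always_eventually allI
        continuous_on_sum continuous_on_divide) (use assms in auto)
qed

lemma compact_UNIV_bool_sequences: "compact (UNIV :: (nat \<Rightarrow> bool) set)"
proof -
  have "compact_space (euclidean :: bool topology)"
    by (simp add: compact_space_def finite_imp_compact)
  then have "compact_space (product_topology (\<lambda>_::nat. euclidean :: bool topology) UNIV)"
    by (simp add: compact_space_product_topology)
  then show ?thesis
    unfolding euclidean_product_topology by (simp add: compact_space_def)
qed

text \<open>The factor \<open>2 ^ Suc k\<close> starts the expansion with the digit of weight
  \<open>1/2\<close>, whereas \<open>digit_sum\<close> gives its first digit weight
  \<open>1\<close>; hence the factor 2 in \<open>digit_sum_binary_digits\<close>.\<close>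

definition binary_digits :: "real \<Rightarrow> nat \<Rightarrow> bool" where
  "binary_digits x k = odd \<lfloor>2 ^ Suc k * x\<rfloor>"

lemma digit_sum_binary_digits:
  assumes "0 \<le> x" "x < 1"
  shows "digit_sum 2 (binary_digits x) = 2 * x"
proof -
  have step: "of_int \<lfloor>2 ^ Suc n * x\<rfloor> = (2 * of_int \<lfloor>2 ^ n * x\<rfloor> + of_bool (binary_digits x n) :: real)" for n
  proof -
    let ?y = "2 ^ n * x"
    have "2 * \<lfloor>?y\<rfloor> \<le> \<lfloor>2 * ?y\<rfloor>" "\<lfloor>2 * ?y\<rfloor> \<le> 2 * \<lfloor>?y\<rfloor> + 1" by linarith+
    moreover have "\<lfloor>2 ^ Suc n * x\<rfloor> = \<lfloor>2 * ?y\<rfloor>" by (simp add: mult.assoc)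
    ultimately have "\<lfloor>2 ^ Suc n * x\<rfloor> = 2 * \<lfloor>?y\<rfloor> + of_bool (binary_digits x n)"
      unfolding binary_digits_def by (auto simp del: power_Suc) presburger+
    then show ?thesis by (metis of_int_add of_int_mult of_int_numeral of_int_of_bool)
  qed
  have partial: "(\<Sum>k<n. of_bool (binary_digits x k) / 2 ^ k) = (2 * (of_int \<lfloor>2 ^ n * x\<rfloor> / 2 ^ n) :: real)" for n
  proof (induction n)
    case 0
    have "\<lfloor>x\<rfloor> = 0" using assms by linarith
    then show ?case by simp
  next
    case (Suc n)
    have "(\<Sum>k<Suc n. of_bool (binary_digits x k) / 2 ^ k) =
        (2 * (of_int \<lfloor>2 ^ n * x\<rfloor> / 2 ^ n) + of_bool (binary_digits x n) / 2 ^ n :: real)"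
      using Suc.IH by (simp only: sum.lessThan_Suc)
    also have "\<dots> = (2 * of_int \<lfloor>2 ^ n * x\<rfloor> + of_bool (binary_digits x n)) / 2 ^ n"
      by (simp only: add_divide_distrib times_divide_eq_right)
    also have "\<dots> = 2 * (of_int \<lfloor>2 ^ Suc n * x\<rfloor> / 2 ^ Suc n)"
      by (subst step) (simp add: divide_simps)
    finally show ?case .
  qed
  have "(\<lambda>n. of_int \<lfloor>2 ^ n * x\<rfloor> / 2 ^ n) \<longlonglongrightarrow> x"
  proof (rule tendsto_sandwich)
    have "x - 1 / 2 ^ n \<le> of_int \<lfloor>2 ^ n * x\<rfloor> / 2 ^ n" "of_int \<lfloor>2 ^ n * x\<rfloor> / 2 ^ n \<le> x" for n
    proof -
      have "2 ^ n * x - 1 \<le> of_int \<lfloor>2 ^ n * x\<rfloor>" "of_int \<lfloor>2 ^ n * x\<rfloor> \<le> 2 ^ n * x" by linarith+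
      then have "(2 ^ n * x - 1) / 2 ^ n \<le> of_int \<lfloor>2 ^ n * x\<rfloor> / 2 ^ n"
        "of_int \<lfloor>2 ^ n * x\<rfloor> / 2 ^ n \<le> (2 ^ n * x) / 2 ^ n"
        by (intro divide_right_mono; simp)+
      then show "x - 1 / 2 ^ n \<le> of_int \<lfloor>2 ^ n * x\<rfloor> / 2 ^ n" "of_int \<lfloor>2 ^ n * x\<rfloor> / 2 ^ n \<le> x"
        by (simp_all add: diff_divide_distrib)
    qed
    then show "\<forall>\<^sub>F n in sequentially. x - 1 / 2 ^ n \<le> of_int \<lfloor>2 ^ n * x\<rfloor> / 2 ^ n"
      "\<forall>\<^sub>F n in sequentially. of_int \<lfloor>2 ^ n * x\<rfloor> / 2 ^ n \<le> x"
      by simp_all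
    have "(\<lambda>n. x - (1 / 2) ^ n) \<longlonglongrightarrow> x - 0"
      by (intro tendsto_intros LIMSEQ_realpow_zero) auto
    then show "(\<lambda>n. x - 1 / 2 ^ n) \<longlonglongrightarrow> x" by (simp add: power_divide)
  qed auto
  then have "(\<lambda>n. \<Sum>k<n. of_bool (binary_digits x k) / 2 ^ k) \<longlonglongrightarrow> 2 * x"
    unfolding partial by (intro tendsto_intros)
  moreover have "(\<lambda>n. \<Sum>k<n. of_bool (binary_digits x k) / 2 ^ k) \<longlonglongrightarrow> digit_sum 2 (binary_digits x)"
    unfolding digit_sum_def by (intro summable_LIMSEQ summable_digits) auto
  ultimately show ?thesis using LIMSEQ_unique by blast
qed

text \<open>Every compact set of a Euclidean space is the continuous image of a subset of
  \<open>[0,2]\<close>, and a preimage can be chosen in a Borel way. A point is turned into the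
  sequence of the binary digits of all its coordinates, and that sequence into a point of the
  Cantor set. Decoding is continuous on the Cantor set, since the Cantor coding is a homeomorphism
  and binary sums are continuous in the digits; Tietze's theorem extends it to the line. Encoding
  is Borel only. This reduces weak compactness and disintegration on compact sets to statements
  about distribution functions on the line.\<close>

lemma compact_real_parametrization:
  fixes K :: "'a::euclidean_space set"
  assumes "compact K"
  obtains \<phi> :: "real \<Rightarrow> 'a" and s :: "'a \<Rightarrow> real"
  where "continuous_on UNIV \<phi>" "s \<in> borel_measurable borel"
    "\<And>x. 0 \<le> s x \<and> s x \<le> 2" "\<And>x. x \<in> K \<Longrightarrow> \<phi> (s x) = x"
proof -
  obtain R where R: "R > 0" "\<And>x. x \<in> K \<Longrightarrow> norm x < R"
    using compact_imp_bounded[OF assms] bounded_pos_less by metis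
  obtain e :: "'a \<Rightarrow> nat" where e: "inj_on e Basis"
    using countable_finite[OF finite_Basis] unfolding countable_def by blast
  \<comment> \<open>The coordinates share one digit sequence: digit \<open>k\<close> of coordinate \<open>b\<close>
    sits at position \<open>prod_encode (e b, k)\<close>. Coordinates are rescaled from
    \<open>(-R, R)\<close> to the range \<open>(0, 2)\<close> of binary sums.\<close>
  define P :: "(nat \<Rightarrow> bool) \<Rightarrow> 'a" where
    "P c = (\<Sum>b\<in>Basis. (R * (digit_sum 2 (\<lambda>k. c (prod_encode (e b, k))) - 1)) *\<^sub>R b)" for c
  define D :: "'a \<Rightarrow> nat \<Rightarrow> bool" where
    "D x n = (let (i, k) = prod_decode n in
       binary_digits (((x \<bullet> inv_into Basis e i) / R + 1) / 2) k)" for x n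
  define s where "s x = digit_sum 3 (D x)" for x
  have PD: "P (D x) = x" if "x \<in> K" for x
  proof -
    have "R * (digit_sum 2 (\<lambda>k. D x (prod_encode (e b, k))) - 1) = x \<bullet> b" if b: "b \<in> Basis" for b
    proof -
      let ?y = "((x \<bullet> b) / R + 1) / 2"
      have "\<bar>x \<bullet> b\<bar> < R" using R(2)[OF \<open>x \<in> K\<close>] Basis_le_norm[OF b, of x] by linarith
      then have "0 \<le> ?y" "?y < 1" using R(1) by (auto simp: field_simps abs_less_iff)
      moreover have "(\<lambda>k. D x (prod_encode (e b, k))) = binary_digits ?y"
        using e b by (simp add: D_def)
      ultimately show ?thesis
        using R(1) by (simp add: digit_sum_binary_digits field_simps)
    qed
    then show ?thesis unfolding P_def by (simp add: euclidean_representation)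
  qed
  have contP: "continuous_on UNIV P"
    unfolding P_def
  proof (intro continuous_intros)
    fix b :: 'a
    have "continuous_on UNIV (\<lambda>c::nat\<Rightarrow>bool. \<lambda>k. c (prod_encode (e b, k)))"
      by (intro continuous_on_coordinatewise_then_product continuous_on_product_coordinates)
    then show "continuous_on UNIV (\<lambda>c. digit_sum 2 (\<lambda>k. c (prod_encode (e b, k))))"
      using continuous_on_compose2[OF continuous_on_digit_sum[of 2]] by fastforce
  qed
  define C where "C = range (digit_sum 3)"
  have C: "compact C"
    unfolding C_def by (intro compact_continuous_image continuous_on_digit_sum
        compact_UNIV_bool_sequences) auto
  have "continuous_on C (inv (digit_sum 3))"
    unfolding C_def
    by (intro continuous_on_inv continuous_on_digit_sum compact_UNIV_bool_sequences)
       (auto simp: inv_f_f[OF inj_digit_sum_3])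
  then have contC: "continuous_on C (\<lambda>r. P (inv (digit_sum 3) r))"
    using continuous_on_compose2[OF contP] by blast
  then have "compact ((\<lambda>r. P (inv (digit_sum 3) r)) ` C)"
    using C compact_continuous_image by blast
  then obtain B where B: "B > 0" "\<And>r. r \<in> C \<Longrightarrow> norm (P (inv (digit_sum 3) r)) \<le> B"
    using compact_imp_bounded bounded_pos by (metis imageI)
  obtain \<phi> :: "real \<Rightarrow> 'a" where \<phi>: "continuous_on UNIV \<phi>" "\<And>r. r \<in> C \<Longrightarrow> \<phi> r = P (inv (digit_sum 3) r)"
    by (rule Tietze[of C _ UNIV B, OF contC])
       (use B C in \<open>auto simp: closed_closedin[symmetric] compact_imp_closed\<close>)
  show thesis
  proof
    show "continuous_on UNIV \<phi>" by fact
    have "(\<lambda>x. binary_digits (((x \<bullet> b) / R + 1) / 2) k) \<in> measurable borel (count_space UNIV)" for b :: 'a and k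
      unfolding binary_digits_def by measurable
    then have [measurable]: "(\<lambda>x. D x n) \<in> measurable borel (count_space UNIV)" for n
      unfolding D_def by (cases "prod_decode n") simp
    show "s \<in> borel_measurable borel" unfolding s_def digit_sum_def by measurable
    show "0 \<le> s x \<and> s x \<le> 2" for x
      using digit_sum_bounds[of 3 "D x"] by (auto simp: s_def)
    show "\<phi> (s x) = x" if "x \<in> K" for x
    proof -
      have "s x \<in> C" by (auto simp: s_def C_def)
      then show ?thesis using \<phi>(2) PD[OF that] by (simp add: s_def inv_f_f[OF inj_digit_sum_3])
    qed
  qed
qed

section \<open>Weak compactness of measures on a compact set\<close>

lemma continuous_integrable_finite_measure:
  fixes g :: "'a::topological_space \<Rightarrow> real"
  assumes "finite_measure M" "sets M = sets borel" "continuous_on UNIV g" "\<And>x. \<bar>g x\<bar> \<le> B"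
  shows "integrable M g"
proof -
  have [measurable_cong]: "sets M = sets borel" by fact
  have [measurable]: "g \<in> borel_measurable borel"
    by (rule borel_measurable_continuous_onI[OF assms(3)])
  show ?thesis
    by (rule finite_measure.integrable_const_bound[OF assms(1), of g B]) (use assms(4) in auto)
qed

lemma open_indicator_approximation:
  fixes U :: "'a::metric_space set"
  assumes "open U"
  obtains g :: "nat \<Rightarrow> 'a \<Rightarrow> real"
  where "\<And>n. continuous_on UNIV (g n)" "\<And>n x. 0 \<le> g n x" "\<And>n x. g n x \<le> indicator U x"
    "\<And>x. (\<lambda>n. g n x) \<longlonglongrightarrow> indicator U x"
proof (cases "U = UNIV")
  case True
  then show ?thesis by (intro that[of "\<lambda>_ _. 1"]) auto
next
  case False
  define g where "g n x = min 1 (real n * infdist x (- U))" for n x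
  have out: "infdist x (- U) = 0 \<longleftrightarrow> x \<notin> U" for x
    using in_closed_iff_infdist_zero[of "- U" x] assms False by auto
  have pos: "0 < infdist x (- U)" if "x \<in> U" for x
    using out[of x] infdist_nonneg[of x "- U"] that by linarith
  show ?thesis
  proof
    show "continuous_on UNIV (g n)" for n
      unfolding g_def by (intro continuous_intros)
    show "0 \<le> g n x" "g n x \<le> indicator U x" for n x
      using out[of x] infdist_nonneg[of x "- U"] by (auto simp: g_def split: split_indicator)
    show "(\<lambda>n. g n x) \<longlonglongrightarrow> indicator U x" for x
    proof (cases "x \<in> U")
      case True
      obtain m :: nat where "1 / infdist x (- U) < m" using reals_Archimedean2 by blast
      then have m: "1 < real m * infdist x (- U)" using pos[OF True] by (simp add: field_simps)
      have "\<forall>\<^sub>F n in sequentially. g n x = 1"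
        using eventually_ge_at_top[of m]
      proof eventually_elim
        case (elim n)
        then have "real m * infdist x (- U) \<le> real n * infdist x (- U)"
          using pos[OF True] by (intro mult_right_mono) auto
        then show ?case using m by (simp add: g_def)
      qed
      then show ?thesis using True by (simp add: tendsto_eventually)
    next
      case False
      then show ?thesis using out[of x] by (simp add: g_def)
    qed
  qed
qed

text \<open>The indicator of an open set is a bounded pointwise limit of continuous functions, so an
  inequality between the integrals of continuous functions passes to open sets.\<close>

lemma emeasure_open_le_of_integrals_le:
  fixes M N :: "'a::metric_space measure"
  assumes M: "finite_measure M" "sets M = sets borel"
    and N: "finite_measure N" "sets N = sets borel"
    and le: "\<And>g :: 'a \<Rightarrow> real. continuous_on UNIV g \<Longrightarrow> (\<And>x. 0 \<le> g x) \<Longrightarrow> (\<And>x. g x \<le> 1) \<Longrightarrow>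
      (\<integral>x. g x \<partial>M) \<le> (\<integral>x. g x \<partial>N)"
    and "open U"
  shows "emeasure M U \<le> emeasure N U"
proof -
  have [measurable_cong]: "sets M = sets borel" "sets N = sets borel" by fact+
  have [measurable]: "U \<in> sets borel" using \<open>open U\<close> by simp
  obtain g where g: "\<And>n. continuous_on UNIV (g n)" "\<And>n x. (0::real) \<le> g n x" 
      "\<And>n x. g n x \<le> indicator U x" "\<And>x. (\<lambda>n. g n x) \<longlonglongrightarrow> indicator U x"
    using open_indicator_approximation[OF \<open>open U\<close>] by metis
  have [measurable]: "g n \<in> borel_measurable borel" for n
    by (rule borel_measurable_continuous_onI[OF g(1)])
  have g1: "g n x \<le> 1" for n x using g(3)[of n x] indicator_le_1[of U x, where 'a=real] by linarith
  have lim: "(\<lambda>n. \<integral>x. g n x \<partial>L) \<longlonglongrightarrow> measure L U" 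
    if "finite_measure L" and [measurable_cong]: "sets L = sets borel" for L
  proof -
    have "(\<lambda>n. \<integral>x. g n x \<partial>L) \<longlonglongrightarrow> (\<integral>x. indicator U x \<partial>L)"
      by (rule integral_dominated_convergence[where w="\<lambda>_. 1"])
         (use g g1 that in \<open>auto intro: finite_measure.integrable_const\<close>)
    then show ?thesis by simp
  qed
  have "measure M U \<le> measure N U"
    by (rule LIMSEQ_le[OF lim[OF M] lim[OF N]]) (use le g(1,2) g1 in auto)
  then show ?thesis
    using M(1) N(1) by (simp add: finite_measure.emeasure_eq_measure)
qed

text \<open>The open sets are a generator that is stable under intersections, so measures with the same
  continuous integrals coincide.\<close>

lemma finite_measure_eqI_continuous:
  fixes M N :: "'a::metric_space measure"
  assumes M: "finite_measure M" "sets M = sets borel"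
    and N: "finite_measure N" "sets N = sets borel"
    and eq: "\<And>g :: 'a \<Rightarrow> real. continuous_on UNIV g \<Longrightarrow> (\<And>x. 0 \<le> g x) \<Longrightarrow> (\<And>x. g x \<le> 1) \<Longrightarrow>
      (\<integral>x. g x \<partial>M) = (\<integral>x. g x \<partial>N)"
  shows "M = N"
proof (rule measure_eqI_generator_eq[where E="{U. open U}" and \<Omega>=UNIV and A="\<lambda>_. UNIV"])
  show "emeasure M U = emeasure N U" if "U \<in> {U. open U}" for U
    using that
    by (intro antisym emeasure_open_le_of_integrals_le[OF M N] emeasure_open_le_of_integrals_le[OF N M])
       (simp_all add: eq)
  show "sets M = sigma_sets UNIV {U. open U}" "sets N = sigma_sets UNIV {U. open U}"
    using M(2) N(2) by (auto simp: borel_def)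
  show "emeasure M UNIV \<noteq> \<infinity>"
    using finite_measure.finite_emeasure_space[OF M(1)] sets_eq_imp_space_eq[OF M(2)] by simp
qed (auto simp: Int_stable_def)

text \<open>After normalization, the images of the measures under the coding \<open>s\<close> are probability
  measures on \<open>[0,2]\<close> and hence tight. Helly's selection theorem gives a weakly
  convergent subsequence on the line, and its limit is pushed back by the continuous decoding
  \<open>\<phi>\<close>: for continuous \<open>g\<close> also \<open>g \<circ> \<phi>\<close> is
  continuous, and \<open>\<phi> \<circ> s\<close> is the identity on \<open>K\<close>. So it is
  harmless that \<open>s\<close> is not continuous. The lower bound on the masses allows the
  normalization.\<close>

proposition bounded_measures_on_compact_convergent_subsequence:
  fixes M :: "nat \<Rightarrow> 'a::euclidean_space measure"
  assumes K: "compact K"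
    and M: "\<And>n. finite_measure (M n)" "\<And>n. sets (M n) = sets borel" "\<And>n. AE x in M n. x \<in> K"
    and mass: "a > 0" "\<And>n. a \<le> measure (M n) UNIV" "\<And>n. measure (M n) UNIV \<le> b"
  obtains r \<mu> where "strict_mono r" "finite_measure \<mu>" "sets \<mu> = sets borel" "AE x in \<mu>. x \<in> K"
    "\<And>g B. continuous_on UNIV g \<Longrightarrow> (\<And>x. \<bar>g x\<bar> \<le> B) \<Longrightarrow>
       (\<lambda>n. \<integral>x. g x \<partial>M (r n)) \<longlonglongrightarrow> (\<integral>x. g x \<partial>\<mu> :: real)"
proof -
  have [measurable_cong]: "sets (M n) = sets borel" for n by fact
  have spM: "space (M n) = UNIV" for n using sets_eq_imp_space_eq[OF M(2)] by simp
  obtain \<phi> :: "real \<Rightarrow> 'a" and s where \<phi>: "continuous_on UNIV \<phi>" 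
    and [measurable]: "s \<in> borel_measurable borel"
    and s: "\<And>x. 0 \<le> s x \<and> s x \<le> (2::real)" "\<And>x. x \<in> K \<Longrightarrow> \<phi> (s x) = x"
    using compact_real_parametrization[OF K] by metis
  have [measurable]: "\<phi> \<in> borel_measurable borel"
    by (rule borel_measurable_continuous_onI[OF \<phi>])
  define c where "c n = measure (M n) UNIV" for n
  have "\<forall>n. c n \<in> {a..b}" using mass by (auto simp: c_def)
  then obtain l r1 where l: "l \<in> {a..b}" "strict_mono r1" "(c \<circ> r1) \<longlonglongrightarrow> l"
    using compact_Icc[of a b] unfolding compact_def by metis
  have cpos: "c n > 0" for n using mass by (auto simp: c_def intro: less_le_trans)
  define N where "N n = distr (density (M n) (\<lambda>_. ennreal (1 / c n))) borel s" for n
  have emN: "emeasure (M n) UNIV = ennreal (c n)" for n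
    using M(1) by (simp add: c_def finite_measure.emeasure_eq_measure)
  have N: "real_distribution (N n)" for n
  proof -
    have "prob_space (density (M n) (\<lambda>_. ennreal (1 / c n)))"
      using cpos[of n]
      by (intro prob_spaceI) (simp add: spM emN emeasure_density nn_integral_cmult_indicator
          flip: ennreal_mult)
    then show ?thesis unfolding N_def by (rule prob_space.real_distribution_distr) simp
  qed
  have intN: "(\<integral>t. f t \<partial>N n) = (\<integral>x. f (s x) \<partial>M n) / c n"
    if [measurable]: "f \<in> borel_measurable borel" for f :: "real \<Rightarrow> real" and n
    using cpos[of n] unfolding N_def by (simp add: integral_distr integral_density)
  have "tight N"
    unfolding tight_def
  proof (intro conjI allI impI)
    show "real_distribution (N n)" for n by (rule N)
    fix \<epsilon> :: real assume "\<epsilon> > 0"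
    have "measure (N n) {-1<..2} = 1" for n
    proof -
      have "{-1<..2} \<in> sets (N n)" by (simp add: N_def)
      then show ?thesis
        using intN[of "indicator {-1<..2}" n] s(1) cpos[of n] 
        by (simp add: order.strict_trans2[of "-1" 0] c_def spM N_def)
    qed
    then show "\<exists>a b. a < b \<and> (\<forall>n. 1 - \<epsilon> < measure (N n) {a<..b})"
      using \<open>\<epsilon> > 0\<close> by (intro exI[of _ "-1"] exI[of _ 2]) simp
  qed
  then obtain r2 N' where r2: "strict_mono (r2 :: nat \<Rightarrow> nat)" "real_distribution N'"
      "weak_conv_m (N \<circ> r1 \<circ> r2) N'"
    using tight_imp_convergent_subsubsequence[OF _ l(2)] by blast
  interpret N': real_distribution N' by fact
  define \<mu> where "\<mu> = density (distr N' borel \<phi>) (\<lambda>_. ennreal l)"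
  have lpos: "l > 0" using l(1) mass(1) by auto
  have setsmu: "sets \<mu> = sets borel" by (simp add: \<mu>_def)
  have fin: "finite_measure \<mu>"
    using N'.emeasure_space_1
    by (intro finite_measureI)
       (simp add: \<mu>_def emeasure_density emeasure_distr nn_integral_cmult_indicator ennreal_mult_eq_top_iff)
  have conv: "(\<lambda>n. \<integral>x. g x \<partial>M (r1 (r2 n))) \<longlonglongrightarrow> (\<integral>x. g x \<partial>\<mu>)"
    if g: "continuous_on UNIV g" "\<And>x. \<bar>g x\<bar> \<le> B" for g :: "'a \<Rightarrow> real" and B
  proof -
    have [measurable]: "g \<in> borel_measurable borel"
      by (rule borel_measurable_continuous_onI[OF g(1)])
    have "continuous_on UNIV (\<lambda>t. g (\<phi> t))"
      using continuous_on_compose2[OF g(1) \<phi>] by simp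
    then have "isCont (\<lambda>t. g (\<phi> t)) t" for t
      by (simp add: continuous_on_eq_continuous_at)
    then have "(\<lambda>n. \<integral>t. g (\<phi> t) \<partial>(N \<circ> r1 \<circ> r2) n) \<longlonglongrightarrow> (\<integral>t. g (\<phi> t) \<partial>N')"
      using N g(2) by (intro weak_conv_imp_integral_bdd_continuous_conv[where B=B] r2) auto
    then have "(\<lambda>n. c (r1 (r2 n)) * (\<integral>t. g (\<phi> t) \<partial>N (r1 (r2 n)))) \<longlonglongrightarrow> l * (\<integral>t. g (\<phi> t) \<partial>N')"
      using LIMSEQ_subseq_LIMSEQ[OF l(3) r2(1)] by (intro tendsto_mult) (auto simp: o_def)
    moreover have "c n * (\<integral>t. g (\<phi> t) \<partial>N n) = (\<integral>x. g x \<partial>M n)" for n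
    proof -
      have "(\<integral>x. g (\<phi> (s x)) \<partial>M n) = (\<integral>x. g x \<partial>M n)"
        using M(3)[of n] by (intro integral_cong_AE) (auto simp: s(2))
      then show ?thesis using cpos[of n] by (simp add: intN)
    qed
    moreover have "l * (\<integral>t. g (\<phi> t) \<partial>N') = (\<integral>x. g x \<partial>\<mu>)"
      using lpos unfolding \<mu>_def by (simp add: integral_density integral_distr)
    ultimately show ?thesis by simp
  qed
  show thesis
  proof (rule that[of "r1 \<circ> r2" \<mu>])
    show "strict_mono (r1 \<circ> r2)" using l(2) r2(1) by (rule strict_mono_o)
    show "finite_measure \<mu>" "sets \<mu> = sets borel" by fact+
    show "(\<lambda>n. \<integral>x. g x \<partial>M ((r1 \<circ> r2) n)) \<longlonglongrightarrow> (\<integral>x. g x \<partial>\<mu>)"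
      if "continuous_on UNIV g" "\<And>x. \<bar>g x\<bar> \<le> B" for g :: "'a \<Rightarrow> real" and B
      using conv[OF that] by simp
    show "AE x in \<mu>. x \<in> K"
    proof -
      have "K \<noteq> {}"
      proof
        assume "K = {}"
        then have "emeasure (M 0) (space (M 0)) = 0"
          using M(3)[of 0] by (simp add: trivial_limit_def flip: ae_filter_eq_bot_iff)
        then show False using cpos[of 0] by (simp add: spM emN)
      qed
      let ?g = "\<lambda>x. min 1 (infdist x K)"
      have cont: "continuous_on UNIV ?g" by (intro continuous_intros)
      have bound: "\<bar>?g x\<bar> \<le> 1" for x using infdist_nonneg[of x K] by auto
      have "(\<integral>x. ?g x \<partial>M n) = 0" for n
      proof (rule integral_eq_zero_AE)
        show "AE x in M n. ?g x = 0" using M(3)[of n] by eventually_elim simp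
      qed
      then have "(\<integral>x. ?g x \<partial>\<mu>) = 0"
        using conv[OF cont bound] LIMSEQ_unique[OF _ tendsto_const[of 0]] by simp
      moreover have "integrable \<mu> ?g"
        by (rule continuous_integrable_finite_measure[OF fin setsmu cont bound])
      ultimately have "AE x in \<mu>. ?g x = 0"
        using integral_nonneg_eq_0_iff_AE[of \<mu> ?g] infdist_nonneg[of _ K] by simp
      then show ?thesis
      proof eventually_elim
        case (elim x)
        then show ?case
          using in_closed_iff_infdist_zero[OF compact_imp_closed[OF K] \<open>K \<noteq> {}\<close>, of x]
          by (simp add: min_def split: if_splits)
      qed
    qed
  qed
qed

section \<open>Disintegration of measures\<close>

text \<open>The measure \<open>\<mu>\<close> is the integral over \<open>\<alpha>\<close> of the images of the
  measures \<open>\<kappa> a\<close> under \<open>p a\<close>. It is stated by integrals of Borel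
  functions and not by a product measure, so that it covers the disintegrations (\<open>p =
  Pair\<close>), Fubini's theorem for completed measures on the cylinder, and kernels living on
  restricted spaces; measurability of the integrals takes the place of measurability of the kernel
  as a map into a space of measures.\<close>

definition decomposes :: "'c::topological_space measure \<Rightarrow> 'a measure \<Rightarrow> ('a \<Rightarrow> 'b measure) \<Rightarrow> ('a \<Rightarrow> 'b \<Rightarrow> 'c) \<Rightarrow> bool" where
  "decomposes \<mu> \<alpha> \<kappa> p \<longleftrightarrow> (\<forall>F\<in>borel_measurable borel.
     (\<forall>a\<in>space \<alpha>. (\<lambda>b. F (p a b)) \<in> borel_measurable (\<kappa> a)) \<and>
     (\<lambda>a. \<integral>\<^sup>+b. F (p a b) \<partial>\<kappa> a) \<in> borel_measurable \<alpha> \<and>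
     (\<integral>\<^sup>+z. F z \<partial>\<mu>) = (\<integral>\<^sup>+a. (\<integral>\<^sup>+b. (F (p a b) :: ennreal) \<partial>\<kappa> a) \<partial>\<alpha>))"

lemma decomposesD:
  fixes F :: "'c::topological_space \<Rightarrow> ennreal"
  assumes "decomposes \<mu> \<alpha> \<kappa> p" "F \<in> borel_measurable borel"
  shows "a \<in> space \<alpha> \<Longrightarrow> (\<lambda>b. F (p a b)) \<in> borel_measurable (\<kappa> a)"
    and "(\<lambda>a. \<integral>\<^sup>+b. F (p a b) \<partial>\<kappa> a) \<in> borel_measurable \<alpha>"
    and "(\<integral>\<^sup>+z. F z \<partial>\<mu>) = (\<integral>\<^sup>+a. (\<integral>\<^sup>+b. F (p a b) \<partial>\<kappa> a) \<partial>\<alpha>)"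
  using assms unfolding decomposes_def by blast+

lemma decomposes_measurable:
  fixes f :: "'c::topological_space \<Rightarrow> 'd::topological_space"
  assumes D: "decomposes \<mu> \<alpha> \<kappa> p" and f: "f \<in> borel_measurable borel" and a: "a \<in> space \<alpha>"
  shows "(\<lambda>b. f (p a b)) \<in> borel_measurable (\<kappa> a)"
proof (rule measurableI)
  fix A :: "'d set" assume "A \<in> sets borel"
  then have "f -` A \<in> sets borel" using measurable_sets[OF f] by simp
  then have "(\<lambda>b. indicator (f -` A) (p a b) :: ennreal) \<in> borel_measurable (\<kappa> a)"
    by (intro decomposesD(1)[OF D _ a]) simp
  then have "(\<lambda>b. indicator (f -` A) (p a b) :: ennreal) -` {1} \<inter> space (\<kappa> a) \<in> sets (\<kappa> a)"
    by (rule measurable_sets) simp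
  also have "(\<lambda>b. indicator (f -` A) (p a b) :: ennreal) -` {1} \<inter> space (\<kappa> a) =
      (\<lambda>b. f (p a b)) -` A \<inter> space (\<kappa> a)"
    by (auto simp: indicator_def split: if_splits)
  finally show "(\<lambda>b. f (p a b)) -` A \<inter> space (\<kappa> a) \<in> sets (\<kappa> a)" .
qed simp

lemma decomposes_AE:
  assumes D: "decomposes \<mu> \<alpha> \<kappa> p"
    and P: "{z. P z} \<in> sets borel" and AE: "AE z in \<mu>. P z"
  shows "AE a in \<alpha>. AE b in \<kappa> a. P (p a b)"
proof -
  let ?F = "indicator (- {z. P z}) :: _ \<Rightarrow> ennreal"
  have F: "?F \<in> borel_measurable borel" using P by simp
  have "(\<integral>\<^sup>+z. ?F z \<partial>\<mu>) = (\<integral>\<^sup>+z. 0 \<partial>\<mu>)"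
    using AE by (intro nn_integral_cong_AE) (auto elim!: eventually_mono)
  then have "(\<integral>\<^sup>+a. (\<integral>\<^sup>+b. ?F (p a b) \<partial>\<kappa> a) \<partial>\<alpha>) = 0"
    using decomposesD(3)[OF D F] by simp
  then have "AE a in \<alpha>. (\<integral>\<^sup>+b. ?F (p a b) \<partial>\<kappa> a) = 0"
    using decomposesD(2)[OF D F] by (simp add: nn_integral_0_iff_AE)
  then show ?thesis
    using AE_space
  proof eventually_elim
    case (elim a)
    then have "AE b in \<kappa> a. ?F (p a b) = 0"
      using decomposesD(1)[OF D F] by (simp add: nn_integral_0_iff_AE)
    then show ?case by eventually_elim (simp add: indicator_def split: if_splits)
  qed
qed

text \<open>Fubini's theorem for signed integrands, obtained by splitting into positive and negative parts.\<close>

lemma decomposes_integral: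
  fixes f :: "'c::topological_space \<Rightarrow> real"
  assumes D: "decomposes \<mu> \<alpha> \<kappa> p" and f[measurable]: "f \<in> borel_measurable borel"
    and int: "integrable \<mu> f"
  shows "AE a in \<alpha>. integrable (\<kappa> a) (\<lambda>b. f (p a b))"
    and "integrable \<alpha> (\<lambda>a. \<integral>b. f (p a b) \<partial>\<kappa> a)"
    and "(\<lambda>a. \<integral>b. f (p a b) \<partial>\<kappa> a) \<in> borel_measurable \<alpha>"
    and "(\<integral>z. f z \<partial>\<mu>) = (\<integral>a. (\<integral>b. f (p a b) \<partial>\<kappa> a) \<partial>\<alpha>)"
proof -
  define P where "P a = (\<integral>\<^sup>+b. ennreal (f (p a b)) \<partial>\<kappa> a)" for a
  define N where "N a = (\<integral>\<^sup>+b. ennreal (- f (p a b)) \<partial>\<kappa> a)" for a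
  have mP: "(\<lambda>z. ennreal (f z)) \<in> borel_measurable borel" and mN: "(\<lambda>z. ennreal (- f z)) \<in> borel_measurable borel"
    by measurable
  have [measurable]: "P \<in> borel_measurable \<alpha>" "N \<in> borel_measurable \<alpha>"
    unfolding P_def[abs_def] N_def[abs_def]
    using decomposesD(2)[OF D mP] decomposesD(2)[OF D mN] by auto
  have iP: "(\<integral>\<^sup>+a. P a \<partial>\<alpha>) = (\<integral>\<^sup>+z. ennreal (f z) \<partial>\<mu>)" and iN: "(\<integral>\<^sup>+a. N a \<partial>\<alpha>) = (\<integral>\<^sup>+z. ennreal (- f z) \<partial>\<mu>)"
    unfolding P_def N_def using decomposesD(3)[OF D mP] decomposesD(3)[OF D mN] by auto
  have fin: "(\<integral>\<^sup>+z. ennreal (f z) \<partial>\<mu>) \<noteq> \<infinity>" "(\<integral>\<^sup>+z. ennreal (- f z) \<partial>\<mu>) \<noteq> \<infinity>"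
    using int by (auto simp: real_integrable_def)
  have AEfin: "AE a in \<alpha>. P a \<noteq> \<infinity>" "AE a in \<alpha>. N a \<noteq> \<infinity>"
    using fin iP iN by (intro nn_integral_PInf_AE; simp)+
  have mf: "(\<lambda>b. f (p a b)) \<in> borel_measurable (\<kappa> a)" if "a \<in> space \<alpha>" for a
    using decomposes_measurable[OF D f that] .
  have int_iff: "integrable (\<kappa> a) (\<lambda>b. f (p a b)) \<longleftrightarrow> P a \<noteq> \<infinity> \<and> N a \<noteq> \<infinity>" if "a \<in> space \<alpha>" for a
    using mf[OF that] by (auto simp: real_integrable_def P_def N_def)
  show AEint: "AE a in \<alpha>. integrable (\<kappa> a) (\<lambda>b. f (p a b))"
    using AEfin AE_space by eventually_elim (simp add: int_iff)
  have eq: "(\<integral>b. f (p a b) \<partial>\<kappa> a) = (if P a \<noteq> \<infinity> \<and> N a \<noteq> \<infinity> then enn2real (P a) - enn2real (N a) else 0)"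
    if "a \<in> space \<alpha>" for a
    using int_iff[OF that] by (auto simp: real_lebesgue_integral_def not_integrable_integral_eq P_def N_def)
  have "(\<lambda>a. \<integral>b. f (p a b) \<partial>\<kappa> a) \<in> borel_measurable \<alpha> \<longleftrightarrow>
      (\<lambda>a. if P a \<noteq> \<infinity> \<and> N a \<noteq> \<infinity> then enn2real (P a) - enn2real (N a) else 0) \<in> borel_measurable \<alpha>"
    by (intro measurable_cong eq)
  then show meas: "(\<lambda>a. \<integral>b. f (p a b) \<partial>\<kappa> a) \<in> borel_measurable \<alpha>" by simp
  have intPN: "integrable \<alpha> (\<lambda>a. enn2real (P a))" "integrable \<alpha> (\<lambda>a. enn2real (N a))"
    and intPN': "(\<integral>a. enn2real (P a) \<partial>\<alpha>) = enn2real (\<integral>\<^sup>+z. ennreal (f z) \<partial>\<mu>)"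
      "(\<integral>a. enn2real (N a) \<partial>\<alpha>) = enn2real (\<integral>\<^sup>+z. ennreal (- f z) \<partial>\<mu>)"
  proof -
    have e: "(\<integral>\<^sup>+a. ennreal (enn2real (P a)) \<partial>\<alpha>) = (\<integral>\<^sup>+a. P a \<partial>\<alpha>)"
      using AEfin(1) by (intro nn_integral_cong_AE) (auto elim!: eventually_mono simp: less_top)
    have e': "(\<integral>\<^sup>+a. ennreal (enn2real (N a)) \<partial>\<alpha>) = (\<integral>\<^sup>+a. N a \<partial>\<alpha>)"
      using AEfin(2) by (intro nn_integral_cong_AE) (auto elim!: eventually_mono simp: less_top)
    show "integrable \<alpha> (\<lambda>a. enn2real (P a))"
      using fin(1) by (intro integrableI_nonneg) (auto simp: e iP less_top)
    show "integrable \<alpha> (\<lambda>a. enn2real (N a))"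
      using fin(2) by (intro integrableI_nonneg) (auto simp: e' iN less_top)
    show "(\<integral>a. enn2real (P a) \<partial>\<alpha>) = enn2real (\<integral>\<^sup>+z. ennreal (f z) \<partial>\<mu>)"
      by (subst integral_eq_nn_integral) (auto simp: e iP)
    show "(\<integral>a. enn2real (N a) \<partial>\<alpha>) = enn2real (\<integral>\<^sup>+z. ennreal (- f z) \<partial>\<mu>)"
      by (subst integral_eq_nn_integral) (auto simp: e' iN)
  qed
  have AEeq: "AE a in \<alpha>. (\<integral>b. f (p a b) \<partial>\<kappa> a) = enn2real (P a) - enn2real (N a)"
    using AEfin AE_space by eventually_elim (simp add: eq)
  show "integrable \<alpha> (\<lambda>a. \<integral>b. f (p a b) \<partial>\<kappa> a)"
    by (subst integrable_cong_AE[OF meas _ AEeq]) (auto intro: intPN)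
  have "(\<integral>a. (\<integral>b. f (p a b) \<partial>\<kappa> a) \<partial>\<alpha>) = (\<integral>a. enn2real (P a) - enn2real (N a) \<partial>\<alpha>)"
    by (rule integral_cong_AE[OF meas _ AEeq]) simp
  also have "\<dots> = (\<integral>z. f z \<partial>\<mu>)"
    using intPN by (simp add: real_lebesgue_integral_def[OF int] intPN')
  finally show "(\<integral>z. f z \<partial>\<mu>) = (\<integral>a. (\<integral>b. f (p a b) \<partial>\<kappa> a) \<partial>\<alpha>)" by simp
qed

text \<open>A conditional distribution function obtained from densities is monotone only up to a null set that
  depends on the pair of arguments. The infimum over the rational arguments to the right is
  monotone and right continuous for every parameter and hence the distribution function of a
  measure. Arguments outside \<open>[0,2)\<close> are prescribed, so that the total mass is 1
  everywhere.\<close>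

lemma kernel_distribution_functions:
  fixes F :: "real \<Rightarrow> 'a \<Rightarrow> real"
  assumes F[measurable]: "\<And>q. F q \<in> borel_measurable M"
    and F01: "\<And>q a. 0 \<le> F q a" 
    and lo: "\<And>q a. q < 0 \<Longrightarrow> F q a = 0" and hi: "\<And>q a. q \<ge> 2 \<Longrightarrow> F q a = 1"
  obtains \<kappa> where "\<kappa> \<in> M \<rightarrow>\<^sub>M prob_algebra borel"
    "\<And>a x. emeasure (\<kappa> a) {..x} = ennreal (INF q\<in>{q\<in>\<rat>. x < q}. F q a)"
proof -
  define G where "G a x = (INF q\<in>{q\<in>\<rat>. x < q}. F q a)" for a x
  have ne: "{q\<in>\<rat>. x < q} \<noteq> {}" for x :: real
    using Rats_dense_in_real[of x "x + 1"] by auto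
  have bdd: "bdd_below ((\<lambda>q. F q a) ` S)" for a S
    using F01 by (auto intro!: bdd_belowI[of _ 0])
  have G_le: "G a x \<le> F q a" if "q \<in> \<rat>" "x < q" for a x q
    unfolding G_def using that by (intro cINF_lower bdd) auto
  have G_ge: "c \<le> G a x" if "\<And>q. q \<in> \<rat> \<Longrightarrow> x < q \<Longrightarrow> c \<le> F q a" for a x c
    unfolding G_def using that by (intro cINF_greatest ne) auto
  have mono: "G a x \<le> G a y" if "x \<le> y" for a x y
    using that by (intro G_ge G_le) auto
  have G0: "0 \<le> G a x" for a x by (intro G_ge F01)
  have approx: "\<exists>q\<in>\<rat>. x < q \<and> F q a < G a x + e" if "e > 0" for a x e
  proof (rule ccontr)
    assume "\<not> ?thesis"
    then have "G a x + e \<le> G a x" by (intro G_ge) force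
    with that show False by simp
  qed
  have right: "continuous (at_right x) (G a)" for a x
    unfolding continuous_within
  proof (rule order_tendstoI)
    fix y assume "y < G a x"
    then have "y < G a z" if "x < z" for z using mono[of x z a] that by linarith
    then show "\<forall>\<^sub>F z in at_right x. y < G a z"
      using eventually_at_right_less[of x] by (rule eventually_mono[rotated])
  next
    fix y assume "G a x < y"
    then obtain q where q: "q \<in> \<rat>" "x < q" "F q a < y"
      using approx[of "y - G a x" x a] by auto
    show "\<forall>\<^sub>F z in at_right x. G a z < y"
      using eventually_at_right_real[OF q(2)]
    proof eventually_elim
      case (elim z)
      then show ?case using G_le[OF q(1), of z a] q(3) by simp
    qed
  qed
  have G_lo: "G a x = 0" if x: "x < 0" for a x
  proof -
    obtain q where "q \<in> \<rat>" "x < q" "q < 0" using Rats_dense_in_real[OF x] by blast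
    then show ?thesis using G_le[of q x a] lo[of q a] G0[of a x] by simp
  qed
  have G_hi: "G a x = 1" if "x \<ge> 2" for a x
  proof (rule antisym)
    obtain q where "q \<in> \<rat>" "x < q" using ne[of x] by auto
    then show "G a x \<le> 1" using G_le[of q x a] hi[of q a] that by simp
    show "1 \<le> G a x" using that by (intro G_ge) (simp add: hi)
  qed
  have bot: "(G a \<longlongrightarrow> 0) at_bot" for a
    by (rule tendsto_eventually, rule eventually_mono[OF eventually_gt_at_bot[of 0]]) (rule G_lo)
  have top: "(G a \<longlongrightarrow> 1) at_top" for a
    by (rule tendsto_eventually, rule eventually_mono[OF eventually_ge_at_top[of 2]]) (rule G_hi)
  define \<kappa> where "\<kappa> a = interval_measure (G a)" for a
  have em: "emeasure (\<kappa> a) {..x} = ennreal (G a x)" for a x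
    unfolding \<kappa>_def by (rule emeasure_interval_measure_Iic[OF mono right bot])
  have mG[measurable]: "(\<lambda>a. G a x) \<in> borel_measurable M" for x
    unfolding G_def by (intro borel_measurable_cINF_real countable_subset[OF _ countable_rat] F) auto
  have "\<kappa> \<in> M \<rightarrow>\<^sub>M prob_algebra borel"
  proof (rule measurable_prob_algebra_generated[where \<Omega>=UNIV and G="range (\<lambda>x. {..x})"])
    show "sets borel = sigma_sets UNIV (range (\<lambda>x::real. {..x}))"
      by (subst borel_eq_atMost) simp
    show "Int_stable (range (\<lambda>x::real. {..x}))"
    proof (rule Int_stableI_image)
      fix x y :: real
      have "{..x} \<inter> {..y} = {..min x y}" by auto
      then show "\<exists>z\<in>UNIV. {..x} \<inter> {..y} = {..z}" by blast
    qed
    show "prob_space (\<kappa> a)" for a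
      unfolding \<kappa>_def using real_distribution_interval_measure[OF mono right bot top]
      by (simp add: real_distribution_def)
    show "(\<lambda>a. emeasure (\<kappa> a) A) \<in> borel_measurable M" if "A \<in> range (\<lambda>x. {..x})" for A
      using that by (auto simp: em)
  qed (auto simp: \<kappa>_def)
  then show thesis using em by (intro that) (auto simp: G_def)
qed

lemma measure_eqI_rectangles:
  fixes M N :: "('a::second_countable_topology \<times> 'b::second_countable_topology) measure"
  assumes M: "finite_measure M" "sets M = sets borel" and N: "sets N = sets borel"
    and eq: "\<And>A B. A \<in> sets borel \<Longrightarrow> B \<in> sets borel \<Longrightarrow> emeasure M (A \<times> B) = emeasure N (A \<times> B)"
  shows "M = N"
proof (rule measure_eqI_generator_eq[OF Int_stable_pair_measure_generator[of borel borel], where A="\<lambda>_. UNIV"])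
  have "sets (borel :: ('a \<times> 'b) measure) = sets ((borel :: 'a measure) \<Otimes>\<^sub>M (borel :: 'b measure))"
    by (simp only: borel_prod)
  also have "\<dots> = sigma_sets UNIV {a \<times> b |a b. a \<in> sets borel \<and> b \<in> sets borel}"
    by (simp add: sets_pair_measure)
  finally show "sets M = sigma_sets UNIV {a \<times> b |a b. a \<in> sets borel \<and> b \<in> sets borel}"
    "sets N = sigma_sets UNIV {a \<times> b |a b. a \<in> sets borel \<and> b \<in> sets borel}"
    using M(2) N by auto
  show "emeasure M UNIV \<noteq> \<infinity>"
    using finite_measure.finite_emeasure_space[OF M(1)] sets_eq_imp_space_eq[OF M(2)] by simp
  show "range (\<lambda>_. UNIV) \<subseteq> {a \<times> b |a b. a \<in> sets (borel::'a measure) \<and> b \<in> sets (borel::'b measure)}"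
    by (auto intro!: exI[of _ UNIV])
qed (use eq in auto)

lemma finite_real_measure_eqI_atMost:
  fixes M N :: "real measure"
  assumes M: "finite_measure M" "sets M = sets borel" and N: "sets N = sets borel"
    and eq: "\<And>x. emeasure M {..x} = emeasure N {..x}"
  shows "M = N"
proof (rule measure_eqI_generator_eq[where E="range (\<lambda>x. {..x})" and \<Omega>=UNIV and A="\<lambda>n. {..real n}"])
  show "Int_stable (range (\<lambda>x::real. {..x}))"
  proof (rule Int_stableI_image)
    fix x y :: real
    have "{..x} \<inter> {..y} = {..min x y}" by auto
    then show "\<exists>z\<in>UNIV. {..x} \<inter> {..y} = {..z}" by blast
  qed
  show "sets M = sigma_sets UNIV (range (\<lambda>x. {..x}))" "sets N = sigma_sets UNIV (range (\<lambda>x. {..x}))"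
    unfolding M(2) N by (simp_all add: borel_eq_atMost)
  show "emeasure M {..real n} \<noteq> \<infinity>" for n
    using finite_measure.emeasure_finite[OF M(1)] by simp
  show "(\<Union>n. {..real n}) = UNIV" using real_arch_simple by auto
qed (use eq in auto)

text \<open>For fixed \<open>q\<close>, the measure \<open>A \<mapsto> \<mu> (A \<times> {..q})\<close> is
  absolutely continuous with respect to the first marginal, and its density is the conditional
  distribution function at \<open>q\<close>. By \<open>kernel_distribution_functions\<close> these
  densities, for rational \<open>q\<close>, yield a probability kernel, and comparing values on
  the sets \<open>A \<times> {..x}\<close> shows that it disintegrates \<open>\<mu>\<close>.
  Outside the support \<open>[0,2]\<close> of the second marginal the densities are replaced by
  \<open>0\<close> and \<open>1\<close>.\<close>

lemma disintegration_real:
  fixes \<mu> :: "('a::second_countable_topology \<times> real) measure"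
  assumes fin: "finite_measure \<mu>" and sets[measurable_cong]: "sets \<mu> = sets borel"
    and supp: "AE z in \<mu>. 0 \<le> snd z \<and> snd z \<le> 2"
  obtains \<kappa> where "\<kappa> \<in> borel \<rightarrow>\<^sub>M prob_algebra borel" "decomposes \<mu> (distr \<mu> borel fst) \<kappa> Pair"
proof -
  interpret finite_measure \<mu> by fact
  have sp: "space \<mu> = UNIV" using sets_eq_imp_space_eq[OF sets] by simp
  have [measurable]: "fst \<in> \<mu> \<rightarrow>\<^sub>M borel" "snd \<in> \<mu> \<rightarrow>\<^sub>M borel" 
    by (simp_all add: measurable_cong_sets[OF sets refl] borel_prod[symmetric])
  have rect[measurable]: "A \<times> B \<in> sets \<mu>" if "A \<in> sets borel" "B \<in> sets borel" 
    for A :: "'a set" and B :: "real set"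
    using that by (simp add: sets borel_prod[symmetric])
  define \<alpha> where "\<alpha> = distr \<mu> borel fst"
  have sets_\<alpha>[measurable_cong]: "sets \<alpha> = sets borel" and sp_\<alpha>: "space \<alpha> = UNIV" by (auto simp: \<alpha>_def)
  interpret \<alpha>: finite_measure \<alpha> unfolding \<alpha>_def by (rule finite_measure_distr) simp
  have em_\<alpha>: "emeasure \<alpha> A = emeasure \<mu> (A \<times> UNIV)" if "A \<in> sets borel" for A
    using that by (simp add: \<alpha>_def emeasure_distr sp) (metis Times_Int_Times UNIV_Times_UNIV fst_vimage_eq_Times)
  define part where "part B = distr (density \<mu> (indicator (UNIV \<times> B))) borel fst" for B
  have em_part: "emeasure (part B) A = emeasure \<mu> (A \<times> B)"
    if [measurable]: "A \<in> sets borel" "B \<in> sets borel" for A B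
  proof -
    have "fst -` A = A \<times> (UNIV::real set)" by auto
    then have "emeasure (part B) A = (\<integral>\<^sup>+z. indicator (UNIV \<times> B) z * indicator (A \<times> UNIV) z \<partial>\<mu>)"
      by (simp add: part_def emeasure_distr sp emeasure_density)
    also have "\<dots> = (\<integral>\<^sup>+z. indicator (A \<times> B) z \<partial>\<mu>)"
      by (intro nn_integral_cong) (auto split: split_indicator)
    finally show ?thesis by simp
  qed
  \<comment> \<open>The conditional probability of \<open>B\<close> given the first component.\<close>
  define R where "R B = RN_deriv \<alpha> (part B)" for B
  have [measurable]: "R B \<in> borel_measurable borel" for B
    using borel_measurable_RN_deriv[of \<alpha> "part B"] by (simp add: R_def measurable_cong_sets[OF sets_\<alpha> refl])
  have dens: "density \<alpha> (R B) = part B" if [measurable]: "B \<in> sets borel" for B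
    unfolding R_def
  proof (rule \<alpha>.density_RN_deriv)
    show "absolutely_continuous \<alpha> (part B)"
      unfolding absolutely_continuous_def
    proof
      fix A assume A: "A \<in> null_sets \<alpha>"
      then have [measurable]: "A \<in> sets borel" by (auto simp: null_sets_def sets_\<alpha>)
      have "emeasure \<mu> (A \<times> B) \<le> emeasure \<mu> (A \<times> UNIV)" by (intro emeasure_mono) auto
      then show "A \<in> null_sets (part B)"
        using A em_\<alpha>[of A] em_part[of A B] by (auto simp: null_sets_def part_def)
    qed
  qed (simp add: part_def sets_\<alpha>)
  have intR: "(\<integral>\<^sup>+a. R B a * indicator A a \<partial>\<alpha>) = emeasure \<mu> (A \<times> B)"
    if "A \<in> sets borel" "B \<in> sets borel" for A B
    using arg_cong[OF dens[OF that(2)], of "\<lambda>M. emeasure M A"] that em_part[OF that]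
    by (simp add: emeasure_density)
  have R_add: "AE a in \<alpha>. R B' a = R B a + R (B' - B) a" 
    if [measurable]: "B \<in> sets borel" "B' \<in> sets borel" and "B \<subseteq> B'" for B B'
  proof (rule \<alpha>.density_unique)
    show "density \<alpha> (R B') = density \<alpha> (\<lambda>a. R B a + R (B' - B) a)"
    proof (rule measure_eqI)
      fix A assume "A \<in> sets (density \<alpha> (R B'))"
      then have [measurable]: "A \<in> sets borel" by (simp add: sets_\<alpha>)
      have "A \<times> B' = A \<times> B \<union> A \<times> (B' - B)" using that by auto
      then have "emeasure \<mu> (A \<times> B') = emeasure \<mu> (A \<times> B) + emeasure \<mu> (A \<times> (B' - B))"
        by (simp, intro plus_emeasure[symmetric]) auto
      then show "emeasure (density \<alpha> (R B')) A = emeasure (density \<alpha> (\<lambda>a. R B a + R (B' - B) a)) A"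
        by (simp add: emeasure_density distrib_right nn_integral_add intR)
    qed simp
  qed measurable
  have R_UNIV: "AE a in \<alpha>. R UNIV a = 1"
  proof (rule \<alpha>.density_unique)
    show "density \<alpha> (R UNIV) = density \<alpha> (\<lambda>_. 1)"
      by (rule measure_eqI) (auto simp: emeasure_density intR em_\<alpha> sets_\<alpha>)
  qed measurable
  have R_mono: "AE a in \<alpha>. R B a \<le> R B' a" if "B \<in> sets borel" "B' \<in> sets borel" "B \<subseteq> B'" for B B'
    using R_add[OF that] by eventually_elim simp
  have R_le1: "AE a in \<alpha>. R B a \<le> 1" if "B \<in> sets borel" for B
    using R_mono[OF that sets.top, simplified] R_UNIV by eventually_elim simp
  define F where "F q a = (if q < 0 then 0 else if q \<ge> 2 then 1 else enn2real (min 1 (R {..q} a)))" for q :: real and a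
  have [measurable]: "F q \<in> borel_measurable borel" for q unfolding F_def[abs_def] by simp
  have F_le1: "F q a \<le> 1" for q a
    using enn2real_mono[of "min 1 (R {..q} a)" 1] by (simp add: F_def)
  have F_ge0: "0 \<le> F q a" for q a by (simp add: F_def)
  obtain \<kappa> where \<kappa>[measurable]: "\<kappa> \<in> borel \<rightarrow>\<^sub>M prob_algebra borel"
    and em_\<kappa>: "\<And>a x. emeasure (\<kappa> a) {..x} = ennreal (INF q\<in>{q\<in>\<rat>. x < q}. F q a)"
  proof (rule kernel_distribution_functions[of F borel])
    show "F q \<in> borel_measurable borel" "0 \<le> F q a" for q a by (simp_all add: F_ge0)
  qed (simp_all add: F_def)
  have intF: "(\<integral>\<^sup>+a. ennreal (F q a) * indicator A a \<partial>\<alpha>) = emeasure \<mu> (A \<times> {..q})"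
    if [measurable]: "A \<in> sets borel" for A q
  proof (cases "q < 0 \<or> q \<ge> 2")
    case False
    have "(\<integral>\<^sup>+a. ennreal (F q a) * indicator A a \<partial>\<alpha>) = (\<integral>\<^sup>+a. R {..q} a * indicator A a \<partial>\<alpha>)"
    proof (rule nn_integral_cong_AE)
      show "AE a in \<alpha>. ennreal (F q a) * indicator A a = R {..q} a * indicator A a"
        using R_le1[of "{..q}", simplified]
      proof eventually_elim
        case (elim a)
        then have "R {..q} a < top" by (rule order.strict_trans1) simp
        then show ?case using False elim by (simp add: F_def min_absorb2)
      qed
    qed
    then show ?thesis by (simp add: intR)
  next
    case True
    then show ?thesis
    proof
      assume q: "q < 0"
      have "emeasure \<mu> (A \<times> {..q}) = emeasure \<mu> {}"
        using supp q by (intro emeasure_eq_AE) (auto elim!: eventually_mono)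
      then show ?thesis using q by (simp add: F_def)
    next
      assume q: "q \<ge> 2"
      have "emeasure \<mu> (A \<times> {..q}) = emeasure \<mu> (A \<times> UNIV)"
      proof (rule emeasure_eq_AE)
        show "AE z in \<mu>. z \<in> A \<times> {..q} \<longleftrightarrow> z \<in> A \<times> UNIV"
          using supp by eventually_elim (use q in \<open>auto simp: mem_Times_iff\<close>)
      qed auto
      then show ?thesis using q by (simp add: F_def em_\<alpha>)
    qed
  qed
  have F_mono: "AE a in \<alpha>. \<forall>p\<in>\<rat>. \<forall>q\<in>\<rat>. p \<le> q \<longrightarrow> F p a \<le> F q a"
  proof (intro AE_ball_countable[THEN iffD2] countable_rat ballI)
    fix p q :: real
    show "AE a in \<alpha>. p \<le> q \<longrightarrow> F p a \<le> F q a"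
    proof (cases "p \<le> q")
      case True
      have "AE a in \<alpha>. R {..p} a \<le> R {..q} a" using True by (intro R_mono) auto
      then show ?thesis
      proof eventually_elim
        case (elim a)
        then have "enn2real (min 1 (R {..p} a)) \<le> enn2real (min 1 (R {..q} a))"
          by (intro enn2real_mono min.mono) (auto simp: min_less_iff_disj)
        then show ?case using True F_le1[of p a] F_ge0[of q a] by (auto simp: F_def)
      qed
    qed simp
  qed
  have int\<kappa>: "(\<integral>\<^sup>+a. emeasure (\<kappa> a) {..x} * indicator A a \<partial>\<alpha>) = emeasure \<mu> (A \<times> {..x})"
    if [measurable]: "A \<in> sets borel" for A x
  proof -
    have "\<exists>q. q \<in> \<rat> \<and> x < q \<and> q < x + 1 / Suc n" for n
      using Rats_dense_in_real[of x "x + 1 / Suc n"] by auto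
    then obtain q where q: "\<And>n. q n \<in> \<rat>" "\<And>n. x < q n" "\<And>n. q n < x + 1 / Suc n" by metis
    have q_lim: "q \<longlonglongrightarrow> x"
    proof (rule tendsto_sandwich[where f="\<lambda>_. x" and h="\<lambda>n. x + 1 / Suc n"])
      have "(\<lambda>n. x + 1 / Suc n) \<longlonglongrightarrow> x + 0"
        by (intro tendsto_intros LIMSEQ_Suc[OF lim_1_over_n])
      then show "(\<lambda>n. x + 1 / Suc n) \<longlonglongrightarrow> x" by simp
    qed (use q in \<open>auto intro!: always_eventually less_imp_le\<close>)
    have "(\<lambda>n. \<integral>\<^sup>+a. ennreal (F (q n) a) * indicator A a \<partial>\<alpha>)
        \<longlonglongrightarrow> (\<integral>\<^sup>+a. emeasure (\<kappa> a) {..x} * indicator A a \<partial>\<alpha>)"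
    proof (rule nn_integral_dominated_convergence[where w="\<lambda>_. 1"])
      show "AE a in \<alpha>. (\<lambda>n. ennreal (F (q n) a) * indicator A a) \<longlonglongrightarrow> emeasure (\<kappa> a) {..x} * indicator A a"
        using F_mono
      proof eventually_elim
        case (elim a)
        let ?S = "{q\<in>\<rat>. x < q}"
        have bdd: "bdd_below ((\<lambda>q. F q a) ` ?S)"
          using F_ge0 by (auto intro!: bdd_belowI[of _ 0])
        have "(\<lambda>n. F (q n) a) \<longlonglongrightarrow> (INF q\<in>?S. F q a)"
        proof (rule order_tendstoI)
          fix y assume "y < (INF q\<in>?S. F q a)"
          moreover have "(INF q\<in>?S. F q a) \<le> F (q n) a" for n
            using q by (intro cINF_lower bdd) auto
          ultimately have "y < F (q n) a" for n by (rule less_le_trans)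
          then show "\<forall>\<^sub>F n in sequentially. y < F (q n) a" by simp
        next
          fix y assume "(INF q\<in>?S. F q a) < y"
          moreover have "?S \<noteq> {}" using q by auto
          ultimately obtain p where p: "p \<in> \<rat>" "x < p" "F p a < y"
            using cINF_less_iff[OF _ bdd, of y] by blast
          show "\<forall>\<^sub>F n in sequentially. F (q n) a < y"
            using order_tendstoD(2)[OF q_lim p(2)]
          proof eventually_elim
            case less: (elim n)
            then have "F (q n) a \<le> F p a" using elim q(1) p(1) by auto
            then show ?case using p(3) by simp
          qed
        qed
        then show ?case
          unfolding em_\<kappa> by (cases "a \<in> A") (simp_all add: tendsto_ennrealI)
      qed
      show "AE a in \<alpha>. ennreal (F (q n) a) * indicator A a \<le> 1" for n
        using F_le1 by (auto split: split_indicator simp: ennreal_le_1)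
      show "(\<integral>\<^sup>+a. 1 \<partial>\<alpha>) < \<infinity>" using \<alpha>.emeasure_finite[of "space \<alpha>"] by (simp add: less_top[symmetric])
      show "(\<lambda>a. emeasure (\<kappa> a) {..x} * indicator A a) \<in> borel_measurable \<alpha>"
        using measurable_emeasure_kernel[OF measurable_prob_algebraD[OF \<kappa>], of "{..x}"] 
        by (auto simp: measurable_cong_sets[OF sets_\<alpha> refl])
    qed auto
    moreover have "(\<lambda>n. \<integral>\<^sup>+z. indicator (A \<times> {..q n}) z \<partial>\<mu>) \<longlonglongrightarrow> (\<integral>\<^sup>+z. indicator (A \<times> {..x}) z \<partial>\<mu>)"
    proof (rule nn_integral_dominated_convergence[where w="\<lambda>_. 1"])
      show "AE z in \<mu>. (\<lambda>n. indicator (A \<times> {..q n}) z) \<longlonglongrightarrow> (indicator (A \<times> {..x}) z :: ennreal)"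
      proof (rule AE_I2)
        fix z
        show "(\<lambda>n. indicator (A \<times> {..q n}) z) \<longlonglongrightarrow> (indicator (A \<times> {..x}) z :: ennreal)"
        proof (cases "snd z \<le> x")
          case True
          then have "snd z \<le> q n" for n using q(2)[of n] by simp
          then have "indicator (A \<times> {..q n}) z = (indicator (A \<times> {..x}) z :: ennreal)" for n
            using True by (cases z) (simp add: indicator_def)
          then show ?thesis by simp
        next
          case False
          then have "\<forall>\<^sub>F n in sequentially. q n < snd z" by (intro order_tendstoD(2)[OF q_lim]) simp
          then have "\<forall>\<^sub>F n in sequentially. indicator (A \<times> {..q n}) z = (0 :: ennreal)"
            by eventually_elim (cases z, auto simp: indicator_def)
          moreover have "indicator (A \<times> {..x}) z = (0 :: ennreal)" using False by (cases z) (auto simp: indicator_def)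
          ultimately show ?thesis by (simp add: tendsto_eventually)
        qed
      qed
      show "(\<integral>\<^sup>+z. 1 \<partial>\<mu>) < \<infinity>" using emeasure_finite[of "space \<mu>"] by (simp add: less_top[symmetric])
    qed (auto split: split_indicator)
    ultimately show ?thesis
      using LIMSEQ_unique by (simp add: intF)
  qed
  define K where "K a = distr (\<kappa> a) borel (Pair a)" for a
  have mPair: "(\<lambda>(x, y). (x, y)) \<in> (borel :: 'a measure) \<Otimes>\<^sub>M (borel :: real measure) \<rightarrow>\<^sub>M borel"
    by (simp add: borel_prod)
  have K[measurable]: "K \<in> borel \<rightarrow>\<^sub>M prob_algebra borel"
    unfolding K_def[abs_def] by (rule measurable_distr_prob_space2[OF \<kappa> mPair])
  have K\<alpha>: "K \<in> \<alpha> \<rightarrow>\<^sub>M subprob_algebra borel"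
    using measurable_prob_algebraD[OF K] by (simp add: measurable_cong_sets[OF sets_\<alpha> refl])
  define \<nu> where "\<nu> = \<alpha> \<bind> K"
  have sets_\<nu>[measurable_cong]: "sets \<nu> = sets borel"
    unfolding \<nu>_def using K\<alpha> by (intro sets_bind[OF sets_kernel]) (auto simp: sp_\<alpha>)
  have sets_\<kappa>: "sets (\<kappa> a) = sets borel" for a
    using sets_kernel[OF measurable_prob_algebraD[OF \<kappa>]] by simp
  have Pair_meas: "Pair a \<in> \<kappa> a \<rightarrow>\<^sub>M borel" for a
    by (subst measurable_cong_sets[OF sets_\<kappa> refl]) (simp add: borel_prod[symmetric])
  have nn_\<nu>: "(\<integral>\<^sup>+z. f z \<partial>\<nu>) = (\<integral>\<^sup>+a. \<integral>\<^sup>+b. f (a, b) \<partial>\<kappa> a \<partial>\<alpha>)"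
    if f: "f \<in> borel_measurable borel" for f
    unfolding \<nu>_def
    by (subst nn_integral_bind[OF f K\<alpha>]) (simp add: K_def nn_integral_distr[OF Pair_meas] f)
  have eq_\<nu>: "\<mu> = \<nu>"
  proof (rule measure_eqI_rectangles[OF fin sets sets_\<nu>])
    fix A :: "'a set" and B :: "real set"
    assume A[measurable]: "A \<in> sets borel" and B[measurable]: "B \<in> sets borel"
    let ?r = "\<lambda>M. distr (density M (indicator (A \<times> (UNIV :: real set)))) borel snd"
    have em: "emeasure (?r M) C = emeasure M (A \<times> C)" 
      if M[measurable_cong]: "sets M = sets borel" and C[measurable]: "C \<in> sets borel" for M C
    proof -
      have m: "X \<times> C \<in> sets M" if "X \<in> sets borel" for X :: "'a set"
        using that C by (simp add: M borel_prod[symmetric])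
      have m': "A \<times> UNIV \<in> sets M" by (simp add: M borel_prod[symmetric])
      have s: "snd \<in> M \<rightarrow>\<^sub>M borel" by (simp add: measurable_cong_sets[OF M refl] borel_prod[symmetric])
      have "snd -` C \<inter> space M = UNIV \<times> C" using sets_eq_imp_space_eq[OF M] by auto
      then have "emeasure (?r M) C = (\<integral>\<^sup>+z. indicator (A \<times> UNIV) z * indicator (UNIV \<times> C) z \<partial>M)"
        using m m' s by (simp add: emeasure_distr emeasure_density)
      also have "\<dots> = (\<integral>\<^sup>+z. indicator (A \<times> C) z \<partial>M)"
        by (intro nn_integral_cong) (auto split: split_indicator)
      finally show ?thesis using m by simp
    qed
    \<comment> \<open>With \<open>A\<close> fixed, both sides are measures in \<open>B\<close>, so half lines suffice.\<close>
    have "?r \<mu> = ?r \<nu>"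
    proof (rule finite_real_measure_eqI_atMost)
      have "emeasure \<mu> (A \<times> UNIV) < \<infinity>" using emeasure_finite[of "A \<times> UNIV"] by (simp add: less_top[symmetric])
      then show "finite_measure (?r \<mu>)"
        by (intro finite_measureI) (simp add: em[OF sets])
      show "emeasure (?r \<mu>) {..x} = emeasure (?r \<nu>) {..x}" for x
      proof -
        have AX: "A \<times> {..x} \<in> sets borel" using rect[OF A, of "{..x}"] by (simp add: sets)
        have "emeasure \<nu> (A \<times> {..x}) = (\<integral>\<^sup>+z. indicator (A \<times> {..x}) z \<partial>\<nu>)"
          using AX by (simp add: sets_\<nu>)
        also have "\<dots> = (\<integral>\<^sup>+a. \<integral>\<^sup>+b. indicator A a * indicator {..x} b \<partial>\<kappa> a \<partial>\<alpha>)"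
          using AX by (simp add: nn_\<nu> indicator_times)
        also have "\<dots> = (\<integral>\<^sup>+a. emeasure (\<kappa> a) {..x} * indicator A a \<partial>\<alpha>)"
          by (intro nn_integral_cong) (simp add: sets_\<kappa> nn_integral_cmult_indicator mult.commute[of _ "indicator A _"])
        finally show ?thesis by (simp add: em sets sets_\<nu> int\<kappa>)
      qed
    qed simp_all
    then show "emeasure \<mu> (A \<times> B) = emeasure \<nu> (A \<times> B)"
      using em[OF sets B] em[OF sets_\<nu> B] by simp
  qed
  have "decomposes \<mu> \<alpha> \<kappa> Pair"
    unfolding decomposes_def
  proof (intro ballI conjI)
    fix F :: "'a \<times> real \<Rightarrow> ennreal" assume F: "F \<in> borel_measurable borel"
    show "(\<lambda>b. F (a, b)) \<in> borel_measurable (\<kappa> a)" for a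
      using measurable_compose[OF Pair_meas F] .
    have "(\<lambda>a. integral\<^sup>N (\<kappa> a) (\<lambda>b. F (a, b))) \<in> borel_measurable borel"
      by (rule nn_integral_measurable_subprob_algebra2[OF _ measurable_prob_algebraD[OF \<kappa>]])
         (use F in \<open>simp add: borel_prod\<close>)
    then show "(\<lambda>a. \<integral>\<^sup>+b. F (a, b) \<partial>\<kappa> a) \<in> borel_measurable \<alpha>"
      by (simp add: measurable_cong_sets[OF sets_\<alpha> refl])
    show "(\<integral>\<^sup>+z. F z \<partial>\<mu>) = (\<integral>\<^sup>+a. \<integral>\<^sup>+b. F (a, b) \<partial>\<kappa> a \<partial>\<alpha>)"
      using nn_\<nu>[OF F] by (simp add: eq_\<nu>)
  qed
  then show thesis using \<kappa> by (intro that) (auto simp: \<alpha>_def)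
qed

lemma decomposes_PairI:
  fixes \<kappa> :: "'a::second_countable_topology \<Rightarrow> 'b::second_countable_topology measure"
  assumes \<kappa>: "\<kappa> \<in> borel \<rightarrow>\<^sub>M subprob_algebra borel" and \<alpha>: "sets \<alpha> = sets borel"
    and eq: "\<And>F :: 'a \<times> 'b \<Rightarrow> ennreal. F \<in> borel_measurable borel \<Longrightarrow>
      (\<integral>\<^sup>+z. F z \<partial>\<mu>) = (\<integral>\<^sup>+a. (\<integral>\<^sup>+b. F (a, b) \<partial>\<kappa> a) \<partial>\<alpha>)"
  shows "decomposes \<mu> \<alpha> \<kappa> Pair"
  unfolding decomposes_def
proof (intro ballI conjI)
  fix F :: "'a \<times> 'b \<Rightarrow> ennreal" assume F: "F \<in> borel_measurable borel"
  have sets_\<kappa>: "sets (\<kappa> a) = sets borel" for a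
    using sets_kernel[OF \<kappa>] by simp
  have "Pair a \<in> \<kappa> a \<rightarrow>\<^sub>M borel" for a
    by (subst measurable_cong_sets[OF sets_\<kappa> refl]) (simp add: borel_prod[symmetric])
  then show "(\<lambda>b. F (a, b)) \<in> borel_measurable (\<kappa> a)" for a
    using measurable_compose[OF _ F] by blast
  have "(\<lambda>a. integral\<^sup>N (\<kappa> a) (\<lambda>b. F (a, b))) \<in> borel_measurable borel"
    by (rule nn_integral_measurable_subprob_algebra2[OF _ \<kappa>]) (use F in \<open>simp add: borel_prod\<close>)
  then show "(\<lambda>a. \<integral>\<^sup>+b. F (a, b) \<partial>\<kappa> a) \<in> borel_measurable \<alpha>"
    by (simp add: measurable_cong_sets[OF \<alpha> refl])
qed (use eq in blast)

text \<open>The coding of the compact set by reals transports the measure to one on the product with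
  \<open>[0,2]\<close>; the kernel obtained there is pushed back by the decoding map.\<close>

theorem disintegration:
  fixes \<mu> :: "('a::second_countable_topology \<times> 'b::euclidean_space) measure"
  assumes fin: "finite_measure \<mu>" and sets[measurable_cong]: "sets \<mu> = sets borel"
    and K: "compact K" and supp: "AE z in \<mu>. snd z \<in> K"
  obtains \<kappa> where "\<kappa> \<in> borel \<rightarrow>\<^sub>M prob_algebra borel" "decomposes \<mu> (distr \<mu> borel fst) \<kappa> Pair"
proof -
  interpret finite_measure \<mu> by fact
  obtain \<phi> :: "real \<Rightarrow> 'b" and s where \<phi>: "continuous_on UNIV \<phi>" 
    and s_meas[measurable]: "s \<in> borel_measurable borel"
    and s: "\<And>x. 0 \<le> s x \<and> s x \<le> (2::real)" "\<And>x. x \<in> K \<Longrightarrow> \<phi> (s x) = x"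
    using compact_real_parametrization[OF K] by metis
  have [measurable]: "\<phi> \<in> borel_measurable borel"
    by (rule borel_measurable_continuous_onI[OF \<phi>])
  define e where "e z = (fst z, s (snd z))" for z :: "'a \<times> 'b"
  have [measurable]: "fst \<in> borel_measurable (borel :: ('a \<times> 'b) measure)" "snd \<in> borel_measurable (borel :: ('a \<times> 'b) measure)"
    "fst \<in> borel_measurable (borel :: ('a \<times> real) measure)"
    by (simp_all add: borel_prod[symmetric])
  have e_meas: "e \<in> borel_measurable borel"
    unfolding e_def[abs_def] by (subst (2) borel_prod[symmetric]) measurable
  then have e[measurable]: "e \<in> \<mu> \<rightarrow>\<^sub>M borel" by (simp add: measurable_cong_sets[OF sets refl])
  define \<mu>' where "\<mu>' = distr \<mu> borel e"
  have fst_eq: "distr \<mu>' borel fst = distr \<mu> borel fst"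
    unfolding \<mu>'_def by (subst distr_distr) (auto simp: o_def e_def)
  obtain \<kappa>' where \<kappa>': "\<kappa>' \<in> borel \<rightarrow>\<^sub>M prob_algebra borel" "decomposes \<mu>' (distr \<mu>' borel fst) \<kappa>' Pair"
  proof (rule disintegration_real)
    show "finite_measure \<mu>'" unfolding \<mu>'_def by (rule finite_measure_distr[OF e])
    have "{z. 0 \<le> snd z \<and> snd z \<le> 2} = (UNIV :: 'a set) \<times> {0..2::real}" by auto
    also have "\<dots> \<in> sets (borel \<Otimes>\<^sub>M borel)" by simp
    finally have "{z. 0 \<le> snd z \<and> snd z \<le> 2} \<in> sets (borel :: ('a \<times> real) measure)"
      by (simp only: borel_prod)
    then show "AE z in \<mu>'. 0 \<le> snd z \<and> snd z \<le> 2"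
      unfolding \<mu>'_def by (subst AE_distr_iff) (auto simp: e_def s(1))
  qed (auto simp: \<mu>'_def)
  define \<kappa> where "\<kappa> a = distr (\<kappa>' a) borel \<phi>" for a
  have \<kappa>: "\<kappa> \<in> borel \<rightarrow>\<^sub>M prob_algebra borel"
    unfolding \<kappa>_def[abs_def] by (rule measurable_distr_prob_space2[OF \<kappa>'(1)]) measurable
  have sets_\<kappa>': "sets (\<kappa>' a) = sets borel" for a
    using sets_kernel[OF measurable_prob_algebraD[OF \<kappa>'(1)]] by simp
  have "decomposes \<mu> (distr \<mu> borel fst) \<kappa> Pair"
  proof (rule decomposes_PairI[OF measurable_prob_algebraD[OF \<kappa>]])
    fix F :: "'a \<times> 'b \<Rightarrow> ennreal" assume F[measurable]: "F \<in> borel_measurable borel"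
    define F' where "F' z = F (fst z, \<phi> (snd z))" for z
    have "(\<lambda>z. (fst z, \<phi> (snd z))) \<in> borel_measurable (borel :: ('a \<times> real) measure)"
      by (simp add: borel_prod[symmetric])
    then have F'[measurable]: "F' \<in> borel_measurable borel"
      unfolding F'_def[abs_def] using measurable_compose[OF _ F] by blast
    have "(\<integral>\<^sup>+z. F z \<partial>\<mu>) = (\<integral>\<^sup>+z. F' (e z) \<partial>\<mu>)"
      using supp by (intro nn_integral_cong_AE) (auto elim!: eventually_mono simp: F'_def e_def s(2))
    also have "\<dots> = (\<integral>\<^sup>+z. F' z \<partial>\<mu>')"
      unfolding \<mu>'_def by (subst nn_integral_distr[OF e]) (use F' in auto)
    also have "\<dots> = (\<integral>\<^sup>+a. \<integral>\<^sup>+b. F' (a, b) \<partial>\<kappa>' a \<partial>distr \<mu> borel fst)"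
      using decomposesD(3)[OF \<kappa>'(2) F'] by (simp add: fst_eq)
    also have "\<dots> = (\<integral>\<^sup>+a. \<integral>\<^sup>+b. F (a, b) \<partial>\<kappa> a \<partial>distr \<mu> borel fst)"
    proof (rule nn_integral_cong)
      fix a :: 'a
      have "Pair a \<in> (borel :: 'b measure) \<rightarrow>\<^sub>M borel" by (simp add: borel_prod[symmetric])
      then have "(\<lambda>b. F (a, b)) \<in> borel_measurable borel" using measurable_compose[OF _ F] by blast
      moreover have "\<phi> \<in> \<kappa>' a \<rightarrow>\<^sub>M borel" by (simp add: measurable_cong_sets[OF sets_\<kappa>' refl])
      ultimately show "(\<integral>\<^sup>+b. F' (a, b) \<partial>\<kappa>' a) = (\<integral>\<^sup>+b. F (a, b) \<partial>\<kappa> a)"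
        unfolding \<kappa>_def F'_def by (subst nn_integral_distr) auto
    qed
    finally show "(\<integral>\<^sup>+z. F z \<partial>\<mu>) = (\<integral>\<^sup>+a. \<integral>\<^sup>+b. F (a, b) \<partial>\<kappa> a \<partial>distr \<mu> borel fst)" .
  qed simp
  with \<kappa> show thesis by (rule that)
qed

section \<open>Lebesgue measure on the cylinder\<close>

lemma sets_cylinder:
  assumes "open \<Omega>"
  shows "open (cylinder \<Omega> T)" "cylinder \<Omega> T \<in> sets borel" "cylinder \<Omega> T \<in> sets lebesgue"
proof -
  show o: "open (cylinder \<Omega> T)" using assms unfolding cylinder_def by (intro open_Times) auto
  then show "cylinder \<Omega> T \<in> sets borel" "cylinder \<Omega> T \<in> sets lebesgue" by auto
qed

lemma nn_integral_lebesgue_on: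
  assumes "S \<in> sets lebesgue"
  shows "(\<integral>\<^sup>+x. f x \<partial>lebesgue_on S) = (\<integral>\<^sup>+x. f x * indicator S x \<partial>lborel)"
  using assms by (simp add: nn_integral_restrict_space nn_integral_completion)

text \<open>Tonelli's theorem holds for Borel measure; the Lebesgue measure on a set is its completion and has
  the same integrals of Borel functions.\<close>

lemma decomposes_cylinder:
  assumes "open \<Omega>"
  shows "decomposes (lebesgue_on (cylinder \<Omega> T)) (lebesgue_on {0<..<T}) (\<lambda>_. lebesgue_on \<Omega>) (\<lambda>t x. (x, t))"
  unfolding decomposes_def
proof (intro ballI conjI)
  fix F :: "point \<Rightarrow> ennreal" assume F[measurable]: "F \<in> borel_measurable borel"
  have F'[measurable]: "F \<in> borel_measurable (borel \<Otimes>\<^sub>M borel)" by (simp add: borel_prod)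
  have [measurable]: "\<Omega> \<in> sets borel" using assms by simp
  have Om: "\<Omega> \<in> sets lebesgue" using assms by auto
  have "(\<lambda>x. F (x, t)) \<in> borel_measurable lebesgue" for t
    by (intro measurable_completion) measurable
  then show "(\<lambda>x. F (x, t)) \<in> borel_measurable (lebesgue_on \<Omega>)" for t
    by (rule measurable_restrict_space1)
  have m: "(\<lambda>t. \<integral>\<^sup>+x. F (x, t) * indicator \<Omega> x \<partial>lborel) \<in> borel_measurable lborel"
    by measurable
  then have "(\<lambda>t. \<integral>\<^sup>+x. F (x, t) * indicator \<Omega> x \<partial>lborel) \<in> borel_measurable lebesgue"
    by (rule measurable_completion)
  then show "(\<lambda>t. \<integral>\<^sup>+x. F (x, t) \<partial>lebesgue_on \<Omega>) \<in> borel_measurable (lebesgue_on {0<..<T})"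
    by (simp add: nn_integral_lebesgue_on[OF Om] measurable_restrict_space1)
  have "(\<integral>\<^sup>+z. F z \<partial>lebesgue_on (cylinder \<Omega> T)) = (\<integral>\<^sup>+z. F z * indicator (cylinder \<Omega> T) z \<partial>lborel)"
    by (rule nn_integral_lebesgue_on[OF sets_cylinder(3)[OF assms]])
  also have "\<dots> = (\<integral>\<^sup>+z. F z * indicator (cylinder \<Omega> T) z \<partial>(lborel \<Otimes>\<^sub>M lborel))"
    by (simp add: lborel_prod)
  also have "\<dots> = (\<integral>\<^sup>+t. \<integral>\<^sup>+x. F (x, t) * indicator (cylinder \<Omega> T) (x, t) \<partial>lborel \<partial>lborel)"
    by (rule lborel_pair.nn_integral_snd[symmetric]) (simp add: cylinder_def)
  also have "\<dots> = (\<integral>\<^sup>+t. (\<integral>\<^sup>+x. F (x, t) * indicator \<Omega> x \<partial>lborel) * indicator {0<..<T} t \<partial>lborel)"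
    by (intro nn_integral_cong) (auto simp: cylinder_def indicator_def intro!: nn_integral_cong)
  finally show "(\<integral>\<^sup>+z. F z \<partial>lebesgue_on (cylinder \<Omega> T)) =
      (\<integral>\<^sup>+t. \<integral>\<^sup>+x. F (x, t) \<partial>lebesgue_on \<Omega> \<partial>lebesgue_on {0<..<T})"
    by (simp add: nn_integral_lebesgue_on Om)
qed

lemma AE_lebesgue_on_borel_iff:
  assumes "S \<in> sets lebesgue"
  shows "(AE x in lebesgue_on S. P x) \<longleftrightarrow> (AE x in lborel. x \<in> S \<longrightarrow> P x)"
  using assms by (simp add: AE_restrict_space_iff AE_completion_iff)

text \<open>A Lebesgue null set is contained in a Borel null set, to which Tonelli's theorem applies.\<close>

lemma AE_cylinder_slices:
  assumes \<Omega>: "open \<Omega>" and P: "AE y in lebesgue_on (cylinder \<Omega> T). P y"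
  shows "AE t in lebesgue_on {0<..<T}. AE x in lebesgue_on \<Omega>. P (x, t)"
proof -
  have "AE y in lborel. y \<in> cylinder \<Omega> T \<longrightarrow> P y"
    using P by (simp add: AE_lebesgue_on_borel_iff sets_cylinder[OF \<Omega>])
  then obtain N where N: "{y \<in> space lborel. \<not> (y \<in> cylinder \<Omega> T \<longrightarrow> P y)} \<subseteq> N" "N \<in> sets lborel" 
      "emeasure lborel N = 0" by (rule AE_E)
  have "AE y in lborel. y \<notin> N" using N by (intro AE_not_in) (auto simp: null_sets_def)
  then have "AE y in lebesgue_on (cylinder \<Omega> T). y \<notin> N"
    by (subst AE_lebesgue_on_borel_iff[OF sets_cylinder(3)[OF \<Omega>]]) (auto elim: eventually_mono)
  then have "AE t in lebesgue_on {0<..<T}. AE x in lebesgue_on \<Omega>. (x, t) \<notin> N"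
    by (rule decomposes_AE[OF decomposes_cylinder[OF \<Omega>], rotated]) (use N in \<open>simp add: Collect_neg_eq\<close>)
  then show ?thesis
    using AE_space
  proof eventually_elim
    case (elim t)
    from elim(1) AE_space show ?case
    proof eventually_elim
      case x: (elim x)
      then have "(x, t) \<in> cylinder \<Omega> T" using elim(2) by (simp add: cylinder_def)
      then show ?case using x(1) N(1) by auto
    qed
  qed
qed

lemma lebesgue_on_AE_eq_borel:
  fixes f :: "'a::euclidean_space \<Rightarrow> 'b::euclidean_space"
  assumes S: "S \<in> sets lebesgue" and f: "f \<in> borel_measurable (lebesgue_on S)"
  obtains g where "g \<in> borel_measurable borel" "AE x in lebesgue_on S. f x = g x"
proof -
  have "(\<lambda>x. if x \<in> S then f x else 0) \<in> borel_measurable lebesgue"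
    using f S by (subst borel_measurable_if) auto
  then have "(\<lambda>x. (if x \<in> S then f x else 0) \<bullet> b) \<in> borel_measurable lebesgue" for b
    by (intro borel_measurable_inner) auto
  then have "\<exists>h\<in>borel_measurable lborel. AE x in lborel. (if x \<in> S then f x else 0) \<bullet> b = h x" for b
    by (intro completion_ex_borel_measurable_real)
  then obtain h where h: "\<And>b. h b \<in> borel_measurable lborel" 
      "\<And>b. AE x in lborel. (if x \<in> S then f x else 0) \<bullet> b = h b x" by metis
  show thesis
  proof
    show "(\<lambda>x. \<Sum>b\<in>Basis. h b x *\<^sub>R b) \<in> borel_measurable borel"
      using h(1) by (auto intro!: borel_measurable_sum borel_measurable_scaleR)
    have "AE x in lborel. \<forall>b\<in>Basis. (if x \<in> S then f x else 0) \<bullet> b = h b x"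
      using h(2) by (intro AE_finite_allI) auto
    then have "AE x in lborel. x \<in> S \<longrightarrow> f x = (\<Sum>b\<in>Basis. h b x *\<^sub>R b)"
    proof eventually_elim
      case (elim x)
      show ?case
      proof
        assume "x \<in> S"
        then have "(\<Sum>b\<in>Basis. h b x *\<^sub>R b) = (\<Sum>b\<in>Basis. (f x \<bullet> b) *\<^sub>R b)"
          using elim by (intro sum.cong) auto
        then show "f x = (\<Sum>b\<in>Basis. h b x *\<^sub>R b)" by (simp add: euclidean_representation)
      qed
    qed
    then show "AE x in lebesgue_on S. f x = (\<Sum>b\<in>Basis. h b x *\<^sub>R b)"
      by (simp add: AE_lebesgue_on_borel_iff[OF S])
  qed
qed

section \<open>Smooth test functions\<close>

lemma Ck_fun_SucI:
  assumes "\<And>x. (f has_derivative D x) (at x)" "\<And>b. b \<in> Basis \<Longrightarrow> Ck_fun k (\<lambda>x. D x b)"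
  shows "Ck_fun (Suc k) f"
proof -
  have "frechet_derivative f (at x) = D x" for x
    using frechet_derivative_at[OF assms(1)] by simp
  then show ?thesis using assms by (auto simp: differentiable_def)
qed

lemma Ck_fun_has_derivative:
  assumes "Ck_fun (Suc k) f"
  shows "(f has_derivative frechet_derivative f (at x)) (at x)"
  using assms frechet_derivative_works by (auto simp del: frechet_derivative_works)

lemma Ck_fun_Suc_imp: "Ck_fun (Suc k) f \<Longrightarrow> Ck_fun k f"
proof (induction k arbitrary: f)
  case 0
  then show ?case
    by (auto simp: continuous_on_eq_continuous_at differentiable_imp_continuous_within)
next
  case (Suc k)
  from Suc.prems have d: "\<And>x. f differentiable (at x)"
    and D: "\<And>b. b \<in> Basis \<Longrightarrow> Ck_fun (Suc k) (\<lambda>x. frechet_derivative f (at x) b)" by simp_all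
  show ?case unfolding Ck_fun.simps(2)[of k] using d Suc.IH[OF D] by blast
qed

lemma Ck_fun_const: "Ck_fun k (\<lambda>x. c)"
proof (induction k arbitrary: c)
  case (Suc k)
  show ?case by (rule Ck_fun_SucI[OF has_derivative_const]) (rule Suc)
qed simp

lemma Ck_fun_add: "Ck_fun k f \<Longrightarrow> Ck_fun k g \<Longrightarrow> Ck_fun k (\<lambda>x. f x + g x)"
proof (induction k arbitrary: f g)
  case 0
  then show ?case by (auto intro: continuous_on_add)
next
  case (Suc k)
  show ?case
  proof (rule Ck_fun_SucI[OF has_derivative_add[OF Ck_fun_has_derivative Ck_fun_has_derivative]])
    show "Ck_fun (Suc k) f" "Ck_fun (Suc k) g" by (rule Suc.prems)+
    show "Ck_fun k (\<lambda>x. frechet_derivative f (at x) b + frechet_derivative g (at x) b)" if "b \<in> Basis" for b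
      using that Suc.prems by (intro Suc.IH) auto
  qed
qed

lemma Ck_fun_mult: "Ck_fun k f \<Longrightarrow> Ck_fun k g \<Longrightarrow> Ck_fun k (\<lambda>x. f x * g x)"
proof (induction k arbitrary: f g)
  case 0
  then show ?case by (auto intro: continuous_on_mult)
next
  case (Suc k)
  have fg: "Ck_fun k f" "Ck_fun k g" using Suc.prems Ck_fun_Suc_imp by blast+
  show ?case
  proof (rule Ck_fun_SucI[OF has_derivative_mult[OF Ck_fun_has_derivative Ck_fun_has_derivative]])
    show "Ck_fun (Suc k) f" "Ck_fun (Suc k) g" by (rule Suc.prems)+
    show "Ck_fun k (\<lambda>x. f x * frechet_derivative g (at x) b + frechet_derivative f (at x) b * g x)" if "b \<in> Basis" for b
      using that Suc.prems fg by (intro Ck_fun_add Suc.IH) auto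
  qed
qed

lemma Ck_fun_prod:
  assumes "finite I" "\<And>i. i \<in> I \<Longrightarrow> Ck_fun k (f i)"
  shows "Ck_fun k (\<lambda>x. \<Prod>i\<in>I. f i x)"
  using assms by (induction I rule: finite_induct) (auto intro: Ck_fun_mult Ck_fun_const)

text \<open>The family is closed under differentiation up to linear combinations, which is what makes the
  smoothness of the flat function \<open>exp_flat 0\<close> an induction on the order.\<close>

definition exp_flat :: "nat \<Rightarrow> real \<Rightarrow> real" where
  "exp_flat n s = (if s > 0 then exp (- (1 / s)) / s ^ n else 0)"

lemma exp_flat_tendsto_0: "(exp_flat n \<longlongrightarrow> 0) (at 0)"
proof -
  have "((\<lambda>s. inverse s ^ n / exp (inverse s)) \<longlongrightarrow> 0) (at_right (0::real))"
    by (rule filterlim_compose[OF tendsto_power_div_exp_0 filterlim_inverse_at_top_right])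
  then have "(exp_flat n \<longlongrightarrow> 0) (at_right 0)"
    by (rule Lim_transform_eventually)
       (auto simp: exp_flat_def eventually_at_filter exp_minus field_simps intro!: always_eventually)
  moreover have "(exp_flat n \<longlongrightarrow> 0) (at_left 0)"
    by (rule tendsto_eventually) (auto simp: exp_flat_def eventually_at_filter intro!: always_eventually)
  ultimately show ?thesis by (simp add: filterlim_split_at_real)
qed

text \<open>At the origin the difference quotient of \<open>exp_flat n\<close> is \<open>exp_flat (n +
  1)\<close>, which tends to 0.\<close>

lemma exp_flat_deriv: "(exp_flat n has_real_derivative (exp_flat (n + 2) s - n * exp_flat (n + 1) s)) (at s)"
proof -
  consider "s > 0" | "s < 0" | "s = 0" by linarith
  then show ?thesis
  proof cases
    case 1
    have "((\<lambda>s. exp (- (1 / s)) / s ^ n) has_real_derivative (exp_flat (n + 2) s - n * exp_flat (n + 1) s)) (at s)"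
    proof -
      have e: "((\<lambda>s. exp (- (1 / s))) has_real_derivative exp (- (1 / s)) * (1 / s\<^sup>2)) (at s)"
        using 1 by (auto intro!: derivative_eq_intros simp: power2_eq_square)
      have "((\<lambda>s. exp (- (1 / s)) / s ^ n) has_real_derivative
          (exp (- (1 / s)) * (1 / s\<^sup>2) * s ^ n - exp (- (1 / s)) * (n * s ^ (n - Suc 0))) / (s ^ n * s ^ n)) (at s)"
        using 1 by (intro DERIV_divide[OF e DERIV_pow]) simp
      also have "(exp (- (1 / s)) * (1 / s\<^sup>2) * s ^ n - exp (- (1 / s)) * (n * s ^ (n - Suc 0))) / (s ^ n * s ^ n) =
          exp_flat (n + 2) s - n * exp_flat (n + 1) s"
        using 1 by (cases n) (simp_all add: exp_flat_def field_simps power2_eq_square)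
      finally show ?thesis .
    qed
    then show ?thesis
      by (rule has_field_derivative_transform_within_open[of _ _ _ "{0<..}"]) (use 1 in \<open>auto simp: exp_flat_def\<close>)
  next
    case 2
    have "((\<lambda>s. 0) has_real_derivative (exp_flat (n + 2) s - n * exp_flat (n + 1) s)) (at s)"
      using 2 by (simp add: exp_flat_def)
    then show ?thesis
      by (rule has_field_derivative_transform_within_open[of _ _ _ "{..<0}"]) (use 2 in \<open>auto simp: exp_flat_def\<close>)
  next
    case 3
    have "(\<lambda>y. (exp_flat n y - exp_flat n 0) / (y - 0)) = exp_flat (Suc n)"
      by (auto simp: exp_flat_def fun_eq_iff)
    then show ?thesis
      using 3 exp_flat_tendsto_0[of "Suc n"] by (simp add: has_field_derivative_iff exp_flat_def)
  qed
qed

lemma Ck_fun_flat: "Ck_fun k (\<lambda>x. exp_flat n (c * (x \<bullet> i) + a))"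
proof (induction k arbitrary: n)
  case 0
  have "continuous_on UNIV (exp_flat n)"
    using DERIV_isCont[OF exp_flat_deriv] by (simp add: continuous_on_eq_continuous_at)
  then have "continuous_on UNIV (\<lambda>x. exp_flat n (c * (x \<bullet> i) + a))"
    by (rule continuous_on_compose2) (auto intro!: continuous_intros)
  then show ?case by simp
next
  case (Suc k)
  show ?case
  proof (rule Ck_fun_SucI)
    fix x :: 'a
    have "((\<lambda>x. c * (x \<bullet> i) + a) has_derivative (\<lambda>h. c * (h \<bullet> i))) (at x)"
      by (auto intro!: derivative_eq_intros)
    from has_derivative_compose[OF this exp_flat_deriv[unfolded has_field_derivative_def]]
    show "((\<lambda>x. exp_flat n (c * (x \<bullet> i) + a)) has_derivative
       (\<lambda>h. (exp_flat (n + 2) (c * (x \<bullet> i) + a) - n * exp_flat (n + 1) (c * (x \<bullet> i) + a)) * (c * (h \<bullet> i)))) (at x)" .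
  next
    fix b :: 'a
    have "Ck_fun k (\<lambda>x. (exp_flat (n + 2) (c * (x \<bullet> i) + a) + (- n) * exp_flat (n + 1) (c * (x \<bullet> i) + a)) * (c * (b \<bullet> i)))"
      by (intro Ck_fun_mult Ck_fun_add Ck_fun_const Suc)
    then show "Ck_fun k (\<lambda>x. (exp_flat (n + 2) (c * (x \<bullet> i) + a) - n * exp_flat (n + 1) (c * (x \<bullet> i) + a)) * (c * (b \<bullet> i)))"
      by simp
  qed
qed

text \<open>A smooth function that is positive exactly on the box. With growing \<open>n\<close> the flat
  function is evaluated at arguments tending to infinity, where it tends to 1.\<close>

definition box_bump :: "'a::euclidean_space \<Rightarrow> 'a \<Rightarrow> nat \<Rightarrow> 'a \<Rightarrow> real" where
  "box_bump a b n x = (\<Prod>i\<in>Basis. exp_flat 0 (Suc n * (x \<bullet> i - a \<bullet> i)) * exp_flat 0 (Suc n * (b \<bullet> i - x \<bullet> i)))"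

lemma Ck_fun_box_bump: "Ck_fun k (box_bump a b n)"
proof -
  have eq: "box_bump a b n = (\<lambda>x. \<Prod>i\<in>Basis. exp_flat 0 (Suc n * (x \<bullet> i) + (- (Suc n * (a \<bullet> i)))) *
      exp_flat 0 ((- real (Suc n)) * (x \<bullet> i) + Suc n * (b \<bullet> i)))"
    unfolding box_bump_def by (simp add: algebra_simps)
  show ?thesis unfolding eq by (intro Ck_fun_prod Ck_fun_mult Ck_fun_flat) simp
qed

lemma exp_flat_0_bounds: "0 \<le> exp_flat 0 s" "exp_flat 0 s \<le> 1"
  by (auto simp: exp_flat_def)

lemma box_bump_bounds: "0 \<le> box_bump a b n x" "box_bump a b n x \<le> 1"
  unfolding box_bump_def
  by (auto intro!: prod_nonneg prod_le_1 mult_nonneg_nonneg mult_le_one simp: exp_flat_0_bounds)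

lemma box_bump_outside: "x \<notin> box a b \<Longrightarrow> box_bump a b n x = 0"
  by (force simp: box_bump_def mem_box exp_flat_def zero_less_mult_iff)

lemma box_bump_tendsto: "(\<lambda>n. box_bump a b n x) \<longlonglongrightarrow> indicator (box a b) x"
proof (cases "x \<in> box a b")
  case False
  then show ?thesis by (simp add: box_bump_outside)
next
  case True
  have lim: "(\<lambda>n. exp_flat 0 (Suc n * s)) \<longlonglongrightarrow> 1" if "s > 0" for s :: real
  proof -
    have "(\<lambda>n. exp (- ((1 / s) * (1 / real (Suc n))))) \<longlonglongrightarrow> exp (- ((1 / s) * 0))"
      by (intro tendsto_intros LIMSEQ_Suc[OF lim_1_over_n])
    moreover have "exp_flat 0 (Suc n * s) = exp (- ((1 / s) * (1 / real (Suc n))))" for n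
      using that by (simp add: exp_flat_def zero_less_mult_iff field_simps add_pos_nonneg)
    ultimately show ?thesis by (simp only: mult_zero_right minus_zero exp_zero)
  qed
  have "(\<lambda>n. box_bump a b n x) \<longlonglongrightarrow> (\<Prod>i\<in>(Basis::'a set). 1 * 1)"
    unfolding box_bump_def using True by (intro tendsto_prod tendsto_mult lim) (auto simp: mem_box)
  then show ?thesis using True by simp
qed

lemma box_bump_test_function:
  assumes "cbox p q \<subseteq> \<Omega>" "box a b \<subseteq> cbox p q"
  shows "box_bump a b n \<in> test_functions \<Omega>"
proof -
  have "{x. box_bump a b n x \<noteq> 0} \<subseteq> cbox p q" using box_bump_outside assms(2) by blast
  then have sub: "closure {x. box_bump a b n x \<noteq> 0} \<subseteq> cbox p q"
    by (rule closure_minimal) (rule closed_cbox)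
  then have "compact (closure {x. box_bump a b n x \<noteq> 0})"
    by (meson bounded_cbox bounded_subset closed_closure compact_eq_bounded_closed)
  with sub show ?thesis unfolding test_functions_def using assms(1) Ck_fun_box_bump by blast
qed

section \<open>Uniqueness of weak gradients\<close>

text \<open>Open boxes form a generator stable under intersections.\<close>

lemma box_Int_box_ex: "\<exists>u v. box a b \<inter> box c d = box u (v :: 'a::euclidean_space)"
proof (intro exI)
  show "box a b \<inter> box c d = box (\<Sum>i\<in>Basis. max (a \<bullet> i) (c \<bullet> i) *\<^sub>R i) (\<Sum>i\<in>Basis. min (b \<bullet> i) (d \<bullet> i) *\<^sub>R i)"
    by (auto simp: mem_box)
qed

text \<open>The positive part and the negative part of the function are densities of the same measure, so they
  agree almost everywhere; at each point one of them vanishes.\<close>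

lemma AE_zero_of_density_eq:
  fixes f :: "'a \<Rightarrow> real"
  assumes "sigma_finite_measure M" and f[measurable]: "f \<in> borel_measurable M"
    and eq: "density M (\<lambda>x. ennreal (f x)) = density M (\<lambda>x. ennreal (- f x))"
  shows "AE x in M. f x = 0"
proof -
  have "AE x in M. ennreal (f x) = ennreal (- f x)"
    by (rule sigma_finite_measure.density_unique[OF assms(1) _ _ eq]) auto
  then show ?thesis
  proof eventually_elim
    case (elim x)
    show ?case
    proof (rule ccontr)
      assume "f x \<noteq> 0"
      then have "f x > 0 \<or> - f x > 0" by linarith
      then show False using elim by (auto simp: ennreal_neg not_less[symmetric] less_imp_le)
    qed
  qed
qed

lemma emeasure_density_parts_eq:
  fixes f :: "'a \<Rightarrow> real"
  assumes f: "integrable M f" and A[measurable]: "A \<in> sets M" 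
    and zero: "(\<integral>x. indicator A x * f x \<partial>M) = 0"
  shows "emeasure (density M (\<lambda>x. ennreal (f x))) A = emeasure (density M (\<lambda>x. ennreal (- f x))) A"
    and "emeasure (density M (\<lambda>x. ennreal (f x))) A \<noteq> \<infinity>"
proof -
  have [measurable]: "f \<in> borel_measurable M" using f by simp
  have int: "integrable M (\<lambda>x. indicator A x * f x)"
    using integrable_mult_indicator[OF A f] by simp
  have e: "emeasure (density M (\<lambda>x. ennreal (g x))) A = (\<integral>\<^sup>+x. ennreal (indicator A x * g x) \<partial>M)"
    if [measurable]: "g \<in> borel_measurable M" for g
    by (subst emeasure_density) (auto intro!: nn_integral_cong split: split_indicator)
  have fin: "(\<integral>\<^sup>+x. ennreal (indicator A x * f x) \<partial>M) \<noteq> \<infinity>"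
    "(\<integral>\<^sup>+x. ennreal (- (indicator A x * f x)) \<partial>M) \<noteq> \<infinity>"
    using int by (auto simp: real_integrable_def)
  have "enn2real (\<integral>\<^sup>+x. ennreal (indicator A x * f x) \<partial>M) = enn2real (\<integral>\<^sup>+x. ennreal (- (indicator A x * f x)) \<partial>M)"
    using real_lebesgue_integral_def[OF int] zero by simp
  then have "(\<integral>\<^sup>+x. ennreal (indicator A x * f x) \<partial>M) = (\<integral>\<^sup>+x. ennreal (- (indicator A x * f x)) \<partial>M)"
    using fin by (metis enn2real_eq_0_iff ennreal_enn2real infinity_ennreal_def top.not_eq_extremum)
  then show "emeasure (density M (\<lambda>x. ennreal (f x))) A = emeasure (density M (\<lambda>x. ennreal (- f x))) A"
    by (simp add: e)
  show "emeasure (density M (\<lambda>x. ennreal (f x))) A \<noteq> \<infinity>"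
    using fin by (simp add: e)
qed

text \<open>The measures with the positive and the negative part of the function as densities agree on boxes,
  hence everywhere.\<close>

lemma AE_zero_of_box_integrals:
  fixes f :: "'a::euclidean_space \<Rightarrow> real"
  assumes f: "integrable lborel f"
    and zero: "\<And>a b. (\<integral>x. indicator (box a b) x * f x \<partial>lborel) = 0"
  shows "AE x in lborel. f x = 0"
proof (rule AE_zero_of_density_eq)
  show "density lborel (\<lambda>x. ennreal (f x)) = density lborel (\<lambda>x. ennreal (- f x))"
  proof (rule measure_eqI_generator_eq[where E="range (\<lambda>(a, b). box a b)" and \<Omega>=UNIV
        and A="\<lambda>n. box (- (real n *\<^sub>R One)) (real n *\<^sub>R One)"])
    show "Int_stable (range (\<lambda>(a, b). box a b :: 'a set))"
      unfolding Int_stable_def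
    proof (intro ballI)
      fix X Y assume "X \<in> range (\<lambda>(a, b). box a b :: 'a set)" "Y \<in> range (\<lambda>(a, b). box a b :: 'a set)"
      then obtain a b c d where "X = box a b" "Y = box c d" by auto
      with box_Int_box_ex[of a b c d] show "X \<inter> Y \<in> range (\<lambda>(a, b). box a b :: 'a set)" by auto
    qed
    show "sets (density lborel (\<lambda>x. ennreal (f x))) = sigma_sets UNIV (range (\<lambda>(a, b). box a b))"
      "sets (density lborel (\<lambda>x. ennreal (- f x))) = sigma_sets UNIV (range (\<lambda>(a, b). box a b))"
      by (simp_all add: borel_eq_box)
    show "(\<Union>n. box (- (real n *\<^sub>R One)) (real n *\<^sub>R One) :: 'a set) = UNIV"
      using UN_box_eq_UNIV by simp
  qed (use emeasure_density_parts_eq[OF f _ zero] in auto)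
qed (use f in \<open>auto intro: sigma_finite_lborel\<close>)

lemma test_function_continuous:
  assumes "\<phi> \<in> test_functions \<Omega>"
  shows "continuous_on UNIV \<phi>"
proof -
  have "Ck_fun 0 \<phi>" using assms by (auto simp: test_functions_def simp del: Ck_fun.simps)
  then show ?thesis by simp
qed

lemma compact_support_integrable:
  fixes G :: "'a::euclidean_space \<Rightarrow> real"
  assumes K: "compact K" "K \<subseteq> \<Omega>" and \<Omega>: "open \<Omega>"
    and G: "integrable (lebesgue_on K) G"
    and \<phi>: "continuous_on UNIV \<phi>" "\<And>x. x \<notin> K \<Longrightarrow> \<phi> x = 0"
  shows "integrable (lebesgue_on \<Omega>) (\<lambda>x. G x * \<phi> x)"
proof -
  have [measurable]: "K \<in> sets lebesgue" "\<Omega> \<in> sets lebesgue"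
    using borel_compact[OF K(1)] borel_open[OF \<Omega>] by auto
  obtain B where B: "\<And>x. x \<in> K \<Longrightarrow> norm (\<phi> x) \<le> B"
    using compact_imp_bounded[OF compact_continuous_image[OF continuous_on_subset[OF \<phi>(1)] K(1)]]
    by (auto simp: bounded_iff)
  have [measurable]: "\<phi> \<in> borel_measurable (lebesgue_on K)"
    by (intro measurable_restrict_space1 measurable_completion) (use \<phi>(1) in \<open>simp add: borel_measurable_continuous_onI\<close>)
  have [measurable]: "G \<in> borel_measurable (lebesgue_on K)" using G by simp
  have "integrable (lebesgue_on K) (\<lambda>x. G x * \<phi> x)"
  proof (rule Bochner_Integration.integrable_bound)
    show "integrable (lebesgue_on K) (\<lambda>x. B * G x)" using G by simp
    show "AE x in lebesgue_on K. norm (G x * \<phi> x) \<le> norm (B * G x)"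
    proof (rule AE_I2)
      fix x assume "x \<in> space (lebesgue_on K)"
      then have "norm (\<phi> x) \<le> B" using B by simp
      then have "norm (\<phi> x) \<le> norm B" by simp
      then have "norm (G x) * norm (\<phi> x) \<le> norm (G x) * norm B" by (intro mult_left_mono) auto
      then show "norm (G x * \<phi> x) \<le> norm (B * G x)" by (simp add: abs_mult mult.commute)
    qed
  qed simp
  then have "integrable lebesgue (\<lambda>x. indicator K x *\<^sub>R (G x * \<phi> x))"
    by (simp add: integrable_restrict_space)
  also have "(\<lambda>x. indicator K x *\<^sub>R (G x * \<phi> x)) = (\<lambda>x. indicator \<Omega> x *\<^sub>R (G x * \<phi> x))"
    using K(2) \<phi>(2) by (auto simp: fun_eq_iff indicator_def)
  finally show ?thesis by (simp add: integrable_restrict_space)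
qed

text \<open>Inside a closed box contained in the domain, the smooth functions supported in smaller boxes test
  the function; by dominated convergence its integrals over all small boxes vanish. Countably many
  boxes cover the domain.\<close>

lemma fundamental_lemma:
  fixes g :: "real ^ 3 \<Rightarrow> real"
  assumes \<Omega>: "open \<Omega>"
    and g: "\<And>K. compact K \<Longrightarrow> K \<subseteq> \<Omega> \<Longrightarrow> integrable (lebesgue_on K) g"
    and zero: "\<And>\<phi>. \<phi> \<in> test_functions \<Omega> \<Longrightarrow> (\<integral>x. g x * \<phi> x \<partial>lebesgue_on \<Omega>) = 0"
  shows "AE x in lebesgue_on \<Omega>. g x = 0"
proof -
  have \<Omega>s: "\<Omega> \<in> sets lebesgue" using \<Omega> by auto
  have local: "AE x in lborel. x \<in> box p q \<longrightarrow> g x = 0" if pq: "cbox p q \<subseteq> \<Omega>" for p q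
  proof -
    define f where "f x = indicator (box p q) x * g x" for x
    have "integrable lebesgue (\<lambda>x. indicator (cbox p q) x *\<^sub>R g x)"
      using g[OF compact_cbox pq] by (simp add: integrable_restrict_space)
    then have "integrable lebesgue (\<lambda>x. indicator (box p q) x *\<^sub>R (indicator (cbox p q) x *\<^sub>R g x))"
      by (rule integrable_mult_indicator[rotated]) auto
    also have "(\<lambda>x. indicator (box p q) x *\<^sub>R (indicator (cbox p q) x *\<^sub>R g x)) = f"
      using box_subset_cbox[of p q] by (auto simp: f_def fun_eq_iff indicator_def)
    finally have f: "integrable lebesgue f" .
    obtain f' where f'[measurable]: "f' \<in> borel_measurable lborel" and ff': "AE x in lborel. f x = f' x"
      using completion_ex_borel_measurable_real[of f lborel] f by auto
    have ff'': "AE x in lebesgue. f x = f' x" using ff' by (rule AE_completion)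
    have f'_leb: "f' \<in> borel_measurable lebesgue" using f' by (rule measurable_completion)
    have "integrable lebesgue f'"
      using f integrable_cong_AE[of f lebesgue f'] ff'' f'_leb by auto
    then have int': "integrable lborel f'" by (simp add: integrable_completion f')
    have "(\<integral>x. indicator (box a b) x * f' x \<partial>lborel) = 0" for a b
    proof -
      obtain u v where uv: "box a b \<inter> box p q = box u v" using box_Int_box_ex by blast
      have "(\<integral>x. indicator (box a b) x * f' x \<partial>lborel) = (\<integral>x. indicator (box a b) x * f' x \<partial>lebesgue)"
        by (rule integral_completion[symmetric]) simp
      also have "\<dots> = (\<integral>x. indicator (box a b) x * f x \<partial>lebesgue)"
        using f f'_leb ff''
        by (intro integral_cong_AE borel_measurable_times borel_measurable_indicator)
           (auto elim: eventually_mono)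
      also have "\<dots> = (\<integral>x. indicator (box u v) x * f x \<partial>lebesgue)"
        using uv by (intro Bochner_Integration.integral_cong) (auto simp: f_def indicator_def)
      finally have 1: "(\<integral>x. indicator (box a b) x * f' x \<partial>lborel) = (\<integral>x. indicator (box u v) x * f x \<partial>lebesgue)" .
      have bump: "(\<integral>x. box_bump u v n x * f x \<partial>lebesgue) = 0" for n
      proof -
        have "box_bump u v n \<in> test_functions \<Omega>"
          using pq uv box_subset_cbox[of p q] by (intro box_bump_test_function[OF pq]) blast
        then have "(\<integral>x. g x * box_bump u v n x \<partial>lebesgue_on \<Omega>) = 0" by (rule zero)
        moreover have "(\<integral>x. g x * box_bump u v n x \<partial>lebesgue_on \<Omega>) = (\<integral>x. indicator \<Omega> x *\<^sub>R (g x * box_bump u v n x) \<partial>lebesgue)"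
          using \<Omega>s by (subst integral_restrict_space) auto
        moreover have "(\<lambda>x. indicator \<Omega> x *\<^sub>R (g x * box_bump u v n x)) = (\<lambda>x. box_bump u v n x * f x)"
        proof
          fix x
          show "indicator \<Omega> x *\<^sub>R (g x * box_bump u v n x) = box_bump u v n x * f x"
            using uv pq box_subset_cbox[of p q] box_bump_outside[of x u v n]
            by (cases "x \<in> box u v") (auto simp: f_def indicator_def)
        qed
        ultimately show ?thesis by simp
      qed
      have m: "box_bump u v n \<in> borel_measurable lebesgue" for n
      proof -
        have "continuous_on UNIV (box_bump u v n)" using Ck_fun_box_bump[of 0] by simp
        then show ?thesis by (intro measurable_completion) (simp add: borel_measurable_continuous_onI)
      qed
      have "(\<lambda>n. \<integral>x. box_bump u v n x * f x \<partial>lebesgue) \<longlonglongrightarrow> (\<integral>x. indicator (box u v) x * f x \<partial>lebesgue)"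
      proof (rule integral_dominated_convergence[where w="\<lambda>x. norm (f x)"])
        show "integrable lebesgue (\<lambda>x. norm (f x))" using f by simp
        show "AE x in lebesgue. (\<lambda>n. box_bump u v n x * f x) \<longlonglongrightarrow> indicator (box u v) x * f x"
          by (intro AE_I2 tendsto_mult box_bump_tendsto tendsto_const)
        show "AE x in lebesgue. norm (box_bump u v n x * f x) \<le> norm (f x)" for n
          using box_bump_bounds[of u v n] by (intro AE_I2) (simp add: abs_mult mult_left_le_one_le)
      qed (use f m in \<open>auto intro!: borel_measurable_times borel_measurable_indicator\<close>)
      then show ?thesis unfolding 1 bump by (simp add: LIMSEQ_const_iff)
    qed
    then have "AE x in lborel. f' x = 0" by (rule AE_zero_of_box_integrals[OF int'])
    with ff' show ?thesis by eventually_elim (auto simp: f_def)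
  qed
  define \<F> where "\<F> = {box p q | p q. cbox p q \<subseteq> \<Omega>}"
  have "\<Omega> = \<Union>\<F>"
  proof
    show "\<Omega> \<subseteq> \<Union>\<F>"
    proof
      fix x assume "x \<in> \<Omega>"
      then obtain e where e: "e > 0" "cball x e \<subseteq> \<Omega>"
        using \<Omega> open_contains_cball by blast
      obtain p q where pq: "x \<in> box p q" "box p q \<subseteq> ball x e"
        using rational_boxes[OF e(1), of x] by blast
      have "closure (box p q) \<subseteq> closure (ball x e)" using pq(2) by (rule closure_mono)
      then have "cbox p q \<subseteq> \<Omega>" using pq(1) e by (subst (asm) closure_box) auto
      with pq(1) show "x \<in> \<Union>\<F>" by (auto simp: \<F>_def)
    qed
    show "\<Union>\<F> \<subseteq> \<Omega>" using box_subset_cbox by (fastforce simp: \<F>_def)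
  qed
  moreover obtain \<F>' where F': "\<F>' \<subseteq> \<F>" "countable \<F>'" "\<Union>\<F>' = \<Union>\<F>"
    using Lindelof[of \<F>] by (auto simp: \<F>_def)
  moreover have "AE x in lborel. \<forall>B\<in>\<F>'. x \<in> B \<longrightarrow> g x = 0"
    using F' local by (subst AE_ball_countable) (auto simp: \<F>_def)
  ultimately have "AE x in lborel. x \<in> \<Omega> \<longrightarrow> g x = 0" by (auto elim!: eventually_mono)
  then show ?thesis by (simp add: AE_lebesgue_on_borel_iff[OF \<Omega>s])
qed

lemma integrable_matrix_entry:
  fixes G :: "'a \<Rightarrow> real ^ 'n ^ 'm"
  assumes "integrable M G"
  shows "integrable M (\<lambda>x. G x $ i $ j)"
  by (rule integrable_bounded_linear[OF bounded_linear_vec_nth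
        integrable_bounded_linear[OF bounded_linear_vec_nth assms]])

lemma test_function_support:
  assumes "\<phi> \<in> test_functions \<Omega>"
  obtains K where "compact K" "K \<subseteq> \<Omega>" "\<forall>x. x \<notin> K \<longrightarrow> \<phi> x = 0"
proof
  show "compact (closure {x. \<phi> x \<noteq> 0})" "closure {x. \<phi> x \<noteq> 0} \<subseteq> \<Omega>"
    using assms by (auto simp: test_functions_def)
  show "\<forall>x. x \<notin> closure {x. \<phi> x \<noteq> 0} \<longrightarrow> \<phi> x = 0"
    using closure_subset[of "{x. \<phi> x \<noteq> 0}"] by auto
qed

text \<open>The norm of the Sobolev space refers to an arbitrarily chosen weak gradient. Uniqueness identifies
  that choice with any given weak gradient, so that a bound of the norm bounds the given gradient.\<close>

lemma weak_gradient_unique: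
  assumes \<Omega>: "open \<Omega>" and G: "weak_gradient \<Omega> u G" and G': "weak_gradient \<Omega> u G'"
  shows "AE x in lebesgue_on \<Omega>. G x = G' x"
proof -
  have "AE x in lebesgue_on \<Omega>. G x $ i $ j - G' x $ i $ j = 0" for i j
  proof (rule fundamental_lemma[OF \<Omega>])
    have li: "integrable (lebesgue_on K) (\<lambda>x. H x $ i $ j)"
      if "compact K" "K \<subseteq> \<Omega>" "weak_gradient \<Omega> u H" for K H
      by (rule integrable_matrix_entry) (use that in \<open>auto simp: weak_gradient_def locally_integrable_def\<close>)
    show "integrable (lebesgue_on K) (\<lambda>x. G x $ i $ j - G' x $ i $ j)" if "compact K" "K \<subseteq> \<Omega>" for K
      using li[OF that G] li[OF that G'] by simp
    fix \<phi> assume \<phi>: "\<phi> \<in> test_functions \<Omega>"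
    obtain K where K: "compact K" "K \<subseteq> \<Omega>" "\<forall>x. x \<notin> K \<longrightarrow> \<phi> x = 0"
      by (rule test_function_support[OF \<phi>])
    have int: "integrable (lebesgue_on \<Omega>) (\<lambda>x. H x $ i $ j * \<phi> x)" if "weak_gradient \<Omega> u H" for H
      by (rule compact_support_integrable[OF K(1,2) \<Omega> li[OF K(1,2) that] test_function_continuous[OF \<phi>]])
         (use K(3) in blast)
    have "(\<integral>x. G x $ i $ j * \<phi> x \<partial>lebesgue_on \<Omega>) = (\<integral>x. G' x $ i $ j * \<phi> x \<partial>lebesgue_on \<Omega>)"
    proof -
      have "- (\<integral>x. G x $ i $ j * \<phi> x \<partial>lebesgue_on \<Omega>) = - (\<integral>x. G' x $ i $ j * \<phi> x \<partial>lebesgue_on \<Omega>)"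
        using G G' \<phi> unfolding weak_gradient_def by simp
      then show ?thesis by simp
    qed
    then show "(\<integral>x. (G x $ i $ j - G' x $ i $ j) * \<phi> x \<partial>lebesgue_on \<Omega>) = 0"
      using int[OF G] int[OF G'] by (simp add: left_diff_distrib)
  qed
  then have "AE x in lebesgue_on \<Omega>. \<forall>i j. G x $ i $ j - G' x $ i $ j = 0"
    by (simp add: AE_all_countable)
  then show ?thesis by eventually_elim (simp add: vec_eq_iff)
qed

section \<open>Square integrable functions on the cylinder\<close>

lemma borel_measurable_lebesgue_on_cong_AE:
  fixes f g :: "'a::euclidean_space \<Rightarrow> 'b::euclidean_space"
  assumes S: "S \<in> sets lebesgue" and f: "f \<in> borel_measurable (lebesgue_on S)"
    and eq: "AE x in lebesgue_on S. f x = g x"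
  shows "g \<in> borel_measurable (lebesgue_on S)"
proof -
  have "(\<lambda>x. if x \<in> S then f x else 0) \<in> borel_measurable lebesgue"
    using f S by (subst borel_measurable_if) auto
  moreover have "AE x in lebesgue. (if x \<in> S then f x else 0) = (if x \<in> S then g x else 0)"
    using eq S by (auto simp: AE_restrict_space_iff elim!: eventually_mono)
  ultimately have "(\<lambda>x. if x \<in> S then g x else 0) \<in> borel_measurable lebesgue"
    by (rule borel_measurable_AE)
  then show ?thesis using S by (subst (asm) borel_measurable_if) auto
qed

lemma borel_measurable_lebesgue_on_borel:
  "f \<in> borel_measurable borel \<Longrightarrow> f \<in> borel_measurable (lebesgue_on S)"
  by (intro measurable_restrict_space1 measurable_completion) simp

lemma AE_slices_measurable:
  fixes f :: "point \<Rightarrow> 'b::euclidean_space"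
  assumes \<Omega>: "open \<Omega>" and f: "f \<in> borel_measurable (lebesgue_on (cylinder \<Omega> T))"
  shows "AE t in lebesgue_on {0<..<T}. slice f t \<in> borel_measurable (lebesgue_on \<Omega>)"
proof -
  obtain g where g: "g \<in> borel_measurable borel" "AE y in lebesgue_on (cylinder \<Omega> T). f y = g y"
    using lebesgue_on_AE_eq_borel[OF sets_cylinder(3)[OF \<Omega>] f] .
  show ?thesis
    using AE_cylinder_slices[OF \<Omega> g(2)] AE_space
  proof eventually_elim
    case (elim t)
    have "(\<lambda>x. g (x, t)) \<in> borel_measurable (lebesgue_on \<Omega>)"
      by (rule decomposes_measurable[OF decomposes_cylinder[OF \<Omega>] g(1) elim(2)])
    then have "(\<lambda>x. f (x, t)) \<in> borel_measurable (lebesgue_on \<Omega>)"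
    proof (rule borel_measurable_lebesgue_on_cong_AE[rotated])
      show "AE x in lebesgue_on \<Omega>. g (x, t) = f (x, t)" using elim(1) by eventually_elim simp
    qed (use \<Omega> in auto)
    then show ?case by (simp add: slice_def)
  qed
qed

lemma nn_integral_cylinder:
  fixes f :: "point \<Rightarrow> real"
  assumes \<Omega>: "open \<Omega>" and f: "f \<in> borel_measurable (lebesgue_on (cylinder \<Omega> T))"
  shows "(\<integral>\<^sup>+y. ennreal (f y) \<partial>lebesgue_on (cylinder \<Omega> T)) =
    (\<integral>\<^sup>+t. (\<integral>\<^sup>+x. ennreal (f (x, t)) \<partial>lebesgue_on \<Omega>) \<partial>lebesgue_on {0<..<T})"
proof -
  obtain g where g[measurable]: "g \<in> borel_measurable borel" and fg: "AE y in lebesgue_on (cylinder \<Omega> T). f y = g y"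
    using lebesgue_on_AE_eq_borel[OF sets_cylinder(3)[OF \<Omega>] f] .
  have "(\<integral>\<^sup>+y. ennreal (f y) \<partial>lebesgue_on (cylinder \<Omega> T)) = (\<integral>\<^sup>+y. ennreal (g y) \<partial>lebesgue_on (cylinder \<Omega> T))"
  proof (rule nn_integral_cong_AE)
    show "AE y in lebesgue_on (cylinder \<Omega> T). ennreal (f y) = ennreal (g y)"
      using fg by eventually_elim simp
  qed
  also have "\<dots> = (\<integral>\<^sup>+t. (\<integral>\<^sup>+x. ennreal (g (x, t)) \<partial>lebesgue_on \<Omega>) \<partial>lebesgue_on {0<..<T})"
    by (rule decomposesD(3)[OF decomposes_cylinder[OF \<Omega>]]) simp
  also have "\<dots> = (\<integral>\<^sup>+t. (\<integral>\<^sup>+x. ennreal (f (x, t)) \<partial>lebesgue_on \<Omega>) \<partial>lebesgue_on {0<..<T})"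
  proof (rule nn_integral_cong_AE)
    show "AE t in lebesgue_on {0<..<T}. (\<integral>\<^sup>+x. ennreal (g (x, t)) \<partial>lebesgue_on \<Omega>) = (\<integral>\<^sup>+x. ennreal (f (x, t)) \<partial>lebesgue_on \<Omega>)"
      using AE_cylinder_slices[OF \<Omega> fg]
    proof eventually_elim
      case (elim t)
      then have "AE x in lebesgue_on \<Omega>. ennreal (g (x, t)) = ennreal (f (x, t))"
        by eventually_elim simp
      then show ?case by (rule nn_integral_cong_AE)
    qed
  qed
  finally show ?thesis .
qed

lemma L2_nn_integral:
  assumes "v \<in> L2 M"
  shows "(\<integral>\<^sup>+x. ennreal ((norm (v x))\<^sup>2) \<partial>M) = ennreal ((L2_norm M v)\<^sup>2)"
  using assms by (subst nn_integral_eq_integral) (auto simp: L2_def L2_norm_def)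

lemma square_integrable_of_slices:
  fixes u :: "point \<Rightarrow> 'b::euclidean_space"
  assumes \<Omega>: "open \<Omega>" and u: "u \<in> L2L2 \<Omega> T"
  shows "integrable (lebesgue_on (cylinder \<Omega> T)) (\<lambda>y. (norm (u y))\<^sup>2)"
proof -
  have m[measurable]: "u \<in> borel_measurable (lebesgue_on (cylinder \<Omega> T))"
    and sl: "AE t in lebesgue_on {0<..<T}. slice u t \<in> L2 (lebesgue_on \<Omega>)"
    and int: "integrable (lebesgue_on {0<..<T}) (\<lambda>t. (L2_norm (lebesgue_on \<Omega>) (slice u t))\<^sup>2)"
    using u by (auto simp: bochner_L2_def bochner_measurable_def strongly_measurable_def)
  have "(\<integral>\<^sup>+y. ennreal ((norm (u y))\<^sup>2) \<partial>lebesgue_on (cylinder \<Omega> T)) =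
      (\<integral>\<^sup>+t. (\<integral>\<^sup>+x. ennreal ((norm (u (x, t)))\<^sup>2) \<partial>lebesgue_on \<Omega>) \<partial>lebesgue_on {0<..<T})"
    by (rule nn_integral_cylinder[OF \<Omega>]) measurable
  also have "\<dots> = (\<integral>\<^sup>+t. ennreal ((L2_norm (lebesgue_on \<Omega>) (slice u t))\<^sup>2) \<partial>lebesgue_on {0<..<T})"
  proof (rule nn_integral_cong_AE)
    show "AE t in lebesgue_on {0<..<T}. (\<integral>\<^sup>+x. ennreal ((norm (u (x, t)))\<^sup>2) \<partial>lebesgue_on \<Omega>) =
        ennreal ((L2_norm (lebesgue_on \<Omega>) (slice u t))\<^sup>2)"
      using sl by eventually_elim (drule L2_nn_integral, simp add: slice_def)
  qed
  also have "\<dots> < \<infinity>" using int by (simp add: nn_integral_eq_integral)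
  finally show ?thesis by (intro integrableI_nonneg) auto
qed

lemma L2L2_norm_eq:
  fixes u :: "point \<Rightarrow> 'b::euclidean_space"
  assumes \<Omega>: "open \<Omega>" and u[measurable]: "u \<in> borel_measurable (lebesgue_on (cylinder \<Omega> T))"
    and int: "integrable (lebesgue_on (cylinder \<Omega> T)) (\<lambda>y. (norm (u y))\<^sup>2)"
  shows "L2L2_norm \<Omega> T u = sqrt (\<integral>y. (norm (u y))\<^sup>2 \<partial>lebesgue_on (cylinder \<Omega> T))"
proof -
  obtain g where g[measurable]: "g \<in> borel_measurable borel" and ug: "AE y in lebesgue_on (cylinder \<Omega> T). u y = g y"
    using lebesgue_on_AE_eq_borel[OF sets_cylinder(3)[OF \<Omega>] u] .
  let ?G = "\<lambda>y. (norm (g y))\<^sup>2"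
  have G: "?G \<in> borel_measurable borel" by measurable
  have intG: "integrable (lebesgue_on (cylinder \<Omega> T)) ?G"
    using int
  proof (rule integrable_cong_AE_imp)
    show "AE y in lebesgue_on (cylinder \<Omega> T). (norm (u y))\<^sup>2 = ?G y" using ug by eventually_elim simp
  qed (rule borel_measurable_lebesgue_on_borel[OF G])
  note dec = decomposes_integral[OF decomposes_cylinder[OF \<Omega>] G intG]
  have sq: "AE t in lebesgue_on {0<..<T}. (\<integral>x. ?G (x, t) \<partial>lebesgue_on \<Omega>) = (L2_norm (lebesgue_on \<Omega>) (slice u t))\<^sup>2"
    using AE_cylinder_slices[OF \<Omega> ug] AE_slices_measurable[OF \<Omega> u] AE_space
  proof eventually_elim
    case (elim t)
    have "(\<lambda>x. ?G (x, t)) \<in> borel_measurable (lebesgue_on \<Omega>)"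
      by (rule decomposes_measurable[OF decomposes_cylinder[OF \<Omega>] G elim(3)])
    moreover have "(\<lambda>x. (norm (slice u t x))\<^sup>2) \<in> borel_measurable (lebesgue_on \<Omega>)"
      using elim(2) by measurable
    moreover have "AE x in lebesgue_on \<Omega>. ?G (x, t) = (norm (slice u t x))\<^sup>2"
      using elim(1) by eventually_elim (simp add: slice_def)
    ultimately have "(\<integral>x. ?G (x, t) \<partial>lebesgue_on \<Omega>) = (\<integral>x. (norm (slice u t x))\<^sup>2 \<partial>lebesgue_on \<Omega>)"
      by (rule integral_cong_AE)
    then show ?case by (simp add: L2_norm_def)
  qed
  have Ts: "{0<..<T} \<in> sets lebesgue" by simp
  have "(\<integral>t. (L2_norm (lebesgue_on \<Omega>) (slice u t))\<^sup>2 \<partial>lebesgue_on {0<..<T}) =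
      (\<integral>t. (\<integral>x. ?G (x, t) \<partial>lebesgue_on \<Omega>) \<partial>lebesgue_on {0<..<T})"
    by (rule integral_cong_AE[OF dec(3) borel_measurable_lebesgue_on_cong_AE[OF Ts dec(3) sq] sq, symmetric])
  also have "\<dots> = (\<integral>y. ?G y \<partial>lebesgue_on (cylinder \<Omega> T))" by (rule dec(4)[symmetric])
  also have "\<dots> = (\<integral>y. (norm (u y))\<^sup>2 \<partial>lebesgue_on (cylinder \<Omega> T))"
  proof (rule integral_cong_AE[OF borel_measurable_lebesgue_on_borel[OF G]])
    show "AE y in lebesgue_on (cylinder \<Omega> T). ?G y = (norm (u y))\<^sup>2" using ug by eventually_elim simp
  qed simp
  finally show ?thesis by (simp add: bochner_L2_norm_def)
qed

lemma norm_add_square_le: "(norm (a + b))\<^sup>2 \<le> 2 * (norm a)\<^sup>2 + 2 * (norm (b :: 'a::real_inner))\<^sup>2"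
proof -
  have "(norm (a + b))\<^sup>2 + (norm (a - b))\<^sup>2 = 2 * (norm a)\<^sup>2 + 2 * (norm b)\<^sup>2"
    by (simp add: power2_norm_eq_inner inner_simps inner_commute)
  then show ?thesis using zero_le_power2[of "norm (a - b)"] by linarith
qed

text \<open>The pointwise bound \<open>|a - b|\<^sup>2 \<le> 2 |a|\<^sup>2 + 2 |b|\<^sup>2\<close> replaces
  the triangle inequality of the norm.\<close>

lemma square_integrable_diff:
  fixes u v :: "'a \<Rightarrow> 'b::euclidean_space"
  assumes [measurable]: "u \<in> borel_measurable M" "v \<in> borel_measurable M"
    and "integrable M (\<lambda>y. (norm (u y))\<^sup>2)" "integrable M (\<lambda>y. (norm (v y))\<^sup>2)"
  shows "integrable M (\<lambda>y. (norm (u y - v y))\<^sup>2)"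
proof (rule Bochner_Integration.integrable_bound)
  show "integrable M (\<lambda>y. 2 * (norm (u y))\<^sup>2 + 2 * (norm (v y))\<^sup>2)" using assms(3,4) by simp
  show "AE y in M. norm ((norm (u y - v y))\<^sup>2) \<le> norm (2 * (norm (u y))\<^sup>2 + 2 * (norm (v y))\<^sup>2)"
    using norm_add_square_le[of "u _" "- v _"] by (intro AE_I2) simp
qed simp

text \<open>A sequence in a compact set has a cluster point: let \<open>U m\<close> be the set of points that
  stay at a positive distance from all members of the sequence with index at least
  \<open>m\<close>. These sets are open and increasing. If they covered the compact closure, one
  of them would, and it would contain a member of the sequence beyond the index \<open>m\<close>.
  So some point of the closure lies in no \<open>U m\<close> and is the limit of members of the
  sequence with indices tending to infinity. This needs only a seminorm, for which the topology is
  not Hausdorff. Squared norms are used throughout, since they are plain integrals over the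
  cylinder.\<close>

lemma relatively_compact_L2L2_sequence:
  fixes d :: "real \<Rightarrow> point \<Rightarrow> 'b::euclidean_space"
  assumes \<Omega>: "open \<Omega>"
    and rc: "relatively_compact_in (seminorm_topology (L2L2 \<Omega> T) (L2L2_norm \<Omega> T)) (d ` {0<..<1})"
  obtains \<delta>s p where "\<And>n::nat. \<delta>s n \<in> {0<..<1}" "\<delta>s \<longlonglongrightarrow> 0" "p \<in> L2L2 \<Omega> T"
    "\<And>\<delta>. \<delta> \<in> {0<..<1} \<Longrightarrow> d \<delta> \<in> L2L2 \<Omega> T"
    "(\<lambda>n. \<integral>y. (norm (d (\<delta>s n) y - p y))\<^sup>2 \<partial>lebesgue_on (cylinder \<Omega> T)) \<longlonglongrightarrow> 0"
proof -
  define V where "V = (L2L2 \<Omega> T :: (point \<Rightarrow> 'b) set)"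
  define X where "X = seminorm_topology V (L2L2_norm \<Omega> T)"
  define E where "E w = (\<integral>y. (norm (w y))\<^sup>2 \<partial>lebesgue_on (cylinder \<Omega> T))" for w :: "point \<Rightarrow> 'b"
  have V_meas: "u \<in> borel_measurable (lebesgue_on (cylinder \<Omega> T))" if "u \<in> V" for u
    using that by (auto simp: V_def bochner_L2_def bochner_measurable_def)
  have V_int: "integrable (lebesgue_on (cylinder \<Omega> T)) (\<lambda>y. (norm (u y))\<^sup>2)" if "u \<in> V" for u
    using square_integrable_of_slices[OF \<Omega>] that by (simp add: V_def)
  have V_diff: "integrable (lebesgue_on (cylinder \<Omega> T)) (\<lambda>y. (norm (u y - v y))\<^sup>2)" if "u \<in> V" "v \<in> V" for u v
    using that by (intro square_integrable_diff V_meas V_int)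
  have N_eq: "L2L2_norm \<Omega> T (\<lambda>y. u y - v y) = sqrt (E (\<lambda>y. u y - v y))" if "u \<in> V" "v \<in> V" for u v
    unfolding E_def by (rule L2L2_norm_eq[OF \<Omega>]) (use that V_meas V_diff in auto)
  have E_tri: "E (\<lambda>y. u y - w y) \<le> 2 * E (\<lambda>y. u y - v y) + 2 * E (\<lambda>y. v y - w y)"
    if "u \<in> V" "v \<in> V" "w \<in> V" for u v w
  proof -
    have "E (\<lambda>y. u y - w y) \<le> (\<integral>y. 2 * (norm (u y - v y))\<^sup>2 + 2 * (norm (v y - w y))\<^sup>2 \<partial>lebesgue_on (cylinder \<Omega> T))"
      unfolding E_def
    proof (rule integral_mono)
      show "(norm (u y - w y))\<^sup>2 \<le> 2 * (norm (u y - v y))\<^sup>2 + 2 * (norm (v y - w y))\<^sup>2" for y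
        using norm_add_square_le[of "u y - v y" "v y - w y"] by simp
    qed (use that V_diff in auto)
    also have "\<dots> = 2 * E (\<lambda>y. u y - v y) + 2 * E (\<lambda>y. v y - w y)"
      unfolding E_def using that V_diff by simp
    finally show ?thesis .
  qed
  have E_nonneg: "0 \<le> E w" for w by (simp add: E_def)
  have X_open: "openin X U \<longleftrightarrow> U \<subseteq> V \<and> (\<forall>u\<in>U. \<exists>e>0. \<forall>v\<in>V. L2L2_norm \<Omega> T (\<lambda>x. v x - u x) < e \<longrightarrow> v \<in> U)" for U
    unfolding X_def by (rule openin_seminorm_topology)
  have "openin X V" by (auto simp: X_open intro: exI[of _ 1])
  then have "V \<subseteq> topspace X" by (rule openin_subset)
  moreover have "topspace X \<subseteq> V" using X_open[of "topspace X"] by simp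
  ultimately have top: "topspace X = V" by blast
  define C where "C = X closure_of (d ` {0<..<1})"
  have dV: "d ` {0<..<1} \<subseteq> V" and C: "compactin X C"
    using rc by (auto simp: relatively_compact_in_def C_def X_def V_def top[unfolded X_def V_def])
  have CV: "C \<subseteq> V" using closure_of_subset_topspace[of X] by (simp add: C_def top)
  have dC: "d ` {0<..<1} \<subseteq> C" unfolding C_def by (rule closure_of_subset) (simp add: dV top)
  \<comment> \<open>The shift by 2 keeps all parameters inside the open interval.\<close>
  define u where "u n = d (1 / (real n + 2))" for n :: nat
  have in01: "1 / (real n + 2) \<in> {0<..<1}" for n by (simp add: field_simps)
  have uC: "u n \<in> C" for n using dC in01 by (auto simp: u_def)
  then have uV: "u n \<in> V" for n using CV by auto
  define U where "U m = {v \<in> V. \<exists>e>0. \<forall>n\<ge>m. e \<le> E (\<lambda>y. u n y - v y)}" for m :: nat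
  have U_open: "openin X (U m)" for m
    unfolding X_open
  proof (intro conjI ballI)
    show "U m \<subseteq> V" by (auto simp: U_def)
    fix v assume "v \<in> U m"
    then obtain e where e: "e > 0" "\<And>n. n \<ge> m \<Longrightarrow> e \<le> E (\<lambda>y. u n y - v y)" and vV: "v \<in> V"
      by (auto simp: U_def)
    show "\<exists>\<epsilon>>0. \<forall>w\<in>V. L2L2_norm \<Omega> T (\<lambda>x. w x - v x) < \<epsilon> \<longrightarrow> w \<in> U m"
    proof (intro exI[of _ "sqrt (e / 4)"] conjI ballI impI)
      fix w assume wV: "w \<in> V" and "L2L2_norm \<Omega> T (\<lambda>x. w x - v x) < sqrt (e / 4)"
      then have small: "E (\<lambda>y. w y - v y) < e / 4" using N_eq[OF wV vV] by simp
      have "e / 4 \<le> E (\<lambda>y. u n y - w y)" if "n \<ge> m" for n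
        using e(2)[OF that] E_tri[OF uV wV vV, of n] small by linarith
      then show "w \<in> U m" using wV e(1) by (auto simp: U_def intro!: exI[of _ "e / 4"])
    qed (use e in auto)
  qed
  have U_mono: "U m \<subseteq> U k" if "m \<le> k" for m k
  proof
    fix v assume "v \<in> U m"
    then obtain e where "v \<in> V" "e > 0" "\<And>n. n \<ge> m \<Longrightarrow> e \<le> E (\<lambda>y. u n y - v y)"
      by (auto simp: U_def)
    with that show "v \<in> U k" unfolding U_def by (auto intro!: exI[of _ e])
  qed
  have "\<not> C \<subseteq> \<Union>(range U)"
  proof
    assume "C \<subseteq> \<Union>(range U)"
    moreover have "\<forall>Y\<in>range U. openin X Y" using U_open by simp
    ultimately have "\<exists>\<F>. finite \<F> \<and> \<F> \<subseteq> range U \<and> C \<subseteq> \<Union>\<F>"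
      using C by (simp only: compactin_def)
    then obtain \<F> where F: "finite \<F>" "\<F> \<subseteq> range U" "C \<subseteq> \<Union>\<F>" by (elim exE conjE)
    obtain I where I: "finite I" "\<F> = U ` I" using finite_subset_image[OF F(1,2)] by auto
    have "C \<subseteq> U (Max (insert 0 I))"
    proof
      fix c assume "c \<in> C"
      then obtain i where "i \<in> I" "c \<in> U i" using F(3) I(2) by auto
      moreover from this have "i \<le> Max (insert 0 I)" using I(1) by (intro Max_ge) auto
      ultimately show "c \<in> U (Max (insert 0 I))" using U_mono by blast
    qed
    then have "u (Max (insert 0 I)) \<in> U (Max (insert 0 I))" using uC by blast
    then show False by (auto simp: U_def E_def)
  qed
  then obtain p where pC: "p \<in> C" and p: "\<And>m. p \<notin> U m" by auto
  have pV: "p \<in> V" using pC CV by auto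
  have "\<exists>n\<ge>k. E (\<lambda>y. u n y - p y) < 1 / Suc k" for k
    using p[of k] pV by (auto simp: U_def not_le)
  then obtain r where r: "\<And>k. r k \<ge> k" "\<And>k. E (\<lambda>y. u (r k) y - p y) < 1 / Suc k" by metis
  have inv0: "(\<lambda>n. 1 / real (Suc n)) \<longlonglongrightarrow> 0" by (rule LIMSEQ_Suc[OF lim_1_over_n])
  show thesis
  proof
    show "1 / (real (r n) + 2) \<in> {0<..<1}" for n by (rule in01)
    show "(\<lambda>n. 1 / (real (r n) + 2)) \<longlonglongrightarrow> 0"
    proof (rule tendsto_sandwich[OF _ _ tendsto_const inv0])
      have "1 / (real (r n) + 2) \<le> 1 / real (Suc n)" for n
        using r(1)[of n] by (intro divide_left_mono) auto
      then show "\<forall>\<^sub>F n in sequentially. 1 / (real (r n) + 2) \<le> 1 / real (Suc n)" by simp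
    qed simp
    show "p \<in> L2L2 \<Omega> T" using pV by (simp add: V_def)
    show "d \<delta> \<in> L2L2 \<Omega> T" if "\<delta> \<in> {0<..<1}" for \<delta> using dV that by (auto simp: V_def)
    have "(\<lambda>n. E (\<lambda>y. u (r n) y - p y)) \<longlonglongrightarrow> 0"
      by (rule tendsto_sandwich[OF _ _ tendsto_const inv0])
         (intro always_eventually allI E_nonneg less_imp_le[OF r(2)])+
    then show "(\<lambda>n. \<integral>y. (norm (d (1 / (real (r n) + 2)) y - p y))\<^sup>2 \<partial>lebesgue_on (cylinder \<Omega> T)) \<longlonglongrightarrow> 0"
      by (simp add: E_def u_def)
  qed
qed

section \<open>Energy bounds and ball coordinates\<close>

text \<open>A uniform bound on the essential suprema gives one constant that bounds almost every slice of each
  function. Adding 1 makes the constant strictly larger than each infimum, so it need not be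
  attained.\<close>

lemma bochner_Linf_bound:
  fixes v :: "real \<Rightarrow> point \<Rightarrow> 'b::euclidean_space"
  assumes fin: "(SUP \<delta>\<in>A. bochner_Linf_norm T N (v \<delta>)) < \<infinity>"
  obtains C where "C \<ge> 0" "\<And>\<delta>. \<delta> \<in> A \<Longrightarrow> AE t in lebesgue_on {0<..<T}. N (slice (v \<delta>) t) \<le> C"
proof
  let ?S = "SUP \<delta>\<in>A. bochner_Linf_norm T N (v \<delta>)"
  let ?C = "enn2real ?S + 1"
  show "?C \<ge> 0" by (simp add: add_nonneg_nonneg)
  fix \<delta> assume "\<delta> \<in> A"
  then have "bochner_Linf_norm T N (v \<delta>) \<le> ?S" by (rule SUP_upper)
  also have "?S = ennreal (enn2real ?S)" using fin by simp
  also have "\<dots> < ennreal ?C" by (intro ennreal_lessI) (auto simp: add_nonneg_pos)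
  finally obtain c where c: "AE t in lebesgue_on {0<..<T}. ennreal (N (slice (v \<delta>) t)) \<le> c" "c < ennreal ?C"
    unfolding bochner_Linf_norm_def Inf_less_iff by auto
  from c(1) show "AE t in lebesgue_on {0<..<T}. N (slice (v \<delta>) t) \<le> ?C"
  proof eventually_elim
    case (elim t)
    then have "ennreal (N (slice (v \<delta>) t)) \<le> ennreal ?C" using c(2) by (auto intro: order_trans less_imp_le)
    then show ?case by (subst (asm) ennreal_le_iff) (auto simp: add_nonneg_nonneg)
  qed
qed

text \<open>Expanding the product gives \<open>1 + |v|\<^sup>2 + |G|\<^sup>2 + |v|\<^sup>2|G|\<^sup>2\<close>:
  the volume of the domain, the squared Sobolev norm, and the squared norm of \<open>|v|
  G\<close>.\<close>

lemma slice_energy_bound: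
  assumes \<Omega>: "open \<Omega>" "bounded \<Omega>"
    and v: "v \<in> H1 \<Omega>" "H1_norm \<Omega> v \<le> C1" and G: "weak_gradient \<Omega> v G"
    and vG: "(\<lambda>x. norm (v x) *\<^sub>R G x) \<in> L2 (lebesgue_on \<Omega>)"
      "L2_norm (lebesgue_on \<Omega>) (\<lambda>x. norm (v x) *\<^sub>R G x) \<le> C2"
  shows "(\<integral>\<^sup>+x. ennreal ((1 + (norm (v x))\<^sup>2) * (1 + (norm (G x))\<^sup>2)) \<partial>lebesgue_on \<Omega>)
    \<le> ennreal (measure lebesgue \<Omega> + C1\<^sup>2 + C2\<^sup>2)"
proof -
  define H where "H = (SOME G. G \<in> L2 (lebesgue_on \<Omega>) \<and> weak_gradient \<Omega> v G)"
  have "\<exists>G. G \<in> L2 (lebesgue_on \<Omega>) \<and> weak_gradient \<Omega> v G" using v(1) by (auto simp: H1_def)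
  then have H: "H \<in> L2 (lebesgue_on \<Omega>)" "weak_gradient \<Omega> v H"
    unfolding H_def by (metis (mono_tags, lifting) someI_ex)+
  have vL2: "v \<in> L2 (lebesgue_on \<Omega>)" using v(1) by (simp add: H1_def)
  have GH: "AE x in lebesgue_on \<Omega>. G x = H x" by (rule weak_gradient_unique[OF \<Omega>(1) G H(2)])
  have [measurable]: "v \<in> borel_measurable (lebesgue_on \<Omega>)" "G \<in> borel_measurable (lebesgue_on \<Omega>)"
    using G by (auto simp: weak_gradient_def locally_integrable_def)
  let ?I = "\<lambda>f. \<integral>\<^sup>+x. ennreal (f x) \<partial>lebesgue_on \<Omega>"
  have lm: "\<Omega> \<in> lmeasurable" using \<Omega>(2,1) by (rule lmeasurable_open)
  have one: "?I (\<lambda>x. 1) = ennreal (measure lebesgue \<Omega>)"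
  proof -
    have "?I (\<lambda>x. 1) = emeasure (lebesgue_on \<Omega>) \<Omega>" by simp
    also have "\<dots> = emeasure lebesgue \<Omega>" using \<Omega>(1) by (subst emeasure_restrict_space) auto
    also have "\<dots> = ennreal (measure lebesgue \<Omega>)" by (rule emeasure_eq_measure2[OF lm])
    finally show ?thesis .
  qed
  have nv: "?I (\<lambda>x. (norm (v x))\<^sup>2) = ennreal ((L2_norm (lebesgue_on \<Omega>) v)\<^sup>2)"
    by (rule L2_nn_integral[OF vL2])
  have "?I (\<lambda>x. (norm (G x))\<^sup>2) = ?I (\<lambda>x. (norm (H x))\<^sup>2)"
  proof (rule nn_integral_cong_AE)
    show "AE x in lebesgue_on \<Omega>. ennreal ((norm (G x))\<^sup>2) = ennreal ((norm (H x))\<^sup>2)"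
      using GH by eventually_elim simp
  qed
  also have "\<dots> = ennreal ((L2_norm (lebesgue_on \<Omega>) H)\<^sup>2)" by (rule L2_nn_integral[OF H(1)])
  finally have nG: "?I (\<lambda>x. (norm (G x))\<^sup>2) = ennreal ((L2_norm (lebesgue_on \<Omega>) H)\<^sup>2)" .
  have nvG: "?I (\<lambda>x. (norm (norm (v x) *\<^sub>R G x))\<^sup>2) = ennreal ((L2_norm (lebesgue_on \<Omega>) (\<lambda>x. norm (v x) *\<^sub>R G x))\<^sup>2)"
    by (rule L2_nn_integral[OF vG(1)])
  have "?I (\<lambda>x. (1 + (norm (v x))\<^sup>2) * (1 + (norm (G x))\<^sup>2)) =
      ?I (\<lambda>x. 1 + (norm (v x))\<^sup>2 + (norm (G x))\<^sup>2 + (norm (norm (v x) *\<^sub>R G x))\<^sup>2)"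
    by (intro nn_integral_cong arg_cong[of _ _ ennreal]) (simp add: algebra_simps power_mult_distrib)
  also have "\<dots> = ?I (\<lambda>x. 1) + ?I (\<lambda>x. (norm (v x))\<^sup>2) + ?I (\<lambda>x. (norm (G x))\<^sup>2) + ?I (\<lambda>x. (norm (norm (v x) *\<^sub>R G x))\<^sup>2)"
    by (simp add: ennreal_plus nn_integral_add)
  also have "\<dots> = ennreal (measure lebesgue \<Omega> + ((L2_norm (lebesgue_on \<Omega>) v)\<^sup>2 + (L2_norm (lebesgue_on \<Omega>) H)\<^sup>2)
      + (L2_norm (lebesgue_on \<Omega>) (\<lambda>x. norm (v x) *\<^sub>R G x))\<^sup>2)"
    unfolding one nv nG nvG by (simp add: ennreal_plus[symmetric] add.assoc del: ennreal_plus)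
  also have "\<dots> \<le> ennreal (measure lebesgue \<Omega> + C1\<^sup>2 + C2\<^sup>2)"
  proof (intro ennreal_leI add_mono order_refl)
    have "(H1_norm \<Omega> v)\<^sup>2 \<le> C1\<^sup>2" using v(2) by (intro power_mono) (auto simp: H1_norm_def)
    then show "(L2_norm (lebesgue_on \<Omega>) v)\<^sup>2 + (L2_norm (lebesgue_on \<Omega>) H)\<^sup>2 \<le> C1\<^sup>2"
      by (simp add: H1_norm_def H_def)
    show "(L2_norm (lebesgue_on \<Omega>) (\<lambda>x. norm (v x) *\<^sub>R G x))\<^sup>2 \<le> C2\<^sup>2"
      using vG(2) by (intro power_mono) (auto simp: L2_norm_def)
  qed
  finally show ?thesis .
qed

text \<open>The homeomorphism of the space onto its open unit ball that is inverse to \<open>h \<mapsto> h /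
  sqrt (1 - |h|\<^sup>2)\<close>.\<close>

definition into_ball :: "'a::euclidean_space \<Rightarrow> 'a" where
  "into_ball h = h /\<^sub>R sqrt (1 + (norm h)\<^sup>2)"

text \<open>The inverse of \<open>into_ball\<close> on the open ball. It will be applied under measures that
  have no mass on the unit sphere, where the formula gives 0.\<close>

definition from_ball :: "'a::euclidean_space \<Rightarrow> 'a" where
  "from_ball s = s /\<^sub>R sqrt (1 - (norm s)\<^sup>2)"

lemma one_minus_norm_into_ball: "1 - (norm (into_ball h))\<^sup>2 = 1 / (1 + (norm h)\<^sup>2)"
proof -
  have p: "1 + (norm h)\<^sup>2 > 0" by (simp add: add_pos_nonneg)
  have "(norm (into_ball h))\<^sup>2 = (norm h)\<^sup>2 / (1 + (norm h)\<^sup>2)"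
    using p by (simp add: into_ball_def power_mult_distrib power_inverse divide_inverse mult.commute)
  then show ?thesis using p by (simp add: field_simps)
qed

lemma norm_into_ball: "norm (into_ball h) < 1"
proof -
  have "1 - (norm (into_ball h))\<^sup>2 > 0"
    unfolding one_minus_norm_into_ball by (simp add: add_pos_nonneg)
  then have "(norm (into_ball h))\<^sup>2 < 1\<^sup>2" by simp
  then show ?thesis by (rule power_less_imp_less_base) simp
qed

lemma from_ball_into_ball: "from_ball (into_ball h) = h"
proof -
  have p: "1 + (norm h)\<^sup>2 > 0" by (simp add: add_pos_nonneg)
  show ?thesis
    using p unfolding from_ball_def one_minus_norm_into_ball
    by (simp add: into_ball_def real_sqrt_divide)
qed

lemma one_plus_norm_from_ball:
  assumes "norm s < 1"
  shows "1 + (norm (from_ball s))\<^sup>2 = 1 / (1 - (norm s)\<^sup>2)"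
proof -
  have p: "1 - (norm s)\<^sup>2 > 0" using assms by (simp add: power_less_one_iff)
  have "(norm (from_ball s))\<^sup>2 = (norm s)\<^sup>2 / (1 - (norm s)\<^sup>2)"
    using p by (simp add: from_ball_def power_mult_distrib power_inverse divide_inverse mult.commute)
  then show ?thesis using p by (simp add: field_simps)
qed

lemma into_ball_from_ball:
  assumes "norm s < 1"
  shows "into_ball (from_ball s) = s"
proof -
  have p: "1 - (norm s)\<^sup>2 > 0" using assms by (simp add: power_less_one_iff)
  then show ?thesis
    unfolding into_ball_def one_plus_norm_from_ball[OF assms]
    by (simp add: from_ball_def real_sqrt_divide)
qed

lemma continuous_on_into_ball: "continuous_on UNIV into_ball"
proof -
  have "sqrt (1 + (norm h)\<^sup>2) \<noteq> 0" for h :: 'a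
    using add_pos_nonneg[of 1 "(norm h)\<^sup>2"] by simp
  then show ?thesis
    unfolding into_ball_def[abs_def] by (intro continuous_intros) auto
qed

lemma borel_measurable_into_ball[measurable]: "into_ball \<in> borel_measurable borel"
  by (rule borel_measurable_continuous_onI[OF continuous_on_into_ball])

lemma borel_measurable_from_ball[measurable]: "from_ball \<in> borel_measurable borel"
  unfolding from_ball_def[abs_def] by measurable

text \<open>In ball coordinates the factor \<open>(1 - |h|\<^sup>2)(1 - |S|\<^sup>2)\<close> is the reciprocal
  of the weight \<open>(1 + |h|\<^sup>2)(1 + |S|\<^sup>2)\<close>. An admissible integrand is
  therefore the weight times a continuous function of the ball coordinates.\<close>

lemma tilde_extension_into_ball:
  assumes g: "tilde_extension \<Omega> T f g" and y: "y \<in> closure (cylinder \<Omega> T)"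
  shows "f (y, h, S) = g (y, into_ball h, into_ball S) * ((1 + (norm h)\<^sup>2) * (1 + (norm S)\<^sup>2))"
proof -
  have p: "1 + (norm h)\<^sup>2 > 0" "1 + (norm S)\<^sup>2 > 0" by (simp_all add: add_pos_nonneg)
  have "g (y, into_ball h, into_ball S) = tilde f (y, into_ball h, into_ball S)"
    using g y norm_into_ball[of h] norm_into_ball[of S] by (simp add: tilde_extension_def)
  also have "\<dots> = f (y, h, S) * (1 - (norm (into_ball h))\<^sup>2) * (1 - (norm (into_ball S))\<^sup>2)"
    by (simp add: tilde_def from_ball_def[symmetric] from_ball_into_ball)
  finally show ?thesis using p by (simp add: one_minus_norm_into_ball)
qed

text \<open>Separability of the continuous functions on a compact set, for an arbitrary subfamily. For each
  accuracy, mesh and list of approximate values on the finite net of that mesh, choose one member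
  of the family which takes these values approximately and varies little at the scale of the mesh.
  There are countably many such data, and members with the same data are uniformly close.\<close>

lemma countable_uniformly_dense:
  fixes e :: "'i \<Rightarrow> 'a::metric_space \<Rightarrow> 'b::{metric_space, second_countable_topology}"
  assumes K: "compact K" and cont: "\<And>f. f \<in> \<F> \<Longrightarrow> continuous_on K (e f)"
  obtains \<D> where "countable \<D>" "\<D> \<subseteq> \<F>"
    "\<And>f \<epsilon>. f \<in> \<F> \<Longrightarrow> \<epsilon> > 0 \<Longrightarrow> \<exists>g\<in>\<D>. \<forall>x\<in>K. dist (e f x) (e g x) < \<epsilon>"
proof -
  obtain B :: "'b set" where B: "countable B" "\<And>U. open U \<Longrightarrow> U \<noteq> {} \<Longrightarrow> \<exists>b\<in>B. b \<in> U"
    using countable_dense_exists by blast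
  have "\<exists>cs. set cs \<subseteq> K \<and> K \<subseteq> (\<Union>c\<in>set cs. ball c (1 / Suc m))" for m
  proof -
    obtain C where C: "C \<subseteq> K" "finite C" "K \<subseteq> (\<Union>c\<in>C. ball c (1 / Suc m))"
    proof (rule compactE_image[OF K, of K "\<lambda>c. ball c (1 / Suc m)"])
      show "K \<subseteq> (\<Union>c\<in>K. ball c (1 / Suc m))" by auto
    qed auto
    obtain xs where "set xs = C" using finite_list[OF C(2)] by blast
    with C show ?thesis by auto
  qed
  then obtain cs where cs: "\<And>m. set (cs m) \<subseteq> K" "\<And>m. K \<subseteq> (\<Union>c\<in>set (cs m). ball c (1 / Suc m))" by metis
  define P where "P k m bs f \<longleftrightarrow> f \<in> \<F> \<and> length bs = length (cs m) \<and>
     (\<forall>x\<in>K. \<forall>y\<in>K. dist x y < 1 / Suc m \<longrightarrow> dist (e f x) (e f y) < 1 / Suc k) \<and>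
     (\<forall>i<length (cs m). dist (e f (cs m ! i)) (bs ! i) < 1 / Suc k)" for k m :: nat and bs f
  define I where "I = {(k, m, bs). bs \<in> lists B \<and> (\<exists>f. P k m bs f)}"
  define \<D> where "\<D> = (\<lambda>(k, m, bs). SOME f. P k m bs f) ` I"
  show thesis
  proof
    have "I \<subseteq> UNIV \<times> UNIV \<times> lists B" by (auto simp: I_def)
    moreover have "countable (UNIV \<times> UNIV \<times> lists B :: (nat \<times> nat \<times> 'b list) set)"
      using B(1) by (intro countable_SIGMA countable_lists) auto
    ultimately have "countable I" by (rule countable_subset)
    then show "countable \<D>" unfolding \<D>_def by (rule countable_image)
    show "\<D> \<subseteq> \<F>"
    proof
      fix f assume "f \<in> \<D>"
      then obtain k m bs where f: "f = (SOME f. P k m bs f)" "\<exists>f. P k m bs f"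
        by (auto simp: \<D>_def I_def)
      have "P k m bs f" unfolding f(1) using f(2) by (rule someI_ex)
      then show "f \<in> \<F>" by (simp add: P_def)
    qed
    fix f and \<epsilon> :: real assume f: "f \<in> \<F>" and "\<epsilon> > 0"
    obtain k :: nat where k: "4 / \<epsilon> < k" using reals_Archimedean2 by blast
    then have k\<epsilon>: "4 / real (Suc k) < \<epsilon>" using \<open>\<epsilon> > 0\<close> by (simp add: field_simps)
    have "uniformly_continuous_on K (e f)" by (rule compact_uniformly_continuous[OF cont[OF f] K])
    then obtain \<eta> where \<eta>: "\<eta> > 0" "\<And>x y. x \<in> K \<Longrightarrow> y \<in> K \<Longrightarrow> dist x y < \<eta> \<Longrightarrow> dist (e f x) (e f y) < 1 / Suc k"
      by (rule uniformly_continuous_onE[of K "e f" "1 / Suc k"]) (auto simp: dist_commute)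
    obtain m :: nat where m: "1 / \<eta> < m" using reals_Archimedean2 by blast
    then have m\<eta>: "1 / real (Suc m) < \<eta>" using \<eta>(1) by (simp add: field_simps)
    have "\<exists>b\<in>B. dist y b < 1 / Suc k" for y
      using B(2)[of "ball y (1 / Suc k)"] by auto
    then obtain b where b: "\<And>y. b y \<in> B" "\<And>y. dist y (b y) < 1 / Suc k" by metis
    define bs where "bs = map (\<lambda>c. b (e f c)) (cs m)"
    have bsB: "bs \<in> lists B" using b(1) by (auto simp: bs_def)
    have Pf: "P k m bs f"
      unfolding P_def
    proof (intro conjI ballI allI impI)
      show "dist (e f x) (e f y) < 1 / Suc k" if "x \<in> K" "y \<in> K" "dist x y < 1 / Suc m" for x y
        using that m\<eta> by (intro \<eta>(2)) auto
      show "dist (e f (cs m ! i)) (bs ! i) < 1 / Suc k" if "i < length (cs m)" for i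
        using b(2)[of "e f (cs m ! i)"] that by (simp add: bs_def)
    qed (simp_all add: bs_def f)
    define g where "g = (SOME f. P k m bs f)"
    have Pg: "P k m bs g" unfolding g_def using Pf by (rule someI)
    have "(k, m, bs) \<in> I" using bsB Pf by (auto simp: I_def)
    then have "g \<in> \<D>" unfolding \<D>_def g_def by (rule rev_image_eqI) simp
    moreover have "dist (e f x) (e g x) < \<epsilon>" if x: "x \<in> K" for x
    proof -
      obtain c where c: "c \<in> set (cs m)" "dist x c < 1 / Suc m" 
        using cs(2)[of m] x by (auto simp: dist_commute)
      then obtain i where i: "i < length (cs m)" "cs m ! i = c" by (auto simp: in_set_conv_nth)
      have cK: "c \<in> K" using cs(1) c(1) by auto
      have "dist (e f x) (e f c) < 1 / Suc k" "dist (e g x) (e g c) < 1 / Suc k"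
        using Pf Pg x cK c(2) by (auto simp: P_def)
      moreover have "dist (e f c) (bs ! i) < 1 / Suc k" "dist (e g c) (bs ! i) < 1 / Suc k"
        using Pf Pg i by (auto simp: P_def)
      ultimately have "dist (e f x) (e g x) < 4 * (1 / Suc k)"
        using dist_triangle[of "e f x" "e g x" "e f c"] dist_triangle2[of "e f c" "e g x" "e g c"]
          dist_triangle2[of "e f c" "e g c" "bs ! i"] dist_commute[of "e g c" "e g x"]
        by linarith
      then show ?thesis using k\<epsilon> by simp
    qed
    ultimately show "\<exists>g\<in>\<D>. \<forall>x\<in>K. dist (e f x) (e g x) < \<epsilon>" by blast
  qed
qed

section \<open>Weak limits of weighted laws\<close>

lemma borel_measurable_fst_snd:
  "f \<in> borel_measurable M \<Longrightarrow> (\<lambda>x. fst (f x)) \<in> borel_measurable M"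
  "f \<in> borel_measurable M \<Longrightarrow> (\<lambda>x. snd (f x)) \<in> borel_measurable M"
  for f :: "'c \<Rightarrow> 'a::second_countable_topology \<times> 'b::second_countable_topology"
proof -
  have "fst \<in> borel_measurable (borel :: ('a \<times> 'b) measure)" "snd \<in> borel_measurable (borel :: ('a \<times> 'b) measure)"
    by (intro borel_measurable_continuous_onI continuous_on_fst continuous_on_snd continuous_on_id)+
  then show "f \<in> borel_measurable M \<Longrightarrow> (\<lambda>x. fst (f x)) \<in> borel_measurable M"
    "f \<in> borel_measurable M \<Longrightarrow> (\<lambda>x. snd (f x)) \<in> borel_measurable M"
    using measurable_compose by blast+
qed

lemma abs_square_norm_diff_le:
  fixes a b :: "'a::real_inner"
  assumes "e > 0"
  shows "\<bar>(norm a)\<^sup>2 - (norm b)\<^sup>2\<bar> \<le> (1 + 1 / e) * (norm (a - b))\<^sup>2 + e * (norm b)\<^sup>2"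
proof -
  let ?c = "norm (a - b)"
  have "\<bar>norm a - norm b\<bar> \<le> ?c" by (rule norm_triangle_ineq3)
  moreover have "norm a + norm b \<le> ?c + 2 * norm b" using norm_triangle_sub[of a b] by simp
  moreover have "\<bar>(norm a)\<^sup>2 - (norm b)\<^sup>2\<bar> = \<bar>norm a - norm b\<bar> * (norm a + norm b)"
    by (simp add: power2_eq_square square_diff_square_factored abs_mult mult.commute)
  ultimately have "\<bar>(norm a)\<^sup>2 - (norm b)\<^sup>2\<bar> \<le> ?c * (?c + 2 * norm b)"
    by (simp add: mult_mono)
  also have "\<dots> \<le> (1 + 1 / e) * ?c\<^sup>2 + e * (norm b)\<^sup>2"
  proof -
    have "0 \<le> (?c - e * norm b)\<^sup>2 / e" using assms by simp
    then show ?thesis using assms by (simp add: power2_diff field_simps power2_eq_square)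
  qed
  finally show ?thesis .
qed

text \<open>The setting after all subsequences have been chosen: states \<open>u n\<close> with gradients \<open>G n\<close>, the strong limit \<open>d\<close> of the
  states, and the weak limit \<open>\<mu>\<close> of the weighted laws of position, state and gradient in ball coordinates. The limit is a Borel function on
  the whole space-time, so that it can be integrated with respect to any Borel measure.\<close>

locale young_limit =
  fixes \<Omega> :: "(real ^ 3) set" and T :: real
    and u :: "nat \<Rightarrow> point \<Rightarrow> real ^ 3" and G :: "nat \<Rightarrow> point \<Rightarrow> real ^ 3 ^ 3"
    and d :: "point \<Rightarrow> real ^ 3" and \<mu> :: "(point \<times> (real ^ 3) \<times> (real ^ 3 ^ 3)) measure"
    and C :: real
  assumes open_\<Omega>: "open \<Omega>" and bounded_\<Omega>: "bounded \<Omega>" and T_pos: "T > 0" and C_nonneg: "C \<ge> 0"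
    and u_meas: "\<And>n. u n \<in> borel_measurable (lebesgue_on (cylinder \<Omega> T))"
    and G_meas: "\<And>n. G n \<in> borel_measurable (lebesgue_on (cylinder \<Omega> T))"
    and energy: "\<And>n. AE t in lebesgue_on {0<..<T}.
      (\<integral>\<^sup>+x. ennreal ((1 + (norm (u n (x, t)))\<^sup>2) * (1 + (norm (G n (x, t)))\<^sup>2)) \<partial>lebesgue_on \<Omega>) \<le> ennreal C"
    and d_meas: "d \<in> borel_measurable borel"
    and d_int: "integrable (lebesgue_on (cylinder \<Omega> T)) (\<lambda>y. (norm (d y))\<^sup>2)"
    and u_lim: "(\<lambda>n. \<integral>y. (norm (u n y - d y))\<^sup>2 \<partial>lebesgue_on (cylinder \<Omega> T)) \<longlonglongrightarrow> 0"
    and u_AE: "AE y in lebesgue_on (cylinder \<Omega> T). (\<lambda>n. u n y) \<longlonglongrightarrow> d y"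
    and finite_\<mu>: "finite_measure \<mu>" and sets_\<mu>: "sets \<mu> = sets borel"
    and \<mu>_K: "AE z in \<mu>. z \<in> closure (cylinder \<Omega> T) \<times> cball 0 1 \<times> cball 0 1"
    and \<mu>_lim: "\<And>g B. continuous_on UNIV g \<Longrightarrow> (\<And>z. \<bar>g z\<bar> \<le> B) \<Longrightarrow>
      (\<lambda>n. \<integral>y. g (y, into_ball (u n y), into_ball (G n y)) *
          ((1 + (norm (u n y))\<^sup>2) * (1 + (norm (G n y))\<^sup>2)) \<partial>lebesgue_on (cylinder \<Omega> T))
        \<longlonglongrightarrow> (\<integral>z. g z \<partial>\<mu>)"
begin

abbreviation "Q \<equiv> cylinder \<Omega> T"
abbreviation "leb_Q \<equiv> lebesgue_on (cylinder \<Omega> T)"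
abbreviation "weight n y \<equiv> (1 + (norm (u n y))\<^sup>2) * (1 + (norm (G n y))\<^sup>2)"

declare u_meas[measurable] G_meas[measurable] sets_\<mu>[measurable_cong]

lemma d_meas_Q[measurable]: "d \<in> borel_measurable leb_Q"
  by (rule borel_measurable_lebesgue_on_borel[OF d_meas])

lemma open_Q: "open Q" and Q_borel: "Q \<in> sets borel" and Q_leb: "Q \<in> sets lebesgue"
  using sets_cylinder[OF open_\<Omega>] by auto

lemma bounded_Q: "bounded Q"
  unfolding cylinder_def using bounded_\<Omega> by (intro bounded_Times) auto

lemma finite_leb_Q: "finite_measure leb_Q"
proof (rule finite_measureI)
  have "Q \<in> lmeasurable" using bounded_Q open_Q by (rule lmeasurable_open)
  then show "emeasure leb_Q (space leb_Q) \<noteq> \<infinity>"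
    using Q_leb by (simp add: emeasure_restrict_space fmeasurable_def less_top)
qed

text \<open>The energy bound holds on almost every time slice, so multiplying by a function of time costs only
  its integral.\<close>

lemma weight_nn_bound:
  assumes [measurable]: "\<psi> \<in> borel_measurable borel" and \<psi>: "\<And>t. 0 \<le> \<psi> t"
  shows "(\<integral>\<^sup>+y. ennreal (\<psi> (snd y) * weight n y) \<partial>leb_Q) \<le> ennreal C * (\<integral>\<^sup>+t. ennreal (\<psi> t) \<partial>lebesgue_on {0<..<T})"
proof -
  have s: "snd \<in> borel_measurable (lebesgue_on Q)"
    by (rule borel_measurable_lebesgue_on_borel[OF borel_measurable_fst_snd(2)]) simp
  have [measurable]: "(\<lambda>y. \<psi> (snd y)) \<in> borel_measurable leb_Q"
    using measurable_compose[OF s assms(1)] .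
  have \<psi>_leb: "(\<lambda>t. ennreal (\<psi> t)) \<in> borel_measurable (lebesgue_on {0<..<T})"
    by (intro borel_measurable_lebesgue_on_borel) measurable
  have "(\<integral>\<^sup>+y. ennreal (\<psi> (snd y) * weight n y) \<partial>leb_Q) =
      (\<integral>\<^sup>+t. (\<integral>\<^sup>+x. ennreal (\<psi> t * weight n (x, t)) \<partial>lebesgue_on \<Omega>) \<partial>lebesgue_on {0<..<T})"
  proof -
    have m: "(\<lambda>y. \<psi> (snd y) * weight n y) \<in> borel_measurable leb_Q" by measurable
    show ?thesis using nn_integral_cylinder[OF open_\<Omega> m] by simp
  qed
  also have "\<dots> \<le> (\<integral>\<^sup>+t. ennreal C * ennreal (\<psi> t) \<partial>lebesgue_on {0<..<T})"
  proof (rule nn_integral_mono_AE)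
    show "AE t in lebesgue_on {0<..<T}. (\<integral>\<^sup>+x. ennreal (\<psi> t * weight n (x, t)) \<partial>lebesgue_on \<Omega>) \<le> ennreal C * ennreal (\<psi> t)"
      using energy[of n] AE_slices_measurable[OF open_\<Omega> u_meas[of n]] AE_slices_measurable[OF open_\<Omega> G_meas[of n]]
    proof eventually_elim
      case (elim t)
      have [measurable]: "(\<lambda>x. u n (x, t)) \<in> borel_measurable (lebesgue_on \<Omega>)"
        "(\<lambda>x. G n (x, t)) \<in> borel_measurable (lebesgue_on \<Omega>)"
        using elim(2,3) by (simp_all add: slice_def)
      have "(\<integral>\<^sup>+x. ennreal (\<psi> t * weight n (x, t)) \<partial>lebesgue_on \<Omega>) =
          (\<integral>\<^sup>+x. ennreal (\<psi> t) * ennreal (weight n (x, t)) \<partial>lebesgue_on \<Omega>)"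
        using \<psi> by (intro nn_integral_cong ennreal_mult) auto
      also have "\<dots> = ennreal (\<psi> t) * (\<integral>\<^sup>+x. ennreal (weight n (x, t)) \<partial>lebesgue_on \<Omega>)"
        by (rule nn_integral_cmult) measurable
      also have "\<dots> \<le> ennreal (\<psi> t) * ennreal C" by (intro mult_left_mono elim(1)) simp
      finally show ?case by (simp add: mult.commute)
    qed
  qed
  also have "\<dots> = ennreal C * (\<integral>\<^sup>+t. ennreal (\<psi> t) \<partial>lebesgue_on {0<..<T})"
    by (rule nn_integral_cmult[OF \<psi>_leb])
  finally show ?thesis .
qed

lemma weight_integrable: "integrable leb_Q (weight n)"
proof (rule integrableI_nonneg)
  have "(\<integral>\<^sup>+y. ennreal (weight n y) \<partial>leb_Q) \<le> ennreal C * (\<integral>\<^sup>+t. 1 \<partial>lebesgue_on {0<..<T})"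
    using weight_nn_bound[of "\<lambda>_. 1" n] by simp
  also have "(\<integral>\<^sup>+t. 1 \<partial>lebesgue_on {0<..<T}) = ennreal T"
    using T_pos by (simp add: emeasure_restrict_space)
  finally show "(\<integral>\<^sup>+y. ennreal (weight n y) \<partial>leb_Q) < \<infinity>"
    by (rule order.strict_trans1) (simp add: ennreal_mult_less_top)
qed auto

lemma weight_ge: "1 \<le> weight n y" "(norm (u n y))\<^sup>2 \<le> weight n y" "(norm (G n y))\<^sup>2 \<le> weight n y"
  by (auto simp: algebra_simps intro: add_nonneg_nonneg)

lemma weight_bounded_integrable:
  assumes [measurable]: "f \<in> borel_measurable leb_Q" and "\<And>y. \<bar>f y\<bar> \<le> B * weight n y"
  shows "integrable leb_Q (f :: point \<Rightarrow> real)"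
proof (rule Bochner_Integration.integrable_bound)
  show "integrable leb_Q (\<lambda>y. B * weight n y)" using weight_integrable by simp
  show "AE y in leb_Q. norm (f y) \<le> norm (B * weight n y)"
    using assms(2) by (intro AE_I2) (auto intro: order_trans[OF _ abs_ge_self])
qed simp

lemma square_norm_u_integrable: "integrable leb_Q (\<lambda>y. (norm (u n y))\<^sup>2)"
  using weight_ge(2) by (intro weight_bounded_integrable[where B=1 and n=n]) auto

text \<open>Convergence in \<open>L\<^sup>2\<close> gives convergence of the squares in
  \<open>L\<^sup>1\<close>.\<close>

lemma square_norm_L1_limit: "(\<lambda>n. \<integral>y. \<bar>(norm (u n y))\<^sup>2 - (norm (d y))\<^sup>2\<bar> \<partial>leb_Q) \<longlonglongrightarrow> 0"
proof -
  define a where "a n = (\<integral>y. (norm (u n y - d y))\<^sup>2 \<partial>leb_Q)" for n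
  define D where "D = (\<integral>y. (norm (d y))\<^sup>2 \<partial>leb_Q)"
  define e where "e n = sqrt (a n + 1 / Suc n)" for n
  have a0: "0 \<le> a n" for n by (simp add: a_def)
  have e_pos: "e n > 0" for n using a0[of n] by (simp add: e_def add_nonneg_pos)
  have "(\<lambda>n. sqrt (a n + 1 / Suc n)) \<longlonglongrightarrow> sqrt (0 + 0)"
    using u_lim by (intro tendsto_intros LIMSEQ_Suc[OF lim_1_over_n]) (simp add: a_def)
  then have e_lim: "e \<longlonglongrightarrow> 0" by (simp add: e_def[abs_def])
  have int: "integrable leb_Q (\<lambda>y. (norm (u n y - d y))\<^sup>2)" for n
    by (intro square_integrable_diff square_norm_u_integrable d_int) measurable
  have le: "(\<integral>y. \<bar>(norm (u n y))\<^sup>2 - (norm (d y))\<^sup>2\<bar> \<partial>leb_Q) \<le> a n + e n + e n * D" for n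
  proof -
    have "(\<integral>y. \<bar>(norm (u n y))\<^sup>2 - (norm (d y))\<^sup>2\<bar> \<partial>leb_Q) \<le>
        (\<integral>y. (1 + 1 / e n) * (norm (u n y - d y))\<^sup>2 + e n * (norm (d y))\<^sup>2 \<partial>leb_Q)"
      using e_pos[of n] int d_int square_norm_u_integrable
      by (intro integral_mono abs_square_norm_diff_le) auto
    also have "\<dots> = a n + a n / e n + e n * D"
      using int[of n] d_int by (simp add: a_def D_def distrib_right)
    also have "a n / e n \<le> e n"
      using e_pos[of n] a0[of n] by (simp add: field_simps e_def)
    finally show ?thesis by simp
  qed
  have "(\<lambda>n. a n + e n + e n * D) \<longlonglongrightarrow> 0 + 0 + 0 * D"
    using u_lim e_lim by (intro tendsto_intros) (simp_all add: a_def)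
  then have "(\<lambda>n. a n + e n + e n * D) \<longlonglongrightarrow> 0" by simp
  then show ?thesis
    by (rule tendsto_sandwich[OF always_eventually always_eventually tendsto_const, rotated 2])
       (use le in auto)
qed

text \<open>Testing the limit with functions that contain the factor \<open>1 - |S|\<^sup>2\<close> cancels
  the weight \<open>1 + |G|\<^sup>2\<close>. What remains depends on \<open>u\<close> only,
  through \<open>|u|\<^sup>2\<close> and a bounded function, and converges because
  \<open>u\<close> converges strongly.\<close>

lemma state_marginal_integral:
  fixes \<psi> :: "point \<times> (real ^ 3) \<Rightarrow> real"
  assumes \<psi>: "continuous_on UNIV \<psi>" "\<And>z. \<bar>\<psi> z\<bar> \<le> B"
  shows "(\<integral>z. \<psi> (fst z, fst (snd z)) * max 0 (1 - (norm (snd (snd z)))\<^sup>2) \<partial>\<mu>) =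
    (\<integral>y. \<psi> (y, into_ball (d y)) * (1 + (norm (d y))\<^sup>2) \<partial>leb_Q)"
proof -
  let ?g = "\<lambda>z :: point \<times> (real ^ 3) \<times> (real ^ 3 ^ 3). \<psi> (fst z, fst (snd z)) * max 0 (1 - (norm (snd (snd z)))\<^sup>2)"
  have B0: "0 \<le> B" using order_trans[OF abs_ge_zero \<psi>(2)] .
  have [measurable]: "\<psi> \<in> borel_measurable borel" by (rule borel_measurable_continuous_onI[OF \<psi>(1)])
  have id_Q: "(\<lambda>y. y) \<in> borel_measurable leb_Q"
    by (rule borel_measurable_lebesgue_on_borel) simp
  have m\<psi>: "(\<lambda>y. \<psi> (y, into_ball (v y))) \<in> borel_measurable leb_Q" if [measurable]: "v \<in> borel_measurable leb_Q" for v
    by (rule measurable_compose[OF borel_measurable_Pair[OF id_Q]]) measurable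
  have "continuous_on UNIV (\<lambda>z::point \<times> (real ^ 3) \<times> (real ^ 3 ^ 3). \<psi> (fst z, fst (snd z)))"
    by (rule continuous_on_compose2[OF \<psi>(1)]) (auto intro!: continuous_intros)
  then have g_cont: "continuous_on UNIV ?g" by (intro continuous_intros)
  have g_bd: "\<bar>?g z\<bar> \<le> B" for z
  proof -
    have "\<bar>max 0 (1 - (norm (snd (snd z)))\<^sup>2)\<bar> \<le> 1" by simp
    then have "\<bar>?g z\<bar> \<le> B * 1" unfolding abs_mult by (intro mult_mono \<psi>(2) B0) auto
    then show ?thesis by simp
  qed
  have "(\<lambda>n. \<integral>y. ?g (y, into_ball (u n y), into_ball (G n y)) * weight n y \<partial>leb_Q) \<longlonglongrightarrow> (\<integral>z. ?g z \<partial>\<mu>)"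
    by (rule \<mu>_lim[OF g_cont g_bd])
  moreover have "?g (y, into_ball (u n y), into_ball (G n y)) * weight n y = \<psi> (y, into_ball (u n y)) * (1 + (norm (u n y))\<^sup>2)" for n y
  proof -
    have "1 + (norm (G n y))\<^sup>2 > 0" by (simp add: add_pos_nonneg)
    then show ?thesis by (simp add: one_minus_norm_into_ball)
  qed
  ultimately have lim1: "(\<lambda>n. \<integral>y. \<psi> (y, into_ball (u n y)) * (1 + (norm (u n y))\<^sup>2) \<partial>leb_Q) \<longlonglongrightarrow> (\<integral>z. ?g z \<partial>\<mu>)"
    by (simp only:)
  have int1: "integrable leb_Q (\<lambda>y. \<psi> (y, into_ball (v y)) * (c + (norm (w y))\<^sup>2))"
    if "v \<in> borel_measurable leb_Q" and [measurable]: "w \<in> borel_measurable leb_Q" and w: "integrable leb_Q (\<lambda>y. (norm (w y))\<^sup>2)" 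
    for v w :: "point \<Rightarrow> real ^ 3" and c
  proof (rule Bochner_Integration.integrable_bound)
    show "integrable leb_Q (\<lambda>y. B * (\<bar>c\<bar> + (norm (w y))\<^sup>2))"
      using w finite_measure.integrable_const[OF finite_leb_Q] 
      by (intro integrable_mult_right Bochner_Integration.integrable_add)
    show "AE y in leb_Q. norm (\<psi> (y, into_ball (v y)) * (c + (norm (w y))\<^sup>2)) \<le> norm (B * (\<bar>c\<bar> + (norm (w y))\<^sup>2))"
    proof (rule AE_I2)
      fix y
      have "\<bar>c + (norm (w y))\<^sup>2\<bar> \<le> \<bar>c\<bar> + (norm (w y))\<^sup>2"
        using abs_triangle_ineq[of c "(norm (w y))\<^sup>2"] by simp
      then have "\<bar>\<psi> (y, into_ball (v y))\<bar> * \<bar>c + (norm (w y))\<^sup>2\<bar> \<le> B * (\<bar>c\<bar> + (norm (w y))\<^sup>2)"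
        by (intro mult_mono \<psi>(2) B0) auto
      then show "norm (\<psi> (y, into_ball (v y)) * (c + (norm (w y))\<^sup>2)) \<le> norm (B * (\<bar>c\<bar> + (norm (w y))\<^sup>2))"
        using B0 by (simp add: abs_mult)
    qed
  qed (use m\<psi>[OF that(1)] in measurable)
  have lim2: "(\<lambda>n. \<integral>y. \<psi> (y, into_ball (u n y)) * (1 + (norm (d y))\<^sup>2) \<partial>leb_Q) \<longlonglongrightarrow>
      (\<integral>y. \<psi> (y, into_ball (d y)) * (1 + (norm (d y))\<^sup>2) \<partial>leb_Q)"
  proof (rule integral_dominated_convergence[where w="\<lambda>y. B * (1 + (norm (d y))\<^sup>2)"])
    show "integrable leb_Q (\<lambda>y. B * (1 + (norm (d y))\<^sup>2))"
      using d_int finite_measure.integrable_const[OF finite_leb_Q]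
      by (intro integrable_mult_right Bochner_Integration.integrable_add)
    show "AE y in leb_Q. (\<lambda>n. \<psi> (y, into_ball (u n y)) * (1 + (norm (d y))\<^sup>2)) \<longlonglongrightarrow> \<psi> (y, into_ball (d y)) * (1 + (norm (d y))\<^sup>2)"
      using u_AE
    proof eventually_elim
      case (elim y)
      have "(\<lambda>n. into_ball (u n y)) \<longlonglongrightarrow> into_ball (d y)"
        using continuous_on_tendsto_compose[OF continuous_on_into_ball elim] by simp
      then have "(\<lambda>n. (y, into_ball (u n y))) \<longlonglongrightarrow> (y, into_ball (d y))" by (intro tendsto_intros)
      then have "(\<lambda>n. \<psi> (y, into_ball (u n y))) \<longlonglongrightarrow> \<psi> (y, into_ball (d y))"
        using continuous_on_tendsto_compose[OF \<psi>(1)] by simp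
      then show ?case by (intro tendsto_intros)
    qed
    show "AE y in leb_Q. norm (\<psi> (y, into_ball (u n y)) * (1 + (norm (d y))\<^sup>2)) \<le> B * (1 + (norm (d y))\<^sup>2)" for n
      by (intro AE_I2) (auto simp: abs_mult intro!: mult_right_mono \<psi>(2))
  qed (use m\<psi> in measurable)
  have lim3: "(\<lambda>n. (\<integral>y. \<psi> (y, into_ball (u n y)) * (1 + (norm (u n y))\<^sup>2) \<partial>leb_Q) -
      (\<integral>y. \<psi> (y, into_ball (u n y)) * (1 + (norm (d y))\<^sup>2) \<partial>leb_Q)) \<longlonglongrightarrow> 0"
  proof (rule Lim_null_comparison)
    have "norm ((\<integral>y. \<psi> (y, into_ball (u n y)) * (1 + (norm (u n y))\<^sup>2) \<partial>leb_Q) -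
      (\<integral>y. \<psi> (y, into_ball (u n y)) * (1 + (norm (d y))\<^sup>2) \<partial>leb_Q)) \<le> B * (\<integral>y. \<bar>(norm (u n y))\<^sup>2 - (norm (d y))\<^sup>2\<bar> \<partial>leb_Q)" for n
    proof -
      have i1: "integrable leb_Q (\<lambda>y. \<psi> (y, into_ball (u n y)) * (1 + (norm (u n y))\<^sup>2))"
        and i2: "integrable leb_Q (\<lambda>y. \<psi> (y, into_ball (u n y)) * (1 + (norm (d y))\<^sup>2))"
        by (intro int1 u_meas d_meas_Q square_norm_u_integrable d_int)+
      have "norm ((\<integral>y. \<psi> (y, into_ball (u n y)) * (1 + (norm (u n y))\<^sup>2) \<partial>leb_Q) -
          (\<integral>y. \<psi> (y, into_ball (u n y)) * (1 + (norm (d y))\<^sup>2) \<partial>leb_Q)) =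
          norm (\<integral>y. \<psi> (y, into_ball (u n y)) * (1 + (norm (u n y))\<^sup>2) - \<psi> (y, into_ball (u n y)) * (1 + (norm (d y))\<^sup>2) \<partial>leb_Q)"
        using i1 i2 by simp
      also have "\<dots> \<le> (\<integral>y. B * \<bar>(norm (u n y))\<^sup>2 - (norm (d y))\<^sup>2\<bar> \<partial>leb_Q)"
      proof (rule Bochner_Integration.integral_norm_bound_integral)
        show "norm (\<psi> (y, into_ball (u n y)) * (1 + (norm (u n y))\<^sup>2) - \<psi> (y, into_ball (u n y)) * (1 + (norm (d y))\<^sup>2))
            \<le> B * \<bar>(norm (u n y))\<^sup>2 - (norm (d y))\<^sup>2\<bar>" for y
          by (auto simp: right_diff_distrib[symmetric] abs_mult intro!: mult_right_mono \<psi>(2))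
        show "integrable leb_Q (\<lambda>y. \<psi> (y, into_ball (u n y)) * (1 + (norm (u n y))\<^sup>2) - \<psi> (y, into_ball (u n y)) * (1 + (norm (d y))\<^sup>2))"
          using i1 i2 by (rule Bochner_Integration.integrable_diff)
        show "integrable leb_Q (\<lambda>y. B * \<bar>(norm (u n y))\<^sup>2 - (norm (d y))\<^sup>2\<bar>)"
          using square_norm_u_integrable d_int by simp
      qed
      finally show ?thesis by simp
    qed
    then show "\<forall>\<^sub>F n in sequentially. norm ((\<integral>y. \<psi> (y, into_ball (u n y)) * (1 + (norm (u n y))\<^sup>2) \<partial>leb_Q) -
      (\<integral>y. \<psi> (y, into_ball (u n y)) * (1 + (norm (d y))\<^sup>2) \<partial>leb_Q)) \<le> B * (\<integral>y. \<bar>(norm (u n y))\<^sup>2 - (norm (d y))\<^sup>2\<bar> \<partial>leb_Q)"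
      by simp
    have "(\<lambda>n. B * (\<integral>y. \<bar>(norm (u n y))\<^sup>2 - (norm (d y))\<^sup>2\<bar> \<partial>leb_Q)) \<longlonglongrightarrow> B * 0"
      by (intro tendsto_intros square_norm_L1_limit)
    then show "(\<lambda>n. B * (\<integral>y. \<bar>(norm (u n y))\<^sup>2 - (norm (d y))\<^sup>2\<bar> \<partial>leb_Q)) \<longlonglongrightarrow> 0" by simp
  qed
  have "(\<lambda>n. \<integral>y. \<psi> (y, into_ball (u n y)) * (1 + (norm (u n y))\<^sup>2) \<partial>leb_Q) \<longlonglongrightarrow>
      (\<integral>y. \<psi> (y, into_ball (d y)) * (1 + (norm (d y))\<^sup>2) \<partial>leb_Q)"
    using tendsto_add[OF lim3 lim2] by simp
  with lim1 show ?thesis by (rule LIMSEQ_unique)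
qed

end

section \<open>The oscillation measure\<close>

text \<open>Only the integrals of Borel functions with respect to the base measure matter, so it may be
  replaced by its completion.\<close>

lemma decomposes_lebesgue_on:
  fixes \<alpha> :: "'a::euclidean_space measure"
  assumes D: "decomposes \<mu> \<alpha> \<kappa> p" and \<alpha>: "sets \<alpha> = sets borel"
    and eq: "\<And>F :: 'a \<Rightarrow> ennreal. F \<in> borel_measurable borel \<Longrightarrow> (\<integral>\<^sup>+a. F a \<partial>\<alpha>) = (\<integral>\<^sup>+a. F a \<partial>lebesgue_on S)"
  shows "decomposes \<mu> (lebesgue_on S) \<kappa> p"
  unfolding decomposes_def
proof (intro ballI conjI)
  fix F :: "'b \<Rightarrow> ennreal" assume F: "F \<in> borel_measurable borel"
  show "(\<lambda>b. F (p a b)) \<in> borel_measurable (\<kappa> a)" for a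
    using decomposesD(1)[OF D F, of a] sets_eq_imp_space_eq[OF \<alpha>] by simp
  have m: "(\<lambda>a. \<integral>\<^sup>+b. F (p a b) \<partial>\<kappa> a) \<in> borel_measurable borel"
    using decomposesD(2)[OF D F] by (simp add: measurable_cong_sets[OF \<alpha> refl])
  then show "(\<lambda>a. \<integral>\<^sup>+b. F (p a b) \<partial>\<kappa> a) \<in> borel_measurable (lebesgue_on S)"
    by (rule borel_measurable_lebesgue_on_borel)
  show "(\<integral>\<^sup>+z. F z \<partial>\<mu>) = (\<integral>\<^sup>+a. \<integral>\<^sup>+b. F (p a b) \<partial>\<kappa> a \<partial>lebesgue_on S)"
    using decomposesD(3)[OF D F] eq[OF m] by simp
qed

lemma finite_measure_density_bounded:
  assumes "finite_measure M" and [measurable]: "f \<in> borel_measurable M" and le: "\<And>x. f x \<le> (1 :: ennreal)"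
  shows "finite_measure (density M f)"
proof (rule finite_measureI)
  have "emeasure (density M f) (space M) = (\<integral>\<^sup>+x. f x \<partial>M)"
    by (subst emeasure_density) (auto intro!: nn_integral_cong)
  also have "\<dots> \<le> (\<integral>\<^sup>+x. 1 \<partial>M)" by (intro nn_integral_mono le)
  also have "\<dots> < \<infinity>" using finite_measure.emeasure_finite[OF assms(1), of "space M"] by (simp add: less_top[symmetric])
  finally show "emeasure (density M f) (space (density M f)) \<noteq> \<infinity>" by simp
qed

context young_limit
begin

lemma measurable_state_components[measurable]:
  "(\<lambda>z. fst z) \<in> borel_measurable \<mu>" "(\<lambda>z. fst (snd z)) \<in> borel_measurable \<mu>"
  "(\<lambda>z. snd (snd z)) \<in> borel_measurable \<mu>"
  "(\<lambda>z. d (fst z)) \<in> borel_measurable \<mu>"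
proof -
  have id: "(\<lambda>z. z) \<in> borel_measurable \<mu>" by (simp add: measurable_cong_sets[OF sets_\<mu> refl])
  show *: "(\<lambda>z. fst z) \<in> borel_measurable \<mu>" "(\<lambda>z. fst (snd z)) \<in> borel_measurable \<mu>"
    "(\<lambda>z. snd (snd z)) \<in> borel_measurable \<mu>"
    by (intro borel_measurable_fst_snd id)+
  show "(\<lambda>z. d (fst z)) \<in> borel_measurable \<mu>" by (rule measurable_compose[OF *(1) d_meas])
qed

text \<open>The law of the position and of the limit state in ball coordinates, with the weight of the state.\<close>

definition state_law :: "(point \<times> (real ^ 3)) measure" where
  "state_law = distr (density leb_Q (\<lambda>y. ennreal (1 + (norm (d y))\<^sup>2))) borel (\<lambda>y. (y, into_ball (d y)))"

lemma graph_measurable: "(\<lambda>y. (y, into_ball (d y))) \<in> borel_measurable leb_Q"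
proof -
  have "(\<lambda>y. y) \<in> borel_measurable leb_Q" by (rule borel_measurable_lebesgue_on_borel) simp
  then show ?thesis by measurable
qed

text \<open>Both measures have the same integrals of continuous functions, by
  \<open>state_marginal_integral\<close>.\<close>

lemma state_law_eq:
  "distr (density \<mu> (\<lambda>z. ennreal (max 0 (1 - (norm (snd (snd z)))\<^sup>2)))) borel (\<lambda>z. (fst z, fst (snd z))) = state_law"
proof (rule finite_measure_eqI_continuous)
  have m: "(\<lambda>z. (fst z, fst (snd z))) \<in> borel_measurable \<mu>" by measurable
  have "ennreal (max 0 (1 - (norm (snd (snd z)))\<^sup>2)) \<le> 1" for z :: "point \<times> (real ^ 3) \<times> (real ^ 3 ^ 3)"
    by (simp add: ennreal_le_1)
  then show "finite_measure (distr (density \<mu> (\<lambda>z. ennreal (max 0 (1 - (norm (snd (snd z)))\<^sup>2)))) borel (\<lambda>z. (fst z, fst (snd z))))"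
    by (intro finite_measure.finite_measure_distr finite_measure_density_bounded finite_\<mu>) (use m in auto)
  have int: "integrable leb_Q (\<lambda>y. 1 + (norm (d y))\<^sup>2)"
    by (intro Bochner_Integration.integrable_add d_int finite_measure.integrable_const[OF finite_leb_Q])
  have "finite_measure (density leb_Q (\<lambda>y. ennreal (1 + (norm (d y))\<^sup>2)))"
  proof (rule finite_measureI)
    have "emeasure (density leb_Q (\<lambda>y. ennreal (1 + (norm (d y))\<^sup>2))) (space leb_Q) = (\<integral>\<^sup>+y. ennreal (1 + (norm (d y))\<^sup>2) \<partial>leb_Q)"
      by (subst emeasure_density) (auto intro!: nn_integral_cong)
    then show "emeasure (density leb_Q (\<lambda>y. ennreal (1 + (norm (d y))\<^sup>2))) (space (density leb_Q (\<lambda>y. ennreal (1 + (norm (d y))\<^sup>2)))) \<noteq> \<infinity>"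
      using nn_integral_eq_integral[OF int] by simp
  qed
  then show "finite_measure state_law"
    unfolding state_law_def by (rule finite_measure.finite_measure_distr) (use graph_measurable in simp)
  fix g :: "point \<times> (real ^ 3) \<Rightarrow> real"
  assume g: "continuous_on UNIV g" "\<And>x. 0 \<le> g x" "\<And>x. g x \<le> 1"
  have [measurable]: "g \<in> borel_measurable borel" by (rule borel_measurable_continuous_onI[OF g(1)])
  have mg: "(\<lambda>z. g (fst z, fst (snd z))) \<in> borel_measurable \<mu>" by (rule measurable_compose[OF m]) simp
  have mg': "(\<lambda>y. g (y, into_ball (d y))) \<in> borel_measurable leb_Q" by (rule measurable_compose[OF graph_measurable]) simp
  have abs1: "\<bar>g z\<bar> \<le> 1" for z using g(2,3)[of z] by linarith
  have "(\<integral>p. g p \<partial>distr (density \<mu> (\<lambda>z. ennreal (max 0 (1 - (norm (snd (snd z)))\<^sup>2)))) borel (\<lambda>z. (fst z, fst (snd z)))) =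
      (\<integral>z. g (fst z, fst (snd z)) * max 0 (1 - (norm (snd (snd z)))\<^sup>2) \<partial>\<mu>)"
    using m mg by (subst integral_distr, simp, simp, subst integral_density) (auto simp: mult.commute)
  also have "\<dots> = (\<integral>y. g (y, into_ball (d y)) * (1 + (norm (d y))\<^sup>2) \<partial>leb_Q)"
    by (rule state_marginal_integral[OF g(1) abs1])
  also have "\<dots> = (\<integral>p. g p \<partial>state_law)"
    unfolding state_law_def using graph_measurable mg'
    by (subst integral_distr, simp, simp, subst integral_density) (auto simp: mult.commute)
  finally show "(\<integral>p. g p \<partial>distr (density \<mu> (\<lambda>z. ennreal (max 0 (1 - (norm (snd (snd z)))\<^sup>2)))) borel (\<lambda>z. (fst z, fst (snd z)))) =
      (\<integral>p. g p \<partial>state_law)" .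
qed (simp_all add: state_law_def)

text \<open>The density \<open>1 - |S|\<^sup>2\<close> is positive exactly where \<open>|S| < 1\<close>. There
  the law of the remaining variables is \<open>state_law\<close>, which is carried by the graph of
  the limit over the open cylinder. So wherever the gradient does not concentrate, the state is
  determined by the position, and no mass sits on the boundary of the cylinder.\<close>

lemma AE_graph: "AE z in \<mu>. norm (snd (snd z)) < 1 \<longrightarrow> fst z \<in> Q \<and> fst (snd z) = into_ball (d (fst z))"
proof -
  let ?P = "\<lambda>p. fst p \<in> Q \<and> snd p = into_ball (d (fst p))"
  let ?d = "density \<mu> (\<lambda>z. ennreal (max 0 (1 - (norm (snd (snd z)))\<^sup>2)))"
  have f: "(\<lambda>p. fst p) \<in> borel_measurable (borel :: (point \<times> (real ^ 3)) measure)"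
    and s: "(\<lambda>p. snd p) \<in> borel_measurable (borel :: (point \<times> (real ^ 3)) measure)"
    by (intro borel_measurable_fst_snd measurable_ident_sets refl)+
  have dm: "(\<lambda>p. snd p - into_ball (d (fst p))) \<in> borel_measurable (borel :: (point \<times> (real ^ 3)) measure)"
    using s measurable_compose[OF f d_meas] by measurable
  have "{p. ?P p} = (\<lambda>p. fst p) -` Q \<inter> (\<lambda>p. snd p - into_ball (d (fst p))) -` {0}" by auto
  also have "\<dots> \<in> sets borel"
    using measurable_sets[OF f Q_borel] measurable_sets[OF dm, of "{0}"] by (intro sets.Int) auto
  finally have P: "{p. ?P p} \<in> sets borel" .
  have P': "{p \<in> space borel. ?P p} \<in> sets borel" using P by simp
  have gm: "(\<lambda>y. (y, into_ball (d y))) \<in> density leb_Q (\<lambda>y. ennreal (1 + (norm (d y))\<^sup>2)) \<rightarrow>\<^sub>M borel"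
    using graph_measurable by simp
  have "AE y in density leb_Q (\<lambda>y. ennreal (1 + (norm (d y))\<^sup>2)). ?P (y, into_ball (d y))"
    by (subst AE_density) (auto intro!: AE_I2)
  then have "AE p in state_law. ?P p"
    unfolding state_law_def by (subst AE_distr_iff[OF gm P'])
  moreover have m: "(\<lambda>z. (fst z, fst (snd z))) \<in> ?d \<rightarrow>\<^sub>M borel"
    by measurable
  ultimately have "AE z in ?d. ?P (fst z, fst (snd z))"
    unfolding state_law_eq[symmetric] by (subst (asm) AE_distr_iff[OF m P'])
  then have "AE z in \<mu>. 0 < ennreal (max 0 (1 - (norm (snd (snd z)))\<^sup>2)) \<longrightarrow> ?P (fst z, fst (snd z))"
    by (subst (asm) AE_density) auto
  then show ?thesis
  proof eventually_elim
    case (elim z)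
    show ?case
    proof
      assume "norm (snd (snd z)) < 1"
      then have "0 < 1 - (norm (snd (snd z)))\<^sup>2" by (simp add: power_less_one_iff)
      then show "fst z \<in> Q \<and> fst (snd z) = into_ball (d (fst z))" using elim by simp
    qed
  qed
qed

text \<open>The reciprocal of the weight in ball coordinates, extended by 0 from the open balls.\<close>

definition deweight :: "point \<times> (real ^ 3) \<times> (real ^ 3 ^ 3) \<Rightarrow> real" where
  "deweight z = max 0 (1 - (norm (fst (snd z)))\<^sup>2) * max 0 (1 - (norm (snd (snd z)))\<^sup>2)"

lemma deweight_bounds: "0 \<le> deweight z" "deweight z \<le> 1"
  unfolding deweight_def by (auto intro!: mult_le_one)

lemma deweight_measurable[measurable]: "deweight \<in> borel_measurable \<mu>"
  unfolding deweight_def[abs_def] by measurable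

text \<open>Removing the weight from the limit measure leaves Lebesgue measure as the law of the position.\<close>

lemma nn_integral_deweight_fst:
  fixes F :: "point \<Rightarrow> ennreal"
  assumes F[measurable]: "F \<in> borel_measurable borel"
  shows "(\<integral>\<^sup>+z. F (fst z) \<partial>density \<mu> (\<lambda>z. ennreal (deweight z))) = (\<integral>\<^sup>+y. F y \<partial>leb_Q)"
proof -
  define H where "H p = F (fst p) * ennreal (max 0 (1 - (norm (snd p))\<^sup>2))" for p :: "point \<times> (real ^ 3)"
  have fs: "(\<lambda>p. fst p) \<in> borel_measurable (borel :: (point \<times> (real ^ 3)) measure)"
    "(\<lambda>p. snd p) \<in> borel_measurable (borel :: (point \<times> (real ^ 3)) measure)"
    by (intro borel_measurable_fst_snd measurable_ident_sets refl)+
  have [measurable]: "H \<in> borel_measurable borel"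
    unfolding H_def[abs_def] using fs measurable_compose[OF fs(1) F] by measurable
  have m: "(\<lambda>z. (fst z, fst (snd z))) \<in> borel_measurable \<mu>" by measurable
  have mF: "(\<lambda>z. F (fst z)) \<in> borel_measurable \<mu>" by (rule measurable_compose[OF measurable_state_components(1) F])
  have mF': "F \<in> borel_measurable leb_Q" by (rule borel_measurable_lebesgue_on_borel[OF F])
  have mH: "(\<lambda>z. H (fst z, fst (snd z))) \<in> borel_measurable \<mu>" by (rule measurable_compose[OF m]) simp
  have mH': "(\<lambda>y. H (y, into_ball (d y))) \<in> borel_measurable leb_Q" by (rule measurable_compose[OF graph_measurable]) simp
  have "(\<integral>\<^sup>+z. F (fst z) \<partial>density \<mu> (\<lambda>z. ennreal (deweight z))) = (\<integral>\<^sup>+z. ennreal (deweight z) * F (fst z) \<partial>\<mu>)"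
    by (subst nn_integral_density) (use mF in auto)
  also have "\<dots> = (\<integral>\<^sup>+z. ennreal (max 0 (1 - (norm (snd (snd z)))\<^sup>2)) * H (fst z, fst (snd z)) \<partial>\<mu>)"
    by (intro nn_integral_cong) (simp add: deweight_def H_def ennreal_mult ac_simps)
  also have "\<dots> = (\<integral>\<^sup>+p. H p \<partial>distr (density \<mu> (\<lambda>z. ennreal (max 0 (1 - (norm (snd (snd z)))\<^sup>2)))) borel (\<lambda>z. (fst z, fst (snd z))))"
    using m mH by (subst nn_integral_distr, simp, simp, subst nn_integral_density) auto
  also have "\<dots> = (\<integral>\<^sup>+p. H p \<partial>state_law)" by (simp only: state_law_eq)
  also have "\<dots> = (\<integral>\<^sup>+y. ennreal (1 + (norm (d y))\<^sup>2) * H (y, into_ball (d y)) \<partial>leb_Q)"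
    unfolding state_law_def using graph_measurable mH'
    by (subst nn_integral_distr, simp, simp, subst nn_integral_density) auto
  also have "\<dots> = (\<integral>\<^sup>+y. F y \<partial>leb_Q)"
  proof (rule nn_integral_cong)
    fix y
    have p: "1 + (norm (d y))\<^sup>2 > 0" by (simp add: add_pos_nonneg)
    have "ennreal (1 + (norm (d y))\<^sup>2) * ennreal (max 0 (1 - (norm (into_ball (d y)))\<^sup>2)) = 1"
    proof -
      have "(1 + (norm (d y))\<^sup>2) * max 0 (1 - (norm (into_ball (d y)))\<^sup>2) = 1"
        using p by (simp add: one_minus_norm_into_ball)
      then show ?thesis by (subst ennreal_mult[symmetric]) (use p in simp_all)
    qed
    then have "ennreal (1 + (norm (d y))\<^sup>2) * ennreal (max 0 (1 - (norm (into_ball (d y)))\<^sup>2)) * F y = F y" by simp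
    then show "ennreal (1 + (norm (d y))\<^sup>2) * H (y, into_ball (d y)) = F y"
      by (simp add: H_def ac_simps)
  qed
  finally show ?thesis .
qed

text \<open>The integrand on the cylinder times the gradients that has the ball representation
  \<open>g\<close>, with the limit put in for the state.\<close>

definition lifted :: "(point \<times> (real ^ 3) \<times> (real ^ 3 ^ 3) \<Rightarrow> real) \<Rightarrow> point \<times> (real ^ 3 ^ 3) \<Rightarrow> real" where
  "lifted g p = g (fst p, into_ball (d (fst p)), into_ball (snd p)) *
     ((1 + (norm (d (fst p)))\<^sup>2) * (1 + (norm (snd p))\<^sup>2))"

lemma lifted_measurable:
  assumes g: "g \<in> borel_measurable borel"
  shows "lifted g \<in> borel_measurable borel"
proof -
  have fs[measurable]: "(\<lambda>p. fst p) \<in> borel_measurable (borel :: (point \<times> (real ^ 3 ^ 3)) measure)"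
    "(\<lambda>p. snd p) \<in> borel_measurable (borel :: (point \<times> (real ^ 3 ^ 3)) measure)"
    by (intro borel_measurable_fst_snd measurable_ident_sets refl)+
  have [measurable]: "(\<lambda>p. d (fst p)) \<in> borel_measurable (borel :: (point \<times> (real ^ 3 ^ 3)) measure)"
    by (rule measurable_compose[OF fs(1) d_meas])
  have "(\<lambda>p. (fst p, into_ball (d (fst p)), into_ball (snd p))) \<in> borel_measurable (borel :: (point \<times> (real ^ 3 ^ 3)) measure)"
    by measurable
  from measurable_compose[OF this g] show ?thesis unfolding lifted_def[abs_def] by measurable
qed

text \<open>The measure \<open>\<omega>\<close> on positions and gradients carries the part of
  \<open>\<mu>\<close> over the open ball of gradients.\<close>

definition oscillation_part :: "(point \<times> (real ^ 3 ^ 3)) measure \<Rightarrow> bool" where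
  "oscillation_part \<omega> \<longleftrightarrow> (\<forall>g B. g \<in> borel_measurable borel \<longrightarrow> (\<forall>z. \<bar>g z\<bar> \<le> B) \<longrightarrow>
     integrable \<omega> (lifted g) \<and>
     (\<integral>p. lifted g p \<partial>\<omega>) = (\<integral>z. (if norm (snd (snd z)) < 1 then g z else 0) \<partial>\<mu>))"

lemma oscillation_partD:
  assumes "oscillation_part \<omega>" "g \<in> borel_measurable borel" "\<And>z. \<bar>g z\<bar> \<le> B"
  shows "integrable \<omega> (lifted g)"
    and "(\<integral>p. lifted g p \<partial>\<omega>) = (\<integral>z. (if norm (snd (snd z)) < 1 then g z else 0) \<partial>\<mu>)"
  using assms unfolding oscillation_part_def by blast+

text \<open>Take the weight off \<open>\<mu>\<close>, forget the state, and disintegrate over the position.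
  The base measure is Lebesgue measure by \<open>nn_integral_deweight_fst\<close>, and the kernel
  in ball coordinates is mapped to the space of matrices by \<open>from_ball\<close>. By
  \<open>AE_graph\<close> the forgotten state is \<open>d\<close>, so no information is lost;
  putting the weight back in is the factor in \<open>lifted\<close>.\<close>

proposition oscillation_measure:
  obtains \<nu> \<omega> where "\<nu> \<in> borel \<rightarrow>\<^sub>M prob_algebra borel" "decomposes \<omega> leb_Q \<nu> Pair"
    "oscillation_part \<omega>"
proof -
  define \<rho> where "\<rho> = density \<mu> (\<lambda>z. ennreal (deweight z))"
  have fin_\<rho>: "finite_measure \<rho>"
    unfolding \<rho>_def by (intro finite_measure_density_bounded finite_\<mu>) (auto simp: deweight_bounds ennreal_le_1)
  have sets_\<rho>: "sets \<rho> = sets \<mu>" by (simp add: \<rho>_def)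
  define \<tau> where "\<tau> = distr \<rho> borel (\<lambda>z. (fst z, snd (snd z)))"
  have m\<tau>: "(\<lambda>z. (fst z, snd (snd z))) \<in> \<rho> \<rightarrow>\<^sub>M borel"
    unfolding \<rho>_def by measurable
  have fin_\<tau>: "finite_measure \<tau>" unfolding \<tau>_def by (rule finite_measure.finite_measure_distr[OF fin_\<rho> m\<tau>])
  have cb: "{p :: point \<times> (real ^ 3 ^ 3). snd p \<in> cball 0 1} \<in> sets borel"
  proof -
    have "{p :: point \<times> (real ^ 3 ^ 3). snd p \<in> cball 0 1} = UNIV \<times> cball 0 1" by auto
    moreover have "closed (UNIV \<times> cball 0 1 :: (point \<times> (real ^ 3 ^ 3)) set)"
      by (intro closed_Times closed_UNIV closed_cball)
    ultimately show ?thesis by simp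
  qed
  have "AE z in \<rho>. snd (snd z) \<in> cball 0 1"
    unfolding \<rho>_def using \<mu>_K by (subst AE_density) (auto elim!: eventually_mono)
  then have supp_\<tau>: "AE p in \<tau>. snd p \<in> cball 0 1"
    unfolding \<tau>_def by (subst AE_distr_iff[OF m\<tau>]) (use cb in auto)
  obtain \<kappa> where \<kappa>: "\<kappa> \<in> borel \<rightarrow>\<^sub>M prob_algebra borel" "decomposes \<tau> (distr \<tau> borel fst) \<kappa> Pair"
    by (rule disintegration[OF fin_\<tau> _ compact_cball supp_\<tau>]) (auto simp: \<tau>_def)
  define \<nu> where "\<nu> y = distr (\<kappa> y) borel from_ball" for y
  have \<nu>: "\<nu> \<in> borel \<rightarrow>\<^sub>M prob_algebra borel"
    unfolding \<nu>_def[abs_def] by (rule measurable_distr_prob_space2[OF \<kappa>(1)]) measurable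
  have sets_\<kappa>: "sets (\<kappa> a) = sets borel" for a
    using sets_kernel[OF measurable_prob_algebraD[OF \<kappa>(1)]] by simp
  define \<omega> where "\<omega> = distr \<rho> borel (\<lambda>z. (fst z, from_ball (snd (snd z))))"
  have m\<omega>: "(\<lambda>z. (fst z, from_ball (snd (snd z)))) \<in> \<rho> \<rightarrow>\<^sub>M borel"
    unfolding \<rho>_def by measurable
  have fs: "(\<lambda>p. fst p) \<in> borel_measurable (borel :: (point \<times> (real ^ 3 ^ 3)) measure)"
    "(\<lambda>p. snd p) \<in> borel_measurable (borel :: (point \<times> (real ^ 3 ^ 3)) measure)"
    by (intro borel_measurable_fst_snd measurable_ident_sets refl)+
  have "decomposes \<omega> (distr \<tau> borel fst) \<nu> Pair"
  proof (rule decomposes_PairI[OF measurable_prob_algebraD[OF \<nu>]])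
    fix F :: "point \<times> (real ^ 3 ^ 3) \<Rightarrow> ennreal" assume F[measurable]: "F \<in> borel_measurable borel"
    have e: "(\<lambda>p. (fst p, from_ball (snd p))) \<in> borel_measurable (borel :: (point \<times> (real ^ 3 ^ 3)) measure)"
      using fs by measurable
    have F': "(\<lambda>p. F (fst p, from_ball (snd p))) \<in> borel_measurable borel"
      by (rule measurable_compose[OF e F])
    have "(\<integral>\<^sup>+p. F p \<partial>\<omega>) = (\<integral>\<^sup>+z. F (fst z, from_ball (snd (snd z))) \<partial>\<rho>)"
      unfolding \<omega>_def by (rule nn_integral_distr[OF m\<omega>]) simp
    also have "\<dots> = (\<integral>\<^sup>+p. F (fst p, from_ball (snd p)) \<partial>\<tau>)"
      unfolding \<tau>_def using F' by (subst nn_integral_distr[OF m\<tau>]) auto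
    also have "\<dots> = (\<integral>\<^sup>+a. \<integral>\<^sup>+b. F (a, from_ball b) \<partial>\<kappa> a \<partial>distr \<tau> borel fst)"
      using decomposesD(3)[OF \<kappa>(2) F'] by simp
    also have "\<dots> = (\<integral>\<^sup>+a. \<integral>\<^sup>+b. F (a, b) \<partial>\<nu> a \<partial>distr \<tau> borel fst)"
    proof (rule nn_integral_cong)
      fix a :: point
      have "Pair a \<in> (borel :: (real ^ 3 ^ 3) measure) \<rightarrow>\<^sub>M borel" by (intro borel_measurable_Pair) auto
      then have "(\<lambda>b. F (a, b)) \<in> borel_measurable borel" using measurable_compose[OF _ F] by blast
      moreover have "from_ball \<in> \<kappa> a \<rightarrow>\<^sub>M borel" by (simp add: measurable_cong_sets[OF sets_\<kappa> refl])
      ultimately show "(\<integral>\<^sup>+b. F (a, from_ball b) \<partial>\<kappa> a) = (\<integral>\<^sup>+b. F (a, b) \<partial>\<nu> a)"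
        unfolding \<nu>_def by (subst nn_integral_distr) auto
    qed
    finally show "(\<integral>\<^sup>+p. F p \<partial>\<omega>) = (\<integral>\<^sup>+a. \<integral>\<^sup>+b. F (a, b) \<partial>\<nu> a \<partial>distr \<tau> borel fst)" .
  qed simp
  then have dec: "decomposes \<omega> leb_Q \<nu> Pair"
  proof (rule decomposes_lebesgue_on)
    fix F :: "point \<Rightarrow> ennreal" assume F: "F \<in> borel_measurable borel"
    have "fst \<in> \<tau> \<rightarrow>\<^sub>M borel" using fs(1) by (simp add: \<tau>_def)
    then have "(\<integral>\<^sup>+a. F a \<partial>distr \<tau> borel fst) = (\<integral>\<^sup>+p. F (fst p) \<partial>\<tau>)"
      by (rule nn_integral_distr) (use F in simp)
    also have "\<dots> = (\<integral>\<^sup>+z. F (fst z) \<partial>\<rho>)"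
      unfolding \<tau>_def using measurable_compose[OF fs(1) F] by (subst nn_integral_distr[OF m\<tau>]) auto
    also have "\<dots> = (\<integral>\<^sup>+y. F y \<partial>leb_Q)" unfolding \<rho>_def by (rule nn_integral_deweight_fst[OF F])
    finally show "(\<integral>\<^sup>+a. F a \<partial>distr \<tau> borel fst) = (\<integral>\<^sup>+y. F y \<partial>leb_Q)" .
  qed simp
  have lift: "integrable \<omega> (lifted g) \<and> (\<integral>p. lifted g p \<partial>\<omega>) = (\<integral>z. (if norm (snd (snd z)) < 1 then g z else 0) \<partial>\<mu>)"
    if g: "g \<in> borel_measurable borel" "\<And>z. \<bar>g z\<bar> \<le> B" for g B
  proof -
    let ?h = "\<lambda>z. lifted g (fst z, from_ball (snd (snd z)))"
    let ?c = "\<lambda>z. if norm (snd (snd z)) < 1 then g z else 0"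
    note [measurable] = lifted_measurable[OF g(1)]
    have mg: "g \<in> borel_measurable \<mu>" using g(1) by (simp add: measurable_cong_sets[OF sets_\<mu> refl])
    have mc: "?c \<in> borel_measurable \<mu>" using mg by measurable
    have mh: "?h \<in> borel_measurable \<mu>"
      using measurable_compose[OF m\<omega> lifted_measurable[OF g(1)]] by (simp add: \<rho>_def)
    have AE: "AE z in \<mu>. deweight z *\<^sub>R ?h z = ?c z"
      using AE_graph
    proof eventually_elim
      case (elim z)
      show ?case
      proof (cases "norm (snd (snd z)) < 1")
        case True
        with elim have h: "fst (snd z) = into_ball (d (fst z))" by simp
        have p: "1 + (norm (d (fst z)))\<^sup>2 > 0" by (simp add: add_pos_nonneg)
        have q: "1 - (norm (snd (snd z)))\<^sup>2 > 0" using True by (simp add: power_less_one_iff)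
        have "deweight z = 1 / (1 + (norm (d (fst z)))\<^sup>2) * (1 - (norm (snd (snd z)))\<^sup>2)"
          using p q by (simp add: deweight_def h one_minus_norm_into_ball max_def)
        moreover have "(fst z, into_ball (d (fst z)), snd (snd z)) = z" using h by (simp add: prod_eq_iff)
        then have "?h z = g z * ((1 + (norm (d (fst z)))\<^sup>2) * (1 / (1 - (norm (snd (snd z)))\<^sup>2)))"
          by (simp add: lifted_def into_ball_from_ball[OF True] one_plus_norm_from_ball[OF True])
        ultimately show ?thesis using p q True by simp
      next
        case False
        then have "1 \<le> (norm (snd (snd z)))\<^sup>2" by (simp add: one_le_power)
        then show ?thesis using False by (simp add: deweight_def)
      qed
    qed
    have int_c: "integrable \<mu> ?c"
      using g(2) order_trans[OF abs_ge_zero g(2)]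
      by (intro finite_measure.integrable_const_bound[OF finite_\<mu>, where B=B] mc) (auto intro!: AE_I2)
    have "integrable \<mu> (\<lambda>z. deweight z *\<^sub>R ?h z)"
      by (subst integrable_cong_AE[OF _ mc AE]) (use int_c mh in auto)
    then have "integrable \<rho> ?h"
      unfolding \<rho>_def by (subst integrable_density) (use mh in \<open>auto simp: deweight_bounds\<close>)
    then have "integrable \<omega> (lifted g)"
      unfolding \<omega>_def by (subst integrable_distr_eq[OF m\<omega>]) auto
    moreover have "(\<integral>p. lifted g p \<partial>\<omega>) = (\<integral>z. ?h z \<partial>\<rho>)"
      unfolding \<omega>_def by (rule integral_distr[OF m\<omega>]) simp
    moreover have "(\<integral>z. ?h z \<partial>\<rho>) = (\<integral>z. deweight z *\<^sub>R ?h z \<partial>\<mu>)"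
      unfolding \<rho>_def by (subst integral_density) (use mh in \<open>auto simp: deweight_bounds\<close>)
    moreover have "(\<integral>z. deweight z *\<^sub>R ?h z \<partial>\<mu>) = (\<integral>z. ?c z \<partial>\<mu>)"
      by (rule integral_cong_AE[OF _ mc AE]) (use mh in simp)
    ultimately show ?thesis by simp
  qed
  have "oscillation_part \<omega>"
    unfolding oscillation_part_def by (intro allI impI) (rule lift, simp, blast)
  then show thesis by (rule that[OF \<nu> dec])
qed

end

section \<open>The concentration measures\<close>

lemma decomposes_restrict_space:
  fixes \<mu> :: "'c::topological_space measure" and \<kappa> :: "'a \<Rightarrow> 'b::topological_space measure"
  assumes D: "decomposes \<mu> \<alpha> \<kappa> p" and sets: "\<And>a. a \<in> space \<alpha> \<Longrightarrow> sets (\<kappa> a) = sets borel"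
    and B: "B \<in> sets borel" and q: "\<And>a b. q (p a b) = b" "{z. q z \<in> B} \<in> sets borel"
    and supp: "AE z in \<mu>. q z \<in> B"
  shows "decomposes \<mu> \<alpha> (\<lambda>a. restrict_space (\<kappa> a) B) p"
  unfolding decomposes_def
proof (intro ballI conjI)
  fix F :: "'c \<Rightarrow> ennreal" assume F[measurable]: "F \<in> borel_measurable borel"
  define F' where "F' z = F z * indicator {z. q z \<in> B} z" for z
  have F': "F' \<in> borel_measurable borel" unfolding F'_def[abs_def] using q(2) by measurable
  have eq: "(\<integral>\<^sup>+b. F (p a b) \<partial>restrict_space (\<kappa> a) B) = (\<integral>\<^sup>+b. F' (p a b) \<partial>\<kappa> a)" if "a \<in> space \<alpha>" for a
  proof -
    have "(\<integral>\<^sup>+b. F (p a b) \<partial>restrict_space (\<kappa> a) B) = (\<integral>\<^sup>+b. F (p a b) * indicator B b \<partial>\<kappa> a)"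
      using B by (intro nn_integral_restrict_space) (simp add: sets[OF that] sets_eq_imp_space_eq[OF sets[OF that]])
    also have "\<dots> = (\<integral>\<^sup>+b. F' (p a b) \<partial>\<kappa> a)"
      by (intro nn_integral_cong) (simp add: F'_def q(1) indicator_def)
    finally show ?thesis .
  qed
  show "(\<lambda>b. F (p a b)) \<in> borel_measurable (restrict_space (\<kappa> a) B)" if "a \<in> space \<alpha>" for a
    by (intro measurable_restrict_space1 decomposesD(1)[OF D F that])
  show "(\<lambda>a. \<integral>\<^sup>+b. F (p a b) \<partial>restrict_space (\<kappa> a) B) \<in> borel_measurable \<alpha>"
    using decomposesD(2)[OF D F'] by (subst measurable_cong[OF eq])
  have "(\<integral>\<^sup>+z. F z \<partial>\<mu>) = (\<integral>\<^sup>+z. F' z \<partial>\<mu>)"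
  proof (rule nn_integral_cong_AE)
    show "AE z in \<mu>. F z = F' z" using supp by eventually_elim (simp add: F'_def)
  qed
  also have "\<dots> = (\<integral>\<^sup>+a. \<integral>\<^sup>+b. F' (p a b) \<partial>\<kappa> a \<partial>\<alpha>)" by (rule decomposesD(3)[OF D F'])
  also have "\<dots> = (\<integral>\<^sup>+a. \<integral>\<^sup>+b. F (p a b) \<partial>restrict_space (\<kappa> a) B \<partial>\<alpha>)"
    by (intro nn_integral_cong) (simp add: eq)
  finally show "(\<integral>\<^sup>+z. F z \<partial>\<mu>) = (\<integral>\<^sup>+a. \<integral>\<^sup>+b. F (p a b) \<partial>restrict_space (\<kappa> a) B \<partial>\<alpha>)" .
qed

lemma prob_space_restrict_spaceI:
  assumes "prob_space M" "B \<in> sets M" "emeasure M B = 1"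
  shows "prob_space (restrict_space M B)"
proof (rule prob_spaceI)
  have "space M \<inter> B = B" using sets.sets_into_space[OF assms(2)] by blast
  then show "emeasure (restrict_space M B) (space (restrict_space M B)) = 1"
    using assms(2,3) by (simp add: space_restrict_space emeasure_restrict_space)
qed

lemma finite_measure_restrict_scale:
  assumes "prob_space M" "r < \<infinity>" "B \<in> sets M"
  shows "finite_measure (restrict_space (scale_measure r M) B)"
proof (rule finite_measureI)
  have sp: "space (restrict_space (scale_measure r M) B) = B"
    using sets.sets_into_space[OF assms(3)] by (auto simp: space_restrict_space space_scale_measure)
  have "space M \<inter> B = B" using sets.sets_into_space[OF assms(3)] by blast
  then have "emeasure (restrict_space (scale_measure r M) B) B = r * emeasure M B"
    using assms(3) by (subst emeasure_restrict_space) (auto simp: space_scale_measure)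
  moreover have "emeasure M B \<le> 1" using prob_space.measure_le_1[OF assms(1)] .
  then have "emeasure M B < \<infinity>" by (rule order.strict_trans1) simp
  ultimately show "emeasure (restrict_space (scale_measure r M) B) (space (restrict_space (scale_measure r M) B)) \<noteq> \<infinity>"
    using assms(2) by (simp add: sp ennreal_mult_eq_top_iff less_top[symmetric])
qed

context young_limit
begin

text \<open>The part of the limit measure on the sphere of gradients, that is, at infinite gradients.\<close>

definition conc :: "(point \<times> (real ^ 3) \<times> (real ^ 3 ^ 3)) measure" where
  "conc = density \<mu> (\<lambda>z. if norm (snd (snd z)) < 1 then 0 else 1)"

definition conc_base :: "point measure" where "conc_base = distr conc borel fst"

lemma finite_conc: "finite_measure conc"
  unfolding conc_def by (intro finite_measure_density_bounded finite_\<mu>) auto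

lemma sets_conc: "sets conc = sets borel" by (simp add: conc_def sets_\<mu>)

lemma fst_conc: "(\<lambda>z. fst z) \<in> conc \<rightarrow>\<^sub>M borel"
  unfolding conc_def by measurable

lemma AE_conc: "AE z in conc. fst z \<in> closure Q \<and> snd z \<in> cball 0 1 \<times> sphere 0 1"
proof -
  have m: "(\<lambda>z. if norm (snd (snd z)) < 1 then 0 else (1::ennreal)) \<in> borel_measurable \<mu>" by measurable
  have "AE z in \<mu>. 0 < (if norm (snd (snd z)) < 1 then 0 else (1::ennreal)) \<longrightarrow> fst z \<in> closure Q \<and> snd z \<in> cball 0 1 \<times> sphere 0 1"
    using \<mu>_K by eventually_elim (auto simp: mem_Times_iff)
  then show ?thesis unfolding conc_def by (subst AE_density[OF m])
qed

lemma sets_conc_base[simp]: "sets conc_base = sets borel" and space_conc_base[simp]: "space conc_base = UNIV"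
  by (simp_all add: conc_base_def)

lemma finite_conc_base: "finite_measure conc_base"
  unfolding conc_base_def by (rule finite_measure.finite_measure_distr[OF finite_conc fst_conc])

lemma AE_conc_base: "AE y in conc_base. y \<in> closure Q"
proof -
  have "AE z in conc. fst z \<in> closure Q" using AE_conc by eventually_elim simp
  then show ?thesis
    unfolding conc_base_def by (subst AE_distr_iff[OF fst_conc]) auto
qed

text \<open>The mass that the approximating measures give to a time interval is at most \<open>C\<close> times
  its length, and this bound is inherited by the weak limit and by parts of it.\<close>

lemma conc_base_time_integral_le:
  fixes g :: "real \<Rightarrow> real"
  assumes g: "continuous_on UNIV g" "\<And>t. 0 \<le> g t" "\<And>t. g t \<le> 1"
  shows "ennreal (\<integral>y. g (snd y) \<partial>conc_base) \<le> ennreal C * (\<integral>\<^sup>+t. ennreal (g t) \<partial>lebesgue_on {0<..<T})"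
proof -
  have [measurable]: "g \<in> borel_measurable borel" by (rule borel_measurable_continuous_onI[OF g(1)])
  have sn: "(\<lambda>y. g (snd y)) \<in> borel_measurable (borel :: point measure)"
  proof -
    have "(\<lambda>y. snd y) \<in> borel_measurable (borel :: point measure)"
      by (intro borel_measurable_fst_snd measurable_ident_sets refl)
    then show ?thesis by measurable
  qed
  have snQ: "(\<lambda>y. g (snd y)) \<in> borel_measurable leb_Q" by (rule borel_measurable_lebesgue_on_borel[OF sn])
  have m: "(\<lambda>z. g (snd (fst z))) \<in> borel_measurable \<mu>"
    by (rule measurable_compose[OF measurable_state_components(1) sn])
  have cont: "continuous_on UNIV (\<lambda>z::point \<times> (real ^ 3) \<times> (real ^ 3 ^ 3). g (snd (fst z)))"
    by (rule continuous_on_compose2[OF g(1)]) (auto intro!: continuous_intros)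
  have bd: "\<bar>g t\<bar> \<le> 1" for t using g(2,3)[of t] by linarith
  have "(\<integral>y. g (snd y) \<partial>conc_base) = (\<integral>z. g (snd (fst z)) \<partial>conc)"
    unfolding conc_base_def by (rule integral_distr[OF fst_conc sn])
  also have "\<dots> = (\<integral>z. (if norm (snd (snd z)) < 1 then 0 else 1) *\<^sub>R g (snd (fst z)) \<partial>\<mu>)"
  proof -
    have "conc = density \<mu> (\<lambda>z. ennreal (if norm (snd (snd z)) < 1 then 0 else 1))"
      unfolding conc_def by (rule arg_cong[of _ _ "density \<mu>"]) auto
    then show ?thesis using m by (simp add: integral_density)
  qed
  also have "\<dots> \<le> (\<integral>z. g (snd (fst z)) \<partial>\<mu>)"
  proof (rule integral_mono')
    show "integrable \<mu> (\<lambda>z. g (snd (fst z)))"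
      by (rule continuous_integrable_finite_measure[OF finite_\<mu> sets_\<mu> cont bd])
  qed (use g(2) in auto)
  finally have le: "(\<integral>y. g (snd y) \<partial>conc_base) \<le> (\<integral>z. g (snd (fst z)) \<partial>\<mu>)" .
  have lim: "(\<lambda>n. \<integral>y. g (snd y) * weight n y \<partial>leb_Q) \<longlonglongrightarrow> (\<integral>z. g (snd (fst z)) \<partial>\<mu>)"
    using \<mu>_lim[OF cont bd] by simp
  have fin: "ennreal C * (\<integral>\<^sup>+t. ennreal (g t) \<partial>lebesgue_on {0<..<T}) < \<infinity>"
  proof -
    have "(\<integral>\<^sup>+t. ennreal (g t) \<partial>lebesgue_on {0<..<T}) \<le> (\<integral>\<^sup>+t. 1 \<partial>lebesgue_on {0<..<T})"
      using g(3) by (intro nn_integral_mono) (simp add: ennreal_le_1)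
    also have "\<dots> < \<infinity>" using T_pos by (simp add: emeasure_restrict_space)
    finally show ?thesis by (simp add: ennreal_mult_less_top)
  qed
  have bnd: "(\<integral>y. g (snd y) * weight n y \<partial>leb_Q) \<le> enn2real (ennreal C * (\<integral>\<^sup>+t. ennreal (g t) \<partial>lebesgue_on {0<..<T}))" for n
  proof -
    have "(\<integral>y. g (snd y) * weight n y \<partial>leb_Q) = enn2real (\<integral>\<^sup>+y. ennreal (g (snd y) * weight n y) \<partial>leb_Q)"
      using g(2) snQ by (intro integral_eq_nn_integral) (auto intro!: AE_I2 mult_nonneg_nonneg)
    also have "\<dots> \<le> enn2real (ennreal C * (\<integral>\<^sup>+t. ennreal (g t) \<partial>lebesgue_on {0<..<T}))"
      using fin by (intro enn2real_mono weight_nn_bound g(2)) auto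
    finally show ?thesis .
  qed
  have "(\<integral>z. g (snd (fst z)) \<partial>\<mu>) \<le> enn2real (ennreal C * (\<integral>\<^sup>+t. ennreal (g t) \<partial>lebesgue_on {0<..<T}))"
    by (rule LIMSEQ_le_const2[OF lim]) (use bnd in blast)
  with le have "ennreal (\<integral>y. g (snd y) \<partial>conc_base) \<le> ennreal (enn2real (ennreal C * (\<integral>\<^sup>+t. ennreal (g t) \<partial>lebesgue_on {0<..<T})))"
    by (intro ennreal_leI) simp
  then show ?thesis unfolding ennreal_enn2real[OF fin[unfolded infinity_ennreal_def]] .
qed

definition time_law :: "real measure" where "time_law = distr conc_base borel snd"

lemma snd_conc_base: "(\<lambda>y. snd y) \<in> conc_base \<rightarrow>\<^sub>M borel"
  by (simp add: measurable_cong_sets[OF sets_conc_base refl], intro borel_measurable_fst_snd) simp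

text \<open>The estimate for continuous test functions passes to open sets, and by outer regularity to Borel
  sets. It excludes concentration at single instants, which is what makes concentration measures
  for almost every time possible.\<close>

lemma time_law_le:
  assumes A: "A \<in> sets borel"
  shows "emeasure time_law A \<le> ennreal C * emeasure lborel (A \<inter> {0<..<T})"
proof -
  \<comment> \<open>The bounding measure, to which outer regularity is applied.\<close>
  define N where "N = density lborel (\<lambda>t. ennreal C * indicator {0<..<T} t)"
  have emN: "emeasure N X = ennreal C * emeasure lborel (X \<inter> {0<..<T})" if "X \<in> sets borel" for X
  proof -
    have "emeasure N X = (\<integral>\<^sup>+t. ennreal C * indicator {0<..<T} t * indicator X t \<partial>lborel)"
      using that by (simp add: N_def emeasure_density)
    also have "\<dots> = (\<integral>\<^sup>+t. ennreal C * indicator (X \<inter> {0<..<T}) t \<partial>lborel)"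
      by (intro nn_integral_cong) (auto simp: indicator_def)
    also have "\<dots> = ennreal C * emeasure lborel (X \<inter> {0<..<T})"
      using that by (intro nn_integral_cmult_indicator) auto
    finally show ?thesis .
  qed
  have setsN: "sets N = sets borel" and setsT: "sets time_law = sets borel" by (simp_all add: N_def time_law_def)
  have finT: "finite_measure time_law"
    unfolding time_law_def by (rule finite_measure.finite_measure_distr[OF finite_conc_base snd_conc_base])
  have finN: "finite_measure N"
  proof (rule finite_measureI)
    show "emeasure N (space N) \<noteq> \<infinity>"
      using emN[of UNIV] T_pos by (simp add: N_def ennreal_mult_eq_top_iff)
  qed
  have open_le: "emeasure time_law U \<le> emeasure N U" if "open U" for U
  proof (rule emeasure_open_le_of_integrals_le[OF finT setsT finN setsN _ that])
    fix g :: "real \<Rightarrow> real" assume g: "continuous_on UNIV g" "\<And>x. 0 \<le> g x" "\<And>x. g x \<le> 1"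
    have [measurable]: "g \<in> borel_measurable borel" by (rule borel_measurable_continuous_onI[OF g(1)])
    have bd: "\<bar>g t\<bar> \<le> 1" for t using g(2,3)[of t] by linarith
    have "(\<integral>\<^sup>+t. ennreal (g t) \<partial>N) = ennreal C * (\<integral>\<^sup>+t. ennreal (g t) \<partial>lebesgue_on {0<..<T})"
      unfolding N_def
      by (subst nn_integral_density) (auto simp: nn_integral_lebesgue_on nn_integral_cmult[symmetric] ac_simps)
    moreover have "(\<integral>\<^sup>+t. ennreal (g t) \<partial>N) = ennreal (\<integral>t. g t \<partial>N)"
      using g(2) by (intro nn_integral_eq_integral continuous_integrable_finite_measure[OF finN setsN g(1) bd]) auto
    moreover have "(\<integral>t. g t \<partial>time_law) = (\<integral>y. g (snd y) \<partial>conc_base)"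
      unfolding time_law_def by (rule integral_distr[OF snd_conc_base]) simp
    ultimately have "ennreal (\<integral>t. g t \<partial>time_law) \<le> ennreal (\<integral>t. g t \<partial>N)"
      using conc_base_time_integral_le[OF g] by simp
    then show "(\<integral>t. g t \<partial>time_law) \<le> (\<integral>t. g t \<partial>N)"
      using g(2) by (subst (asm) ennreal_le_iff) (auto intro: integral_nonneg_AE)
  qed
  have "emeasure N A = (INF U\<in>{U. A \<subseteq> U \<and> open U}. emeasure N U)"
    using finN A by (intro outer_regular) (auto simp: setsN finite_measure.emeasure_finite)
  moreover have "emeasure time_law A \<le> emeasure N U" if "A \<subseteq> U" "open U" for U
    using emeasure_mono[OF that(1), of time_law] open_le[OF that(2)] that(2)
    by (auto simp: setsT intro: order_trans)
  ultimately have "emeasure time_law A \<le> emeasure N A" by (auto intro: INF_greatest)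
  then show ?thesis by (simp add: emN[OF A])
qed

text \<open>Disintegrate over time. The time law has a density with respect to Lebesgue measure by
  \<open>time_law_le\<close>, and this density is moved into the kernel.\<close>

lemma concentration_time_slices:
  obtains r and \<kappa> :: "real \<Rightarrow> (real ^ 3) measure"
  where "AE t in lebesgue_on {0<..<T}. r t < (\<infinity> :: ennreal)" "\<kappa> \<in> borel \<rightarrow>\<^sub>M prob_algebra borel"
    "decomposes conc_base (lebesgue_on {0<..<T}) (\<lambda>t. scale_measure (r t) (\<kappa> t)) (\<lambda>t x. (x, t))"
proof -
  let ?sw = "\<lambda>y. (snd y, fst y) :: real \<times> (real ^ 3)"
  have swm: "?sw \<in> borel_measurable borel"
    by (intro borel_measurable_Pair borel_measurable_fst_snd) simp_all
  have sw: "?sw \<in> conc_base \<rightarrow>\<^sub>M borel" using swm by (simp add: measurable_cong_sets[OF sets_conc_base refl])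
  define \<eta> where "\<eta> = distr conc_base borel ?sw"
  have fin_\<eta>: "finite_measure \<eta>" unfolding \<eta>_def by (rule finite_measure.finite_measure_distr[OF finite_conc_base sw])
  have fstm: "(\<lambda>p. fst p) \<in> borel_measurable (borel :: (real \<times> (real ^ 3)) measure)"
    by (intro borel_measurable_fst_snd) simp
  have compact: "compact (closure \<Omega>)" using bounded_\<Omega> by simp
  have "{p :: real \<times> (real ^ 3). snd p \<in> closure \<Omega>} = UNIV \<times> closure \<Omega>" by auto
  moreover have "closed (UNIV \<times> closure \<Omega> :: (real \<times> (real ^ 3)) set)" by (intro closed_Times) auto
  ultimately have cl: "{p \<in> space borel. snd (p :: real \<times> (real ^ 3)) \<in> closure \<Omega>} \<in> sets borel" by simp
  have supp: "AE p in \<eta>. snd p \<in> closure \<Omega>"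
    unfolding \<eta>_def
  proof (subst AE_distr_iff[OF sw cl])
    show "AE y in conc_base. snd (?sw y) \<in> closure \<Omega>"
      using AE_conc_base by eventually_elim (auto simp: cylinder_def closure_Times)
  qed
  obtain \<kappa> where \<kappa>: "\<kappa> \<in> borel \<rightarrow>\<^sub>M prob_algebra borel" "decomposes \<eta> (distr \<eta> borel fst) \<kappa> Pair"
    by (rule disintegration[OF fin_\<eta> _ compact supp]) (auto simp: \<eta>_def)
  have tl: "distr \<eta> borel fst = time_law"
    unfolding \<eta>_def time_law_def using fstm by (subst distr_distr[OF _ sw]) (auto simp: o_def)
  define N where "N = density lborel (indicator {0<..<T} :: real \<Rightarrow> ennreal)"
  have finN: "finite_measure N"
    unfolding N_def using T_pos by (intro finite_measureI) (simp add: emeasure_density)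
  interpret N: finite_measure N by fact
  have setsN: "sets N = sets borel" by (simp add: N_def)
  have setsT: "sets time_law = sets borel" by (simp add: time_law_def)
  have ac: "absolutely_continuous N time_law"
    unfolding absolutely_continuous_def
  proof
    fix A assume A: "A \<in> null_sets N"
    then have A': "A \<in> sets borel" by (auto simp: null_sets_def setsN)
    have "emeasure N A = (\<integral>\<^sup>+t. indicator (A \<inter> {0<..<T}) t \<partial>lborel)"
      using A' by (auto simp: N_def emeasure_density indicator_def intro!: nn_integral_cong)
    also have "\<dots> = emeasure lborel (A \<inter> {0<..<T})" using A' by simp
    finally have "emeasure lborel (A \<inter> {0<..<T}) = 0" using A by (simp add: null_sets_def)
    then show "A \<in> null_sets time_law" using time_law_le[OF A'] A' by (auto simp: null_sets_def setsT)
  qed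
  define r where "r = RN_deriv N time_law"
  have r[measurable]: "r \<in> borel_measurable borel"
    using borel_measurable_RN_deriv[of N time_law] by (simp add: r_def measurable_cong_sets[OF setsN refl])
  have dens: "density N r = time_law" unfolding r_def by (rule N.density_RN_deriv[OF ac]) (simp add: setsN setsT)
  have "finite_measure time_law"
    unfolding time_law_def by (rule finite_measure.finite_measure_distr[OF finite_conc_base snd_conc_base])
  then have "AE t in N. r t \<noteq> \<infinity>"
    unfolding r_def by (intro N.RN_deriv_finite[OF _ ac]) (auto simp: setsN setsT finite_measure_def)
  then have "AE t in lborel. t \<in> {0<..<T} \<longrightarrow> r t < \<infinity>"
    unfolding N_def by (subst (asm) AE_density) (auto simp: less_top indicator_def elim!: eventually_mono)
  then have r_fin: "AE t in lebesgue_on {0<..<T}. r t < \<infinity>" by (simp add: AE_lebesgue_on_borel_iff)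
  have sets_\<kappa>: "sets (\<kappa> t) = sets borel" for t
    using sets_kernel[OF measurable_prob_algebraD[OF \<kappa>(1)]] by simp
  have "decomposes conc_base (lebesgue_on {0<..<T}) (\<lambda>t. scale_measure (r t) (\<kappa> t)) (\<lambda>t x. (x, t))"
    unfolding decomposes_def
  proof (intro ballI conjI)
    fix F :: "point \<Rightarrow> ennreal" assume F[measurable]: "F \<in> borel_measurable borel"
    define F' where "F' p = F (snd p, fst p)" for p :: "real \<times> (real ^ 3)"
    have "(\<lambda>p::real \<times> (real ^ 3). (snd p, fst p)) \<in> borel_measurable borel"
      by (intro borel_measurable_Pair borel_measurable_fst_snd) simp_all
    then have F': "F' \<in> borel_measurable borel" unfolding F'_def[abs_def] by (rule measurable_compose[OF _ F])
    have slice_m: "(\<lambda>x. F (x, t)) \<in> borel_measurable (\<kappa> t)" for t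
      using decomposesD(1)[OF \<kappa>(2) F', of t] by (simp add: F'_def)
    show "(\<lambda>x. F (x, t)) \<in> borel_measurable (scale_measure (r t) (\<kappa> t))" for t
      using slice_m by (simp add: measurable_cong_sets[OF sets_scale_measure refl])
    have sc: "(\<integral>\<^sup>+x. F (x, t) \<partial>scale_measure (r t) (\<kappa> t)) = r t * (\<integral>\<^sup>+x. F (x, t) \<partial>\<kappa> t)" for t
      by (rule nn_integral_scale_measure[OF slice_m])
    have m: "(\<lambda>t. \<integral>\<^sup>+x. F (x, t) \<partial>\<kappa> t) \<in> borel_measurable borel"
      using decomposesD(2)[OF \<kappa>(2) F'] by (simp add: F'_def)
    then have m': "(\<lambda>t. r t * (\<integral>\<^sup>+x. F (x, t) \<partial>\<kappa> t)) \<in> borel_measurable borel" by measurable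
    then show "(\<lambda>t. \<integral>\<^sup>+x. F (x, t) \<partial>scale_measure (r t) (\<kappa> t)) \<in> borel_measurable (lebesgue_on {0<..<T})"
      unfolding sc by (rule borel_measurable_lebesgue_on_borel)
    have "(\<integral>\<^sup>+y. F y \<partial>conc_base) = (\<integral>\<^sup>+p. F' p \<partial>\<eta>)"
      unfolding \<eta>_def using F' by (subst nn_integral_distr[OF sw]) (auto simp: F'_def)
    also have "\<dots> = (\<integral>\<^sup>+t. (\<integral>\<^sup>+x. F (x, t) \<partial>\<kappa> t) \<partial>time_law)"
      using decomposesD(3)[OF \<kappa>(2) F'] by (simp add: tl F'_def)
    also have "\<dots> = (\<integral>\<^sup>+t. r t * (\<integral>\<^sup>+x. F (x, t) \<partial>\<kappa> t) \<partial>N)"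
      using m unfolding dens[symmetric] by (subst nn_integral_density) (auto simp: measurable_cong_sets[OF setsN refl])
    also have "\<dots> = (\<integral>\<^sup>+t. indicator {0<..<T} t * (r t * (\<integral>\<^sup>+x. F (x, t) \<partial>\<kappa> t)) \<partial>lborel)"
      unfolding N_def using m' by (subst nn_integral_density) auto
    also have "\<dots> = (\<integral>\<^sup>+t. (\<integral>\<^sup>+x. F (x, t) \<partial>scale_measure (r t) (\<kappa> t)) \<partial>lebesgue_on {0<..<T})"
      by (simp add: nn_integral_lebesgue_on sc mult.commute)
    finally show "(\<integral>\<^sup>+y. F y \<partial>conc_base) = (\<integral>\<^sup>+t. (\<integral>\<^sup>+x. F (x, t) \<partial>scale_measure (r t) (\<kappa> t)) \<partial>lebesgue_on {0<..<T})" .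
  qed
  with r_fin \<kappa>(1) show thesis by (rule that)
qed

end

section \<open>Vanishing integrals and bounds of test functions\<close>

text \<open>The positive and the negative part of \<open>f\<close>, as densities, give finite measures with
  the same integrals of continuous functions; by \<open>finite_measure_eqI_continuous\<close> they
  coincide.\<close>

lemma AE_zero_of_continuous_tests:
  fixes f :: "'a::euclidean_space \<Rightarrow> real"
  assumes S: "S \<in> sets lebesgue" and f: "integrable (lebesgue_on S) f"
    and zero: "\<And>\<psi> :: 'a \<Rightarrow> real. continuous_on UNIV \<psi> \<Longrightarrow> (\<And>x. 0 \<le> \<psi> x) \<Longrightarrow> (\<And>x. \<psi> x \<le> 1) \<Longrightarrow>
      (\<integral>x. \<psi> x * f x \<partial>lebesgue_on S) = 0"
  shows "AE x in lebesgue_on S. f x = 0"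
proof -
  define f0 where "f0 x = indicator S x *\<^sub>R f x" for x
  have f0: "integrable lebesgue f0" using f S by (simp add: integrable_restrict_space f0_def[abs_def])
  then obtain g where g[measurable]: "g \<in> borel_measurable lborel" and fg: "AE x in lborel. f0 x = g x"
    using completion_ex_borel_measurable_real[of f0 lborel] by auto
  have fg': "AE x in lebesgue. f0 x = g x" using fg by (rule AE_completion)
  have g_leb: "g \<in> borel_measurable lebesgue" using g by (rule measurable_completion)
  have f0m: "f0 \<in> borel_measurable lebesgue" using f0 by simp
  have "integrable lebesgue g" by (rule integrable_cong_AE_imp[OF f0 g_leb fg'])
  then have int: "integrable lborel g" by (simp add: integrable_completion)
  have "density lborel (\<lambda>x. ennreal (g x)) = density lborel (\<lambda>x. ennreal (- g x))"
  proof (rule finite_measure_eqI_continuous)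
    have fin: "finite_measure (density lborel (\<lambda>x. ennreal (h x)))" if h: "integrable lborel h" for h :: "'a \<Rightarrow> real"
    proof (rule finite_measureI)
      have "emeasure (density lborel (\<lambda>x. ennreal (h x))) UNIV = (\<integral>\<^sup>+x. ennreal (h x) \<partial>lborel)"
        using h by (subst emeasure_density) auto
      then show "emeasure (density lborel (\<lambda>x. ennreal (h x))) (space (density lborel (\<lambda>x. ennreal (h x)))) \<noteq> \<infinity>"
        using h by (simp add: real_integrable_def)
    qed
    show "finite_measure (density lborel (\<lambda>x. ennreal (g x)))" "finite_measure (density lborel (\<lambda>x. ennreal (- g x)))"
      using fin[OF int] fin[of "\<lambda>x. - g x"] int by simp_all
    fix \<psi> :: "'a \<Rightarrow> real" assume \<psi>: "continuous_on UNIV \<psi>" "\<And>x. 0 \<le> \<psi> x" "\<And>x. \<psi> x \<le> 1"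
    have [measurable]: "\<psi> \<in> borel_measurable borel" by (rule borel_measurable_continuous_onI[OF \<psi>(1)])
    have \<psi>_leb: "\<psi> \<in> borel_measurable lebesgue" by (rule measurable_completion) simp
    have e: "(\<integral>x. \<psi> x \<partial>density lborel (\<lambda>x. ennreal (h x))) = (\<integral>x. max 0 (h x) * \<psi> x \<partial>lborel)"
      if [measurable]: "h \<in> borel_measurable lborel" for h
    proof -
      have "density lborel (\<lambda>x. ennreal (h x)) = density lborel (\<lambda>x. ennreal (max 0 (h x)))"
        by (rule arg_cong[of _ _ "density lborel"]) (auto simp: max_def ennreal_neg)
      then show ?thesis by (simp only:) (subst integral_density; simp)
    qed
    have ip: "integrable lborel (\<lambda>x. max 0 (h x) * \<psi> x)" if h: "integrable lborel h" for h :: "'a \<Rightarrow> real"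
    proof (rule Bochner_Integration.integrable_bound[OF h])
      show "AE x in lborel. norm (max 0 (h x) * \<psi> x) \<le> norm (h x)"
      proof (rule AE_I2)
        fix x
        have "\<bar>max 0 (h x)\<bar> * \<bar>\<psi> x\<bar> \<le> \<bar>h x\<bar> * 1" using \<psi>(2,3)[of x] by (intro mult_mono) auto
        then show "norm (max 0 (h x) * \<psi> x) \<le> norm (h x)" by (simp add: abs_mult)
      qed
    qed (use h in measurable)
    have ineg: "integrable lborel (\<lambda>x. - g x)" using int by simp
    have "(\<integral>x. \<psi> x \<partial>density lborel (\<lambda>x. ennreal (g x))) - (\<integral>x. \<psi> x \<partial>density lborel (\<lambda>x. ennreal (- g x))) =
        (\<integral>x. max 0 (g x) * \<psi> x - max 0 (- g x) * \<psi> x \<partial>lborel)"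
      using ip[OF int] ip[OF ineg] by (simp add: e)
    also have "\<dots> = (\<integral>x. \<psi> x * g x \<partial>lborel)"
      by (intro Bochner_Integration.integral_cong) (auto simp: max_def)
    also have "\<dots> = (\<integral>x. \<psi> x * g x \<partial>lebesgue)" by (rule integral_completion[symmetric]) measurable
    also have "\<dots> = (\<integral>x. \<psi> x * f0 x \<partial>lebesgue)"
    proof (rule integral_cong_AE)
      show "AE x in lebesgue. \<psi> x * g x = \<psi> x * f0 x" using fg' by eventually_elim simp
    qed (use \<psi>_leb g_leb f0m in \<open>auto intro: borel_measurable_times\<close>)
    also have "\<dots> = (\<integral>x. \<psi> x * f x \<partial>lebesgue_on S)"
      using S by (subst integral_restrict_space) (auto simp: f0_def intro!: Bochner_Integration.integral_cong)
    also have "\<dots> = 0" by (rule zero[OF \<psi>])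
    finally show "(\<integral>x. \<psi> x \<partial>density lborel (\<lambda>x. ennreal (g x))) = (\<integral>x. \<psi> x \<partial>density lborel (\<lambda>x. ennreal (- g x)))"
      by simp
  qed simp_all
  then have "AE x in lborel. g x = 0"
    by (intro AE_zero_of_density_eq sigma_finite_lborel) auto
  with fg have "AE x in lborel. x \<in> S \<longrightarrow> f x = 0" by eventually_elim (auto simp: f0_def)
  then show ?thesis by (simp add: AE_lebesgue_on_borel_iff[OF S])
qed

lemma integral_cylinder_zero:
  fixes f :: "point \<Rightarrow> real"
  assumes \<Omega>: "open \<Omega>" and f: "integrable (lebesgue_on (cylinder \<Omega> T)) f"
    and zero: "AE t in lebesgue_on {0<..<T}. (\<integral>x. f (x, t) \<partial>lebesgue_on \<Omega>) = 0"
  shows "(\<integral>y. f y \<partial>lebesgue_on (cylinder \<Omega> T)) = 0"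
proof -
  have fm: "f \<in> borel_measurable (lebesgue_on (cylinder \<Omega> T))" using f by simp
  obtain g where g: "g \<in> borel_measurable borel" and fg: "AE y in lebesgue_on (cylinder \<Omega> T). f y = g y"
    using lebesgue_on_AE_eq_borel[OF sets_cylinder(3)[OF \<Omega>] fm] .
  have gm: "g \<in> borel_measurable (lebesgue_on (cylinder \<Omega> T))" by (rule borel_measurable_lebesgue_on_borel[OF g])
  have ig: "integrable (lebesgue_on (cylinder \<Omega> T)) g" by (rule integrable_cong_AE_imp[OF f gm fg])
  note dec = decomposes_integral[OF decomposes_cylinder[OF \<Omega>] g ig]
  have "AE t in lebesgue_on {0<..<T}. (\<integral>x. g (x, t) \<partial>lebesgue_on \<Omega>) = 0"
    using zero AE_cylinder_slices[OF \<Omega> fg] AE_slices_measurable[OF \<Omega> fm] AE_slices_measurable[OF \<Omega> gm]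
  proof eventually_elim
    case (elim t)
    have "(\<integral>x. g (x, t) \<partial>lebesgue_on \<Omega>) = (\<integral>x. f (x, t) \<partial>lebesgue_on \<Omega>)"
    proof (rule integral_cong_AE)
      show "AE x in lebesgue_on \<Omega>. g (x, t) = f (x, t)" using elim(2) by eventually_elim simp
    qed (use elim(3,4) in \<open>simp_all add: slice_def\<close>)
    then show ?case using elim(1) by simp
  qed
  then have "(\<integral>t. (\<integral>x. g (x, t) \<partial>lebesgue_on \<Omega>) \<partial>lebesgue_on {0<..<T}) = 0" by (rule integral_eq_zero_AE)
  moreover have "(\<integral>y. f y \<partial>lebesgue_on (cylinder \<Omega> T)) = (\<integral>y. g y \<partial>lebesgue_on (cylinder \<Omega> T))"
    by (rule integral_cong_AE[OF fm gm fg])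
  ultimately show ?thesis using dec(4) by simp
qed

lemma test_function_partial_derivative:
  assumes \<phi>: "\<phi> \<in> test_functions \<Omega>"
  shows "continuous_on UNIV (\<lambda>x. frechet_derivative \<phi> (at x) (axis j 1))"
    and "x \<notin> closure {x. \<phi> x \<noteq> 0} \<Longrightarrow> frechet_derivative \<phi> (at x) (axis j 1) = 0"
proof -
  have "Ck_fun (Suc 0) \<phi>" using \<phi> unfolding test_functions_def by blast
  then show "continuous_on UNIV (\<lambda>x. frechet_derivative \<phi> (at x) (axis j 1))"
    by (simp add: axis_in_Basis_iff)
  assume x: "x \<notin> closure {x. \<phi> x \<noteq> 0}"
  have "((\<lambda>_. 0) has_derivative (\<lambda>_. 0)) (at x)" by simp
  then have "(\<phi> has_derivative (\<lambda>_. 0)) (at x)"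
    by (rule has_derivative_transform_within_open[where s="- closure {x. \<phi> x \<noteq> 0}"])
       (use x closure_subset[of "{x. \<phi> x \<noteq> 0}"] in auto)
  from frechet_derivative_at[OF this] show "frechet_derivative \<phi> (at x) (axis j 1) = 0" by metis
qed

lemma test_function_bounded:
  assumes \<phi>: "\<phi> \<in> test_functions \<Omega>"
  obtains B where "\<And>x. \<bar>\<phi> x\<bar> \<le> B" "\<And>x. \<bar>frechet_derivative \<phi> (at x) (axis j 1)\<bar> \<le> B"
proof -
  let ?K = "closure {x. \<phi> x \<noteq> 0}"
  have K: "compact ?K" using \<phi> by (simp add: test_functions_def)
  have bd: "\<exists>B. \<forall>x. \<bar>f x\<bar> \<le> B" if f: "continuous_on UNIV f" "\<And>x. x \<notin> ?K \<Longrightarrow> f x = 0" for f :: "real ^ 3 \<Rightarrow> real"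
  proof -
    obtain B where B: "\<And>x. x \<in> ?K \<Longrightarrow> norm (f x) \<le> B"
      using compact_imp_bounded[OF compact_continuous_image[OF continuous_on_subset[OF f(1) subset_UNIV] K]]
      by (auto simp: bounded_iff)
    have "\<bar>f x\<bar> \<le> max 0 B" for x
    proof (cases "x \<in> ?K")
      case True
      then show ?thesis using B[of x] by simp
    next
      case False
      then show ?thesis using f(2) by simp
    qed
    then show ?thesis by blast
  qed
  have "\<phi> x = 0" if "x \<notin> ?K" for x using that closure_subset[of "{x. \<phi> x \<noteq> 0}"] by auto
  then obtain B1 where B1: "\<And>x. \<bar>\<phi> x\<bar> \<le> B1" using bd[OF test_function_continuous[OF \<phi>]] by blast
  obtain B2 where B2: "\<And>x. \<bar>frechet_derivative \<phi> (at x) (axis j 1)\<bar> \<le> B2"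
    using bd[OF test_function_partial_derivative[OF \<phi>]] by blast
  show thesis
    by (rule that[of "max B1 B2"]) (use B1 B2 in \<open>simp_all add: le_max_iff_disj\<close>)
qed

context young_limit
begin

text \<open>The iterated integrals of the two families represent the part of \<open>\<mu>\<close> at infinite
  gradients. All integrability statements are part of the property, because the integral of a
  non-integrable function is 0.\<close>

definition concentration_part ::
    "(real \<Rightarrow> (real ^ 3) measure) \<Rightarrow> (point \<Rightarrow> ((real ^ 3) \<times> (real ^ 3 ^ 3)) measure) \<Rightarrow> bool" where
  "concentration_part m \<nu> \<longleftrightarrow> (\<forall>g B. g \<in> borel_measurable borel \<longrightarrow> (\<forall>z. \<bar>g z\<bar> \<le> B) \<longrightarrow>
     (AE t in lebesgue_on {0<..<T}. (AE x in m t. integrable (\<nu> (x, t)) (\<lambda>b. g ((x, t), b))) \<and>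
        integrable (m t) (\<lambda>x. \<integral>b. g ((x, t), b) \<partial>\<nu> (x, t))) \<and>
     integrable (lebesgue_on {0<..<T}) (\<lambda>t. \<integral>x. (\<integral>b. g ((x, t), b) \<partial>\<nu> (x, t)) \<partial>m t) \<and>
     (\<integral>t. (\<integral>x. (\<integral>b. g ((x, t), b) \<partial>\<nu> (x, t)) \<partial>m t) \<partial>lebesgue_on {0<..<T}) =
       (\<integral>z. (if norm (snd (snd z)) < 1 then 0 else (g z :: real)) \<partial>\<mu>))"

lemma concentration_partD:
  fixes g :: "point \<times> (real ^ 3) \<times> (real ^ 3 ^ 3) \<Rightarrow> real"
  assumes "concentration_part m \<nu>" "g \<in> borel_measurable borel" "\<And>z. \<bar>g z\<bar> \<le> B"
  shows "AE t in lebesgue_on {0<..<T}. (AE x in m t. integrable (\<nu> (x, t)) (\<lambda>b. g ((x, t), b))) \<and>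
        integrable (m t) (\<lambda>x. \<integral>b. g ((x, t), b) \<partial>\<nu> (x, t))"
    and "integrable (lebesgue_on {0<..<T}) (\<lambda>t. \<integral>x. (\<integral>b. g ((x, t), b) \<partial>\<nu> (x, t)) \<partial>m t)"
    and "(\<integral>t. (\<integral>x. (\<integral>b. g ((x, t), b) \<partial>\<nu> (x, t)) \<partial>m t) \<partial>lebesgue_on {0<..<T}) =
      (\<integral>z. (if norm (snd (snd z)) < 1 then 0 else g z) \<partial>\<mu>)"
  using assms(1)[unfolded concentration_part_def, THEN spec, THEN spec, THEN mp, OF assms(2), THEN mp,
      OF allI[OF assms(3)]] by blast+

text \<open>Disintegrate the concentration first over the position in space-time, which gives the angle
  measures, and then its base over time, which gives the spatial measures \<open>m\<close>. Both
  kernels are restricted to the closed sets that carry them; null sets on which a kernel is not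
  carried by its set, or where the density in time is infinite, are avoided.\<close>

proposition concentration_measure:
  obtains m \<nu> where
    "\<forall>y. sets (\<nu> y) = sets (restrict_space borel (cball 0 1 \<times> sphere 0 1))"
    "AE t in lebesgue_on {0<..<T}. sets (m t) = sets (restrict_space borel (closure \<Omega>)) \<and> finite_measure (m t) \<and>
       (AE x in m t. sets (\<nu> (x, t)) = sets (restrict_space borel (cball 0 1 \<times> sphere 0 1)) \<and> prob_space (\<nu> (x, t)))"
    "concentration_part m \<nu>"
proof -
  let ?B = "cball 0 1 \<times> sphere 0 1 :: ((real ^ 3) \<times> (real ^ 3 ^ 3)) set"
  have closedB: "closed ?B" by (intro closed_Times closed_cball closed_sphere)
  then have B: "?B \<in> sets borel" by simp
  have compact: "compact (cball 0 1 \<times> cball 0 1 :: ((real ^ 3) \<times> (real ^ 3 ^ 3)) set)"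
    by (intro compact_Times compact_cball)
  have "AE z in conc. snd z \<in> cball 0 1 \<times> cball 0 1"
    using AE_conc by eventually_elim (auto simp: mem_Times_iff)
  then obtain \<kappa> where \<kappa>: "\<kappa> \<in> borel \<rightarrow>\<^sub>M prob_algebra borel" "decomposes conc conc_base \<kappa> Pair"
    using disintegration[OF finite_conc sets_conc compact] unfolding conc_base_def by blast
  have sets_\<kappa>: "sets (\<kappa> a) = sets borel" for a
    using sets_kernel[OF measurable_prob_algebraD[OF \<kappa>(1)]] by simp
  have prob_\<kappa>: "prob_space (\<kappa> a)" for a
    using measurable_space[OF \<kappa>(1), of a] by (simp add: space_prob_algebra)
  define \<nu> where "\<nu> y = restrict_space (\<kappa> y) ?B" for y
  have snd_eq: "{z :: point \<times> (real ^ 3) \<times> (real ^ 3 ^ 3). snd z \<in> ?B} \<in> sets borel"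
  proof -
    have "{z :: point \<times> (real ^ 3) \<times> (real ^ 3 ^ 3). snd z \<in> ?B} = UNIV \<times> ?B" by auto
    moreover have "closed (UNIV \<times> ?B :: (point \<times> (real ^ 3) \<times> (real ^ 3 ^ 3)) set)"
      by (rule closed_Times[OF closed_UNIV closedB])
    ultimately show ?thesis by simp
  qed
  have AEB: "AE z in conc. snd z \<in> ?B" using AE_conc by eventually_elim simp
  have dec1: "decomposes conc conc_base \<nu> Pair"
    unfolding \<nu>_def[abs_def] by (rule decomposes_restrict_space[OF \<kappa>(2) sets_\<kappa> B _ snd_eq AEB]) simp
  \<comment> \<open>The Borel set of positions at which restricting the kernel keeps its mass.\<close>
  define PP where "PP = {y. emeasure (\<kappa> y) ?B = 1}"
  have PPs: "PP \<in> sets borel"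
  proof -
    have "(\<lambda>y. emeasure (\<kappa> y) ?B) \<in> borel_measurable borel"
      by (rule measurable_emeasure_kernel[OF measurable_prob_algebraD[OF \<kappa>(1)] B])
    from measurable_sets[OF this, of "{1}"] show ?thesis by (simp add: PP_def vimage_def)
  qed
  have AEP: "AE y in conc_base. y \<in> PP"
    using decomposes_AE[OF \<kappa>(2) snd_eq AEB]
  proof eventually_elim
    case (elim y)
    then have "emeasure (\<kappa> y) ?B = emeasure (\<kappa> y) (space (\<kappa> y))"
      using B by (intro emeasure_eq_AE) (auto simp: sets_\<kappa> sets_eq_imp_space_eq[OF sets_\<kappa>] elim!: eventually_mono)
    then show ?case using prob_space.emeasure_space_1[OF prob_\<kappa>[of y]] by (simp add: PP_def)
  qed
  have prob_\<nu>: "prob_space (\<nu> y)" if "y \<in> PP" for y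
    unfolding \<nu>_def using that B by (intro prob_space_restrict_spaceI prob_\<kappa>) (auto simp: PP_def sets_\<kappa>)
  have sets_\<nu>: "sets (\<nu> y) = sets (restrict_space borel ?B)" for y
    unfolding \<nu>_def by (rule sets_restrict_space_cong[OF sets_\<kappa>])
  obtain r and \<kappa>t :: "real \<Rightarrow> (real ^ 3) measure"
    where r: "AE t in lebesgue_on {0<..<T}. r t < (\<infinity> :: ennreal)" and \<kappa>t: "\<kappa>t \<in> borel \<rightarrow>\<^sub>M prob_algebra borel"
    and dect: "decomposes conc_base (lebesgue_on {0<..<T}) (\<lambda>t. scale_measure (r t) (\<kappa>t t)) (\<lambda>t x. (x, t))"
    by (rule concentration_time_slices)
  have sets_\<kappa>t: "sets (\<kappa>t a) = sets borel" for a
    using sets_kernel[OF measurable_prob_algebraD[OF \<kappa>t]] by simp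
  have prob_\<kappa>t: "prob_space (\<kappa>t a)" for a
    using measurable_space[OF \<kappa>t, of a] by (simp add: space_prob_algebra)
  define m where "m t = restrict_space (scale_measure (r t) (\<kappa>t t)) (closure \<Omega>)" for t
  have sets_m: "sets (m t) = sets (restrict_space borel (closure \<Omega>))" for t
    unfolding m_def by (rule sets_restrict_space_cong) (simp add: sets_\<kappa>t)
  have fst_cl: "{y :: point. fst y \<in> closure \<Omega>} \<in> sets borel"
  proof -
    have "{y :: point. fst y \<in> closure \<Omega>} = closure \<Omega> \<times> UNIV" by auto
    moreover have "closed (closure \<Omega> \<times> UNIV :: point set)" by (intro closed_Times) auto
    ultimately show ?thesis by simp
  qed
  have AEcl: "AE y in conc_base. fst y \<in> closure \<Omega>"
    using AE_conc_base by eventually_elim (auto simp: cylinder_def closure_Times)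
  have dec2: "decomposes conc_base (lebesgue_on {0<..<T}) m (\<lambda>t x. (x, t))"
    unfolding m_def[abs_def]
    by (rule decomposes_restrict_space[OF dect _ _ _ fst_cl AEcl]) (simp_all add: sets_\<kappa>t)
  have "{y. y \<in> PP} \<in> sets borel" using PPs by simp
  from decomposes_AE[OF dec2 this AEP]
  have AEPt: "AE t in lebesgue_on {0<..<T}. AE x in m t. (x, t) \<in> PP" .
  have main: "AE t in lebesgue_on {0<..<T}. sets (m t) = sets (restrict_space borel (closure \<Omega>)) \<and> finite_measure (m t) \<and>
       (AE x in m t. sets (\<nu> (x, t)) = sets (restrict_space borel ?B) \<and> prob_space (\<nu> (x, t)))"
    using r AEPt
  proof eventually_elim
    case (elim t)
    have "finite_measure (m t)"
      unfolding m_def using elim(1) by (intro finite_measure_restrict_scale prob_\<kappa>t) (simp_all add: sets_\<kappa>t)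
    moreover have "AE x in m t. sets (\<nu> (x, t)) = sets (restrict_space borel ?B) \<and> prob_space (\<nu> (x, t))"
      using elim(2) by eventually_elim (simp add: sets_\<nu> prob_\<nu>)
    ultimately show ?case by (simp add: sets_m)
  qed
  have ints: "(AE t in lebesgue_on {0<..<T}. (AE x in m t. integrable (\<nu> (x, t)) (\<lambda>b. g ((x, t), b))) \<and>
        integrable (m t) (\<lambda>x. \<integral>b. g ((x, t), b) \<partial>\<nu> (x, t))) \<and>
      integrable (lebesgue_on {0<..<T}) (\<lambda>t. \<integral>x. (\<integral>b. g ((x, t), b) \<partial>\<nu> (x, t)) \<partial>m t) \<and>
      (\<integral>t. (\<integral>x. (\<integral>b. g ((x, t), b) \<partial>\<nu> (x, t)) \<partial>m t) \<partial>lebesgue_on {0<..<T}) =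
      (\<integral>z. (if norm (snd (snd z)) < 1 then 0 else g z) \<partial>\<mu>)"
    if g: "g \<in> borel_measurable borel" "\<And>z. \<bar>g z\<bar> \<le> B'" for g :: "point \<times> (real ^ 3) \<times> (real ^ 3 ^ 3) \<Rightarrow> real" and B'
  proof -
    have g_conc: "g \<in> borel_measurable conc" using g(1) by (simp add: measurable_cong_sets[OF sets_conc refl])
    have g_\<mu>: "g \<in> borel_measurable \<mu>" using g(1) by (simp add: measurable_cong_sets[OF sets_\<mu> refl])
    have ig: "integrable conc g"
      by (rule finite_measure.integrable_const_bound[OF finite_conc _ g_conc, where B=B']) (use g(2) in auto)
    note d1 = decomposes_integral[OF dec1 g(1) ig]
    define H where "H y = (\<integral>b. g (y, b) \<partial>\<nu> y)" for y
    have H: "H \<in> borel_measurable borel"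
      using d1(3) by (simp add: H_def[abs_def] measurable_cong_sets[OF sets_conc_base refl])
    have iH: "integrable conc_base H" using d1(2) by (simp add: H_def[abs_def])
    note d2 = decomposes_integral[OF dec2 H iH]
    have "AE t in lebesgue_on {0<..<T}. (AE x in m t. integrable (\<nu> (x, t)) (\<lambda>b. g ((x, t), b))) \<and>
        integrable (m t) (\<lambda>x. H (x, t))"
      using d2(1) AEPt
    proof eventually_elim
      case (elim t)
      from elim(2) have "AE x in m t. integrable (\<nu> (x, t)) (\<lambda>b. g ((x, t), b))"
      proof eventually_elim
        case x: (elim x)
        then interpret prob_space "\<nu> (x, t)" by (rule prob_\<nu>)
        show ?case
        proof (rule integrable_const_bound[where B=B'])
          show "(\<lambda>b. g ((x, t), b)) \<in> borel_measurable (\<nu> (x, t))"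
            by (rule decomposes_measurable[OF dec1 g(1)]) simp
        qed (use g(2) in auto)
      qed
      with elim(1) show ?case by simp
    qed
    moreover have "(\<integral>y. H y \<partial>conc_base) = (\<integral>z. (if norm (snd (snd z)) < 1 then 0 else g z) \<partial>\<mu>)"
    proof -
      have "conc = density \<mu> (\<lambda>z. ennreal (if norm (snd (snd z)) < 1 then 0 else 1))"
        unfolding conc_def by (rule arg_cong[of _ _ "density \<mu>"]) auto
      then have "(\<integral>z. g z \<partial>conc) = (\<integral>z. (if norm (snd (snd z)) < 1 then 0 else 1) *\<^sub>R g z \<partial>\<mu>)"
        using g_\<mu> by (simp add: integral_density)
      also have "\<dots> = (\<integral>z. (if norm (snd (snd z)) < 1 then 0 else g z) \<partial>\<mu>)"
        by (intro Bochner_Integration.integral_cong) auto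
      finally show ?thesis using d1(4) by (simp add: H_def[abs_def])
    qed
    ultimately show ?thesis using d2(2,4) by (simp add: H_def)
  qed
  have "concentration_part m \<nu>"
    unfolding concentration_part_def by (intro allI impI) (rule ints, simp, blast)
  moreover have "\<forall>y. sets (\<nu> y) = sets (restrict_space borel ?B)" using sets_\<nu> by blast
  ultimately show thesis using main by (intro that)
qed

text \<open>A function linear in the state and in the gradient grows strictly slower than the weight. Its ball
  representation is continuous and vanishes on the sphere of gradients, so it does not see the
  concentration. This is why the barycenter of the oscillation measure alone is the limit
  gradient.\<close>

lemma linear_limit:
  fixes \<alpha> \<beta> :: "point \<Rightarrow> real" and a :: "real ^ 3" and b :: "real ^ 3 ^ 3"
  assumes \<alpha>: "continuous_on UNIV \<alpha>" "\<And>y. \<bar>\<alpha> y\<bar> \<le> B" and \<beta>: "continuous_on UNIV \<beta>" "\<And>y. \<bar>\<beta> y\<bar> \<le> B"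
    and osc: "oscillation_part \<omega>"
  shows "integrable \<omega> (\<lambda>p. \<alpha> (fst p) * (d (fst p) \<bullet> a) + \<beta> (fst p) * (snd p \<bullet> b))"
    and "(\<lambda>n. \<integral>y. \<alpha> y * (u n y \<bullet> a) + \<beta> y * (G n y \<bullet> b) \<partial>leb_Q) \<longlonglongrightarrow>
      (\<integral>p. \<alpha> (fst p) * (d (fst p) \<bullet> a) + \<beta> (fst p) * (snd p \<bullet> b) \<partial>\<omega>)"
proof -
  \<comment> \<open>Since \<open>into_ball h = h / sqrt (1 + |h|\<^sup>2)\<close>, the square root turns this into
    \<open>(h \<bullet> a) / (1 + |h|\<^sup>2)\<close>; the truncations by \<open>max 0\<close>
    make \<open>g\<close> continuous and bounded everywhere and 0 beyond the ball.\<close>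
  define g where "g z = \<alpha> (fst z) * (fst (snd z) \<bullet> a * sqrt (max 0 (1 - (norm (fst (snd z)))\<^sup>2))) * max 0 (1 - (norm (snd (snd z)))\<^sup>2)
    + \<beta> (fst z) * (snd (snd z) \<bullet> b * sqrt (max 0 (1 - (norm (snd (snd z)))\<^sup>2))) * max 0 (1 - (norm (fst (snd z)))\<^sup>2)"
    for z :: "point \<times> (real ^ 3) \<times> (real ^ 3 ^ 3)"
  have B0: "0 \<le> B" using order_trans[OF abs_ge_zero \<alpha>(2)] .
  have inner_bd: "\<bar>h \<bullet> c * sqrt (max 0 (1 - (norm h)\<^sup>2))\<bar> \<le> norm c" for h c :: "'v::euclidean_space"
  proof (cases "norm h < 1")
    case True
    have "\<bar>h \<bullet> c\<bar> \<le> norm h * norm c" by (rule Cauchy_Schwarz_ineq2)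
    also have "\<dots> \<le> 1 * norm c" using True by (intro mult_right_mono) auto
    finally have "\<bar>h \<bullet> c\<bar> * sqrt (max 0 (1 - (norm h)\<^sup>2)) \<le> norm c * 1"
      by (intro mult_mono) auto
    then show ?thesis by (simp add: abs_mult)
  next
    case False
    then have "1 \<le> (norm h)\<^sup>2" by (simp add: one_le_power)
    then show ?thesis by simp
  qed
  have max_bd: "\<bar>max 0 (1 - (norm h)\<^sup>2)\<bar> \<le> 1" for h :: "'v::euclidean_space" by simp
  have g_bd: "\<bar>g z\<bar> \<le> B * norm a * 1 + B * norm b * 1" for z
    unfolding g_def
    by (rule order_trans[OF abs_triangle_ineq], unfold abs_mult[of "_ * (_ * _)"] abs_mult[of "\<alpha> _"] abs_mult[of "\<beta> _"])
       (intro add_mono mult_mono \<alpha>(2) \<beta>(2) inner_bd max_bd B0 mult_nonneg_nonneg; simp)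
  have c1: "continuous_on UNIV (\<lambda>z::point \<times> (real ^ 3) \<times> (real ^ 3 ^ 3). \<alpha> (fst z))"
    by (rule continuous_on_compose2[OF \<alpha>(1)]) (auto intro!: continuous_intros)
  have c2: "continuous_on UNIV (\<lambda>z::point \<times> (real ^ 3) \<times> (real ^ 3 ^ 3). \<beta> (fst z))"
    by (rule continuous_on_compose2[OF \<beta>(1)]) (auto intro!: continuous_intros)
  have g_cont: "continuous_on UNIV g"
    unfolding g_def[abs_def] by (intro continuous_intros c1 c2)
  have g_meas: "g \<in> borel_measurable borel" by (rule borel_measurable_continuous_onI[OF g_cont])
  have sq: "sqrt (1 / (1 + s\<^sup>2)) = 1 / sqrt (1 + s\<^sup>2)" "sqrt (1 + s\<^sup>2) * sqrt (1 + s\<^sup>2) = 1 + s\<^sup>2" for s :: real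
    by (simp_all add: real_sqrt_divide)
  have key: "g (y, into_ball h, into_ball S) * ((1 + (norm h)\<^sup>2) * (1 + (norm S)\<^sup>2)) = \<alpha> y * (h \<bullet> a) + \<beta> y * (S \<bullet> b)" for y h S
  proof -
    define p q where "p = 1 + (norm h)\<^sup>2" and "q = 1 + (norm S)\<^sup>2"
    have pq: "p > 0" "q > 0" by (simp_all add: p_def q_def add_pos_nonneg)
    have inner1: "into_ball h \<bullet> a * sqrt (max 0 (1 / p)) = (h \<bullet> a) / p" "into_ball S \<bullet> b * sqrt (max 0 (1 / q)) = (S \<bullet> b) / q"
      using pq by (simp_all add: into_ball_def p_def[symmetric] q_def[symmetric] real_sqrt_divide divide_inverse mult.assoc
          real_sqrt_inverse[symmetric] flip: real_sqrt_mult)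
    have "g (y, into_ball h, into_ball S) = \<alpha> y * ((h \<bullet> a) / p) * (1 / q) + \<beta> y * ((S \<bullet> b) / q) * (1 / p)"
      unfolding g_def fst_conv snd_conv one_minus_norm_into_ball p_def[symmetric] q_def[symmetric] inner1
      using pq by simp
    then show ?thesis using pq by (simp add: p_def[symmetric] q_def[symmetric] field_simps)
  qed
  have lift_eq: "lifted g = (\<lambda>p. \<alpha> (fst p) * (d (fst p) \<bullet> a) + \<beta> (fst p) * (snd p \<bullet> b))"
    by (auto simp: lifted_def key)
  show "integrable \<omega> (\<lambda>p. \<alpha> (fst p) * (d (fst p) \<bullet> a) + \<beta> (fst p) * (snd p \<bullet> b))"
    using oscillation_partD(1)[OF osc g_meas g_bd] by (simp only: lift_eq)
  have "(\<lambda>z. if norm (snd (snd z)) < 1 then g z else 0) = g"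
  proof
    fix z
    show "(if norm (snd (snd z)) < 1 then g z else 0) = g z"
    proof (cases "norm (snd (snd z)) < 1")
      case False
      then have "1 \<le> (norm (snd (snd z)))\<^sup>2" by (simp add: one_le_power)
      then show ?thesis using False by (simp add: g_def)
    qed simp
  qed
  then have "(\<integral>p. lifted g p \<partial>\<omega>) = (\<integral>z. g z \<partial>\<mu>)" using oscillation_partD(2)[OF osc g_meas g_bd] by simp
  then show "(\<lambda>n. \<integral>y. \<alpha> y * (u n y \<bullet> a) + \<beta> y * (G n y \<bullet> b) \<partial>leb_Q) \<longlonglongrightarrow>
      (\<integral>p. \<alpha> (fst p) * (d (fst p) \<bullet> a) + \<beta> (fst p) * (snd p \<bullet> b) \<partial>\<omega>)"
    using \<mu>_lim[OF g_cont g_bd] by (simp only: key lift_eq)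
qed

end

section \<open>The gradient of the limit\<close>

lemma integrable_lebesgue_on_subset:
  fixes f :: "'a::euclidean_space \<Rightarrow> 'b::{banach, second_countable_topology}"
  assumes "integrable (lebesgue_on S) f" "K \<subseteq> S" "K \<in> sets lebesgue" "S \<in> sets lebesgue"
  shows "integrable (lebesgue_on K) f"
proof -
  have "integrable lebesgue (\<lambda>x. indicator S x *\<^sub>R f x)"
    using assms by (simp add: integrable_restrict_space)
  then have "integrable lebesgue (\<lambda>x. indicator K x *\<^sub>R (indicator S x *\<^sub>R f x))"
    by (rule integrable_mult_indicator[OF assms(3)])
  also have "(\<lambda>x. indicator K x *\<^sub>R (indicator S x *\<^sub>R f x)) = (\<lambda>x. indicator K x *\<^sub>R f x)"
    using assms(2) by (auto simp: fun_eq_iff indicator_def)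
  finally show ?thesis using assms(3) by (simp add: integrable_restrict_space)
qed

lemma integrable_euclidean_components:
  fixes f :: "'a \<Rightarrow> 'b::euclidean_space"
  assumes "\<And>b. b \<in> Basis \<Longrightarrow> integrable M (\<lambda>x. f x \<bullet> b)"
  shows "integrable M f"
proof -
  have "integrable M (\<lambda>x. \<Sum>b\<in>Basis. (f x \<bullet> b) *\<^sub>R b)"
    using assms by (intro Bochner_Integration.integrable_sum integrable_scaleR_left) auto
  then show ?thesis by (simp add: euclidean_representation)
qed

lemma integrable_bounded_continuous_mult:
  fixes \<alpha> f :: "'a::euclidean_space \<Rightarrow> real"
  assumes \<alpha>: "continuous_on UNIV \<alpha>" "\<And>x. \<bar>\<alpha> x\<bar> \<le> B" and f: "integrable (lebesgue_on S) f"
  shows "integrable (lebesgue_on S) (\<lambda>x. \<alpha> x * f x)"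
proof (rule Bochner_Integration.integrable_bound)
  show "integrable (lebesgue_on S) (\<lambda>x. B * f x)" using f by simp
  have "\<alpha> \<in> borel_measurable (lebesgue_on S)"
    by (intro borel_measurable_lebesgue_on_borel borel_measurable_continuous_onI \<alpha>(1))
  then show "(\<lambda>x. \<alpha> x * f x) \<in> borel_measurable (lebesgue_on S)" using f by simp
  show "AE x in lebesgue_on S. norm (\<alpha> x * f x) \<le> norm (B * f x)"
  proof (rule AE_I2)
    fix x
    have "\<bar>\<alpha> x\<bar> \<le> \<bar>B\<bar>" using \<alpha>(2)[of x] by linarith
    then show "norm (\<alpha> x * f x) \<le> norm (B * f x)" by (simp add: abs_mult mult_right_mono)
  qed
qed

context young_limit
begin

lemma le_one_plus_square: "s \<le> 1 + s\<^sup>2" for s :: real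
proof -
  have "0 \<le> (s - 1)\<^sup>2" by simp
  then have "2 * s \<le> 1 + s\<^sup>2" by (simp add: power2_diff)
  moreover have "0 \<le> s\<^sup>2" by simp
  ultimately show ?thesis by linarith
qed

lemma norm_le_weight: "norm (u n y) \<le> weight n y" "norm (G n y) \<le> weight n y"
proof -
  have "norm (u n y) * 1 \<le> weight n y" "1 * norm (G n y) \<le> weight n y"
    by (intro mult_mono le_one_plus_square; simp)+
  then show "norm (u n y) \<le> weight n y" "norm (G n y) \<le> weight n y" by simp_all
qed

text \<open>Integration by parts for \<open>u n\<close> and \<open>G n\<close>, tested with \<open>\<psi>(t)
  \<phi>(x)\<close>, involves only linear functions of both, so by \<open>linear_limit\<close> it
  passes to the limit and holds for \<open>d\<close> and the barycenter of the oscillation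
  measure. Since \<open>\<psi>\<close> is arbitrary, it holds for almost every time with an
  exceptional set depending on \<open>\<phi>\<close>. A countable family of test functions, dense
  in the \<open>C\<^sup>1\<close> norm, removes this dependence.\<close>

lemma limit_weak_gradient:
  fixes \<nu> :: "point \<Rightarrow> (real ^ 3 ^ 3) measure"
  assumes \<nu>: "\<nu> \<in> borel \<rightarrow>\<^sub>M prob_algebra borel" and dec: "decomposes \<omega> leb_Q \<nu> Pair"
    and osc: "oscillation_part \<omega>"
    and wg: "\<And>n. AE t in lebesgue_on {0<..<T}. weak_gradient \<Omega> (slice (u n) t) (slice (G n) t)"
  shows "AE y in leb_Q. integrable (\<nu> y) (\<lambda>S. S)"
    and "spatial_gradient \<Omega> T d (\<lambda>y. \<integral>S. S \<partial>\<nu> y)"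
proof -
  define Dd where "Dd y = (\<integral>S. S \<partial>\<nu> y)" for y
  have prob_\<nu>: "prob_space (\<nu> y)" for y
    using measurable_space[OF \<nu>, of y] by (simp add: space_prob_algebra)
  have fs: "(\<lambda>p. fst p) \<in> borel_measurable (borel :: (point \<times> (real ^ 3 ^ 3)) measure)"
    "(\<lambda>p. snd p) \<in> borel_measurable (borel :: (point \<times> (real ^ 3 ^ 3)) measure)"
    by (intro borel_measurable_fst_snd measurable_ident_sets refl)+
  have dfst: "(\<lambda>p. d (fst p)) \<in> borel_measurable (borel :: (point \<times> (real ^ 3 ^ 3)) measure)"
    by (rule measurable_compose[OF fs(1) d_meas])
  have Dd[measurable]: "Dd \<in> borel_measurable borel"
    unfolding Dd_def[abs_def]
    by (rule measurable_compose[OF measurable_prob_algebraD[OF \<nu>] integral_measurable_subprob_algebra]) simp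
  note d_meas[measurable]
  have ib: "integrable \<omega> (\<lambda>p. snd p \<bullet> b)" for b
    using linear_limit(1)[where \<alpha>="\<lambda>_. 0" and B=1 and \<beta>="\<lambda>_. 1" and a=0 and b=b, OF _ _ _ _ osc] by simp
  have AEb: "AE y in leb_Q. integrable (\<nu> y) (\<lambda>S. S \<bullet> b)" and iqb: "integrable leb_Q (\<lambda>y. \<integral>S. S \<bullet> b \<partial>\<nu> y)" for b
  proof -
    have m: "(\<lambda>p. snd p \<bullet> b) \<in> borel_measurable (borel :: (point \<times> (real ^ 3 ^ 3)) measure)"
      using fs by measurable
    show "AE y in leb_Q. integrable (\<nu> y) (\<lambda>S. S \<bullet> b)" "integrable leb_Q (\<lambda>y. \<integral>S. S \<bullet> b \<partial>\<nu> y)"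
      using decomposes_integral[OF dec m ib] by simp_all
  qed
  have "AE y in leb_Q. \<forall>b\<in>Basis. integrable (\<nu> y) (\<lambda>S. S \<bullet> b)"
    by (rule AE_finite_allI[OF finite_Basis AEb])
  then show AEint: "AE y in leb_Q. integrable (\<nu> y) (\<lambda>S. S)"
    by eventually_elim (rule integrable_euclidean_components, blast)
  have Dd_inner: "AE y in leb_Q. \<forall>b. Dd y \<bullet> b = (\<integral>S. S \<bullet> b \<partial>\<nu> y)"
    using AEint by eventually_elim (simp add: Dd_def)
  have iDd: "integrable leb_Q (\<lambda>y. Dd y \<bullet> b)" for b
  proof (rule integrable_cong_AE_imp[OF iqb[of b]])
    show "(\<lambda>y. Dd y \<bullet> b) \<in> borel_measurable leb_Q"
      by (rule borel_measurable_lebesgue_on_borel) measurable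
    show "AE y in leb_Q. (\<integral>S. S \<bullet> b \<partial>\<nu> y) = Dd y \<bullet> b" using Dd_inner by eventually_elim simp
  qed
  have id: "integrable leb_Q (\<lambda>y. d y \<bullet> a)" for a
  proof (rule Bochner_Integration.integrable_bound)
    show "integrable leb_Q (\<lambda>y. norm a * (1 + (norm (d y))\<^sup>2))"
      by (intro integrable_mult_right Bochner_Integration.integrable_add d_int finite_measure.integrable_const[OF finite_leb_Q])
    show "AE y in leb_Q. norm (d y \<bullet> a) \<le> norm (norm a * (1 + (norm (d y))\<^sup>2))"
    proof (rule AE_I2)
      fix y
      have "\<bar>d y \<bullet> a\<bar> \<le> norm (d y) * norm a" by (rule Cauchy_Schwarz_ineq2)
      also have "\<dots> \<le> (1 + (norm (d y))\<^sup>2) * norm a" by (intro mult_right_mono le_one_plus_square) simp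
      finally show "norm (d y \<bullet> a) \<le> norm (norm a * (1 + (norm (d y))\<^sup>2))" by (simp add: mult.commute)
    qed
  qed measurable
  \<comment> \<open>The integrand of the weak formulation, with both terms on one side.\<close>
  define F where "F \<phi> i j y = frechet_derivative \<phi> (at (fst y)) (axis j 1) * (d y \<bullet> axis i 1) + \<phi> (fst y) * (Dd y \<bullet> axis i (axis j 1))"
    for \<phi> :: "real ^ 3 \<Rightarrow> real" and i j :: 3 and y :: point
  have zero_t: "AE t in lebesgue_on {0<..<T}. (\<integral>x. F \<phi> i j (x, t) \<partial>lebesgue_on \<Omega>) = 0"
    if \<phi>: "\<phi> \<in> test_functions \<Omega>" for \<phi> i j
  proof -
    obtain B where B: "\<And>x. \<bar>\<phi> x\<bar> \<le> B" "\<And>x. \<bar>frechet_derivative \<phi> (at x) (axis j 1)\<bar> \<le> B"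
      by (rule test_function_bounded[OF \<phi>, of j]) (rule that)
    have B0: "0 \<le> B" using order_trans[OF abs_ge_zero B(1)] .
    let ?a = "axis i 1 :: real ^ 3" and ?b = "axis i (axis j 1) :: real ^ 3 ^ 3"
    have c\<phi>: "continuous_on UNIV (\<lambda>y::point. \<phi> (fst y))"
      by (rule continuous_on_compose2[OF test_function_continuous[OF \<phi>]]) (auto intro!: continuous_intros)
    have cD: "continuous_on UNIV (\<lambda>y::point. frechet_derivative \<phi> (at (fst y)) (axis j 1))"
      by (rule continuous_on_compose2[OF test_function_partial_derivative(1)[OF \<phi>]]) (auto intro!: continuous_intros)
    have [measurable]: "(\<lambda>y::point. \<phi> (fst y)) \<in> borel_measurable borel" 
      "(\<lambda>y::point. frechet_derivative \<phi> (at (fst y)) (axis j 1)) \<in> borel_measurable borel"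
      by (rule borel_measurable_continuous_onI[OF c\<phi>], rule borel_measurable_continuous_onI[OF cD])
    have F_meas[measurable]: "F \<phi> i j \<in> borel_measurable borel" unfolding F_def[abs_def] by measurable
    have iF: "integrable leb_Q (F \<phi> i j)"
      unfolding F_def[abs_def]
      by (intro Bochner_Integration.integrable_add integrable_bounded_continuous_mult[OF cD B(2)]
          integrable_bounded_continuous_mult[OF c\<phi> B(1)] id iDd)
    have test: "(\<integral>y. \<psi> (snd y) * F \<phi> i j y \<partial>leb_Q) = 0 \<and> integrable leb_Q (\<lambda>y. \<psi> (snd y) * F \<phi> i j y)"
      if \<psi>: "continuous_on UNIV \<psi>" "\<And>t. 0 \<le> \<psi> t" "\<And>t. \<psi> t \<le> 1" for \<psi> :: "real \<Rightarrow> real"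
    proof -
      let ?\<alpha> = "\<lambda>y::point. \<psi> (snd y) * frechet_derivative \<phi> (at (fst y)) (axis j 1)"
      let ?\<beta> = "\<lambda>y::point. \<psi> (snd y) * \<phi> (fst y)"
      have c\<psi>: "continuous_on UNIV (\<lambda>y::point. \<psi> (snd y))"
        by (rule continuous_on_compose2[OF \<psi>(1)]) (auto intro!: continuous_intros)
      have [measurable]: "(\<lambda>y::point. \<psi> (snd y)) \<in> borel_measurable borel"
        by (rule borel_measurable_continuous_onI[OF c\<psi>])
      have bd: "\<bar>\<psi> t * s\<bar> \<le> B" if "\<bar>s\<bar> \<le> B" for t s
      proof -
        have "\<bar>\<psi> t\<bar> * \<bar>s\<bar> \<le> 1 * B" using that \<psi>(2,3)[of t] by (intro mult_mono) auto
        then show ?thesis by (simp add: abs_mult)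
      qed
      have c\<alpha>: "continuous_on UNIV ?\<alpha>" and c\<beta>: "continuous_on UNIV ?\<beta>"
        by (intro continuous_on_mult c\<psi> cD c\<phi>)+
      have b\<alpha>: "\<bar>?\<alpha> y\<bar> \<le> B" and b\<beta>: "\<bar>?\<beta> y\<bar> \<le> B" for y by (intro bd B)+
      note L = linear_limit[where \<alpha>="?\<alpha>" and B=B and \<beta>="?\<beta>" and a="?a" and b="?b",
          OF c\<alpha> b\<alpha> c\<beta> b\<beta> osc]
      let ?H = "\<lambda>p::point \<times> (real ^ 3 ^ 3). ?\<alpha> (fst p) * (d (fst p) \<bullet> ?a) + ?\<beta> (fst p) * (snd p \<bullet> ?b)"
      have [measurable]: "(\<lambda>p::point \<times> (real ^ 3 ^ 3). ?\<alpha> (fst p)) \<in> borel_measurable borel"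
        "(\<lambda>p::point \<times> (real ^ 3 ^ 3). ?\<beta> (fst p)) \<in> borel_measurable borel"
        by (rule measurable_compose[OF fs(1) borel_measurable_continuous_onI[OF c\<alpha>]],
            rule measurable_compose[OF fs(1) borel_measurable_continuous_onI[OF c\<beta>]])
      have mH: "?H \<in> borel_measurable borel" using fs(2) dfst by measurable
      have eqH: "AE y in leb_Q. (\<integral>S. ?H (y, S) \<partial>\<nu> y) = \<psi> (snd y) * F \<phi> i j y"
        using AEb[of ?b] Dd_inner
      proof eventually_elim
        case (elim y)
        interpret prob_space "\<nu> y" by (rule prob_\<nu>)
        show ?case using elim prob_space by (simp add: F_def algebra_simps)
      qed
      note dH = decomposes_integral[OF dec mH L(1)]
      have mF: "(\<lambda>y. \<psi> (snd y) * F \<phi> i j y) \<in> borel_measurable leb_Q"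
        by (rule borel_measurable_lebesgue_on_borel) measurable
      have int: "integrable leb_Q (\<lambda>y. \<psi> (snd y) * F \<phi> i j y)"
        by (rule integrable_cong_AE_imp[OF dH(2) mF eqH])
      have eq: "(\<integral>p. ?H p \<partial>\<omega>) = (\<integral>y. \<psi> (snd y) * F \<phi> i j y \<partial>leb_Q)"
        unfolding dH(4) by (rule integral_cong_AE[OF dH(3) mF eqH])
      have "(\<integral>y. ?\<alpha> y * (u n y \<bullet> ?a) + ?\<beta> y * (G n y \<bullet> ?b) \<partial>leb_Q) = 0" for n
      proof (rule integral_cylinder_zero[OF open_\<Omega>])
        have [measurable]: "?\<alpha> \<in> borel_measurable leb_Q" "?\<beta> \<in> borel_measurable leb_Q"
          by (intro borel_measurable_lebesgue_on_borel borel_measurable_continuous_onI c\<alpha> c\<beta>)+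
        show "integrable leb_Q (\<lambda>y. ?\<alpha> y * (u n y \<bullet> ?a) + ?\<beta> y * (G n y \<bullet> ?b))"
        proof (rule weight_bounded_integrable[where B="2 * B" and n=n])
          fix y
          have "\<bar>u n y \<bullet> ?a\<bar> \<le> weight n y"
            using Finite_Cartesian_Product.norm_nth_le[of "u n y" i] norm_le_weight(1)[of n y] by (simp add: inner_axis)
          moreover have "\<bar>G n y \<bullet> ?b\<bar> \<le> weight n y"
            using Finite_Cartesian_Product.norm_nth_le[of "G n y" i] Finite_Cartesian_Product.norm_nth_le[of "G n y $ i" j]
              norm_le_weight(2)[of n y] by (simp add: inner_axis)
          ultimately have "\<bar>?\<alpha> y\<bar> * \<bar>u n y \<bullet> ?a\<bar> \<le> B * weight n y" "\<bar>?\<beta> y\<bar> * \<bar>G n y \<bullet> ?b\<bar> \<le> B * weight n y"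
            by (intro mult_mono b\<alpha> b\<beta> B0; simp)+
          then show "\<bar>?\<alpha> y * (u n y \<bullet> ?a) + ?\<beta> y * (G n y \<bullet> ?b)\<bar> \<le> 2 * B * weight n y"
            unfolding abs_mult[symmetric] using abs_triangle_ineq[of "?\<alpha> y * (u n y \<bullet> ?a)" "?\<beta> y * (G n y \<bullet> ?b)"]
            by linarith
        qed measurable
        show "AE t in lebesgue_on {0<..<T}. (\<integral>x. ?\<alpha> (x, t) * (u n (x, t) \<bullet> ?a) + ?\<beta> (x, t) * (G n (x, t) \<bullet> ?b) \<partial>lebesgue_on \<Omega>) = 0"
          using wg[of n]
        proof eventually_elim
          case (elim t)
          let ?K = "closure {x. \<phi> x \<noteq> 0}"
          have K: "compact ?K" "?K \<subseteq> \<Omega>" using \<phi> by (auto simp: test_functions_def)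
          have out: "\<phi> x = 0" if "x \<notin> ?K" for x using that closure_subset[of "{x. \<phi> x \<noteq> 0}"] by auto
          have sK: "integrable (lebesgue_on ?K) (slice (u n) t)" "integrable (lebesgue_on ?K) (slice (G n) t)"
            using elim K by (auto simp: weak_gradient_def locally_integrable_def)
          have iK: "integrable (lebesgue_on ?K) (\<lambda>x. slice (u n) t x $ i)" "integrable (lebesgue_on ?K) (\<lambda>x. slice (G n) t x $ i $ j)"
            by (rule integrable_bounded_linear[OF bounded_linear_vec_nth sK(1)],
                rule integrable_matrix_entry[OF sK(2)])
          have i1: "integrable (lebesgue_on \<Omega>) (\<lambda>x. slice (u n) t x $ i * frechet_derivative \<phi> (at x) (axis j 1))"
            by (rule compact_support_integrable[OF K open_\<Omega> iK(1) test_function_partial_derivative(1)[OF \<phi>] test_function_partial_derivative(2)[OF \<phi>]])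
          have i2: "integrable (lebesgue_on \<Omega>) (\<lambda>x. slice (G n) t x $ i $ j * \<phi> x)"
            by (rule compact_support_integrable[OF K open_\<Omega> iK(2) test_function_continuous[OF \<phi>] out])
          have "(\<integral>x. slice (u n) t x $ i * frechet_derivative \<phi> (at x) (axis j 1) \<partial>lebesgue_on \<Omega>) =
              - (\<integral>x. slice (G n) t x $ i $ j * \<phi> x \<partial>lebesgue_on \<Omega>)"
            using elim \<phi> unfolding weak_gradient_def by simp
          then have "(\<integral>x. slice (u n) t x $ i * frechet_derivative \<phi> (at x) (axis j 1) + slice (G n) t x $ i $ j * \<phi> x \<partial>lebesgue_on \<Omega>) = 0"
            using i1 i2 by simp
          then have "(\<integral>x. \<psi> t * (slice (u n) t x $ i * frechet_derivative \<phi> (at x) (axis j 1) + slice (G n) t x $ i $ j * \<phi> x) \<partial>lebesgue_on \<Omega>) = 0"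
            by simp
          moreover have "\<psi> t * (slice (u n) t x $ i * frechet_derivative \<phi> (at x) (axis j 1) + slice (G n) t x $ i $ j * \<phi> x) =
              ?\<alpha> (x, t) * (u n (x, t) \<bullet> ?a) + ?\<beta> (x, t) * (G n (x, t) \<bullet> ?b)" for x
            by (simp add: slice_def inner_axis algebra_simps)
          ultimately show ?case by (simp only:)
        qed
      qed
      then have "(\<integral>p. ?H p \<partial>\<omega>) = 0" using L(2) by (simp add: LIMSEQ_const_iff)
      then show ?thesis using eq int by simp
    qed
    note dF = decomposes_integral[OF decomposes_cylinder[OF open_\<Omega>] F_meas iF]
    show ?thesis
    proof (rule AE_zero_of_continuous_tests[OF _ dF(2)])
      fix \<psi> :: "real \<Rightarrow> real" assume \<psi>: "continuous_on UNIV \<psi>" "\<And>t. 0 \<le> \<psi> t" "\<And>t. \<psi> t \<le> 1"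
      have "continuous_on UNIV (\<lambda>y::point. \<psi> (snd y))"
        by (rule continuous_on_compose2[OF \<psi>(1)]) (auto intro!: continuous_intros)
      then have [measurable]: "(\<lambda>y::point. \<psi> (snd y)) \<in> borel_measurable borel"
        by (rule borel_measurable_continuous_onI)
      have m: "(\<lambda>y. \<psi> (snd y) * F \<phi> i j y) \<in> borel_measurable borel" by measurable
      note t = test[OF \<psi>]
      from decomposes_integral(4)[OF decomposes_cylinder[OF open_\<Omega>] m conjunct2[OF t]] conjunct1[OF t]
      show "(\<integral>t. \<psi> t * (\<integral>x. F \<phi> i j (x, t) \<partial>lebesgue_on \<Omega>) \<partial>lebesgue_on {0<..<T}) = 0" by simp
    qed simp
  qed
  \<comment> \<open>Uniform closeness of these jets is closeness in the \<open>C\<^sup>1\<close> norm.\<close>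
  define e where "e \<phi> x = (\<phi> x, \<chi> j. frechet_derivative \<phi> (at x) (axis j 1))" for \<phi> :: "real ^ 3 \<Rightarrow> real" and x
  have e_cont: "continuous_on (closure \<Omega>) (e \<phi>)" if \<phi>: "\<phi> \<in> test_functions \<Omega>" for \<phi>
  proof -
    have "continuous_on UNIV (e \<phi>)"
      unfolding e_def[abs_def]
      by (intro continuous_on_Pair continuous_on_vec_lambda test_function_continuous[OF \<phi>] test_function_partial_derivative(1)[OF \<phi>])
    then show ?thesis by (rule continuous_on_subset) simp
  qed
  have "compact (closure \<Omega>)" using bounded_\<Omega> by simp
  then obtain \<D> where D: "countable \<D>" "\<D> \<subseteq> test_functions \<Omega>"
    "\<And>\<phi> \<epsilon>. \<phi> \<in> test_functions \<Omega> \<Longrightarrow> \<epsilon> > 0 \<Longrightarrow> \<exists>\<phi>'\<in>\<D>. \<forall>x\<in>closure \<Omega>. dist (e \<phi> x) (e \<phi>' x) < \<epsilon>"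
    using countable_uniformly_dense[of "closure \<Omega>" "test_functions \<Omega>" e] e_cont by metis
  have "AE t in lebesgue_on {0<..<T}. \<forall>\<phi>\<in>\<D>. \<forall>i j. (\<integral>x. F \<phi> i j (x, t) \<partial>lebesgue_on \<Omega>) = 0"
    using D(1,2) zero_t by (subst AE_ball_countable) (auto simp: AE_all_countable)
  moreover have "AE t in lebesgue_on {0<..<T}. \<forall>a\<in>Basis. integrable (lebesgue_on \<Omega>) (\<lambda>x. d (x, t) \<bullet> a)"
  proof (rule AE_finite_allI[OF finite_Basis])
    show "AE t in lebesgue_on {0<..<T}. integrable (lebesgue_on \<Omega>) (\<lambda>x. d (x, t) \<bullet> a)" for a
      by (rule decomposes_integral(1)[OF decomposes_cylinder[OF open_\<Omega>] _ id]) measurable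
  qed
  moreover have "AE t in lebesgue_on {0<..<T}. \<forall>a\<in>Basis. integrable (lebesgue_on \<Omega>) (\<lambda>x. Dd (x, t) \<bullet> a)"
  proof (rule AE_finite_allI[OF finite_Basis])
    show "AE t in lebesgue_on {0<..<T}. integrable (lebesgue_on \<Omega>) (\<lambda>x. Dd (x, t) \<bullet> a)" for a
      by (rule decomposes_integral(1)[OF decomposes_cylinder[OF open_\<Omega>] _ iDd]) measurable
  qed
  ultimately have "AE t in lebesgue_on {0<..<T}. weak_gradient \<Omega> (slice d t) (slice Dd t)"
  proof eventually_elim
    case (elim t)
    have id_t: "integrable (lebesgue_on \<Omega>) (slice d t)"
      by (rule integrable_euclidean_components, unfold slice_def) (rule bspec[OF elim(2)])
    have iDd_t: "integrable (lebesgue_on \<Omega>) (slice Dd t)"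
      by (rule integrable_euclidean_components, unfold slice_def) (rule bspec[OF elim(3)])
    have \<Omega>_leb: "\<Omega> \<in> sets lebesgue" using open_\<Omega> by auto
    have loc: "locally_integrable \<Omega> f" if f: "integrable (lebesgue_on \<Omega>) f" for f :: "real ^ 3 \<Rightarrow> 'v::euclidean_space"
      unfolding locally_integrable_def
    proof (intro conjI allI impI)
      show "f \<in> borel_measurable (lebesgue_on \<Omega>)" using f by simp
      show "integrable (lebesgue_on K) f" if "compact K \<and> K \<subseteq> \<Omega>" for K
        by (rule integrable_lebesgue_on_subset[OF f _ _ \<Omega>_leb]) (use that borel_compact[of K] in auto)
    qed
    show ?case
      unfolding weak_gradient_def
    proof (intro conjI ballI allI)
      show "locally_integrable \<Omega> (slice d t)" "locally_integrable \<Omega> (slice Dd t)" by (intro loc id_t iDd_t)+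
      fix \<phi> i j assume \<phi>: "\<phi> \<in> test_functions \<Omega>"
      let ?u = "\<lambda>x. slice d t x $ i" and ?g = "\<lambda>x. slice Dd t x $ i $ j"
      let ?D = "\<lambda>\<phi> x. frechet_derivative \<phi> (at x) (axis j 1) :: real"
      have iu: "integrable (lebesgue_on \<Omega>) ?u" and ig: "integrable (lebesgue_on \<Omega>) ?g"
        by (rule integrable_bounded_linear[OF bounded_linear_vec_nth id_t], rule integrable_matrix_entry[OF iDd_t])
      have pieces: "integrable (lebesgue_on \<Omega>) (\<lambda>x. ?D \<phi> x * ?u x)" "integrable (lebesgue_on \<Omega>) (\<lambda>x. \<phi> x * ?g x)"
        if \<phi>: "\<phi> \<in> test_functions \<Omega>" for \<phi>
      proof -
        obtain B where B: "\<And>x. \<bar>\<phi> x\<bar> \<le> B" "\<And>x. \<bar>?D \<phi> x\<bar> \<le> B"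
          by (rule test_function_bounded[OF \<phi>, of j]) (rule that)
        show "integrable (lebesgue_on \<Omega>) (\<lambda>x. ?D \<phi> x * ?u x)"
          by (rule integrable_bounded_continuous_mult[OF test_function_partial_derivative(1)[OF \<phi>] B(2) iu])
        show "integrable (lebesgue_on \<Omega>) (\<lambda>x. \<phi> x * ?g x)"
          by (rule integrable_bounded_continuous_mult[OF test_function_continuous[OF \<phi>] B(1) ig])
      qed
      have F_eq: "F \<phi> i j (x, t) = ?D \<phi> x * ?u x + \<phi> x * ?g x" for \<phi> x
        by (simp add: F_def slice_def inner_axis)
      define A where "A = (\<integral>x. \<bar>?u x\<bar> + \<bar>?g x\<bar> \<partial>lebesgue_on \<Omega>)"
      have A0: "0 \<le> A" unfolding A_def by (intro integral_nonneg_AE AE_I2) auto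
      have small: "\<bar>\<integral>x. ?D \<phi> x * ?u x + \<phi> x * ?g x \<partial>lebesgue_on \<Omega>\<bar> \<le> \<epsilon> * A" if eps: "\<epsilon> > 0" for \<epsilon>
      proof -
        obtain \<phi>' where \<phi>': "\<phi>' \<in> \<D>" "\<And>x. x \<in> closure \<Omega> \<Longrightarrow> dist (e \<phi> x) (e \<phi>' x) < \<epsilon>"
          using D(3)[OF \<phi> eps] by blast
        have \<phi>'t: "\<phi>' \<in> test_functions \<Omega>" using D(2) \<phi>'(1) by blast
        have "(\<integral>x. F \<phi>' i j (x, t) \<partial>lebesgue_on \<Omega>) = 0"
          using elim(1) \<phi>'(1) by blast
        then have "(\<integral>x. ?D \<phi>' x * ?u x + \<phi>' x * ?g x \<partial>lebesgue_on \<Omega>) = 0"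
          by (simp only: F_eq)
        then have "(\<integral>x. ?D \<phi> x * ?u x + \<phi> x * ?g x \<partial>lebesgue_on \<Omega>) =
            (\<integral>x. (?D \<phi> x * ?u x + \<phi> x * ?g x) - (?D \<phi>' x * ?u x + \<phi>' x * ?g x) \<partial>lebesgue_on \<Omega>)"
          using pieces[OF \<phi>] pieces[OF \<phi>'t] by simp
        also have "\<bar>\<dots>\<bar> \<le> (\<integral>x. \<epsilon> * (\<bar>?u x\<bar> + \<bar>?g x\<bar>) \<partial>lebesgue_on \<Omega>)"
        proof (rule Bochner_Integration.integral_abs_bound_integral)
          show "integrable (lebesgue_on \<Omega>) (\<lambda>x. (?D \<phi> x * ?u x + \<phi> x * ?g x) - (?D \<phi>' x * ?u x + \<phi>' x * ?g x))"
            by (intro Bochner_Integration.integrable_diff Bochner_Integration.integrable_add pieces \<phi> \<phi>'t)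
          show "integrable (lebesgue_on \<Omega>) (\<lambda>x. \<epsilon> * (\<bar>?u x\<bar> + \<bar>?g x\<bar>))"
            using iu ig by (intro integrable_mult_right Bochner_Integration.integrable_add integrable_abs)
          fix x assume "x \<in> space (lebesgue_on \<Omega>)"
          then have "x \<in> closure \<Omega>" using closure_subset[of \<Omega>] by auto
          then have close: "dist (e \<phi> x) (e \<phi>' x) < \<epsilon>" by (rule \<phi>'(2))
          have d1: "\<bar>\<phi> x - \<phi>' x\<bar> \<le> \<epsilon>"
            using dist_fst_le[of "e \<phi> x" "e \<phi>' x"] close by (simp add: e_def dist_real_def)
          have "dist (snd (e \<phi> x) $ j) (snd (e \<phi>' x) $ j) \<le> dist (snd (e \<phi> x)) (snd (e \<phi>' x))"
            by (rule dist_vec_nth_le)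
          then have d2: "\<bar>?D \<phi> x - ?D \<phi>' x\<bar> \<le> \<epsilon>"
            using dist_snd_le[of "e \<phi> x" "e \<phi>' x"] close by (simp add: e_def dist_real_def)
          have "(?D \<phi> x * ?u x + \<phi> x * ?g x) - (?D \<phi>' x * ?u x + \<phi>' x * ?g x) =
              (?D \<phi> x - ?D \<phi>' x) * ?u x + (\<phi> x - \<phi>' x) * ?g x" by (simp add: algebra_simps)
          also have "\<bar>\<dots>\<bar> \<le> \<bar>?D \<phi> x - ?D \<phi>' x\<bar> * \<bar>?u x\<bar> + \<bar>\<phi> x - \<phi>' x\<bar> * \<bar>?g x\<bar>"
            unfolding abs_mult[symmetric] by (rule abs_triangle_ineq)
          also have "\<dots> \<le> \<epsilon> * \<bar>?u x\<bar> + \<epsilon> * \<bar>?g x\<bar>"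
            by (intro add_mono mult_right_mono d1 d2) auto
          finally show "\<bar>(?D \<phi> x * ?u x + \<phi> x * ?g x) - (?D \<phi>' x * ?u x + \<phi>' x * ?g x)\<bar> \<le> \<epsilon> * (\<bar>?u x\<bar> + \<bar>?g x\<bar>)"
            by (simp add: distrib_left)
        qed
        finally show ?thesis by (simp add: A_def)
      qed
      have "\<bar>\<integral>x. ?D \<phi> x * ?u x + \<phi> x * ?g x \<partial>lebesgue_on \<Omega>\<bar> \<le> 0"
      proof (rule field_le_epsilon)
        fix \<epsilon> :: real assume "\<epsilon> > 0"
        \<comment> \<open>The summand 1 avoids dividing by \<open>A = 0\<close>.\<close>
        then have "\<epsilon> / (A + 1) * A \<le> \<epsilon>" using A0 by (simp add: field_simps)
        then show "\<bar>\<integral>x. ?D \<phi> x * ?u x + \<phi> x * ?g x \<partial>lebesgue_on \<Omega>\<bar> \<le> 0 + \<epsilon>"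
          using small[of "\<epsilon> / (A + 1)"] \<open>\<epsilon> > 0\<close> A0 by simp
      qed
      then have "(\<integral>x. ?D \<phi> x * ?u x \<partial>lebesgue_on \<Omega>) + (\<integral>x. \<phi> x * ?g x \<partial>lebesgue_on \<Omega>) = 0"
        using pieces[OF \<phi>] by simp
      then show "(\<integral>x. ?u x * ?D \<phi> x \<partial>lebesgue_on \<Omega>) = - (\<integral>x. ?g x * \<phi> x \<partial>lebesgue_on \<Omega>)"
        by (simp add: mult.commute)
    qed
  qed
  moreover have "Dd \<in> borel_measurable leb_Q" by (rule borel_measurable_lebesgue_on_borel[OF Dd])
  ultimately have "spatial_gradient \<Omega> T d Dd" unfolding spatial_gradient_def by blast
  then show "spatial_gradient \<Omega> T d (\<lambda>y. \<integral>S. S \<partial>\<nu> y)" by (simp add: Dd_def[abs_def])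
qed

end

section \<open>Representation of the limit\<close>

lemma L2_norm_cong_AE:
  fixes f g :: "'a \<Rightarrow> 'b::euclidean_space"
  assumes [measurable]: "f \<in> borel_measurable M" "g \<in> borel_measurable M" and "AE x in M. f x = g x"
  shows "L2_norm M f = L2_norm M g"
proof -
  have "AE x in M. (norm (f x))\<^sup>2 = (norm (g x))\<^sup>2" using assms(3) by eventually_elim simp
  then have "(\<integral>x. (norm (f x))\<^sup>2 \<partial>M) = (\<integral>x. (norm (g x))\<^sup>2 \<partial>M)"
    by (intro integral_cong_AE) measurable
  then show ?thesis by (simp add: L2_norm_def)
qed

text \<open>A Borel representative can be composed with Borel maps and evaluated under measures other than
  Lebesgue measure, which a Lebesgue measurable function cannot.\<close>

lemma L2L2_borel_representative:
  fixes p :: "point \<Rightarrow> 'b::euclidean_space"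
  assumes \<Omega>: "open \<Omega>" and p: "p \<in> L2L2 \<Omega> T"
  obtains q where "q \<in> borel_measurable borel" "q \<in> L2L2 \<Omega> T" "AE y in lebesgue_on (cylinder \<Omega> T). p y = q y"
proof -
  let ?V = "L2 (lebesgue_on \<Omega>) :: (real ^ 3 \<Rightarrow> 'b) set" and ?N = "L2_norm (lebesgue_on \<Omega>) :: (real ^ 3 \<Rightarrow> 'b) \<Rightarrow> real"
  let ?L = "lebesgue_on {0<..<T}"
  have pm: "p \<in> borel_measurable (lebesgue_on (cylinder \<Omega> T))"
    and pV: "AE t in ?L. slice p t \<in> ?V"
    and pint: "integrable ?L (\<lambda>t. (?N (slice p t))\<^sup>2)"
    using p by (auto simp: bochner_L2_def bochner_measurable_def strongly_measurable_def)
  obtain s where s: "\<And>n. simple_function ?L (s n)" "\<And>n. s n ` {0<..<T} \<subseteq> ?V"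
      "AE t in ?L. (\<lambda>n. ?N (\<lambda>x. slice p t x - s n t x)) \<longlonglongrightarrow> 0"
    using p by (auto simp: bochner_L2_def bochner_measurable_def strongly_measurable_def)
  obtain q where q: "q \<in> borel_measurable borel" and pq: "AE y in lebesgue_on (cylinder \<Omega> T). p y = q y"
    using lebesgue_on_AE_eq_borel[OF sets_cylinder(3)[OF \<Omega>] pm] .
  have qm: "q \<in> borel_measurable (lebesgue_on (cylinder \<Omega> T))" by (rule borel_measurable_lebesgue_on_borel[OF q])
  have pq_slice: "AE t in ?L. AE x in lebesgue_on \<Omega>. slice p t x = slice q t x"
    using AE_cylinder_slices[OF \<Omega> pq] by (simp add: slice_def)
  have qV: "AE t in ?L. slice q t \<in> ?V"
    using pV pq_slice AE_slices_measurable[OF \<Omega> qm]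
  proof eventually_elim
    case (elim t)
    have "integrable (lebesgue_on \<Omega>) (\<lambda>x. (norm (slice q t x))\<^sup>2)"
    proof (rule integrable_cong_AE_imp)
      show "integrable (lebesgue_on \<Omega>) (\<lambda>x. (norm (slice p t x))\<^sup>2)" using elim(1) by (simp add: L2_def)
      show "AE x in lebesgue_on \<Omega>. (norm (slice p t x))\<^sup>2 = (norm (slice q t x))\<^sup>2"
        using elim(2) by eventually_elim simp
    qed (use elim(3) in measurable)
    then show ?case using elim(3) by (simp add: L2_def)
  qed
  have qs: "AE t in ?L. (\<lambda>n. ?N (\<lambda>x. slice q t x - s n t x)) \<longlonglongrightarrow> 0"
    using s(3) pV qV pq_slice AE_space
  proof eventually_elim
    case (elim t)
    have "?N (\<lambda>x. slice p t x - s n t x) = ?N (\<lambda>x. slice q t x - s n t x)" for n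
    proof (rule L2_norm_cong_AE)
      have "s n t \<in> ?V" using s(2)[of n] elim(5) by auto
      then show "(\<lambda>x. slice p t x - s n t x) \<in> borel_measurable (lebesgue_on \<Omega>)"
        "(\<lambda>x. slice q t x - s n t x) \<in> borel_measurable (lebesgue_on \<Omega>)"
        using elim(2,3) by (auto simp: L2_def intro: borel_measurable_diff)
      show "AE x in lebesgue_on \<Omega>. slice p t x - s n t x = slice q t x - s n t x"
        using elim(4) by eventually_elim simp
    qed
    then show ?case using elim(1) by simp
  qed
  have Neq: "AE t in ?L. (?N (slice p t))\<^sup>2 = (?N (slice q t))\<^sup>2"
    using pV qV pq_slice
  proof eventually_elim
    case (elim t)
    have "?N (slice p t) = ?N (slice q t)"
      by (rule L2_norm_cong_AE) (use elim in \<open>simp_all add: L2_def\<close>)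
    then show ?case by simp
  qed
  have qN_meas: "(\<lambda>t. (?N (slice q t))\<^sup>2) \<in> borel_measurable ?L"
    by (rule borel_measurable_lebesgue_on_cong_AE[OF _ _ Neq]) (use pint in auto)
  have qint: "integrable ?L (\<lambda>t. (?N (slice q t))\<^sup>2)"
    by (rule integrable_cong_AE_imp[OF pint qN_meas Neq])
  have q2: "q \<in> L2L2 \<Omega> T"
    using qm qV qs qint s(1,2) unfolding bochner_L2_def bochner_measurable_def strongly_measurable_def by blast
  show thesis by (rule that[OF q q2 pq])
qed

text \<open>Weak convergence is tested with bounded continuous functions on the whole space, while the ball
  representation of an integrand is continuous on a compact set only.\<close>

lemma bounded_extension:
  fixes g :: "'a::euclidean_space \<Rightarrow> real"
  assumes K: "compact K" and g: "continuous_on K g"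
  obtains h B where "continuous_on UNIV h" "\<And>z. z \<in> K \<Longrightarrow> h z = g z" "\<And>z. \<bar>h z\<bar> \<le> B"
proof -
  obtain B where B: "B > 0" "\<And>z. z \<in> K \<Longrightarrow> norm (g z) \<le> B"
    using compact_imp_bounded[OF compact_continuous_image[OF g K]] by (auto simp: bounded_pos)
  have cl: "closedin (top_of_set UNIV) K" using compact_imp_closed[OF K] by (simp add: closed_closedin[symmetric])
  obtain h where h: "continuous_on UNIV h" "\<And>z. z \<in> K \<Longrightarrow> h z = g z" "\<And>z. z \<in> UNIV \<Longrightarrow> norm (h z) \<le> B"
    by (rule Tietze[OF g cl less_imp_le[OF B(1)] B(2)]) (simp, rule that)
  show thesis by (rule that[OF h(1,2)]) (use h(3) in auto)
qed

context young_limit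
begin

text \<open>An admissible integrand is the weight times a continuous function \<open>g\<close> of the ball
  coordinates, so its integrals along the sequence converge to the integral of \<open>g\<close>
  with respect to \<open>\<mu>\<close>. The part of \<open>\<mu>\<close> with \<open>|S| <
  1\<close> is represented by the oscillation measure and the part with \<open>|S| = 1\<close> by
  the concentration measures.\<close>

theorem generalized_young_limit:
  assumes wg: "\<And>n. AE t in lebesgue_on {0<..<T}. weak_gradient \<Omega> (slice (u n) t) (slice (G n) t)"
  shows "\<exists>\<nu>o m \<nu>i. generalized_young_measure \<Omega> T \<nu>o m \<nu>i \<and>
     (\<forall>f\<in>integrands \<Omega> T.
        pairing_integrable \<Omega> T d \<nu>o m \<nu>i f \<and>
        (\<lambda>n. \<integral>y. f (y, u n y, G n y) \<partial>leb_Q) \<longlonglongrightarrow>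
          (\<integral>t. pairing \<Omega> T d \<nu>o m \<nu>i f t \<partial>lebesgue_on {0<..<T})) \<and>
     (\<exists>Dd_lim. spatial_gradient \<Omega> T d Dd_lim \<and>
        (AE y in leb_Q. integrable (\<nu>o y) (\<lambda>S. S) \<and> (\<integral>S. S \<partial>\<nu>o y) = Dd_lim y))"
proof -
  obtain \<nu>o \<omega> where \<nu>o: "\<nu>o \<in> borel \<rightarrow>\<^sub>M prob_algebra borel" and dec: "decomposes \<omega> leb_Q \<nu>o Pair"
    and osc: "oscillation_part \<omega>" by (rule oscillation_measure)
  have sets_\<nu>o: "sets (\<nu>o y) = sets borel" and prob_\<nu>o: "prob_space (\<nu>o y)" for y
    using measurable_space[OF \<nu>o, of y] by (simp_all add: space_prob_algebra)
  obtain m \<nu>i where sets_\<nu>i': "\<forall>y. sets (\<nu>i y) = sets (restrict_space borel (cball 0 1 \<times> sphere 0 1))"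
    and m: "AE t in lebesgue_on {0<..<T}. sets (m t) = sets (restrict_space borel (closure \<Omega>)) \<and> finite_measure (m t) \<and>
       (AE x in m t. sets (\<nu>i (x, t)) = sets (restrict_space borel (cball 0 1 \<times> sphere 0 1)) \<and> prob_space (\<nu>i (x, t)))"
    and conc: "concentration_part m \<nu>i"
    by (rule concentration_measure)
  note sets_\<nu>i = sets_\<nu>i'[rule_format]
  have gym: "generalized_young_measure \<Omega> T \<nu>o m \<nu>i"
    unfolding generalized_young_measure_def
  proof (intro conjI allI impI)
    show "AE y in leb_Q. sets (\<nu>o y) = sets borel \<and> prob_space (\<nu>o y)" by (simp add: sets_\<nu>o prob_\<nu>o)
    fix \<phi> :: "real ^ 3 ^ 3 \<Rightarrow> real" assume "continuous_on UNIV \<phi> \<and> (\<phi> \<longlongrightarrow> 0) at_infinity"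
    then have "\<phi> \<in> borel_measurable borel" by (simp add: borel_measurable_continuous_onI)
    then have "(\<lambda>y. \<integral>S. \<phi> S \<partial>\<nu>o y) \<in> borel_measurable borel"
      by (rule measurable_compose[OF measurable_prob_algebraD[OF \<nu>o] integral_measurable_subprob_algebra])
    then show "(\<lambda>y. \<integral>S. \<phi> S \<partial>\<nu>o y) \<in> borel_measurable leb_Q" by (rule borel_measurable_lebesgue_on_borel)
  qed (rule m)
  have pair: "pairing_integrable \<Omega> T d \<nu>o m \<nu>i f \<and>
        (\<lambda>n. \<integral>y. f (y, u n y, G n y) \<partial>leb_Q) \<longlonglongrightarrow>
          (\<integral>t. pairing \<Omega> T d \<nu>o m \<nu>i f t \<partial>lebesgue_on {0<..<T})"
    if f: "f \<in> integrands \<Omega> T" for f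
  proof -
    let ?L = "lebesgue_on {0<..<T}"
    define g where "g = tilde_ext \<Omega> T f"
    have "\<exists>g. tilde_extension \<Omega> T f g" using f by (simp add: integrands_def)
    then have g: "tilde_extension \<Omega> T f g" unfolding g_def tilde_ext_def by (rule someI_ex)
    let ?K = "closure Q \<times> cball 0 1 \<times> cball 0 1 :: (point \<times> (real ^ 3) \<times> (real ^ 3 ^ 3)) set"
    have K: "compact ?K" using bounded_Q by (intro compact_Times compact_cball) simp
    have "continuous_on ?K g" using g by (simp add: tilde_extension_def)
    then obtain h B where h: "continuous_on UNIV h" "\<And>z. z \<in> ?K \<Longrightarrow> h z = g z" "\<And>z. \<bar>h z\<bar> \<le> B"
      by (rule bounded_extension[OF K]) (rule that)
    have hm: "h \<in> borel_measurable borel" by (rule borel_measurable_continuous_onI[OF h(1)])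
    have fh: "f (y, v, S) = h (y, into_ball v, into_ball S) * ((1 + (norm v)\<^sup>2) * (1 + (norm S)\<^sup>2))" if "y \<in> closure Q" for y v S
    proof -
      have "(y, into_ball v, into_ball S) \<in> ?K"
        using that norm_into_ball[of v] norm_into_ball[of S] by simp
      then show ?thesis using tilde_extension_into_ball[OF g that, of v S] h(2) by simp
    qed
    have Qcl: "y \<in> closure Q" if "y \<in> Q" for y using that closure_subset by blast
    have f_lift: "f (y, d y, S) = lifted h (y, S)" if "y \<in> Q" for y S
      using fh[OF Qcl[OF that]] by (simp add: lifted_def)
    note lm = lifted_measurable[OF hm] and li = oscillation_partD[OF osc hm h(3)]
    note dl = decomposes_integral[OF dec lm li(1)]
    define I where "I y = (\<integral>S. lifted h (y, S) \<partial>\<nu>o y)" for y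
    have I_meas: "I \<in> borel_measurable borel"
    proof -
      have PairK: "(\<lambda>y. distr (\<nu>o y) borel (Pair y)) \<in> borel \<rightarrow>\<^sub>M subprob_algebra borel"
        by (rule measurable_prob_algebraD[OF measurable_distr_prob_space2[OF \<nu>o]]) (simp add: borel_prod)
      have "(\<lambda>y. \<integral>p. lifted h p \<partial>distr (\<nu>o y) borel (Pair y)) \<in> borel_measurable borel"
        by (rule measurable_compose[OF PairK integral_measurable_subprob_algebra[OF lm]])
      moreover have "(\<integral>p. lifted h p \<partial>distr (\<nu>o y) borel (Pair y)) = I y" for y
      proof -
        have "Pair y \<in> \<nu>o y \<rightarrow>\<^sub>M borel"
          by (subst measurable_cong_sets[OF sets_\<nu>o refl]) (intro borel_measurable_Pair; simp)
        then show ?thesis unfolding I_def by (rule integral_distr) (rule lm)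
      qed
      ultimately show ?thesis by simp
    qed
    have I_int: "integrable leb_Q I" using dl(2) by (simp add: I_def[abs_def])
    note dI = decomposes_integral[OF decomposes_cylinder[OF open_\<Omega>] I_meas I_int]
    have inQ: "(x, t) \<in> Q" if "x \<in> \<Omega>" "t \<in> {0<..<T}" for x t using that by (simp add: cylinder_def)
    have inclQ: "(x, t) \<in> closure Q" if "x \<in> closure \<Omega>" "t \<in> {0<..<T}" for x t
      using that closure_subset[of "{0<..<T}"] by (auto simp: cylinder_def closure_Times)
    have osc_t: "(\<integral>S. f ((x, t), d (x, t), S) \<partial>\<nu>o (x, t)) = I (x, t)" if "x \<in> \<Omega>" "t \<in> {0<..<T}" for x t
      using f_lift[OF inQ[OF that]] by (simp add: I_def)
    have osc_t': "(\<integral>x. (\<integral>S. f ((x, t), d (x, t), S) \<partial>\<nu>o (x, t)) \<partial>lebesgue_on \<Omega>) = (\<integral>x. I (x, t) \<partial>lebesgue_on \<Omega>)"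
      if "t \<in> {0<..<T}" for t
      using osc_t[OF _ that] by (intro Bochner_Integration.integral_cong) auto
    have ext: "g ((x, t), b) = h ((x, t), b)" if "x \<in> closure \<Omega>" "t \<in> {0<..<T}" "b \<in> cball 0 1 \<times> sphere 0 1" for x t b
      using h(2)[of "((x, t), b)"] inclQ[OF that(1,2)] that(3) by auto
    have conc_x: "(\<integral>(v, S). g ((x, t), v, S) \<partial>\<nu>i (x, t)) = (\<integral>b. h ((x, t), b) \<partial>\<nu>i (x, t)) \<and>
        (integrable (\<nu>i (x, t)) (\<lambda>(v, S). g ((x, t), v, S)) \<longleftrightarrow> integrable (\<nu>i (x, t)) (\<lambda>b. h ((x, t), b)))"
      if "x \<in> closure \<Omega>" "t \<in> {0<..<T}" for x t
    proof -
      have "space (\<nu>i (x, t)) = cball 0 1 \<times> sphere 0 1"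
        using sets_eq_imp_space_eq[OF sets_\<nu>i] by (simp add: space_restrict_space)
      then have e: "(case b of (v, S) \<Rightarrow> g ((x, t), v, S)) = h ((x, t), b)" if "b \<in> space (\<nu>i (x, t))" for b
        using ext[OF \<open>x \<in> closure \<Omega>\<close> \<open>t \<in> {0<..<T}\<close>, of b] that by (cases b) simp
      show ?thesis
        using e by (intro conjI Bochner_Integration.integral_cong Bochner_Integration.integrable_cong) auto
    qed
    let ?J = "\<lambda>t. \<integral>x. (\<integral>b. h ((x, t), b) \<partial>\<nu>i (x, t)) \<partial>m t"
    have conc_t: "AE t in ?L. (AE x in m t. integrable (\<nu>i (x, t)) (\<lambda>(v, S). g ((x, t), v, S))) \<and>
        integrable (m t) (\<lambda>x. \<integral>(v, S). g ((x, t), v, S) \<partial>\<nu>i (x, t)) \<and>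
        (\<integral>x. (\<integral>(v, S). g ((x, t), v, S) \<partial>\<nu>i (x, t)) \<partial>m t) = ?J t"
      using m concentration_partD(1)[OF conc hm h(3)] AE_space
    proof eventually_elim
      case (elim t)
      then have t: "t \<in> {0<..<T}" by simp
      have sp: "space (m t) = closure \<Omega>"
        using sets_eq_imp_space_eq[OF conjunct1[OF elim(1)]] by (simp add: space_restrict_space)
      have e: "(\<integral>(v, S). g ((x, t), v, S) \<partial>\<nu>i (x, t)) = (\<integral>b. h ((x, t), b) \<partial>\<nu>i (x, t))"
        and ei: "integrable (\<nu>i (x, t)) (\<lambda>(v, S). g ((x, t), v, S)) \<longleftrightarrow> integrable (\<nu>i (x, t)) (\<lambda>b. h ((x, t), b))"
        if "x \<in> space (m t)" for x
        using conc_x[OF _ t, of x] that sp by auto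
      have "AE x in m t. integrable (\<nu>i (x, t)) (\<lambda>(v, S). g ((x, t), v, S))"
        using conjunct1[OF elim(2)] AE_space by eventually_elim (simp add: ei)
      moreover have "integrable (m t) (\<lambda>x. \<integral>(v, S). g ((x, t), v, S) \<partial>\<nu>i (x, t))"
        using conjunct2[OF elim(2)] by (subst Bochner_Integration.integrable_cong[OF refl e]) simp_all
      moreover have "(\<integral>x. (\<integral>(v, S). g ((x, t), v, S) \<partial>\<nu>i (x, t)) \<partial>m t) = ?J t"
        by (rule Bochner_Integration.integral_cong[OF refl e])
      ultimately show ?case by blast
    qed
    have pairing_eq: "AE t in ?L. (\<integral>x. I (x, t) \<partial>lebesgue_on \<Omega>) + ?J t = pairing \<Omega> T d \<nu>o m \<nu>i f t"
      using conc_t AE_space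
    proof eventually_elim
      case (elim t)
      then show ?case using osc_t'[of t] by (simp add: pairing_def g_def)
    qed
    have intIJ: "integrable ?L (\<lambda>t. (\<integral>x. I (x, t) \<partial>lebesgue_on \<Omega>) + ?J t)"
      by (intro Bochner_Integration.integrable_add dI(2) concentration_partD(2)[OF conc hm h(3)])
    have mp: "pairing \<Omega> T d \<nu>o m \<nu>i f \<in> borel_measurable ?L"
      by (rule borel_measurable_lebesgue_on_cong_AE[OF _ _ pairing_eq]) (use intIJ in auto)
    have ip: "integrable ?L (pairing \<Omega> T d \<nu>o m \<nu>i f)"
      by (rule integrable_cong_AE_imp[OF intIJ mp pairing_eq])
    have pint: "pairing_integrable \<Omega> T d \<nu>o m \<nu>i f"
      unfolding pairing_integrable_def
    proof (intro conjI ip)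
      show "AE t in ?L.
        (AE x in lebesgue_on \<Omega>. integrable (\<nu>o (x, t)) (\<lambda>S. f ((x, t), d (x, t), S))) \<and>
        integrable (lebesgue_on \<Omega>) (\<lambda>x. \<integral>S. f ((x, t), d (x, t), S) \<partial>\<nu>o (x, t)) \<and>
        (AE x in m t. integrable (\<nu>i (x, t)) (\<lambda>(h, S). tilde_ext \<Omega> T f ((x, t), h, S))) \<and>
        integrable (m t) (\<lambda>x. \<integral>(h, S). tilde_ext \<Omega> T f ((x, t), h, S) \<partial>\<nu>i (x, t))"
        using conc_t dI(1) AE_cylinder_slices[OF open_\<Omega> dl(1)] AE_space
      proof eventually_elim
        case (elim t)
        then have t: "t \<in> {0<..<T}" by simp
        have "AE x in lebesgue_on \<Omega>. integrable (\<nu>o (x, t)) (\<lambda>S. f ((x, t), d (x, t), S))"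
          using elim(3) AE_space
        proof eventually_elim
          case (elim x)
          then show ?case using f_lift[OF inQ[OF _ t], of x] by simp
        qed
        moreover have "integrable (lebesgue_on \<Omega>) (\<lambda>x. \<integral>S. f ((x, t), d (x, t), S) \<partial>\<nu>o (x, t))"
          using elim(2) by (subst Bochner_Integration.integrable_cong[OF refl osc_t[OF _ t]]) simp_all
        ultimately show ?case using elim(1) by (simp add: g_def)
      qed
    qed
    have "(\<integral>t. pairing \<Omega> T d \<nu>o m \<nu>i f t \<partial>?L) = (\<integral>t. (\<integral>x. I (x, t) \<partial>lebesgue_on \<Omega>) + ?J t \<partial>?L)"
      by (rule integral_cong_AE[OF borel_measurable_integrable[OF intIJ] mp pairing_eq, symmetric])
    also have "\<dots> = (\<integral>y. I y \<partial>leb_Q) + (\<integral>z. (if norm (snd (snd z)) < 1 then 0 else h z) \<partial>\<mu>)"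
      using dI(2,4) concentration_partD(2)[OF conc hm h(3)] concentration_partD(3)[OF conc hm h(3)] by simp
    also have "(\<integral>y. I y \<partial>leb_Q) = (\<integral>z. (if norm (snd (snd z)) < 1 then h z else 0) \<partial>\<mu>)"
      using dl(4) li(2) by (simp add: I_def[abs_def])
    also have "(\<integral>z. (if norm (snd (snd z)) < 1 then h z else 0) \<partial>\<mu>) + (\<integral>z. (if norm (snd (snd z)) < 1 then 0 else h z) \<partial>\<mu>) = (\<integral>z. h z \<partial>\<mu>)"
    proof -
      have hmu[measurable]: "h \<in> borel_measurable \<mu>" using hm by (simp add: measurable_cong_sets[OF sets_\<mu> refl])
      have B0: "0 \<le> B" using order_trans[OF abs_ge_zero h(3)] .
      have "integrable \<mu> (\<lambda>z. if norm (snd (snd z)) < 1 then h z else 0)"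
        "integrable \<mu> (\<lambda>z. if norm (snd (snd z)) < 1 then 0 else h z)"
        by (rule finite_measure.integrable_const_bound[OF finite_\<mu>, where B=B]; use h(3) B0 in \<open>auto intro!: AE_I2\<close>)+
      note Bochner_Integration.integral_add[OF this, symmetric]
      also have "(\<integral>z. (if norm (snd (snd z)) < 1 then h z else 0) + (if norm (snd (snd z)) < 1 then 0 else h z) \<partial>\<mu>) = (\<integral>z. h z \<partial>\<mu>)"
        by (intro Bochner_Integration.integral_cong) auto
      finally show ?thesis .
    qed
    finally have eq: "(\<integral>t. pairing \<Omega> T d \<nu>o m \<nu>i f t \<partial>?L) = (\<integral>z. h z \<partial>\<mu>)" .
    have "(\<integral>y. f (y, u n y, G n y) \<partial>leb_Q) = (\<integral>y. h (y, into_ball (u n y), into_ball (G n y)) * weight n y \<partial>leb_Q)" for n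
      using fh[OF Qcl] by (intro Bochner_Integration.integral_cong) auto
    then show ?thesis using pint \<mu>_lim[OF h(1,3)] by (simp add: eq)
  qed
  note grad = limit_weak_gradient[OF \<nu>o dec osc wg]
  have "AE y in leb_Q. integrable (\<nu>o y) (\<lambda>S. S) \<and> (\<integral>S. S \<partial>\<nu>o y) = (\<integral>S. S \<partial>\<nu>o y)"
    using grad(1) by eventually_elim simp
  then have ex: "\<exists>Dd_lim. spatial_gradient \<Omega> T d Dd_lim \<and>
      (AE y in leb_Q. integrable (\<nu>o y) (\<lambda>S. S) \<and> (\<integral>S. S \<partial>\<nu>o y) = Dd_lim y)"
    using grad(2) by (intro exI[of _ "\<lambda>y. \<integral>S. S \<partial>\<nu>o y"] conjI)
  show ?thesis
    by (intro exI[of _ \<nu>o] exI[of _ m] exI[of _ \<nu>i] conjI gym ex ballI pair)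
qed

end

section \<open>Existence of generalized gradient Young measures\<close>

text \<open>The hypotheses on the state and on the product of its modulus with the gradient combine to a bound
  of the weight which is uniform in time and in the parameter.\<close>

lemma energy_bounds:
  fixes d :: "real \<Rightarrow> point \<Rightarrow> real ^ 3" and Dd :: "real \<Rightarrow> point \<Rightarrow> real ^ 3 ^ 3"
  assumes \<Omega>: "open \<Omega>" "bounded \<Omega>"
    and d: "\<And>\<delta>. \<delta> \<in> A \<Longrightarrow> d \<delta> \<in> LinfH1 \<Omega> T"
    and d_sup: "(SUP \<delta>\<in>A. LinfH1_norm \<Omega> T (d \<delta>)) < \<infinity>"
    and grad: "\<And>\<delta>. \<delta> \<in> A \<Longrightarrow> spatial_gradient \<Omega> T (d \<delta>) (Dd \<delta>)"
    and dD: "\<And>\<delta>. \<delta> \<in> A \<Longrightarrow> (\<lambda>y. norm (d \<delta> y) *\<^sub>R Dd \<delta> y) \<in> LinfL2 \<Omega> T"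
    and dD_sup: "(SUP \<delta>\<in>A. LinfL2_norm \<Omega> T (\<lambda>y. norm (d \<delta> y) *\<^sub>R Dd \<delta> y)) < \<infinity>"
  obtains C where "C \<ge> 0" "\<And>\<delta>. \<delta> \<in> A \<Longrightarrow> AE t in lebesgue_on {0<..<T}.
    (\<integral>\<^sup>+x. ennreal ((1 + (norm (d \<delta> (x, t)))\<^sup>2) * (1 + (norm (Dd \<delta> (x, t)))\<^sup>2)) \<partial>lebesgue_on \<Omega>) \<le> ennreal C"
proof -
  let ?L = "lebesgue_on {0<..<T}"
  obtain C1 where C1: "C1 \<ge> 0" "\<And>\<delta>. \<delta> \<in> A \<Longrightarrow> AE t in ?L. H1_norm \<Omega> (slice (d \<delta>) t) \<le> C1"
    using bochner_Linf_bound[OF d_sup] by blast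
  obtain C2 where C2: "C2 \<ge> 0" "\<And>\<delta>. \<delta> \<in> A \<Longrightarrow>
      AE t in ?L. L2_norm (lebesgue_on \<Omega>) (slice (\<lambda>y. norm (d \<delta> y) *\<^sub>R Dd \<delta> y) t) \<le> C2"
    using bochner_Linf_bound[OF dD_sup] by blast
  show thesis
  proof
    show "0 \<le> measure lebesgue \<Omega> + C1\<^sup>2 + C2\<^sup>2" by simp
    fix \<delta> assume \<delta>: "\<delta> \<in> A"
    have "AE t in ?L. slice (d \<delta>) t \<in> H1 \<Omega>"
      using d[OF \<delta>] by (simp add: bochner_Linf_def bochner_measurable_def strongly_measurable_def)
    moreover have "AE t in ?L. slice (\<lambda>y. norm (d \<delta> y) *\<^sub>R Dd \<delta> y) t \<in> L2 (lebesgue_on \<Omega>)"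
      using dD[OF \<delta>] by (simp add: bochner_Linf_def bochner_measurable_def strongly_measurable_def)
    moreover have "AE t in ?L. weak_gradient \<Omega> (slice (d \<delta>) t) (slice (Dd \<delta>) t)"
      using grad[OF \<delta>] by (simp add: spatial_gradient_def)
    ultimately show "AE t in ?L. (\<integral>\<^sup>+x. ennreal ((1 + (norm (d \<delta> (x, t)))\<^sup>2) * (1 + (norm (Dd \<delta> (x, t)))\<^sup>2)) \<partial>lebesgue_on \<Omega>)
        \<le> ennreal (measure lebesgue \<Omega> + C1\<^sup>2 + C2\<^sup>2)"
      using C1(2)[OF \<delta>] C2(2)[OF \<delta>]
    proof eventually_elim
      case (elim t)
      have s: "slice (\<lambda>y. norm (d \<delta> y) *\<^sub>R Dd \<delta> y) t = (\<lambda>x. norm (slice (d \<delta>) t x) *\<^sub>R slice (Dd \<delta>) t x)"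
        by (simp add: slice_def)
      show ?case
        using slice_energy_bound[OF \<Omega> elim(1,4,3) elim(2)[unfolded s] elim(5)[unfolded s]]
        by (simp add: slice_def)
    qed
  qed
qed

text \<open>The laws of position, state and gradient in ball coordinates, with density \<open>(1 +
  |u|\<^sup>2)(1 + |G|\<^sup>2)\<close>, live on one compact set. Their masses are bounded by the
  energy from above, and by the volume of the cylinder from below because the density is at least
  1.\<close>

lemma weighted_laws_subsequence:
  fixes u :: "nat \<Rightarrow> point \<Rightarrow> real ^ 3" and G :: "nat \<Rightarrow> point \<Rightarrow> real ^ 3 ^ 3"
  assumes \<Omega>: "open \<Omega>" "bounded \<Omega>" "\<Omega> \<noteq> {}" and T: "T > 0"
    and meas: "\<And>n. u n \<in> borel_measurable (lebesgue_on (cylinder \<Omega> T))" "\<And>n. G n \<in> borel_measurable (lebesgue_on (cylinder \<Omega> T))"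
    and energy: "\<And>n. AE t in lebesgue_on {0<..<T}.
      (\<integral>\<^sup>+x. ennreal ((1 + (norm (u n (x, t)))\<^sup>2) * (1 + (norm (G n (x, t)))\<^sup>2)) \<partial>lebesgue_on \<Omega>) \<le> ennreal C"
    and C: "C \<ge> 0"
  obtains r \<mu> where "strict_mono (r :: nat \<Rightarrow> nat)" "finite_measure \<mu>" "sets \<mu> = sets borel"
    "AE z in \<mu>. z \<in> closure (cylinder \<Omega> T) \<times> cball 0 1 \<times> cball 0 1"
    "\<forall>g B. continuous_on UNIV g \<longrightarrow> (\<forall>z. \<bar>g z\<bar> \<le> B) \<longrightarrow>
      (\<lambda>n. \<integral>y. g (y, into_ball (u (r n) y), into_ball (G (r n) y)) *
          ((1 + (norm (u (r n) y))\<^sup>2) * (1 + (norm (G (r n) y))\<^sup>2)) \<partial>lebesgue_on (cylinder \<Omega> T))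
        \<longlonglongrightarrow> (\<integral>z. (g z :: real) \<partial>\<mu>)"
proof -
  let ?Q = "cylinder \<Omega> T" and ?L = "lebesgue_on (cylinder \<Omega> T)"
  let ?w = "\<lambda>n y. (1 + (norm (u n y))\<^sup>2) * (1 + (norm (G n y))\<^sup>2)"
  note [measurable] = meas
  have Q_leb: "?Q \<in> sets lebesgue" by (rule sets_cylinder(3)[OF \<Omega>(1)])
  have bddQ: "bounded ?Q" unfolding cylinder_def using \<Omega>(2) by (intro bounded_Times) auto
  have lm: "?Q \<in> lmeasurable" by (rule lmeasurable_open[OF bddQ sets_cylinder(1)[OF \<Omega>(1)]])
  have neQ: "?Q \<noteq> {}" using \<Omega>(3) T by (auto simp: cylinder_def intro: exI[of _ "T / 2"])
  let ?e = "\<lambda>n y. (y, into_ball (u n y), into_ball (G n y))"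
  have idm: "(\<lambda>y. y) \<in> borel_measurable ?L" by (rule borel_measurable_lebesgue_on_borel) simp
  have e[measurable]: "?e n \<in> borel_measurable ?L" for n using idm by measurable
  define M where "M n = distr (density ?L (\<lambda>y. ennreal (?w n y))) borel (?e n)" for n
  have w1: "1 \<le> ?w n y" for n y by (simp add: algebra_simps add_nonneg_nonneg)
  have emM: "emeasure (M n) UNIV = (\<integral>\<^sup>+y. ennreal (?w n y) \<partial>?L)" for n
    unfolding M_def by (simp add: emeasure_distr emeasure_density) (intro nn_integral_cong, simp)
  have up: "(\<integral>\<^sup>+y. ennreal (?w n y) \<partial>?L) \<le> ennreal (C * T)" for n
  proof -
    have "(\<integral>\<^sup>+y. ennreal (?w n y) \<partial>?L) =
        (\<integral>\<^sup>+t. (\<integral>\<^sup>+x. ennreal (?w n (x, t)) \<partial>lebesgue_on \<Omega>) \<partial>lebesgue_on {0<..<T})"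
      by (rule nn_integral_cylinder[OF \<Omega>(1)]) measurable
    also have "\<dots> \<le> (\<integral>\<^sup>+t. ennreal C \<partial>lebesgue_on {0<..<T})" by (rule nn_integral_mono_AE[OF energy])
    also have "\<dots> = ennreal (C * T)" using T C by (simp add: emeasure_restrict_space ennreal_mult)
    finally show ?thesis .
  qed
  have finM: "finite_measure (M n)" for n
  proof (rule finite_measureI)
    have "emeasure (M n) UNIV < \<infinity>" unfolding emM using up[of n] by (rule order.strict_trans1) simp
    then show "emeasure (M n) (space (M n)) \<noteq> \<infinity>" by (simp add: M_def)
  qed
  have em: "emeasure (M n) UNIV = ennreal (measure (M n) UNIV)" for n
    using finM by (simp add: finite_measure.emeasure_eq_measure)
  define a where "a = measure lebesgue ?Q"
  have a: "emeasure lebesgue ?Q = ennreal a" unfolding a_def by (rule emeasure_eq_measure2[OF lm])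
  have "a > 0"
  proof (rule ccontr)
    assume "\<not> a > 0"
    then have "emeasure lebesgue ?Q = 0" using a by (simp add: not_less ennreal_neg)
    then have "?Q \<in> null_sets lebesgue" using Q_leb by (simp add: null_sets_def)
    then have "negligible ?Q" by (simp add: negligible_iff_null_sets)
    then show False using open_not_negligible[OF sets_cylinder(1)[OF \<Omega>(1)] neQ] by simp
  qed
  have lo: "a \<le> measure (M n) UNIV" for n
  proof -
    have "ennreal a = (\<integral>\<^sup>+y. 1 \<partial>?L)"
      using Q_leb by (simp add: emeasure_restrict_space a)
    also have "\<dots> \<le> (\<integral>\<^sup>+y. ennreal (?w n y) \<partial>?L)"
      using w1 by (intro nn_integral_mono) (simp add: ennreal_ge_1)
    finally have "ennreal a \<le> ennreal (measure (M n) UNIV)" using emM em by simp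
    then show ?thesis by (subst (asm) ennreal_le_iff) auto
  qed
  have hi: "measure (M n) UNIV \<le> C * T" for n
  proof -
    have "ennreal (measure (M n) UNIV) \<le> ennreal (C * T)" using up[of n] emM[of n] em[of n] by simp
    then show ?thesis using C T by (subst (asm) ennreal_le_iff) auto
  qed
  let ?K = "closure ?Q \<times> cball 0 1 \<times> cball 0 1 :: (point \<times> (real ^ 3) \<times> (real ^ 3 ^ 3)) set"
  have K: "compact ?K" using bddQ by (intro compact_Times compact_cball) simp
  have setsM: "sets (M n) = sets borel" for n by (simp add: M_def)
  have "closed ?K" by (rule compact_imp_closed[OF K])
  then have K': "{z \<in> space borel. z \<in> ?K} \<in> sets borel" by simp
  have suppM: "AE z in M n. z \<in> ?K" for n
  proof -
    have "AE y in density ?L (\<lambda>y. ennreal (?w n y)). ?e n y \<in> ?K"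
    proof (subst AE_density)
      show "AE y in ?L. 0 < ennreal (?w n y) \<longrightarrow> ?e n y \<in> ?K"
      proof (rule AE_I2, rule impI)
        fix y assume "y \<in> space ?L"
        then have "y \<in> closure ?Q" using closure_subset[of ?Q] by auto
        then show "?e n y \<in> ?K" using norm_into_ball[of "u n y"] norm_into_ball[of "G n y"] by simp
      qed
    qed measurable
    then show ?thesis unfolding M_def by (subst AE_distr_iff[OF _ K']) simp_all
  qed
  have intM: "(\<integral>z. g z \<partial>M n) = (\<integral>y. g (?e n y) * ?w n y \<partial>?L)"
    if "continuous_on UNIV g" for g :: "point \<times> (real ^ 3) \<times> (real ^ 3 ^ 3) \<Rightarrow> real" and n
  proof -
    have gm: "g \<in> borel_measurable borel" by (rule borel_measurable_continuous_onI[OF that])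
    have ge: "(\<lambda>y. g (?e n y)) \<in> borel_measurable ?L" by (rule measurable_compose[OF e gm])
    have "(\<integral>z. g z \<partial>M n) = (\<integral>y. g (?e n y) \<partial>density ?L (\<lambda>y. ennreal (?w n y)))"
      unfolding M_def by (rule integral_distr) (use gm in simp_all)
    also have "\<dots> = (\<integral>y. ?w n y *\<^sub>R g (?e n y) \<partial>?L)"
      by (rule integral_density[OF ge]) auto
    finally show ?thesis by (simp add: mult.commute)
  qed
  obtain r \<mu> where r: "strict_mono (r :: nat \<Rightarrow> nat)" "finite_measure \<mu>" "sets \<mu> = sets borel" "AE z in \<mu>. z \<in> ?K"
    and lim: "\<And>g B. continuous_on UNIV g \<Longrightarrow> (\<And>x. \<bar>g x\<bar> \<le> B) \<Longrightarrow>
       (\<lambda>n. \<integral>x. g x \<partial>M (r n)) \<longlonglongrightarrow> (\<integral>x. g x \<partial>\<mu> :: real)"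
  proof (rule bounded_measures_on_compact_convergent_subsequence[where M=M, OF K finM setsM suppM \<open>a > 0\<close> lo hi])
    fix r \<mu>
    assume "strict_mono (r :: nat \<Rightarrow> nat)" "finite_measure \<mu>" "sets \<mu> = sets borel" "AE z in \<mu>. z \<in> ?K"
      "\<And>g B. continuous_on UNIV g \<Longrightarrow> (\<And>x. \<bar>g x\<bar> \<le> B) \<Longrightarrow>
       (\<lambda>n. \<integral>x. g x \<partial>M (r n)) \<longlonglongrightarrow> (\<integral>x. g x \<partial>\<mu> :: real)"
    then show thesis by (rule that)
  qed
  have "\<forall>g B. continuous_on UNIV g \<longrightarrow> (\<forall>z. \<bar>g z\<bar> \<le> B) \<longrightarrow>
      (\<lambda>n. \<integral>y. g (?e (r n) y) * ?w (r n) y \<partial>?L) \<longlonglongrightarrow> (\<integral>z. (g z :: real) \<partial>\<mu>)"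
  proof (intro allI impI)
    fix g :: "point \<times> (real ^ 3) \<times> (real ^ 3 ^ 3) \<Rightarrow> real" and B
    assume g: "continuous_on UNIV g" "\<forall>z. \<bar>g z\<bar> \<le> B"
    show "(\<lambda>n. \<integral>y. g (?e (r n) y) * ?w (r n) y \<partial>?L) \<longlonglongrightarrow> (\<integral>z. g z \<partial>\<mu>)"
      using lim[OF g(1) spec[OF g(2)]] by (simp only: intM[OF g(1)])
  qed
  with r show thesis by (rule that)
qed

theorem theorem3p1:
  fixes \<Omega> :: "(real ^ 3) set" and T :: real
    and d :: "real \<Rightarrow> point \<Rightarrow> real ^ 3"
    and Dd :: "real \<Rightarrow> point \<Rightarrow> real ^ 3 ^ 3"
  assumes "bounded_Ck1_domain 3 \<Omega>"
    and "T > 0"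
    and "\<And>\<delta>. \<delta> \<in> {0<..<1} \<Longrightarrow> d \<delta> \<in> LinfH1 \<Omega> T"
    and "(SUP \<delta>\<in>{0<..<1}. LinfH1_norm \<Omega> T (d \<delta>)) < \<infinity>"
    and "\<And>\<delta>. \<delta> \<in> {0<..<1} \<Longrightarrow> spatial_gradient \<Omega> T (d \<delta>) (Dd \<delta>)"
    and "\<And>\<delta>. \<delta> \<in> {0<..<1} \<Longrightarrow> (\<lambda>y. norm (d \<delta> y) *\<^sub>R Dd \<delta> y) \<in> LinfL2 \<Omega> T"
    and "(SUP \<delta>\<in>{0<..<1}. LinfL2_norm \<Omega> T (\<lambda>y. norm (d \<delta> y) *\<^sub>R Dd \<delta> y)) < \<infinity>"
    and "relatively_compact_in (seminorm_topology (L2L2 \<Omega> T) (L2L2_norm \<Omega> T)) (d ` {0<..<1})"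
  shows "\<exists>(\<delta>s :: nat \<Rightarrow> real) (d_lim :: point \<Rightarrow> real ^ 3) \<nu>o m \<nu>i.
     (\<forall>n. \<delta>s n \<in> {0<..<1}) \<and> \<delta>s \<longlonglongrightarrow> 0 \<and>
     d_lim \<in> L2L2 \<Omega> T \<and>
     (\<lambda>n. L2L2_norm \<Omega> T (\<lambda>y. d (\<delta>s n) y - d_lim y)) \<longlonglongrightarrow> 0 \<and>
     generalized_young_measure \<Omega> T \<nu>o m \<nu>i \<and>
     (\<forall>f\<in>integrands \<Omega> T.
        pairing_integrable \<Omega> T d_lim \<nu>o m \<nu>i f \<and>
        (\<lambda>n. \<integral>y. f (y, d (\<delta>s n) y, Dd (\<delta>s n) y) \<partial>lebesgue_on (cylinder \<Omega> T)) \<longlonglongrightarrow>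
          (\<integral>t. pairing \<Omega> T d_lim \<nu>o m \<nu>i f t \<partial>lebesgue_on {0<..<T})) \<and>
     (\<exists>Dd_lim. spatial_gradient \<Omega> T d_lim Dd_lim \<and>
        (AE y in lebesgue_on (cylinder \<Omega> T).
           integrable (\<nu>o y) (\<lambda>S. S) \<and> (\<integral>S. S \<partial>\<nu>o y) = Dd_lim y))"
proof -
  let ?L = "lebesgue_on (cylinder \<Omega> T)"
  have \<Omega>: "open \<Omega>" "bounded \<Omega>" "\<Omega> \<noteq> {}" using assms(1) by (auto simp: bounded_Ck1_domain_def)
  obtain \<delta>0 p where \<delta>0: "\<And>n::nat. \<delta>0 n \<in> {0<..<1}" "\<delta>0 \<longlonglongrightarrow> 0" and p: "p \<in> L2L2 \<Omega> T"
    and dL2: "\<And>\<delta>. \<delta> \<in> {0<..<1} \<Longrightarrow> d \<delta> \<in> L2L2 \<Omega> T"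
    and p_lim: "(\<lambda>n. \<integral>y. (norm (d (\<delta>0 n) y - p y))\<^sup>2 \<partial>?L) \<longlonglongrightarrow> 0"
  proof (rule relatively_compact_L2L2_sequence[OF \<Omega>(1) assms(8)])
    fix \<delta>s p
    assume "\<And>n::nat. \<delta>s n \<in> {0<..<1}" "\<delta>s \<longlonglongrightarrow> 0" "p \<in> L2L2 \<Omega> T"
      "\<And>\<delta>. \<delta> \<in> {0<..<1} \<Longrightarrow> d \<delta> \<in> L2L2 \<Omega> T"
      "(\<lambda>n. \<integral>y. (norm (d (\<delta>s n) y - p y))\<^sup>2 \<partial>?L) \<longlonglongrightarrow> 0"
    then show thesis by (rule that)
  qed
  \<comment> \<open>The representative \<open>q\<close> is the limit asserted by the theorem; it differs from
    \<open>p\<close> on a null set only.\<close>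
  obtain q where q: "q \<in> borel_measurable borel" "q \<in> L2L2 \<Omega> T" and pq: "AE y in ?L. p y = q y"
    by (rule L2L2_borel_representative[OF \<Omega>(1) p])
  have qm: "q \<in> borel_measurable ?L" by (rule borel_measurable_lebesgue_on_borel[OF q(1)])
  have pm: "p \<in> borel_measurable ?L" using p by (simp add: bochner_L2_def bochner_measurable_def)
  have dm: "d \<delta> \<in> borel_measurable ?L" if "\<delta> \<in> {0<..<1}" for \<delta>
    using dL2[OF that] by (simp add: bochner_L2_def bochner_measurable_def)
  have Dm: "Dd \<delta> \<in> borel_measurable ?L" if "\<delta> \<in> {0<..<1}" for \<delta>
    using assms(5)[OF that] by (simp add: spatial_gradient_def)
  have q_int: "integrable ?L (\<lambda>y. (norm (q y))\<^sup>2)" by (rule square_integrable_of_slices[OF \<Omega>(1) q(2)])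
  have dq_int: "integrable ?L (\<lambda>y. (norm (d \<delta> y - q y))\<^sup>2)" if "\<delta> \<in> {0<..<1}" for \<delta>
    by (rule square_integrable_diff[OF dm[OF that] qm square_integrable_of_slices[OF \<Omega>(1) dL2[OF that]] q_int])
  have dq_eq: "(\<integral>y. (norm (d (\<delta>0 n) y - p y))\<^sup>2 \<partial>?L) = (\<integral>y. (norm (d (\<delta>0 n) y - q y))\<^sup>2 \<partial>?L)" for n
  proof (rule integral_cong_AE)
    show "AE y in ?L. (norm (d (\<delta>0 n) y - p y))\<^sup>2 = (norm (d (\<delta>0 n) y - q y))\<^sup>2"
      using pq by eventually_elim simp
  qed (use dm[OF \<delta>0(1)[of n]] pm qm in measurable)
  have q_lim: "(\<lambda>n. \<integral>y. (norm (d (\<delta>0 n) y - q y))\<^sup>2 \<partial>?L) \<longlonglongrightarrow> 0"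
    using p_lim by (simp only: dq_eq)
  \<comment> \<open>Pointwise convergence of the states allows dominated convergence for bounded functions of them.\<close>
  have "\<exists>r::nat \<Rightarrow> nat. strict_mono r \<and> (AE y in ?L. (\<lambda>n. (norm (d (\<delta>0 (r n)) y - q y))\<^sup>2) \<longlonglongrightarrow> 0)"
    by (rule tendsto_L1_AE_subseq) (use dq_int \<delta>0(1) q_lim in simp_all)
  then obtain r1 :: "nat \<Rightarrow> nat" where r1: "strict_mono r1"
    and AE1: "AE y in ?L. (\<lambda>n. (norm (d (\<delta>0 (r1 n)) y - q y))\<^sup>2) \<longlonglongrightarrow> 0" by blast
  obtain C where C: "C \<ge> 0" "\<And>\<delta>. \<delta> \<in> {0<..<1} \<Longrightarrow> AE t in lebesgue_on {0<..<T}.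
    (\<integral>\<^sup>+x. ennreal ((1 + (norm (d \<delta> (x, t)))\<^sup>2) * (1 + (norm (Dd \<delta> (x, t)))\<^sup>2)) \<partial>lebesgue_on \<Omega>) \<le> ennreal C"
  proof (rule energy_bounds[OF \<Omega>(1,2) assms(3,4,5,6,7)])
    fix C
    assume "C \<ge> 0" "\<And>\<delta>. \<delta> \<in> {0<..<1} \<Longrightarrow> AE t in lebesgue_on {0<..<T}.
      (\<integral>\<^sup>+x. ennreal ((1 + (norm (d \<delta> (x, t)))\<^sup>2) * (1 + (norm (Dd \<delta> (x, t)))\<^sup>2)) \<partial>lebesgue_on \<Omega>) \<le> ennreal C"
    then show thesis by (rule that)
  qed
  define \<delta>1 where "\<delta>1 n = \<delta>0 (r1 n)" for n
  have \<delta>1: "\<delta>1 n \<in> {0<..<1}" for n using \<delta>0(1) by (simp add: \<delta>1_def)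
  obtain r2 \<mu> where r2: "strict_mono (r2 :: nat \<Rightarrow> nat)"
    and \<mu>: "finite_measure \<mu>" "sets \<mu> = sets borel" "AE z in \<mu>. z \<in> closure (cylinder \<Omega> T) \<times> cball 0 1 \<times> cball 0 1"
    and \<mu>_lim: "\<forall>g B. continuous_on UNIV g \<longrightarrow> (\<forall>z. \<bar>g z\<bar> \<le> B) \<longrightarrow>
      (\<lambda>n. \<integral>y. g (y, into_ball (d (\<delta>1 (r2 n)) y), into_ball (Dd (\<delta>1 (r2 n)) y)) *
          ((1 + (norm (d (\<delta>1 (r2 n)) y))\<^sup>2) * (1 + (norm (Dd (\<delta>1 (r2 n)) y))\<^sup>2)) \<partial>?L)
        \<longlonglongrightarrow> (\<integral>z. (g z :: real) \<partial>\<mu>)"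
    by (rule weighted_laws_subsequence[where u="\<lambda>n. d (\<delta>1 n)" and G="\<lambda>n. Dd (\<delta>1 n)" and C=C,
          OF \<Omega> assms(2) dm[OF \<delta>1] Dm[OF \<delta>1] C(2)[OF \<delta>1] C(1)])
  define \<delta>s where "\<delta>s n = \<delta>1 (r2 n)" for n
  have \<delta>s: "\<delta>s n \<in> {0<..<1}" for n using \<delta>1 by (simp add: \<delta>s_def)
  have sub: "strict_mono (r1 \<circ> r2)" using r1 r2 by (rule strict_mono_o)
  have \<delta>s_eq: "\<delta>s = \<delta>0 \<circ> (r1 \<circ> r2)" by (simp add: fun_eq_iff \<delta>s_def \<delta>1_def)
  have \<delta>s_lim: "\<delta>s \<longlonglongrightarrow> 0" unfolding \<delta>s_eq by (rule LIMSEQ_subseq_LIMSEQ[OF \<delta>0(2) sub])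
  have u_lim: "(\<lambda>n. \<integral>y. (norm (d (\<delta>s n) y - q y))\<^sup>2 \<partial>?L) \<longlonglongrightarrow> 0"
    using LIMSEQ_subseq_LIMSEQ[OF q_lim sub] by (simp add: o_def \<delta>s_def \<delta>1_def)
  have u_AE: "AE y in ?L. (\<lambda>n. d (\<delta>s n) y) \<longlonglongrightarrow> q y"
    using AE1
  proof eventually_elim
    case (elim y)
    have "(\<lambda>n. sqrt ((norm (d (\<delta>0 (r1 n)) y - q y))\<^sup>2)) \<longlonglongrightarrow> sqrt 0" by (intro tendsto_real_sqrt elim)
    then have "(\<lambda>n. d (\<delta>0 (r1 n)) y) \<longlonglongrightarrow> q y"
      by (simp add: LIM_zero_iff tendsto_norm_zero_iff)
    from LIMSEQ_subseq_LIMSEQ[OF this r2] show ?case by (simp add: o_def \<delta>s_def \<delta>1_def)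
  qed
  interpret young_limit \<Omega> T "\<lambda>n. d (\<delta>s n)" "\<lambda>n. Dd (\<delta>s n)" q \<mu> C
  proof (rule young_limit.intro)
    show "(\<lambda>n. \<integral>y. g (y, into_ball (d (\<delta>s n) y), into_ball (Dd (\<delta>s n) y)) *
          ((1 + (norm (d (\<delta>s n) y))\<^sup>2) * (1 + (norm (Dd (\<delta>s n) y))\<^sup>2)) \<partial>?L) \<longlonglongrightarrow> (\<integral>z. g z \<partial>\<mu>)"
      if "continuous_on UNIV g" "\<And>z. \<bar>g z\<bar> \<le> B" for g B
      using \<mu>_lim[THEN spec, THEN spec, THEN mp, OF that(1), THEN mp, OF allI[OF that(2)]]
      by (simp only: \<delta>s_def)
  qed (use \<Omega> assms(2) C \<delta>s dm Dm q(1) q_int u_lim u_AE \<mu> in \<open>simp_all add: o_def\<close>)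
  have wg: "AE t in lebesgue_on {0<..<T}. weak_gradient \<Omega> (slice (d (\<delta>s n)) t) (slice (Dd (\<delta>s n)) t)" for n
    using assms(5)[OF \<delta>s[of n]] by (simp add: spatial_gradient_def)
  have N_eq: "L2L2_norm \<Omega> T (\<lambda>y. d (\<delta>s n) y - q y) = sqrt (\<integral>y. (norm (d (\<delta>s n) y - q y))\<^sup>2 \<partial>?L)" for n
  proof (rule L2L2_norm_eq[OF \<Omega>(1)])
    show "(\<lambda>y. d (\<delta>s n) y - q y) \<in> borel_measurable ?L" by (intro borel_measurable_diff dm \<delta>s qm)
  qed (rule dq_int[OF \<delta>s])
  have "(\<lambda>n. sqrt (\<integral>y. (norm (d (\<delta>s n) y - q y))\<^sup>2 \<partial>?L)) \<longlonglongrightarrow> sqrt 0"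
    by (intro tendsto_real_sqrt u_lim)
  then have N_lim: "(\<lambda>n. L2L2_norm \<Omega> T (\<lambda>y. d (\<delta>s n) y - q y)) \<longlonglongrightarrow> 0" by (simp add: N_eq)
  obtain \<nu>o m \<nu>i where gym: "generalized_young_measure \<Omega> T \<nu>o m \<nu>i"
    and lim: "\<forall>f\<in>integrands \<Omega> T.
        pairing_integrable \<Omega> T q \<nu>o m \<nu>i f \<and>
        (\<lambda>n. \<integral>y. f (y, d (\<delta>s n) y, Dd (\<delta>s n) y) \<partial>?L) \<longlonglongrightarrow>
          (\<integral>t. pairing \<Omega> T q \<nu>o m \<nu>i f t \<partial>lebesgue_on {0<..<T})"
    and grad: "\<exists>Dd_lim. spatial_gradient \<Omega> T q Dd_lim \<and>
        (AE y in ?L. integrable (\<nu>o y) (\<lambda>S. S) \<and> (\<integral>S. S \<partial>\<nu>o y) = Dd_lim y)"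
    by (insert generalized_young_limit[OF wg], elim exE conjE, rule that) (assumption, assumption, rule exI, rule conjI)
  show ?thesis
    by (intro exI[of _ \<delta>s] exI[of _ q] exI[of _ \<nu>o] exI[of _ m] exI[of _ \<nu>i] conjI allI \<delta>s \<delta>s_lim q(2) N_lim gym lim grad)
qed

end
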